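(* Let $(\omega,p)$ satisfy Hypothesis $\mathfrak{M}$, with index $j$, and let $\omega_0$ be a non-empty open set with $\overline{\omega_0}\subset\omega$. Fix $\kappa\in(1,2)$, let $\beta$ be a weight function associated with $(\omega_0,j,p,\kappa)$, and let $\eta,\xi$ be the associated Carleman weights with parameter $\lambda>0$. Let $b,d\in L^\infty(Q)$ and let $\mathcal{L}$, $\mathcal{V}$ be the associated operator and function space. (All these notions are defined in the context.) Then there exist $s_0>0$, $\lambda_0>0$ and a constant $C>0$ depending on $\omega$, $\Gamma$, $L$, $T$, $p$, $\|\beta\|_{C^3([0,L]\setminus\Gamma)}$, $s_0$ and $\lambda_0$ such that for all $u\in\mathcal{V}$, all $s\ge s_0$ and all $\lambda\ge\lambda_0$, $$C\iint_Q e^{-2s\eta}\big(s^5\lambda^6\xi^5|u|^2+s^3\lambda^4\xi^3|u_x|^2+s\lambda^2\xi|u_{xx}|^2\big)\,dx\,dt \le \|e^{-s\eta}\mathcal{L}u\|_{L^2(Q)}^2+\iint_{(0,T)\times\omega}e^{-2s\eta}\big(s^5\lambda^6\xi^5|u|^2+s^3\lambda^4\xi^3|u_x|^2+s\lambda^2\xi|u_{xx}|^2\big)\,dx\,dt .$$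
   Context: Let $T,L>0$, $N\ge1$, $0=a_0<a_1<\dots<a_N=L$, $\Gamma=\{a_1,\dots,a_{N-1}\}$, $I_k=(a_k,a_{k+1})$, $Q=(0,T)\times(0,L)$. The function $p$ is piecewise constant: $p(x)=p_k>0$ on $[a_k,a_{k+1})$, $k=0,\dots,N-1$; so $p(a_k^-)=p_{k-1}$, $p(a_k^+)=p_k$. $H^s_{\mathrm{pw}}(0,L)=\{u\in L^2(0,L): u|_{I_k}\in H^s(I_k),\ k=0,\dots,N-1\}$. Space derivatives of functions in this space are taken separately on each $I_k$. Hypothesis $\mathfrak{M}$ on $(\omega,p)$ ($\omega\subset(0,L)$ non-empty and open): there is $j\in\{0,\dots,N-1\}$ with $\overline\omega\subset I_j$ and: (1) if $j\notin\{0,N-1\}$, then $p(a_k^-)>p(a_k^+)$ for $1\le k\le j$ and $p(a_k^-)<p(a_k^+)$ for $j+1\le k\le N-1$; (2) if $j=0$, then $p(a_k^-)<p(a_k^+)$ for $1\le k\le N-1$; (3) if $j=N-1$, then $p(a_k^-)>p(a_k^+)$ for $1\le k\le N-1$. Weight function associated with $(\omega_0,j,p,\kappa)$: a function $\beta\in C([0,L])$ with $\beta|_{\overline{I_k}}\in C^3(\overline{I_k})$ for all $k$ (one-sided derivatives at the interfaces) such that, for some $r>0$: $\min_{[0,L]}\beta\ge r$; $\beta'\ne0$ in $\overline{I_j}\setminus\omega_0$; if $j\notin\{0,N-1\}$, $\beta'\ge r$ in $\overline{I_k}$ for $0\le k\le j-1$ and $\beta'\le -r$ in $\overline{I_k}$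 for $j+1\le k\le N-1$; if $j=0$, $\beta'\le -r$ in $\overline{I_k}$ for $1\le k\le N-1$ and $\beta'(0)>0$; if $j=N-1$, $\beta'\ge r$ in $\overline{I_k}$ for $0\le k\le N-2$ and $\beta'(L)<0$; moreover $\kappa\max_{[0,L]}\beta<2\min_{[0,L]}\beta$; and for $k=1,\dots,N-1$: $\beta(a_k^-)=\beta(a_k^+)$, $\sqrt{p_{k-1}}\beta'(a_k^-)=\sqrt{p_k}\beta'(a_k^+)$, $p_{k-1}\beta''(a_k^-)=p_k\beta''(a_k^+)$. Carleman weights: for $\lambda>0$ and $(t,x)\in Q$, $$\eta(t,x)=\frac{e^{\kappa\lambda\|\beta\|_\infty}-e^{\lambda\beta(x)}}{t(T-t)},\qquad \xi(t,x)=\frac{e^{\lambda\beta(x)}}{t(T-t)}.$$ Operator: $\mathcal{L}=\partial_t+p(x)\partial_x^3+b(t,x)\partial_x+d(t,x)$, and $\mathcal{V}$ is the space of $u\in L^2(0,T;H^3_{\mathrm{pw}}(0,L)\cap H^1_0(0,L))$ with $\mathcal{L}u\in L^2(Q)$ satisfying, for $t\in(0,T)$ and $k=1,\dots,N-1$, the transmission conditions $u(t,a_k^-)=u(t,a_k^+)$, $\sqrt{p_{k-1}}u_x(t,a_k^-)=\sqrt{p_k}u_x(t,a_k^+)$, $p_{k-1}u_{xx}(t,a_k^-)=p_ku_{xx}(t,a_k^+)$. *)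

theory Defs
  imports "HOL-Analysis.Analysis"
begin

text \<open>
  All function spaces consist of real-valued representatives; two functions that agree almost
  everywhere are the same element. A function of time and space is a curried function
  \<open>u t x\<close>, and subsets of the space-time cylinder are sets of pairs \<open>(t, x)\<close>.
\<close>

section \<open>Lebesgue and Sobolev spaces\<close>

definition L2 :: "'a::euclidean_space set \<Rightarrow> ('a \<Rightarrow> real) set" where
  "L2 S = {f. f \<in> borel_measurable (lebesgue_on S) \<and> integrable (lebesgue_on S) (\<lambda>x. (f x)\<^sup>2)}"

definition L2_norm :: "'a::euclidean_space set \<Rightarrow> ('a \<Rightarrow> real) \<Rightarrow> real" where
  "L2_norm S f = sqrt (LINT x|lebesgue_on S. (f x)\<^sup>2)"

definition Linf :: "'a::euclidean_space set \<Rightarrow> ('a \<Rightarrow> real) set" where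
  "Linf S = {f. f \<in> borel_measurable (lebesgue_on S) \<and> (\<exists>M. AE x in lebesgue_on S. \<bar>f x\<bar> \<le> M)}"

primrec Ck :: "nat \<Rightarrow> ('a::euclidean_space \<Rightarrow> real) \<Rightarrow> bool" where
  "Ck 0 f \<longleftrightarrow> continuous_on UNIV f"
| "Ck (Suc k) f \<longleftrightarrow> (\<forall>x. f differentiable (at x)) \<and>
     (\<forall>v\<in>Basis. Ck k (\<lambda>x. frechet_derivative f (at x) v))"

text \<open>\<open>test_fun S\<close> is the set of smooth functions with compact support in the open set \<open>S\<close>.\<close>

definition test_fun :: "'a::euclidean_space set \<Rightarrow> ('a \<Rightarrow> real) set" where
  "test_fun S = {\<phi>. (\<forall>k. Ck k \<phi>) \<and> (\<exists>K. compact K \<and> K \<subseteq> S \<and> (\<forall>x. x \<notin> K \<longrightarrow> \<phi> x = 0))}"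

text \<open>\<open>g\<close> is a square integrable weak derivative of order \<open>m\<close> of \<open>f\<close> on the open interval \<open>I\<close>.\<close>

definition weak_deriv :: "real set \<Rightarrow> nat \<Rightarrow> (real \<Rightarrow> real) \<Rightarrow> (real \<Rightarrow> real) \<Rightarrow> bool" where
  "weak_deriv I m f g \<longleftrightarrow> f \<in> L2 I \<and> g \<in> L2 I \<and>
     (\<forall>\<phi>\<in>test_fun I. (LINT x|lebesgue_on I. f x * (deriv ^^ m) \<phi> x)
        = (- 1) ^ m * (LINT x|lebesgue_on I. g x * \<phi> x))"

definition wderiv :: "real set \<Rightarrow> nat \<Rightarrow> (real \<Rightarrow> real) \<Rightarrow> real \<Rightarrow> real" where
  "wderiv I m f = (SOME g. weak_deriv I m f g)"

definition Hs :: "nat \<Rightarrow> real set \<Rightarrow> (real \<Rightarrow> real) set" where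
  "Hs m I = {f \<in> L2 I. \<forall>i\<le>m. \<exists>g. weak_deriv I i f g}"

definition Hs_norm :: "nat \<Rightarrow> real set \<Rightarrow> (real \<Rightarrow> real) \<Rightarrow> real" where
  "Hs_norm m I f = sqrt (\<Sum>i\<le>m. (L2_norm I (wderiv I i f))\<^sup>2)"

definition H10 :: "real set \<Rightarrow> (real \<Rightarrow> real) set" where
  "H10 I = {f \<in> Hs 1 I. \<forall>\<epsilon>>0. \<exists>\<phi>\<in>test_fun I. Hs_norm 1 I (\<lambda>x. f x - \<phi> x) < \<epsilon>}"

text \<open>
  Value at a point \<open>y\<close> of the closure of an open interval \<open>I\<close> of the continuous representative
  of \<open>f\<close> on the closure; it is unique when it exists, in particular for \<open>f \<in> Hs 1 I\<close>.
\<close>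

definition trace :: "real set \<Rightarrow> (real \<Rightarrow> real) \<Rightarrow> real \<Rightarrow> real" where
  "trace I f y = (THE c. \<exists>w. continuous_on (closure I) w \<and>
     (AE x in lebesgue_on I. w x = f x) \<and> w y = c)"

section \<open>The partition and piecewise Sobolev spaces\<close>

definition is_partition :: "real \<Rightarrow> nat \<Rightarrow> (nat \<Rightarrow> real) \<Rightarrow> bool" where
  "is_partition L N a \<longleftrightarrow> N \<ge> 1 \<and> a 0 = 0 \<and> a N = L \<and> (\<forall>k<N. a k < a (Suc k))"

definition subint :: "(nat \<Rightarrow> real) \<Rightarrow> nat \<Rightarrow> real set" where
  "subint a k = {a k<..<a (Suc k)}"

definition interfaces :: "nat \<Rightarrow> (nat \<Rightarrow> real) \<Rightarrow> real set" where
  "interfaces N a = a ` {1..<N}"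

definition pcoef :: "nat \<Rightarrow> (nat \<Rightarrow> real) \<Rightarrow> (nat \<Rightarrow> real) \<Rightarrow> real \<Rightarrow> real" where
  "pcoef N a p x = (\<Sum>k<N. p k * indicator {a k..<a (Suc k)} x)"

definition Hpw :: "nat \<Rightarrow> real \<Rightarrow> nat \<Rightarrow> (nat \<Rightarrow> real) \<Rightarrow> (real \<Rightarrow> real) set" where
  "Hpw m L N a = {f \<in> L2 {0<..<L}. \<forall>k<N. f \<in> Hs m (subint a k)}"

definition Hpw_norm :: "nat \<Rightarrow> nat \<Rightarrow> (nat \<Rightarrow> real) \<Rightarrow> (real \<Rightarrow> real) \<Rightarrow> real" where
  "Hpw_norm m N a f = sqrt (\<Sum>k<N. (Hs_norm m (subint a k) f)\<^sup>2)"

section \<open>Functions of time and space\<close>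

definition cylinder :: "real \<Rightarrow> real \<Rightarrow> (real \<times> real) set" where
  "cylinder T L = {0<..<T} \<times> {0<..<L}"

text \<open>
  \<open>bochner_L2 T X nrm\<close> is \<open>L\<^sup>2(0,T;X)\<close> for a space \<open>X\<close> of functions with norm \<open>nrm\<close>:
  strongly measurable \<open>u\<close> (almost everywhere the limit in \<open>X\<close> of simple functions) whose norm
  is square integrable.
\<close>

definition simple_in :: "real \<Rightarrow> (real \<Rightarrow> real) set \<Rightarrow> (real \<Rightarrow> real \<Rightarrow> real) \<Rightarrow> bool" where
  "simple_in T X \<sigma> \<longleftrightarrow> (\<exists>n A v.
     (\<forall>i<n. A i \<in> sets (lebesgue_on {0<..<T}) \<and> v i \<in> X) \<and>
     (\<forall>t\<in>{0<..<T}. \<sigma> t = (\<lambda>x. \<Sum>i<(n::nat). indicator (A i) t * v i x)))"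

definition bochner_L2 ::
  "real \<Rightarrow> (real \<Rightarrow> real) set \<Rightarrow> ((real \<Rightarrow> real) \<Rightarrow> real) \<Rightarrow> (real \<Rightarrow> real \<Rightarrow> real) set" where
  "bochner_L2 T X nrm = {u.
     (AE t in lebesgue_on {0<..<T}. u t \<in> X) \<and>
     (\<exists>\<sigma>. (\<forall>n. simple_in T X (\<sigma> n)) \<and>
        (AE t in lebesgue_on {0<..<T}. (\<lambda>n. nrm (\<lambda>x. \<sigma> n t x - u t x)) \<longlonglongrightarrow> 0)) \<and>
     integrable (lebesgue_on {0<..<T}) (\<lambda>t. (nrm (u t))\<^sup>2)}"

text \<open>
  The space derivative of order \<open>m\<close>, taken separately on each subinterval. The derivative is
  chosen jointly measurable in \<open>(t, x)\<close>, since a choice made separately for each \<open>t\<close> (as with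
  \<open>wderiv\<close>) need not be; it is then unique up to a null set of the cylinder.
\<close>

definition pw_dx :: "nat \<Rightarrow> real \<Rightarrow> real \<Rightarrow> nat \<Rightarrow> (nat \<Rightarrow> real) \<Rightarrow> (real \<Rightarrow> real \<Rightarrow> real)
    \<Rightarrow> real \<Rightarrow> real \<Rightarrow> real" where
  "pw_dx m T L N a u = (SOME g.
     (\<lambda>(t, x). g t x) \<in> borel_measurable (lebesgue_on (cylinder T L)) \<and>
     (AE t in lebesgue_on {0<..<T}. \<forall>k<N. weak_deriv (subint a k) m (u t) (g t)))"

text \<open>
  \<open>g\<close> is the image of \<open>u\<close> under the operator \<open>\<partial>\<^sub>t + p \<partial>\<^sub>x\<^sup>3 + b \<partial>\<^sub>x + d\<close>, where the
  time derivative is a distribution on the cylinder.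
\<close>

definition is_Lop :: "real \<Rightarrow> real \<Rightarrow> nat \<Rightarrow> (nat \<Rightarrow> real) \<Rightarrow> (nat \<Rightarrow> real)
    \<Rightarrow> (real \<Rightarrow> real \<Rightarrow> real) \<Rightarrow> (real \<Rightarrow> real \<Rightarrow> real)
    \<Rightarrow> (real \<Rightarrow> real \<Rightarrow> real) \<Rightarrow> (real \<Rightarrow> real \<Rightarrow> real) \<Rightarrow> bool" where
  "is_Lop T L N a p b d u g \<longleftrightarrow> (\<forall>\<phi>\<in>test_fun (cylinder T L).
     (LINT (t, x)|lebesgue_on (cylinder T L). g t x * \<phi> (t, x)) =
     (LINT (t, x)|lebesgue_on (cylinder T L).
        - u t x * deriv (\<lambda>\<tau>. \<phi> (\<tau>, x)) t +
        (pcoef N a p x * pw_dx 3 T L N a u t x + b t x * pw_dx 1 T L N a u t x + d t x * u t x)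
          * \<phi> (t, x)))"

definition Lop :: "real \<Rightarrow> real \<Rightarrow> nat \<Rightarrow> (nat \<Rightarrow> real) \<Rightarrow> (nat \<Rightarrow> real)
    \<Rightarrow> (real \<Rightarrow> real \<Rightarrow> real) \<Rightarrow> (real \<Rightarrow> real \<Rightarrow> real)
    \<Rightarrow> (real \<Rightarrow> real \<Rightarrow> real) \<Rightarrow> real \<Rightarrow> real \<Rightarrow> real" where
  "Lop T L N a p b d u =
     (SOME g. (\<lambda>(t, x). g t x) \<in> L2 (cylinder T L) \<and> is_Lop T L N a p b d u g)"

text \<open>
  Transmission conditions at the interior nodes; \<open>p (k - 1)\<close> and \<open>p k\<close> are the values of the
  coefficient on the left and on the right of \<open>a k\<close>.
\<close>

definition transmission :: "nat \<Rightarrow> (nat \<Rightarrow> real) \<Rightarrow> (nat \<Rightarrow> real) \<Rightarrow> (real \<Rightarrow> real) \<Rightarrow> bool" where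
  "transmission N a p v \<longleftrightarrow> (\<forall>k\<in>{1..<N}.
     (let l = subint a (k - 1); r = subint a k in
       trace l v (a k) = trace r v (a k) \<and>
       sqrt (p (k - 1)) * trace l (wderiv l 1 v) (a k) = sqrt (p k) * trace r (wderiv r 1 v) (a k) \<and>
       p (k - 1) * trace l (wderiv l 2 v) (a k) = p k * trace r (wderiv r 2 v) (a k)))"

text \<open>
  Membership in \<open>L2\<close> of the cylinder selects a jointly measurable representative of an element
  of the Bochner space.
\<close>

definition Vspace :: "real \<Rightarrow> real \<Rightarrow> nat \<Rightarrow> (nat \<Rightarrow> real) \<Rightarrow> (nat \<Rightarrow> real)
    \<Rightarrow> (real \<Rightarrow> real \<Rightarrow> real) \<Rightarrow> (real \<Rightarrow> real \<Rightarrow> real) \<Rightarrow> (real \<Rightarrow> real \<Rightarrow> real) set" where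
  "Vspace T L N a p b d = {u.
     (\<lambda>(t, x). u t x) \<in> L2 (cylinder T L) \<and>
     u \<in> bochner_L2 T (Hpw 3 L N a \<inter> H10 {0<..<L}) (Hpw_norm 3 N a) \<and>
     (\<exists>g. (\<lambda>(t, x). g t x) \<in> L2 (cylinder T L) \<and> is_Lop T L N a p b d u g) \<and>
     (AE t in lebesgue_on {0<..<T}. transmission N a p (u t))}"

section \<open>Hypothesis M and the weights\<close>

definition hypothesis_M ::
  "real \<Rightarrow> nat \<Rightarrow> (nat \<Rightarrow> real) \<Rightarrow> (nat \<Rightarrow> real) \<Rightarrow> real set \<Rightarrow> nat \<Rightarrow> bool" where
  "hypothesis_M L N a p \<omega> j \<longleftrightarrow>
     \<omega> \<noteq> {} \<and> open \<omega> \<and> \<omega> \<subseteq> {0<..<L} \<and> j \<le> N - 1 \<and> closure \<omega> \<subseteq> subint a j \<and>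
     (j \<notin> {0, N - 1} \<longrightarrow>
        (\<forall>k. 1 \<le> k \<and> k \<le> j \<longrightarrow> p (k - 1) > p k) \<and>
        (\<forall>k. j + 1 \<le> k \<and> k \<le> N - 1 \<longrightarrow> p (k - 1) < p k)) \<and>
     (j = 0 \<longrightarrow> (\<forall>k. 1 \<le> k \<and> k \<le> N - 1 \<longrightarrow> p (k - 1) < p k)) \<and>
     (j = N - 1 \<longrightarrow> (\<forall>k. 1 \<le> k \<and> k \<le> N - 1 \<longrightarrow> p (k - 1) > p k))"

text \<open>Derivatives relative to \<open>S\<close>, hence one-sided at the end points of a closed interval.\<close>

definition Dw :: "real set \<Rightarrow> nat \<Rightarrow> (real \<Rightarrow> real) \<Rightarrow> real \<Rightarrow> real" where
  "Dw S i f = ((\<lambda>g x. vector_derivative g (at x within S)) ^^ i) f"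

definition Cm_on :: "nat \<Rightarrow> real set \<Rightarrow> (real \<Rightarrow> real) \<Rightarrow> bool" where
  "Cm_on m S f \<longleftrightarrow> (\<forall>i<m. Dw S i f differentiable_on S) \<and> (\<forall>i\<le>m. continuous_on S (Dw S i f))"

definition sup_norm :: "real \<Rightarrow> (real \<Rightarrow> real) \<Rightarrow> real" where
  "sup_norm L \<beta> = (SUP x\<in>{0..L}. \<bar>\<beta> x\<bar>)"

definition C3_norm :: "real \<Rightarrow> nat \<Rightarrow> (nat \<Rightarrow> real) \<Rightarrow> (real \<Rightarrow> real) \<Rightarrow> real" where
  "C3_norm L N a \<beta> = (let S = {0..L} - interfaces N a in \<Sum>i\<le>3. SUP x\<in>S. \<bar>Dw S i \<beta> x\<bar>)"

definition weight_function :: "real \<Rightarrow> nat \<Rightarrow> (nat \<Rightarrow> real) \<Rightarrow> (nat \<Rightarrow> real)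
    \<Rightarrow> real set \<Rightarrow> nat \<Rightarrow> real \<Rightarrow> (real \<Rightarrow> real) \<Rightarrow> bool" where
  "weight_function L N a p \<omega>\<^sub>0 j \<kappa> \<beta> \<longleftrightarrow>
     (let J = (\<lambda>k. {a k..a (Suc k)}); D = (\<lambda>i k. Dw (J k) i \<beta>) in
       continuous_on {0..L} \<beta> \<and> (\<forall>k<N. Cm_on 3 (J k) \<beta>) \<and>
       (\<exists>r>0.
         (INF x\<in>{0..L}. \<beta> x) \<ge> r \<and>
         (\<forall>x\<in>J j - \<omega>\<^sub>0. D 1 j x \<noteq> 0) \<and>
         (j \<notin> {0, N - 1} \<longrightarrow>
            (\<forall>k<j. \<forall>x\<in>J k. D 1 k x \<ge> r) \<and> (\<forall>k\<in>{j+1..N-1}. \<forall>x\<in>J k. D 1 k x \<le> - r)) \<and>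
         (j = 0 \<longrightarrow> (\<forall>k\<in>{1..N-1}. \<forall>x\<in>J k. D 1 k x \<le> - r) \<and> D 1 0 0 > 0) \<and>
         (j = N - 1 \<longrightarrow> (\<forall>k<N-1. \<forall>x\<in>J k. D 1 k x \<ge> r) \<and> D 1 (N - 1) L < 0)) \<and>
       \<kappa> * (SUP x\<in>{0..L}. \<beta> x) < 2 * (INF x\<in>{0..L}. \<beta> x) \<and>
       (\<forall>k\<in>{1..<N}.
         Lim (at_left (a k)) \<beta> = Lim (at_right (a k)) \<beta> \<and>
         sqrt (p (k - 1)) * D 1 (k - 1) (a k) = sqrt (p k) * D 1 k (a k) \<and>
         p (k - 1) * D 2 (k - 1) (a k) = p k * D 2 k (a k)))"

definition carleman_eta :: "real \<Rightarrow> real \<Rightarrow> real \<Rightarrow> (real \<Rightarrow> real) \<Rightarrow> real \<Rightarrow> real \<Rightarrow> real \<Rightarrow> real" where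
  "carleman_eta T L \<kappa> \<beta> lam t x =
     (exp (\<kappa> * lam * sup_norm L \<beta>) - exp (lam * \<beta> x)) / (t * (T - t))"

definition carleman_xi :: "real \<Rightarrow> (real \<Rightarrow> real) \<Rightarrow> real \<Rightarrow> real \<Rightarrow> real \<Rightarrow> real" where
  "carleman_xi T \<beta> lam t x = exp (lam * \<beta> x) / (t * (T - t))"

end

theory Submission
  imports Defs "HOL-Real_Asymp.Real_Asymp"
begin

text \<open>
  Put \<open>v = exp (- s \<eta>) u\<close>. The conjugated operator is \<open>L\<^sub>A + L\<^sub>B\<close> plus terms of lower order, where
  \<open>L\<^sub>A v = v\<^sub>t + p (v\<^sub>x\<^sub>x\<^sub>x + 3 M\<^sup>2 v\<^sub>x + 3 M M\<^sub>x v)\<close>, \<open>L\<^sub>B v = p (3 M v\<^sub>x\<^sub>x + 3 M\<^sub>x v\<^sub>x + M\<^sup>3 v)\<close> and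
  \<open>M = s \<eta>\<^sub>x\<close>. In the product \<open>L\<^sub>A v L\<^sub>B v\<close> the space terms form an exact derivative plus a bulk
  form with leading part \<open>- 9/2 M\<^sub>x (v\<^sub>x\<^sub>x\<^sup>2 + 2 M\<^sup>2 v\<^sub>x\<^sup>2 + M\<^sup>4 v\<^sup>2)\<close>, and \<open>M\<^sub>x < 0\<close> for large \<open>\<lambda>\<close> where
  \<open>\<beta>' \<noteq> 0\<close>. At an interface \<open>p\<^sup>2\<close> times the flux is inversely proportional to \<open>sqrt p\<close>, so that hypothesis M
  gives its jump the right sign. The term \<open>v\<^sub>t (M v\<^sub>x\<^sub>x + M\<^sub>x v\<^sub>x)\<close> cannot be integrated by parts in space,
  as \<open>v\<^sub>t\<close> is only square integrable. But with \<open>v = w sqrt (t (T - t))\<close> it is, up to lower order,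
  \<open>w\<^sub>t\<close> times the image of \<open>w\<close> under a symmetric operator independent of time, and its integral vanishes.
\<close>

section \<open>Absolutely continuous functions on an interval\<close>

text \<open>On each subinterval \<open>L\<^sub>B\<close> is the symmetric operator
  \<open>3 p (M v_x)_x + p M^3 v\<close>, and the space part of \<open>L\<^sub>A\<close> is
  antisymmetric; the term \<open>3 M M_x v\<close> is exactly what makes it so. Of the conjugated
  third derivative only \<open>p M_xx v\<close> remains, which is of lower order. An element of
  \<open>V\<close> has a square integrable time derivative and piecewise three space derivatives,
  and it is not replaced by smooth functions, which would have to respect the transmission
  conditions. Instead every integration by parts is one-dimensional, along almost every slice. This
  requires Borel functions for \<open>u\<close>, \<open>u_t\<close> and the space derivatives for
  which the slices in \<open>t\<close> and the slices in \<open>x\<close> are absolutely continuous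
  at the same time. The two conditions on \<kappa> act separately. From \<open>\<kappa> > 1\<close>
  the factor \<open>exp (- s \<eta>)\<close> decays at both ends of the time interval faster than
  any power of \<open>t (T - t)\<close>, so that no boundary terms in time arise. From
  \<open>\<kappa> max \<beta> < 2 min \<beta>\<close> one gets a bound of \<open>\<eta>_t\<close> by
  \<open>T \<xi>^2\<close>, so that \<open>s \<eta>_t v\<close> is of lower order.\<close>

lemma integrable_pair_mult:
  fixes f g :: "real \<Rightarrow> real"
  assumes "integrable lborel f" "integrable lborel g"
  shows "integrable (lborel \<Otimes>\<^sub>M lborel) (\<lambda>z. f (fst z) * g (snd z))"
proof -
  have [measurable]: "f \<in> borel_measurable borel" "g \<in> borel_measurable borel"
    using assms by (auto dest: borel_measurable_integrable)
  show ?thesis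
    by (rule lborel_pair.Fubini_integrable) (use assms in \<open>auto simp: abs_mult\<close>)
qed

text \<open>The density is carried as an argument and matters only up to null sets, while
  \<open>f\<close> has genuine values at both end points. Chains \<open>AC f f1\<close>,
  \<open>AC f1 f2\<close>, \<open>AC f2 f3\<close> thus express regularity of third order together
  with its traces.\<close>

definition AC :: "real \<Rightarrow> real \<Rightarrow> (real \<Rightarrow> real) \<Rightarrow> (real \<Rightarrow> real) \<Rightarrow> bool" where
  "AC a b f f' \<longleftrightarrow> set_integrable lborel {a..b} f' \<and>
     (\<forall>x\<in>{a..b}. (LBINT y:{a..x}. f' y) = f x - f a)"

lemma AC_integrable: "AC a b f f' \<Longrightarrow> set_integrable lborel {a..b} f'"
  by (simp add: AC_def)

lemma AC_integral: "AC a b f f' \<Longrightarrow> a \<le> b \<Longrightarrow> (LBINT x:{a..b}. f' x) = f b - f a"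
  by (simp add: AC_def)

lemma set_integrable_subinterval:
  fixes f :: "real \<Rightarrow> real"
  assumes "set_integrable lborel {a..b} f" "c \<ge> a" "d \<le> b"
  shows "set_integrable lborel {c..d} f"
  by (rule set_integrable_subset[OF assms(1)]) (use assms in auto)

lemma AC_continuous:
  assumes "AC a b f f'"
  shows "continuous_on {a..b} f"
proof -
  have i: "set_integrable lborel {a..b} f'" using assms by (simp add: AC_def)
  have "continuous_on {a..b} (\<lambda>x. f a + integral {a..x} f')"
    by (intro continuous_intros indefinite_integral_continuous_1 set_borel_integral_eq_integral(1) i)
  moreover have "f x = f a + integral {a..x} f'" if "x \<in> {a..b}" for x
  proof -
    have "set_integrable lborel {a..x} f'"
      by (rule set_integrable_subinterval[OF i]) (use that in auto)
    then have "(LBINT y:{a..x}. f' y) = integral {a..x} f'"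
      by (rule set_borel_integral_eq_integral)
    then show ?thesis using assms that by (simp add: AC_def)
  qed
  ultimately show ?thesis by (metis (no_types, lifting) continuous_on_cong)
qed

lemma AC_cong_simple:
  assumes "AC a b f f'" "\<And>x. x \<in> {a..b} \<Longrightarrow> g x = f x" "\<And>x. x \<in> {a..b} \<Longrightarrow> g' x = f' x"
  shows "AC a b g g'"
proof -
  have 1: "set_integrable lborel {a..b} g' \<longleftrightarrow> set_integrable lborel {a..b} f'"
    by (rule set_integrable_cong) (use assms in auto)
  have 2: "(LBINT y:{a..x}. g' y) = (LBINT y:{a..x}. f' y)" if "x \<in> {a..b}" for x
    by (rule set_lebesgue_integral_cong) (use assms that in auto)
  show ?thesis unfolding AC_def using 1 2 assms by (auto simp: AC_def)
qed

lemma AC_add: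
  assumes "AC a b f f'" "AC a b g g'"
  shows "AC a b (\<lambda>x. f x + g x) (\<lambda>x. f' x + g' x)"
proof -
  note i = AC_integrable[OF assms(1)] AC_integrable[OF assms(2)]
  have "(LBINT y:{a..x}. f' y + g' y) = (LBINT y:{a..x}. f' y) + (LBINT y:{a..x}. g' y)"
    if "x \<in> {a..b}" for x
    by (intro set_integral_add(2) set_integrable_subinterval[OF i(1)] set_integrable_subinterval[OF i(2)])
       (use that in auto)
  then show ?thesis using assms i by (auto simp: AC_def intro!: set_integral_add)
qed

lemma AC_cmult:
  assumes "AC a b f f'"
  shows "AC a b (\<lambda>x. c * f x) (\<lambda>x. c * f' x)"
  using assms by (auto simp: AC_def right_diff_distrib)

lemma AC_minus:
  assumes "AC a b f f'"
  shows "AC a b (\<lambda>x. - f x) (\<lambda>x. - f' x)"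
  using AC_cmult[OF assms, of "-1"] by simp

lemma AC_diff:
  assumes "AC a b f f'" "AC a b g g'"
  shows "AC a b (\<lambda>x. f x - g x) (\<lambda>x. f' x - g' x)"
  using AC_add[OF assms(1) AC_minus[OF assms(2)]] by simp

lemma AC_C1:
  assumes "\<And>x. x \<in> {a..b} \<Longrightarrow> (f has_real_derivative f' x) (at x within {a..b})"
    and "continuous_on {a..b} f'"
  shows "AC a b f f'"
proof -
  have i: "set_integrable lborel {a..b} f'"
    using borel_integrable_compact[OF _ assms(2)] by (simp add: set_integrable_def)
  have "(LBINT y:{a..x}. f' y) = f x - f a" if x: "x \<in> {a..b}" for x
  proof -
    have "set_integrable lborel {a..x} f'"
      by (rule set_integrable_subinterval[OF i]) (use x in auto)
    then have "(LBINT y:{a..x}. f' y) = integral {a..x} f'"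
      by (rule set_borel_integral_eq_integral)
    moreover have "(f' has_integral (f x - f a)) {a..x}"
      using x assms(1)
      by (intro fundamental_theorem_of_calculus)
         (auto simp flip: has_real_derivative_iff_has_vector_derivative
           intro!: DERIV_subset[of _ _ _ "{a..b}" "{a..x}"])
    ultimately show ?thesis by (simp add: integral_unique)
  qed
  then show ?thesis using i by (simp add: AC_def)
qed

text \<open>No derivative is asked for at the end points. This is meant for the time weights, whose
  formulas are singular there.\<close>

lemma AC_interior:
  assumes "continuous_on {a..b} f" "\<And>x. x \<in> {a<..<b} \<Longrightarrow> (f has_real_derivative f' x) (at x)"
    and i: "set_integrable lborel {a..b} f'"
  shows "AC a b f f'"
proof -
  have "(LBINT y:{a..x}. f' y) = f x - f a" if x: "x \<in> {a..b}" for x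
  proof -
    have "set_integrable lborel {a..x} f'"
      by (rule set_integrable_subinterval[OF i]) (use x in auto)
    then have "(LBINT y:{a..x}. f' y) = integral {a..x} f'"
      by (rule set_borel_integral_eq_integral)
    moreover have "(f' has_integral (f x - f a)) {a..x}"
      using x assms(1,2)
      by (intro fundamental_theorem_of_calculus_interior)
         (auto simp flip: has_real_derivative_iff_has_vector_derivative
           intro: continuous_on_subset)
    ultimately show ?thesis by (simp add: integral_unique)
  qed
  then show ?thesis using i by (simp add: AC_def)
qed

lemma set_integrable_mult_continuous:
  fixes f g :: "real \<Rightarrow> real"
  assumes i: "set_integrable lborel {a..b} f" and c: "continuous_on {a..b} g"
  shows "set_integrable lborel {a..b} (\<lambda>x. f x * g x)"
proof -
  have "compact (g ` {a..b})" by (rule compact_continuous_image[OF c]) auto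
  then have "bounded (g ` {a..b})" by (rule compact_imp_bounded)
  then obtain B where B: "\<And>x. x \<in> {a..b} \<Longrightarrow> \<bar>g x\<bar> \<le> B" by (fastforce simp: bounded_iff)
  have m: "(\<lambda>x. indicator {a..b} x *\<^sub>R f x) \<in> borel_measurable borel"
    using i unfolding set_integrable_def by (auto dest: borel_measurable_integrable)
  have mg: "(\<lambda>x. indicator {a..b} x *\<^sub>R g x) \<in> borel_measurable borel"
    by (rule borel_measurable_continuous_on_indicator[OF _ c]) auto
  have eq: "(\<lambda>x. indicator {a..b} x *\<^sub>R (f x * g x)) =
     (\<lambda>x. (indicator {a..b} x *\<^sub>R f x) * (indicator {a..b} x *\<^sub>R g x))"
    by (auto simp: indicator_def)
  have "integrable lborel (\<lambda>x. B * (indicator {a..b} x *\<^sub>R f x))"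
    using i unfolding set_integrable_def by (rule integrable_mult_right)
  then show ?thesis
    unfolding set_integrable_def
  proof (rule Bochner_Integration.integrable_bound)
    show "(\<lambda>x. indicator {a..b} x *\<^sub>R (f x * g x)) \<in> borel_measurable lborel"
      unfolding eq using m mg by simp
    show "AE x in lborel. norm (indicator {a..b} x *\<^sub>R (f x * g x)) \<le> norm (B * (indicator {a..b} x *\<^sub>R f x))"
      using B by (auto simp: indicator_def abs_mult intro!: AE_I2)
         (metis abs_ge_self abs_ge_zero mult.commute mult_left_mono order_trans)
  qed
qed

text \<open>Product rule without pointwise derivatives: \<open>(f x - f a) * (g x - g a)\<close> is
  the integral of \<open>F r * G s\<close> over a square, which the diagonal cuts into two
  triangles. Integrating out the inner variable in each triangle by Fubini yields the integrals of
  \<open>f' g\<close> and \<open>f g'\<close>, up to the values at \<open>a\<close>.\<close>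

lemma AC_mult:
  assumes f: "AC a b f f'" and g: "AC a b g g'"
  shows "AC a b (\<lambda>x. f x * g x) (\<lambda>x. f' x * g x + f x * g' x)"
  unfolding AC_def
proof (intro conjI ballI)
  note fc = AC_continuous[OF f] and gc = AC_continuous[OF g]
  note fi = AC_integrable[OF f] and gi = AC_integrable[OF g]
  have fg: "set_integrable lborel {a..b} (\<lambda>x. f' x * g x)"
    by (rule set_integrable_mult_continuous[OF fi gc])
  have gf: "set_integrable lborel {a..b} (\<lambda>x. g' x * f x)"
    by (rule set_integrable_mult_continuous[OF gi fc])
  show "set_integrable lborel {a..b} (\<lambda>x. f' x * g x + f x * g' x)"
    using set_integral_add(1)[OF fg gf] by (simp add: mult.commute)
  fix x assume x: "x \<in> {a..b}"
  define F where "F = (\<lambda>r. indicator {a..x} r * f' r)"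
  define G where "G = (\<lambda>r. indicator {a..x} r * g' r)"
  have iF: "integrable lborel F" and iG: "integrable lborel G"
    using set_integrable_subinterval[OF fi, of a x] set_integrable_subinterval[OF gi, of a x] x
    by (auto simp: F_def G_def set_integrable_def)
  have [measurable]: "F \<in> borel_measurable borel" "G \<in> borel_measurable borel"
    using iF iG by (auto dest: borel_measurable_integrable)
  have fr: "f r = f a + (LBINT s. F s * indicator {..r} s)" if "r \<in> {a..x}" for r
  proof -
    have "(LBINT s. F s * indicator {..r} s) = (LBINT s:{a..r}. f' s)"
      unfolding set_lebesgue_integral_def F_def
      by (rule Bochner_Integration.integral_cong) (use that in \<open>auto simp: indicator_def\<close>)
    then show ?thesis using f that x by (auto simp: AC_def)
  qed
  have gr: "g r = g a + (LBINT s. G s * indicator {..r} s)" if "r \<in> {a..x}" for r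
  proof -
    have "(LBINT s. G s * indicator {..r} s) = (LBINT s:{a..r}. g' s)"
      unfolding set_lebesgue_integral_def G_def
      by (rule Bochner_Integration.integral_cong) (use that in \<open>auto simp: indicator_def\<close>)
    then show ?thesis using g that x by (auto simp: AC_def)
  qed
  have sF: "(LBINT r. F r) = f x - f a" and sG: "(LBINT r. G r) = g x - g a"
    using f g x by (auto simp: F_def G_def AC_def set_lebesgue_integral_def)
  have iFG: "integrable (lborel \<Otimes>\<^sub>M lborel) (\<lambda>z. F (fst z) * G (snd z))"
    by (rule integrable_pair_mult[OF iF iG])
  have iFG1: "integrable (lborel \<Otimes>\<^sub>M lborel) (\<lambda>(r,s). F r * G s * indicator {z. snd z \<le> fst z} (r,s))"
    and iFG2: "integrable (lborel \<Otimes>\<^sub>M lborel) (\<lambda>(r,s). F r * G s * indicator {z. fst z \<le> snd z} (r,s))"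
    by (rule Bochner_Integration.integrable_bound[OF iFG];
        force simp: indicator_def split_beta' intro!: AE_I2)+
  let ?A = "LBINT r. LBINT s. F r * G s * indicator {z. snd z \<le> fst z} (r,s)"
  let ?B = "LBINT r. LBINT s. F r * G s * indicator {z. fst z \<le> snd z} (r,s)"
  have i1: "integrable lborel (\<lambda>r. LBINT s. F r * G s * indicator {z. snd z \<le> fst z} (r,s))"
    using lborel_pair.integrable_fst'[OF iFG1] by simp
  have i2: "integrable lborel (\<lambda>r. LBINT s. F r * G s * indicator {z. fst z \<le> snd z} (r,s))"
    using lborel_pair.integrable_fst'[OF iFG2] by simp
  have AB: "?A + ?B = (f x - f a) * (g x - g a)"
  proof -
    have "?A + ?B = (LBINT r. (LBINT s. F r * G s * indicator {z. snd z \<le> fst z} (r,s))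
        + (LBINT s. F r * G s * indicator {z. fst z \<le> snd z} (r,s)))"
      using i1 i2 by (simp add: Bochner_Integration.integral_add)
    also have "\<dots> = (LBINT r. F r * (LBINT s. G s))"
    proof (rule Bochner_Integration.integral_cong[OF refl])
      fix r
      have a: "integrable lborel (\<lambda>s. F r * G s * indicator {z. snd z \<le> fst z} (r,s))"
              "integrable lborel (\<lambda>s. F r * G s * indicator {z. fst z \<le> snd z} (r,s))"
        by (rule Bochner_Integration.integrable_bound[OF integrable_mult_right[OF iG, of "F r"]];
            auto simp: indicator_def intro!: AE_I2)+
      have "(LBINT s. F r * G s * indicator {z. snd z \<le> fst z} (r,s))
        + (LBINT s. F r * G s * indicator {z. fst z \<le> snd z} (r,s))
        = (LBINT s. F r * G s * indicator {z. snd z \<le> fst z} (r,s) + F r * G s * indicator {z. fst z \<le> snd z} (r,s))"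
        using a by (simp add: Bochner_Integration.integral_add)
      \<comment> \<open>Both closed triangles contain the diagonal, which for fixed \<open>r\<close>
        is a single point.\<close>
      also have "\<dots> = (LBINT s. F r * G s)"
        by (rule integral_cong_AE; (measurable)?)
           (use AE_lborel_singleton[of r] in \<open>auto elim!: eventually_mono simp: indicator_def\<close>)
      finally show "(LBINT s. F r * G s * indicator {z. snd z \<le> fst z} (r,s))
        + (LBINT s. F r * G s * indicator {z. fst z \<le> snd z} (r,s)) = F r * (LBINT s. G s)" by simp
    qed
    also have "\<dots> = (f x - f a) * (g x - g a)" using sF sG by simp
    finally show ?thesis .
  qed
  have B': "?B = (LBINT s. LBINT r. F r * G s * indicator {z. fst z \<le> snd z} (r,s))"
    using lborel_pair.Fubini_integral[OF iFG2] by simp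
  have A1: "(LBINT r:{a..x}. f' r * g r) = (f x - f a) * g a + ?A"
  proof -
    have "(LBINT r:{a..x}. f' r * g r) = (LBINT r. F r * g a + (LBINT s. F r * G s * indicator {z. snd z \<le> fst z} (r,s)))"
      unfolding set_lebesgue_integral_def
    proof (rule Bochner_Integration.integral_cong[OF refl])
      fix r
      have "(LBINT s. F r * G s * indicator {z. snd z \<le> fst z} (r,s)) = F r * (LBINT s. G s * indicator {..r} s)"
        by (subst integral_mult_right_zero[symmetric], rule Bochner_Integration.integral_cong) (auto simp: indicator_def)
      then show "indicator {a..x} r *\<^sub>R (f' r * g r) = F r * g a + (LBINT s. F r * G s * indicator {z. snd z \<le> fst z} (r,s))"
        using gr[of r] by (auto simp: F_def indicator_def algebra_simps)
    qed
    also have "\<dots> = (LBINT r. F r * g a) + ?A"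
      by (rule Bochner_Integration.integral_add) (use iF i1 in auto)
    finally show ?thesis using sF by simp
  qed
  have B1: "(LBINT r:{a..x}. g' r * f r) = (g x - g a) * f a + ?B"
  proof -
    have i3: "integrable lborel (\<lambda>s. LBINT r. F r * G s * indicator {z. fst z \<le> snd z} (r,s))"
      using lborel_pair.integrable_snd[OF iFG2] by simp
    have "(LBINT r:{a..x}. g' r * f r) = (LBINT r. G r * f a + (LBINT s. F s * G r * indicator {z. fst z \<le> snd z} (s,r)))"
      unfolding set_lebesgue_integral_def
    proof (rule Bochner_Integration.integral_cong[OF refl])
      fix r
      have "(LBINT s. F s * G r * indicator {z. fst z \<le> snd z} (s,r)) = G r * (LBINT s. F s * indicator {..r} s)"
        by (subst integral_mult_right_zero[symmetric], rule Bochner_Integration.integral_cong) (auto simp: indicator_def)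
      then show "indicator {a..x} r *\<^sub>R (g' r * f r) = G r * f a + (LBINT s. F s * G r * indicator {z. fst z \<le> snd z} (s,r))"
        using fr[of r] by (auto simp: G_def indicator_def algebra_simps)
    qed
    also have "\<dots> = (LBINT r. G r * f a) + ?B"
      unfolding B' by (rule Bochner_Integration.integral_add) (use iG i3 in auto)
    finally show ?thesis using sG by simp
  qed
  have "(LBINT y:{a..x}. f' y * g y + f y * g' y) = (LBINT y:{a..x}. f' y * g y) + (LBINT y:{a..x}. g' y * f y)"
    using set_integral_add(2)[OF set_integrable_subinterval[OF fg, of a x] set_integrable_subinterval[OF gf, of a x]] x
    by (simp add: mult.commute)
  then show "(LBINT y:{a..x}. f' y * g y + f y * g' y) = f x * g x - f a * g a"
    using A1 B1 AB by (simp add: algebra_simps)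
qed

section \<open>Test functions and weak derivatives\<close>

declare Ck.simps(2) [simp del]

definition smooth :: "('a::euclidean_space \<Rightarrow> real) \<Rightarrow> bool" where
  "smooth f \<longleftrightarrow> (\<forall>k. Ck k f)"

lemma frechet_derivative_real:
  assumes "(f has_real_derivative D) (at x)"
  shows "frechet_derivative f (at x) = (\<lambda>h. D * h)"
  using frechet_derivative_at[of f "\<lambda>h. D * h" x] assms
  by (simp add: has_field_derivative_def)

lemma Ck_Suc_realI:
  fixes f :: "real \<Rightarrow> real"
  assumes "\<And>x. (f has_real_derivative f' x) (at x)" "Ck k f'"
  shows "Ck (Suc k) f"
proof -
  have "(\<lambda>x. frechet_derivative f (at x) 1) = f'"
    using frechet_derivative_real[OF assms(1)] by auto
  moreover have "f differentiable at x" for x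
    using assms(1) real_differentiable_def by blast
  ultimately show ?thesis using assms(2) by (simp add: Ck.simps(2))
qed

lemma Ck_Suc_realD:
  fixes f :: "real \<Rightarrow> real"
  assumes "Ck (Suc k) f"
  shows "(f has_real_derivative deriv f x) (at x)" "Ck k (deriv f)"
proof -
  have d: "\<And>x. (f has_real_derivative deriv f x) (at x)"
    using assms by (auto simp: Ck.simps(2) DERIV_deriv_iff_real_differentiable)
  then show "(f has_real_derivative deriv f x) (at x)" .
  have "(\<lambda>x. frechet_derivative f (at x) 1) = deriv f"
    using frechet_derivative_real[OF d] by auto
  then show "Ck k (deriv f)" using assms by (simp add: Ck.simps(2))
qed

lemma Ck_0I: "Ck (Suc k) (f :: 'a::euclidean_space \<Rightarrow> real) \<Longrightarrow> Ck 0 f"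
  by (auto simp: Ck.simps(2) continuous_on_eq_continuous_at intro!: differentiable_imp_continuous_within)

lemma Ck_Suc_imp: "Ck (Suc k) (f :: real \<Rightarrow> real) \<Longrightarrow> Ck k f"
proof (induction k arbitrary: f)
  case 0
  then show ?case by (rule Ck_0I)
next
  case (Suc k)
  show ?case
    by (rule Ck_Suc_realI[OF Ck_Suc_realD(1)[OF Suc.prems] Suc.IH[OF Ck_Suc_realD(2)[OF Suc.prems]]])
qed

lemma Ck_add: "Ck k f \<Longrightarrow> Ck k g \<Longrightarrow> Ck k (\<lambda>x. f x + g x :: real)" for f g :: "real \<Rightarrow> real"
proof (induction k arbitrary: f g)
  case 0
  then show ?case by (auto intro: continuous_intros)
next
  case (Suc k)
  show ?case
    by (rule Ck_Suc_realI[of _ "\<lambda>x. deriv f x + deriv g x"])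
       (use Ck_Suc_realD[OF Suc.prems(1)] Ck_Suc_realD[OF Suc.prems(2)] Suc.IH
         in \<open>auto intro!: derivative_eq_intros\<close>)
qed

lemma Ck_mult: "Ck k f \<Longrightarrow> Ck k g \<Longrightarrow> Ck k (\<lambda>x. f x * g x :: real)" for f g :: "real \<Rightarrow> real"
proof (induction k arbitrary: f g)
  case 0
  then show ?case by (auto intro: continuous_intros)
next
  case (Suc k)
  note f = Ck_Suc_realD[OF Suc.prems(1)] Ck_Suc_imp[OF Suc.prems(1)]
  note g = Ck_Suc_realD[OF Suc.prems(2)] Ck_Suc_imp[OF Suc.prems(2)]
  show ?case
  proof (rule Ck_Suc_realI[of _ "\<lambda>x. deriv f x * g x + f x * deriv g x"])
    show "Ck k (\<lambda>x. deriv f x * g x + f x * deriv g x)"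
      by (intro Ck_add Suc.IH f g)
    show "((\<lambda>x. f x * g x) has_real_derivative deriv f x * g x + f x * deriv g x) (at x)" for x
      by (rule derivative_eq_intros f g refl)+ simp
  qed
qed

lemma Ck_const [simp]: "Ck k (\<lambda>x::real. c)"
proof (induction k arbitrary: c)
  case (Suc k)
  show ?case by (rule Ck_Suc_realI[of _ "\<lambda>x. 0"]) (use Suc in auto)
qed simp

lemma Ck_affine: "Ck k f \<Longrightarrow> Ck k (\<lambda>x. f (a * x + b))" for f :: "real \<Rightarrow> real"
proof (induction k arbitrary: f)
  case 0
  then have "continuous_on UNIV f" by simp
  then have "continuous_on UNIV (\<lambda>x. f (a * x + b))"
    by (rule continuous_on_compose2) (auto intro!: continuous_intros)
  then show ?case by simp
next
  case (Suc k)
  note f = Ck_Suc_realD[OF Suc.prems]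
  show ?case
  proof (rule Ck_Suc_realI[of _ "\<lambda>x. a * deriv f (a * x + b)"])
    show "Ck k (\<lambda>x. a * deriv f (a * x + b))" by (intro Ck_mult Ck_const Suc.IH f)
    show "((\<lambda>x. f (a * x + b)) has_real_derivative a * deriv f (a * x + b)) (at x)" for x
    proof -
      have "((\<lambda>x. a * x + b) has_real_derivative a) (at x)"
        by (auto intro!: derivative_eq_intros)
      from DERIV_chain2[OF f(1) this] show ?thesis by (simp add: mult.commute)
    qed
  qed
qed

lemma smoothD:
  fixes f :: "real \<Rightarrow> real"
  assumes "smooth f"
  shows "(f has_real_derivative deriv f x) (at x)" "smooth (deriv f)" "continuous_on UNIV f"
  using assms Ck_Suc_realD[of _ f] unfolding smooth_def by (blast, blast, metis Ck.simps(1))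

text \<open>Coinduction over a class closed under differentiation; it is applied to the class of all
  \<open>pexp q\<close>, so that no higher derivative has to be computed.\<close>

lemma smooth_coinduct:
  fixes f :: "real \<Rightarrow> real"
  assumes "P f" "\<And>f. P f \<Longrightarrow> \<exists>f'. (\<forall>x. (f has_real_derivative f' x) (at x)) \<and> P f'"
  shows "smooth f"
proof -
  have "P f \<Longrightarrow> Ck k f" for k f
  proof (induction k arbitrary: f)
    case 0
    then obtain f' where "\<And>x. (f has_real_derivative f' x) (at x)" using assms(2) by blast
    then show ?case by (auto simp: continuous_on_eq_continuous_at intro: DERIV_isCont)
  next
    case (Suc k)
    then obtain f' where "\<And>x. (f has_real_derivative f' x) (at x)" "P f'" using assms(2) by blast
    with Suc.IH show ?case by (intro Ck_Suc_realI[of f f']) auto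
  qed
  with assms(1) show ?thesis by (auto simp: smooth_def)
qed

lemma smooth_derivI:
  fixes f :: "real \<Rightarrow> real"
  assumes "\<And>x. (f has_real_derivative f' x) (at x)" "smooth f'"
  shows "smooth f"
  unfolding smooth_def
proof
  fix k show "Ck k f"
  proof (cases k)
    case 0
    then show ?thesis using assms(1) by (auto simp: continuous_on_eq_continuous_at intro: DERIV_isCont)
  next
    case (Suc n)
    then show ?thesis using Ck_Suc_realI[OF assms(1), of n] assms(2) by (auto simp: smooth_def)
  qed
qed

lemma poly_exp_tendsto_0: "((\<lambda>y. poly q y * exp (- y)) \<longlongrightarrow> 0) at_top" for q :: "real poly"
proof -
  have "((\<lambda>y. \<Sum>i\<le>degree q. coeff q i * (y ^ i / exp y)) \<longlongrightarrow> (\<Sum>i\<le>degree q. coeff q i * 0)) at_top"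
    by (intro tendsto_sum tendsto_mult tendsto_const tendsto_power_div_exp_0)
  then show ?thesis
    by (simp add: poly_altdef sum_distrib_right sum_divide_distrib exp_minus divide_inverse mult.assoc)
qed

text \<open>The polynomial factor makes the usual flat function \<open>exp (- 1 / x)\<close> part of
  a family that is closed under differentiation.\<close>

definition pexp :: "real poly \<Rightarrow> real \<Rightarrow> real" where
  "pexp q x = (if x > 0 then poly q (1 / x) * exp (- (1 / x)) else 0)"

text \<open>With \<open>y = 1 / x\<close> one has \<open>dy/dx = - y^2\<close>, which turns
  \<open>q\<close> into \<open>y^2 (q - q')\<close>. At zero the difference quotient is of the same
  type with \<open>pCons 0 q\<close> for \<open>q\<close>, hence tends to zero.\<close>

lemma pexp_has_derivative:
  "(pexp q has_real_derivative pexp ([:0, 0, 1:] * (q - pderiv q)) x) (at x)"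
proof -
  consider "x > 0" | "x < 0" | "x = 0" by linarith
  then show ?thesis
  proof cases
    case 1
    have "((\<lambda>x. poly q (1 / x) * exp (- (1 / x))) has_real_derivative
       pexp ([:0, 0, 1:] * (q - pderiv q)) x) (at x)"
      using 1 by (auto intro!: derivative_eq_intros simp: pexp_def field_simps power2_eq_square)
    then show ?thesis
      by (rule has_field_derivative_transform_within_open[where S = "{0<..}"])
         (use 1 in \<open>auto simp: pexp_def\<close>)
  next
    case 2
    have "((\<lambda>x. 0) has_real_derivative 0) (at x)" by simp
    then have "(pexp q has_real_derivative 0) (at x)"
      by (rule has_field_derivative_transform_within_open[where S = "{..<0}"])
         (use 2 in \<open>auto simp: pexp_def\<close>)
    then show ?thesis using 2 by (simp add: pexp_def)
  next
    case 3
    have r: "((\<lambda>h. pexp q h / h) \<longlongrightarrow> 0) (at_right 0)"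
    proof -
      have "((\<lambda>h. poly (pCons 0 q) (inverse h) * exp (- inverse h)) \<longlongrightarrow> 0) (at_right 0)"
        by (rule filterlim_compose[OF poly_exp_tendsto_0 filterlim_inverse_at_top_right])
      then show ?thesis
        by (rule Lim_transform_eventually)
           (auto simp: pexp_def eventually_at_filter field_simps)
    qed
    have l: "((\<lambda>h. pexp q h / h) \<longlongrightarrow> 0) (at_left 0)"
      by (rule Lim_transform_eventually[OF tendsto_const])
         (auto simp: pexp_def eventually_at_filter)
    have "((\<lambda>h. pexp q h / h) \<longlongrightarrow> 0) (at 0)"
      using l r by (simp add: filterlim_split_at)
    then show ?thesis using 3 by (simp add: has_field_derivative_def has_derivative_at pexp_def DERIV_def flip: has_field_derivative_def)
  qed
qed

lemma smooth_pexp: "smooth (pexp q)"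
  by (rule smooth_coinduct[where P = "\<lambda>f. \<exists>q. f = pexp q"]) (use pexp_has_derivative in blast)+

text \<open>Two dilated copies of the flat step, one for each end. Dilation by \<open>n + 1\<close>
  drives the values inside to 1, and the shift by 1 keeps the support strictly between
  \<open>l\<close> and \<open>u\<close>. Later \<open>l\<close> and \<open>u\<close> are rational,
  so that the family is countable.\<close>

definition bump :: "real \<Rightarrow> real \<Rightarrow> nat \<Rightarrow> real \<Rightarrow> real" where
  "bump l u n x = pexp 1 (real (Suc n) * x + (- real (Suc n) * l - 1)) *
     pexp 1 ((- real (Suc n)) * x + (real (Suc n) * u - 1))"

lemma smooth_bump: "smooth (bump l u n)"
  unfolding smooth_def bump_def
  using smooth_pexp[of 1] unfolding smooth_def by (intro allI Ck_mult Ck_affine) auto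

lemma pexp_1_bounds: "0 \<le> pexp 1 x" "pexp 1 x \<le> 1"
  by (auto simp: pexp_def)

lemma bump_bounds: "0 \<le> bump l u n x" "bump l u n x \<le> 1"
  unfolding bump_def by (simp_all add: pexp_1_bounds mult_le_one)

lemma bump_support: "x \<notin> {l + 1 / Suc n..u - 1 / Suc n} \<Longrightarrow> bump l u n x = 0"
  by (auto simp: bump_def pexp_def field_simps)

lemma bump_tendsto: "(\<lambda>n. bump l u n x) \<longlonglongrightarrow> indicator {l<..<u} x"
proof (cases "x \<in> {l<..<u}")
  case True
  have E: "(\<lambda>n. pexp 1 (real (Suc n) * d - 1)) \<longlonglongrightarrow> 1" if "d > 0" for d
  proof -
    have "filterlim (\<lambda>n. real (Suc n) * d - 1) at_top sequentially"
      using that by real_asymp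
    then have *: "\<forall>\<^sub>F n in sequentially. real (Suc n) * d - 1 > 0"
      unfolding filterlim_at_top_dense by blast
    have "(\<lambda>n. exp (- (1 / (real (Suc n) * d - 1)))) \<longlonglongrightarrow> 1"
      using that by real_asymp
    then show ?thesis
      by (rule Lim_transform_eventually) (use * in \<open>auto elim!: eventually_mono simp: pexp_def\<close>)
  qed
  have "(\<lambda>n. pexp 1 (real (Suc n) * (x - l) - 1) * pexp 1 (real (Suc n) * (u - x) - 1)) \<longlonglongrightarrow> 1 * 1"
    by (intro tendsto_mult E) (use True in auto)
  then show ?thesis using True by (simp add: bump_def algebra_simps)
next
  case False
  have "bump l u n x = 0" for n
  proof (rule bump_support)
    have "1 / real (Suc n) > 0" by simp
    then show "x \<notin> {l + 1 / Suc n..u - 1 / Suc n}"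
      using False by (simp only: atLeastAtMost_iff greaterThanLessThan_iff, linarith)
  qed
  then show ?thesis using False by simp
qed

lemma bump_test_fun:
  assumes "c \<le> l" "u \<le> d"
  shows "bump l u n \<in> test_fun {c<..<d}"
proof -
  have "1 / real (Suc n) > 0" by simp
  then have "{l + 1 / Suc n..u - 1 / Suc n} \<subseteq> {c<..<d}"
    using assms by (intro subsetI) (simp only: atLeastAtMost_iff greaterThanLessThan_iff, linarith)
  then show ?thesis
    using smooth_bump bump_support unfolding test_fun_def smooth_def
    by (auto simp del: of_nat_Suc intro!: exI[of _ "{l + 1 / Suc n..u - 1 / Suc n}"])
qed

text \<open>The positive and the negative part of \<open>f\<close> are densities of two measures
  that agree on all half-lines, hence everywhere; densities are unique almost everywhere.\<close>

lemma integral_tails_zero: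
  assumes f: "integrable lborel f" and z: "\<And>x::real. (LBINT y:{x<..}. f y) = 0"
  shows "AE x in lborel. f x = (0::real)"
proof -
  have [measurable]: "f \<in> borel_measurable borel" using f by (auto dest: borel_measurable_integrable)
  define p where "p = (\<lambda>x. ennreal (max 0 (f x)))"
  define m where "m = (\<lambda>x. ennreal (max 0 (- f x)))"
  have [measurable]: "p \<in> borel_measurable borel" "m \<in> borel_measurable borel"
    by (auto simp: p_def m_def)
  have e: "emeasure (density lborel p) {x<..} = ennreal (LBINT y:{x<..}. max 0 (f y))"
       "emeasure (density lborel m) {x<..} = ennreal (LBINT y:{x<..}. max 0 (- f y))"
       "(LBINT y:{x<..}. max 0 (f y)) = (LBINT y:{x<..}. max 0 (- f y))" for x
  proof -
    have i: "set_integrable lborel {x<..} (\<lambda>y. max 0 (f y))" "set_integrable lborel {x<..} (\<lambda>y. max 0 (- f y))"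
      unfolding set_integrable_def
      by (intro integrable_mult_indicator Bochner_Integration.integrable_max f
          Bochner_Integration.integrable_minus integrable_zero; simp)+
    show "emeasure (density lborel p) {x<..} = ennreal (LBINT y:{x<..}. max 0 (f y))"
      using nn_integral_eq_integral[OF i(1)[unfolded set_integrable_def]]
      by (auto simp: emeasure_density set_lebesgue_integral_def p_def
         indicator_def max_def if_distrib ennreal_neg cong: if_cong intro!: nn_integral_cong elim!: trans[rotated])
    show "emeasure (density lborel m) {x<..} = ennreal (LBINT y:{x<..}. max 0 (- f y))"
      using nn_integral_eq_integral[OF i(2)[unfolded set_integrable_def]]
      by (auto simp: emeasure_density set_lebesgue_integral_def m_def
         indicator_def max_def if_distrib ennreal_neg cong: if_cong intro!: nn_integral_cong elim!: trans[rotated])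
    have "(LBINT y:{x<..}. max 0 (f y)) - (LBINT y:{x<..}. max 0 (- f y))
        = (LBINT y:{x<..}. max 0 (f y) - max 0 (- f y))"
      using set_integral_diff(2)[OF i] by simp
    also have "\<dots> = (LBINT y:{x<..}. f y)"
      by (rule set_lebesgue_integral_cong) (auto simp: max_def)
    finally show "(LBINT y:{x<..}. max 0 (f y)) = (LBINT y:{x<..}. max 0 (- f y))" using z by simp
  qed
  have "density lborel p = density lborel m"
    by (rule measure_eqI_lessThan) (auto simp: e)
  then have "AE x in lborel. p x = m x"
    by (intro sigma_finite_measure.density_unique[OF sigma_finite_lborel]) auto
  then show ?thesis
    by (rule eventually_mono) (auto simp: p_def m_def max_def split: if_splits)
qed

text \<open>The bumps converge boundedly to indicators, so the integral of \<open>f\<close> vanishes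
  over intervals with rational end points and then over all tails. The restriction to rational end
  points is what makes the family of \<open>du_Bois_Reymond\<close> countable.\<close>

lemma rational_bumps_separate:
  fixes f :: "real \<Rightarrow> real"
  assumes cd: "c < d" and f: "set_integrable lborel {c<..<d} f"
    and z: "\<And>l u n. l \<in> \<rat> \<inter> {c<..<d} \<Longrightarrow> u \<in> \<rat> \<inter> {c<..<d} \<Longrightarrow>
              (LBINT x:{c<..<d}. f x * bump l u n x) = 0"
  shows "AE x in lborel. x \<in> {c<..<d} \<longrightarrow> f x = 0"
proof -
  define F where "F = (\<lambda>x. indicator {c<..<d} x * f x)"
  have F: "integrable lborel F" using f by (simp add: F_def set_integrable_def)
  have [measurable]: "F \<in> borel_measurable borel" using F by (auto dest: borel_measurable_integrable)
  have [measurable]: "bump l u n \<in> borel_measurable borel" for l u n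
    using smoothD(3)[OF smooth_bump] by (rule borel_measurable_continuous_onI)
  have zi: "(LINT x|lborel. F x * indicator {l<..<u} x) = 0"
    if "l \<in> \<rat> \<inter> {c<..<d}" "u \<in> \<rat> \<inter> {c<..<d}" for l u
  proof -
    have "(\<lambda>n. LINT x|lborel. F x * bump l u n x) \<longlonglongrightarrow> (LINT x|lborel. F x * indicator {l<..<u} x)"
    proof (rule integral_dominated_convergence[where w = "\<lambda>x. \<bar>F x\<bar>"])
      show "AE x in lborel. (\<lambda>n. F x * bump l u n x) \<longlonglongrightarrow> F x * indicator {l<..<u} x"
        by (intro AE_I2 tendsto_mult tendsto_const bump_tendsto)
      show "AE x in lborel. norm (F x * bump l u n x) \<le> \<bar>F x\<bar>" for n
        using bump_bounds[of l u n] by (auto simp: abs_mult intro!: AE_I2 mult_left_le)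
    qed (use F in auto)
    moreover have "(LINT x|lborel. F x * bump l u n x) = 0" for n
      using z[OF that, of n] by (simp add: F_def set_lebesgue_integral_def mult.assoc)
    ultimately show ?thesis by (simp add: LIMSEQ_const_iff)
  qed
  \<comment> \<open>Neither \<open>m\<close> nor \<open>d\<close> need be rational, and
    \<open>m\<close> may be the end point \<open>c\<close> itself; the interval is exhausted from
    inside by rational ones.\<close>
  have zt: "(LINT x|lborel. F x * indicator {m<..<d} x) = 0" if m: "c \<le> m" "m < d" for m
  proof -
    have "\<exists>l\<in>\<rat>. m < l \<and> l < min d (m + 1 / Suc n)" for n
      by (rule Rats_dense_in_real) (use m in auto)
    then obtain l where l: "\<And>n. l n \<in> \<rat>" "\<And>n. m < l n" "\<And>n. l n < d" "\<And>n. l n < m + 1 / real (Suc n)"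
      by (metis min_less_iff_conj)
    have "\<exists>u\<in>\<rat>. max m (d - 1 / Suc n) < u \<and> u < d" for n
      by (rule Rats_dense_in_real) (use m in auto)
    then obtain u where u: "\<And>n. u n \<in> \<rat>" "\<And>n. m < u n" "\<And>n. u n < d" "\<And>n. d - 1 / real (Suc n) < u n"
      by (metis max_less_iff_conj)
    have "(\<lambda>n. LINT x|lborel. F x * indicator {l n<..<u n} x) \<longlonglongrightarrow> (LINT x|lborel. F x * indicator {m<..<d} x)"
    proof (rule integral_dominated_convergence[where w = "\<lambda>x. \<bar>F x\<bar>"])
      have "(\<lambda>n. indicator {l n<..<u n} x :: real) \<longlonglongrightarrow> indicator {m<..<d} x" for x
      proof (cases "x \<in> {m<..<d}")
        case True
        have "(\<lambda>n. 1 / real (Suc n)) \<longlonglongrightarrow> 0" by real_asymp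
        then have "\<forall>\<^sub>F n in sequentially. 1 / real (Suc n) < min (x - m) (d - x)"
          using True by (intro order_tendstoD(2)) auto
        then have "\<forall>\<^sub>F n in sequentially. indicator {m<..<d} x = (indicator {l n<..<u n} x :: real)"
        proof (rule eventually_mono)
          fix n assume "1 / real (Suc n) < min (x - m) (d - x)"
          then show "indicator {m<..<d} x = (indicator {l n<..<u n} x :: real)"
            using l(4)[of n] u(4)[of n] True by (auto simp: indicator_def)
        qed
        then show ?thesis by (rule Lim_transform_eventually[OF tendsto_const])
      next
        case False
        then have "indicator {l n<..<u n} x = (0 :: real)" for n
          using l(2)[of n] u(3)[of n] by (auto simp: indicator_def)
        with False show ?thesis by simp
      qed
      then show "AE x in lborel. (\<lambda>n. F x * indicator {l n<..<u n} x) \<longlonglongrightarrow> F x * indicator {m<..<d} x"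
        by (intro AE_I2 tendsto_mult tendsto_const)
    qed (use F in \<open>auto simp: indicator_def intro!: AE_I2\<close>)
    moreover have "(LINT x|lborel. F x * indicator {l n<..<u n} x) = 0" for n
      by (rule zi) (use l[of n] u[of n] m in auto)
    ultimately show ?thesis by (simp add: LIMSEQ_const_iff)
  qed
  have "AE x in lborel. F x = 0"
  proof (rule integral_tails_zero[OF F])
    fix x
    have "(LBINT y:{x<..}. F y) = (LINT y|lborel. F y * indicator {max c x<..<d} y)"
      unfolding set_lebesgue_integral_def
      by (rule Bochner_Integration.integral_cong) (auto simp: F_def indicator_def)
    also have "\<dots> = 0"
    proof (cases "x < d")
      case True
      then show ?thesis using cd by (intro zt) auto
    next
      case False
      then show ?thesis by (simp add: indicator_def)
    qed
    finally show "(LBINT y:{x<..}. F y) = 0" .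
  qed
  then show ?thesis by (rule eventually_mono) (auto simp: F_def indicator_def)
qed

lemma set_integrable_bump: "set_integrable lborel A (bump l u n)" if "A \<in> sets borel" "A \<subseteq> {c..d}"
proof -
  have "set_integrable lborel {c..d} (bump l u n)"
    using borel_integrable_compact[of "{c..d}" "bump l u n"] smoothD(3)[OF smooth_bump]
    by (auto simp: set_integrable_def intro: continuous_on_subset)
  then show ?thesis by (rule set_integrable_subset) (use that in auto)
qed

lemma bump_integral_pos:
  assumes "c < d"
  shows "\<exists>n. (LBINT x:{c<..<d}. bump c d n x) > 0"
proof -
  have [measurable]: "bump l u n \<in> borel_measurable borel" for l u n
    using smoothD(3)[OF smooth_bump] by (rule borel_measurable_continuous_onI)
  have "(\<lambda>n. LINT x|lborel. indicator {c<..<d} x * bump c d n x) \<longlonglongrightarrow> (LINT x|lborel. indicator {c<..<d} x * indicator {c<..<d} x)"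
  proof (rule integral_dominated_convergence[where w = "indicator {c<..<d}"])
    show "AE x in lborel. (\<lambda>n. indicator {c<..<d} x * bump c d n x) \<longlonglongrightarrow> indicator {c<..<d} x * indicator {c<..<d} x"
      by (intro AE_I2 tendsto_mult tendsto_const bump_tendsto)
    show "AE x in lborel. norm (indicator {c<..<d} x * bump c d n x) \<le> indicator {c<..<d} x" for n
      using bump_bounds[of c d n] by (auto simp: indicator_def intro!: AE_I2)
  qed (use assms in \<open>auto intro!: integrable_real_indicator\<close>)
  moreover have "(LINT x|lborel. indicator {c<..<d} x * indicator {c<..<d} x) = d - c"
    using assms by (simp flip: indicator_inter_arith)
  ultimately have "\<forall>\<^sub>F n in sequentially. (LINT x|lborel. indicator {c<..<d} x * bump c d n x) > 0"
    using assms by (auto intro!: order_tendstoD(1))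
  then show ?thesis by (auto simp: set_lebesgue_integral_def dest: eventually_happens)
qed

text \<open>Zero mean is what makes the primitive vanish to the right of the support, so that it is
  again a test function.\<close>

lemma smooth_primitive:
  assumes \<psi>: "smooth \<psi>" and supp: "\<And>x. x \<notin> {\<alpha>..\<beta>} \<Longrightarrow> \<psi> x = 0"
    and ord: "c < \<alpha>" "\<beta> < d" and z: "(LBINT x:{c<..<d}. \<psi> x) = 0"
  shows "\<exists>\<Theta>. \<Theta> \<in> test_fun {c<..<d} \<and> (\<forall>x. (\<Theta> has_real_derivative \<psi> x) (at x))"
proof -
  define \<Theta> where "\<Theta> x = integral {c..x} \<psi>" for x
  have cont: "continuous_on A \<psi>" for A
    using smoothD(3)[OF \<psi>] by (rule continuous_on_subset) auto
  have zero_left: "\<Theta> x = 0" if "x < \<alpha>" for x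
  proof -
    have "integral {c..x} \<psi> = integral {c..x} (\<lambda>x. 0)"
      by (rule integral_cong) (use supp that in auto)
    then show ?thesis by (simp add: \<Theta>_def)
  qed
  have zero_right: "\<Theta> x = 0" if "x > \<beta>" for x
  proof (cases "x \<ge> \<alpha>")
    case True
    have "set_integrable lborel {c..x} \<psi>"
      using borel_integrable_compact[OF _ cont, of "{c..x}"] by (simp add: set_integrable_def)
    then have "\<Theta> x = (LBINT y:{c..x}. \<psi> y)"
      unfolding \<Theta>_def by (rule set_borel_integral_eq_integral(2)[symmetric])
    also have "\<dots> = (LBINT y:{c<..<d}. \<psi> y)"
      unfolding set_lebesgue_integral_def
      by (rule Bochner_Integration.integral_cong) (use supp ord that True in \<open>auto simp: indicator_def\<close>)
    finally show ?thesis using z by simp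
  qed (use zero_left in auto)
  have der: "(\<Theta> has_real_derivative \<psi> x) (at x)" for x
  proof (cases "x > c")
    case True
    have "(\<Theta> has_real_derivative \<psi> x) (at x within {c..x+1})"
      unfolding \<Theta>_def by (rule integral_has_real_derivative[OF cont]) (use True in auto)
    moreover have "at x within {c..x+1} = at x"
      by (rule at_within_interior) (use True in auto)
    ultimately show ?thesis by simp
  next
    case False
    have "((\<lambda>x. 0) has_real_derivative \<psi> x) (at x)"
      using supp[of x] False ord by simp
    then show ?thesis
      by (rule has_field_derivative_transform_within_open[where S = "{..<\<alpha>}"])
         (use False ord zero_left in auto)
  qed
  have "smooth \<Theta>" by (rule smooth_derivI[OF der \<psi>])
  then have "\<Theta> \<in> test_fun {c<..<d}"
    using zero_left zero_right ord unfolding test_fun_def smooth_def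
    by (auto intro!: exI[of _ "{\<alpha>..\<beta>}"])
  with der show ?thesis by blast
qed

lemma test_fun_smooth: "\<phi> \<in> test_fun S \<Longrightarrow> smooth \<phi>"
  by (auto simp: test_fun_def smooth_def)

lemma test_fun_zero: "\<phi> \<in> test_fun S \<Longrightarrow> x \<notin> S \<Longrightarrow> \<phi> x = 0"
  by (auto simp: test_fun_def)

text \<open>Only countably many test functions are used, so that the null sets arising from a parameter
  can be collected.\<close>

lemma du_Bois_Reymond:
  assumes cd: "c < d"
  obtains F :: "(real \<Rightarrow> real) set" where "countable F" "F \<subseteq> test_fun {c<..<d}"
    "\<And>f g. set_integrable lborel {c<..<d} f \<Longrightarrow> set_integrable lborel {c<..<d} g \<Longrightarrow>
       (\<And>\<theta>. \<theta> \<in> F \<Longrightarrow> (LBINT x:{c<..<d}. f x * deriv \<theta> x) = - (LBINT x:{c<..<d}. g x * \<theta> x)) \<Longrightarrow>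
       \<exists>C. AE x in lborel. x \<in> {c<..<d} \<longrightarrow> f x = C + (LBINT y:{c<..x}. g y)"
proof -
  let ?I = "{c<..<d}"
  obtain n0 where n0: "(LBINT x:?I. bump c d n0 x) > 0"
    using bump_integral_pos[OF cd] by blast
  \<comment> \<open>Subtracting the multiple \<open>m l u n\<close> of one fixed bump removes the
    mean of \<open>bump l u n\<close>; the resulting \<psi> has a primitive among the test
    functions. Testing with these primitives says that \<open>f\<close> minus a primitive of
    \<open>g\<close> acts on bumps like a constant.\<close>
  define m where "m l u n = (LBINT x:?I. bump l u n x) / (LBINT x:?I. bump c d n0 x)" for l u n
  define \<psi> where "\<psi> l u n x = bump l u n x + (- m l u n) * bump c d n0 x" for l u n x
  have ib: "set_integrable lborel ?I (bump l u n)" for l u n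
    by (rule set_integrable_bump[of _ c d]) auto
  have cb: "continuous_on A (bump l u n)" for A l u n
    using smoothD(3)[OF smooth_bump] by (rule continuous_on_subset) auto
  have z\<psi>: "(LBINT x:?I. \<psi> l u n x) = 0" for l u n
  proof -
    have "(LBINT x:?I. \<psi> l u n x) = (LBINT x:?I. bump l u n x) + (LBINT x:?I. (- m l u n) * bump c d n0 x)"
      unfolding \<psi>_def by (intro set_integral_add(2) set_integrable_mult_right ib)
    also have "(LBINT x:?I. (- m l u n) * bump c d n0 x) = (- m l u n) * (LBINT x:?I. bump c d n0 x)"
      by (rule set_integral_mult_right)
    finally show ?thesis using n0 by (simp add: m_def)
  qed
  have s\<psi>: "smooth (\<psi> l u n)" for l u n
    using smooth_bump unfolding \<psi>_def smooth_def by (intro allI Ck_add Ck_mult Ck_const) auto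
  have "\<exists>\<Theta>. \<Theta> \<in> test_fun ?I \<and> (\<forall>x. (\<Theta> has_real_derivative \<psi> l u n x) (at x))"
    if lu: "l \<in> ?I" "u \<in> ?I" for l u n
  proof (rule smooth_primitive[OF s\<psi> _ _ _ z\<psi>])
    let ?e = "1 / real (Suc n0)"
    have e: "?e > 0" "1 / real (Suc n) > 0" by auto
    show "c < min l (c + ?e)" "max u (d - ?e) < d" using lu e by (auto simp del: of_nat_Suc)
    fix x assume x: "x \<notin> {min l (c + ?e)..max u (d - ?e)}"
    have "bump l u n x = 0" by (rule bump_support) (use x e in \<open>simp del: of_nat_Suc, linarith\<close>)
    moreover have "bump c d n0 x = 0" by (rule bump_support) (use x e in \<open>simp del: of_nat_Suc, linarith\<close>)
    ultimately show "\<psi> l u n x = 0" by (simp add: \<psi>_def)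
  qed
  then obtain \<Theta> where \<Theta>: "\<And>l u n. l \<in> ?I \<Longrightarrow> u \<in> ?I \<Longrightarrow> \<Theta> l u n \<in> test_fun ?I"
     "\<And>l u n x. l \<in> ?I \<Longrightarrow> u \<in> ?I \<Longrightarrow> (\<Theta> l u n has_real_derivative \<psi> l u n x) (at x)"
    by metis
  define F where "F = (\<lambda>(l,u,n). \<Theta> l u n) ` ((\<rat> \<inter> ?I) \<times> (\<rat> \<inter> ?I) \<times> UNIV)"
  show ?thesis
  proof (rule that[of F])
    show "countable F" unfolding F_def
      by (intro countable_image countable_SIGMA countable_Int1 countable_rat) auto
    show "F \<subseteq> test_fun ?I" using \<Theta>(1) by (auto simp: F_def)
    fix f g
    assume f: "set_integrable lborel ?I f" and g: "set_integrable lborel ?I g"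
      and eq: "\<And>\<theta>. \<theta> \<in> F \<Longrightarrow> (LBINT x:?I. f x * deriv \<theta> x) = - (LBINT x:?I. g x * \<theta> x)"
    define h where "h = (\<lambda>x. indicator ?I x * g x)"
    have hi: "integrable lborel h" using g by (simp add: h_def set_integrable_def)
    define H where "H = (\<lambda>x. LBINT y:{c..x}. h y)"
    have AH: "AC c d H h"
      unfolding AC_def
    proof (intro conjI ballI)
      show "set_integrable lborel {c..d} h"
        unfolding set_integrable_def by (rule integrable_mult_indicator) (use hi in auto)
      have "H c = (LBINT y:{c..c}. 0)"
        unfolding H_def by (rule set_lebesgue_integral_cong) (auto simp: h_def)
      then show "(LBINT y:{c..x}. h y) = H x - H c" for x
        by (simp add: H_def)
    qed
    note Hc = AC_continuous[OF AH]
    have Hi: "set_integrable lborel {c..d} H"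
      using borel_integrable_compact[OF _ Hc] by (simp add: set_integrable_def)
    have HI: "set_integrable lborel ?I H" by (rule set_integrable_subset[OF Hi]) auto
    have mulint: "set_integrable lborel ?I (\<lambda>x. k x * w x)"
      if "set_integrable lborel ?I k" "continuous_on {c..d} w" for k w :: "real \<Rightarrow> real"
    proof -
      define k' where "k' x = indicator ?I x * k x" for x
      have "set_integrable lborel {c..d} k'"
        using that(1) unfolding k'_def set_integrable_def
        by (rule Bochner_Integration.integrable_cong[THEN iffD1, rotated 2]) (auto simp: indicator_def)
      from set_integrable_mult_continuous[OF this that(2)]
      have "set_integrable lborel ?I (\<lambda>x. k' x * w x)" by (rule set_integrable_subset) auto
      then show ?thesis
        by (rule set_integrable_cong[THEN iffD1, rotated 3]) (auto simp: k'_def)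
    qed
    define D where "D = (\<lambda>x. f x - H x)"
    have Di: "set_integrable lborel ?I D"
      unfolding D_def by (rule set_integral_diff(1)[OF f HI])
    \<comment> \<open>The constant is forced: it is the mean of \<open>D\<close> with respect to the
      fixed bump.\<close>
    define C where "C = (LBINT x:?I. D x * bump c d n0 x) / (LBINT x:?I. bump c d n0 x)"
    have Dm: "set_integrable lborel ?I (\<lambda>x. D x * bump l u n x)" for l u n
      by (rule mulint[OF Di cb])
    have "AE x in lborel. x \<in> ?I \<longrightarrow> D x - C = 0"
    proof (rule rational_bumps_separate[OF cd])
      have "set_integrable lborel ?I (\<lambda>x. C)"
        using cd by (intro set_integrable_subset[of lborel "{c..d}" "\<lambda>x. C" "?I"])
           (auto simp: set_integrable_def intro!: borel_integrable_compact)
      then show "set_integrable lborel ?I (\<lambda>x. D x - C)" by (rule set_integral_diff(1)[OF Di])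
      fix l u n assume l: "l \<in> \<rat> \<inter> ?I" and u: "u \<in> \<rat> \<inter> ?I"
      let ?\<theta> = "\<Theta> l u n"
      have th: "?\<theta> \<in> test_fun ?I" "\<And>x. (?\<theta> has_real_derivative \<psi> l u n x) (at x)" "?\<theta> \<in> F"
        using \<Theta>[of l u n] l u by (auto simp: F_def intro!: rev_image_eqI[of "(l, u, n)"])
      have d\<theta>: "deriv ?\<theta> = \<psi> l u n" using th(2) by (auto intro: DERIV_imp_deriv)
      have c\<psi>: "continuous_on A (\<psi> l u n)" for A
        using smoothD(3)[OF s\<psi>] by (rule continuous_on_subset) auto
      have "AC c d ?\<theta> (\<psi> l u n)"
        by (rule AC_C1[OF _ c\<psi>]) (use th(2) in \<open>auto intro: has_field_derivative_at_within\<close>)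
      from AC_mult[OF AH this] have "AC c d (\<lambda>x. H x * ?\<theta> x) (\<lambda>x. h x * ?\<theta> x + H x * \<psi> l u n x)" .
      from AC_integral[OF this] cd
      have e1: "(LBINT x:{c..d}. h x * ?\<theta> x + H x * \<psi> l u n x) = 0"
        using test_fun_zero[OF th(1), of c] test_fun_zero[OF th(1), of d] by simp
      have c\<theta>: "continuous_on A ?\<theta>" for A
        using smoothD(3)[OF test_fun_smooth[OF th(1)]] by (rule continuous_on_subset) auto
      have hI: "set_integrable lborel ?I h" using hi unfolding set_integrable_def
        by (intro integrable_mult_indicator) auto
      have "(LBINT x:{c..d}. h x * ?\<theta> x + H x * \<psi> l u n x) = (LBINT x:?I. h x * ?\<theta> x + H x * \<psi> l u n x)"
        unfolding set_lebesgue_integral_def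
        by (rule integral_cong_AE)
           (use set_integral_add(1)[OF mulint[OF hI c\<theta>] mulint[OF HI c\<psi>]]
               AE_lborel_singleton[of c] AE_lborel_singleton[of d]
               set_integral_add(1)[OF set_integrable_mult_continuous[OF _ c\<theta>, of c d h] set_integrable_mult_continuous[OF Hi c\<psi>]]
               AC_integrable[OF AH]
            in \<open>auto simp: set_integrable_def indicator_def dest: borel_measurable_integrable elim: eventually_elim2\<close>)
      also have "\<dots> = (LBINT x:?I. h x * ?\<theta> x) + (LBINT x:?I. H x * \<psi> l u n x)"
        by (rule set_integral_add(2)[OF mulint[OF hI c\<theta>] mulint[OF HI c\<psi>]])
      also have "(LBINT x:?I. h x * ?\<theta> x) = (LBINT x:?I. g x * ?\<theta> x)"
        by (rule set_lebesgue_integral_cong) (auto simp: h_def)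
      finally have e2: "(LBINT x:?I. H x * \<psi> l u n x) = - (LBINT x:?I. g x * ?\<theta> x)"
        using e1 by simp
      have "(LBINT x:?I. D x * \<psi> l u n x) = (LBINT x:?I. f x * \<psi> l u n x - H x * \<psi> l u n x)"
        by (simp add: D_def left_diff_distrib)
      also have "\<dots> = 0"
        using e2 eq[OF th(3)] d\<theta> set_integral_diff(2)[OF mulint[OF f c\<psi>] mulint[OF HI c\<psi>]] by simp
      finally have e3: "(LBINT x:?I. D x * \<psi> l u n x) = 0" .
      have "(LBINT x:?I. D x * \<psi> l u n x) = (LBINT x:?I. D x * bump l u n x + (- m l u n) * (D x * bump c d n0 x))"
        by (simp add: \<psi>_def algebra_simps)
      also have "\<dots> = (LBINT x:?I. D x * bump l u n x) + (LBINT x:?I. (- m l u n) * (D x * bump c d n0 x))"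
        by (intro set_integral_add(2) set_integrable_mult_right Dm)
      also have "(LBINT x:?I. (- m l u n) * (D x * bump c d n0 x)) = - C * (LBINT x:?I. bump l u n x)"
        unfolding set_integral_mult_right using n0 by (simp add: C_def m_def)
      finally have e4: "(LBINT x:?I. D x * bump l u n x) = C * (LBINT x:?I. bump l u n x)"
        using e3 by simp
      have "(LBINT x:?I. (D x - C) * bump l u n x) = (LBINT x:?I. D x * bump l u n x - C * bump l u n x)"
        by (simp add: left_diff_distrib)
      also have "\<dots> = (LBINT x:?I. D x * bump l u n x) - (LBINT x:?I. C * bump l u n x)"
        by (intro set_integral_diff(2) set_integrable_mult_right Dm ib)
      finally show "(LBINT x:?I. (D x - C) * bump l u n x) = 0" using e4 by simp
    qed
    then have "AE x in lborel. x \<in> ?I \<longrightarrow> f x = C + (LBINT y:{c<..x}. g y)"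
    proof (rule eventually_mono, intro impI)
      fix x assume x: "x \<in> ?I \<longrightarrow> D x - C = 0" "x \<in> ?I"
      have "H x = (LBINT y:{c<..x}. g y)"
        unfolding H_def set_lebesgue_integral_def
        by (rule Bochner_Integration.integral_cong) (use x in \<open>auto simp: h_def indicator_def\<close>)
      then show "f x = C + (LBINT y:{c<..x}. g y)" using x by (simp add: D_def)
    qed
    then show "\<exists>C. AE x in lborel. x \<in> ?I \<longrightarrow> f x = C + (LBINT y:{c<..x}. g y)" ..
  qed
qed

section \<open>Borel representatives of functions on a restricted Lebesgue measure\<close>

lemma AE_lebesgue_on_iff:
  assumes "S \<in> sets borel"
  shows "(AE x in lebesgue_on S. P x) \<longleftrightarrow> (AE x in lborel. x \<in> S \<longrightarrow> P x)"
  using assms by (simp add: AE_restrict_space_iff AE_completion_iff)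

text \<open>The function spaces live on \<open>lebesgue_on S\<close>, whereas Fubini and
  translations are used for \<open>lborel\<close>. Passing to a Borel function that vanishes off
  \<open>S\<close> connects the two.\<close>

lemma borel_representative:
  fixes f :: "'a::euclidean_space \<Rightarrow> real"
  assumes f: "f \<in> borel_measurable (lebesgue_on S)" and S [measurable]: "S \<in> sets borel"
  obtains f' where "f' \<in> borel_measurable borel" "AE x in lborel. x \<in> S \<longrightarrow> f x = f' x"
    "\<And>x. x \<notin> S \<Longrightarrow> f' x = 0"
proof -
  have "(\<lambda>x. indicator S x *\<^sub>R f x) \<in> borel_measurable lebesgue"
    using f S by (subst (asm) borel_measurable_restrict_space_iff) auto
  then obtain g where g: "g \<in> borel_measurable lborel" "AE x in lborel. indicator S x *\<^sub>R f x = g x"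
    using completion_ex_borel_measurable_real by blast
  have [measurable]: "g \<in> borel_measurable borel" using g(1) by simp
  show ?thesis
  proof (rule that[of "\<lambda>x. indicator S x * g x"])
    show "AE x in lborel. x \<in> S \<longrightarrow> f x = indicator S x * g x"
      using g(2) by (rule eventually_mono) auto
  qed auto
qed

lemma lebesgue_on_borel_measurableI:
  fixes f :: "'a::euclidean_space \<Rightarrow> real"
  assumes [measurable]: "f' \<in> borel_measurable borel" "S \<in> sets borel" and "AE x in lborel. x \<in> S \<longrightarrow> f x = f' x"
  shows "f \<in> borel_measurable (lebesgue_on S)"
proof -
  have 1: "AE x in lebesgue. indicator S x *\<^sub>R f' x = indicator S x *\<^sub>R f x"
    unfolding AE_completion_iff using assms(3) by (rule eventually_mono) (auto simp: indicator_def)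
  have 2: "(\<lambda>x. indicator S x *\<^sub>R f' x) \<in> borel_measurable lebesgue"
    by (rule measurable_completion) simp
  have "(\<lambda>x. indicator S x *\<^sub>R f x) \<in> borel_measurable lebesgue"
    by (rule borel_measurable_AE[OF 2 1])
  then show ?thesis by (subst borel_measurable_restrict_space_iff) auto
qed

lemma lebesgue_on_transfer:
  fixes f :: "'a::euclidean_space \<Rightarrow> real"
  assumes f': "f' \<in> borel_measurable borel" and S: "S \<in> sets borel"
    and eq: "AE x in lborel. x \<in> S \<longrightarrow> f x = f' x"
  shows "(LINT x|lebesgue_on S. f x) = (LBINT x:S. f' x)"
    "integrable (lebesgue_on S) f \<longleftrightarrow> set_integrable lborel S f'"
proof -
  note [measurable] = f' S
  have f: "f \<in> borel_measurable (lebesgue_on S)" by (rule lebesgue_on_borel_measurableI[OF assms])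
  have f2: "f' \<in> borel_measurable (lebesgue_on S)" by (rule lebesgue_on_borel_measurableI[OF f' S]) auto
  have ae: "AE x in lebesgue_on S. f x = f' x" using eq S by (simp add: AE_lebesgue_on_iff)
  have m: "(\<lambda>x. indicator S x *\<^sub>R f' x) \<in> borel_measurable lborel" by simp
  have "(LINT x|lebesgue_on S. f x) = (LINT x|lebesgue_on S. f' x)"
    by (rule integral_cong_AE[OF f f2 ae])
  also have "\<dots> = (LINT x|lebesgue. indicator S x *\<^sub>R f' x)"
    using S by (subst integral_restrict_space) auto
  also have "\<dots> = (LBINT x:S. f' x)"
    unfolding set_lebesgue_integral_def by (rule integral_completion[OF m])
  finally show "(LINT x|lebesgue_on S. f x) = (LBINT x:S. f' x)" .
  have "integrable (lebesgue_on S) f \<longleftrightarrow> integrable (lebesgue_on S) f'"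
    by (rule integrable_cong_AE[OF f f2 ae])
  also have "\<dots> \<longleftrightarrow> integrable lebesgue (\<lambda>x. indicator S x *\<^sub>R f' x)"
    using S by (subst integrable_restrict_space) auto
  also have "\<dots> \<longleftrightarrow> set_integrable lborel S f'"
    unfolding set_integrable_def by (rule integrable_completion[OF m])
  finally show "integrable (lebesgue_on S) f \<longleftrightarrow> set_integrable lborel S f'" .
qed

lemma L2_representative:
  fixes f :: "'a::euclidean_space \<Rightarrow> real"
  assumes "f \<in> L2 S" "S \<in> sets borel"
  obtains f' where "f' \<in> borel_measurable borel" "AE x in lborel. x \<in> S \<longrightarrow> f x = f' x"
    "\<And>x. x \<notin> S \<Longrightarrow> f' x = 0" "integrable lborel (\<lambda>x. (f' x)\<^sup>2)"
    "(L2_norm S f)\<^sup>2 = (LBINT x. (f' x)\<^sup>2)"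
proof -
  have f: "f \<in> borel_measurable (lebesgue_on S)" "integrable (lebesgue_on S) (\<lambda>x. (f x)\<^sup>2)"
    using assms(1) by (auto simp: L2_def)
  obtain f' where f': "f' \<in> borel_measurable borel" "AE x in lborel. x \<in> S \<longrightarrow> f x = f' x"
    "\<And>x. x \<notin> S \<Longrightarrow> f' x = 0"
    using borel_representative[OF f(1) assms(2)] by blast
  have m: "(\<lambda>x. (f' x)\<^sup>2) \<in> borel_measurable borel" using f'(1) by measurable
  have ae: "AE x in lborel. x \<in> S \<longrightarrow> (f x)\<^sup>2 = (f' x)\<^sup>2" using f'(2) by (rule eventually_mono) auto
  note tr = lebesgue_on_transfer[OF m assms(2) ae]
  have e: "(\<lambda>x. indicator S x *\<^sub>R (f' x)\<^sup>2) = (\<lambda>x. (f' x)\<^sup>2)"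
    using f'(3) by (auto simp: indicator_def fun_eq_iff)
  have "0 \<le> (LINT x|lebesgue_on S. (f x)\<^sup>2)" by simp
  then have "(L2_norm S f)\<^sup>2 = (LBINT x. (f' x)\<^sup>2)"
    using tr(1) unfolding set_lebesgue_integral_def e by (simp add: L2_norm_def)
  moreover have "integrable lborel (\<lambda>x. (f' x)\<^sup>2)"
    using tr(2) f(2) unfolding set_integrable_def e by simp
  ultimately show ?thesis using that f' by blast
qed

lemma L2_I:
  fixes f :: "'a::euclidean_space \<Rightarrow> real"
  assumes "f' \<in> borel_measurable borel" "S \<in> sets borel" "AE x in lborel. x \<in> S \<longrightarrow> f x = f' x"
    "set_integrable lborel S (\<lambda>x. (f' x)\<^sup>2)"
  shows "f \<in> L2 S" "L2_norm S f = sqrt (LBINT x:S. (f' x)\<^sup>2)"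
proof -
  have m: "(\<lambda>x. (f' x)\<^sup>2) \<in> borel_measurable borel" using assms(1) by measurable
  have ae: "AE x in lborel. x \<in> S \<longrightarrow> (f x)\<^sup>2 = (f' x)\<^sup>2" using assms(3) by (rule eventually_mono) auto
  note tr = lebesgue_on_transfer[OF m assms(2) ae]
  show "f \<in> L2 S" using lebesgue_on_borel_measurableI[OF assms(1-3)] tr(2) assms(4) by (simp add: L2_def)
  show "L2_norm S f = sqrt (LBINT x:S. (f' x)\<^sup>2)" using tr(1) by (simp add: L2_norm_def)
qed

lemma integrable_mult_L2:
  fixes f g :: "'a \<Rightarrow> real"
  assumes [measurable]: "f \<in> borel_measurable M" "g \<in> borel_measurable M"
    and "integrable M (\<lambda>x. (f x)\<^sup>2)" "integrable M (\<lambda>x. (g x)\<^sup>2)"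
  shows "integrable M (\<lambda>x. f x * g x)"
proof (rule Bochner_Integration.integrable_bound)
  show "integrable M (\<lambda>x. (f x)\<^sup>2 + (g x)\<^sup>2)"
    by (intro Bochner_Integration.integrable_add assms)
  show "AE x in M. norm (f x * g x) \<le> norm ((f x)\<^sup>2 + (g x)\<^sup>2)"
  proof (intro AE_I2)
    fix x
    have "2 * (\<bar>f x\<bar> * \<bar>g x\<bar>) \<le> (f x)\<^sup>2 + (g x)\<^sup>2"
      using sum_squares_bound[of "\<bar>f x\<bar>" "\<bar>g x\<bar>"] by simp
    moreover have "0 \<le> \<bar>f x\<bar> * \<bar>g x\<bar>" by simp
    ultimately have "\<bar>f x\<bar> * \<bar>g x\<bar> \<le> (f x)\<^sup>2 + (g x)\<^sup>2" by linarith
    then show "norm (f x * g x) \<le> norm ((f x)\<^sup>2 + (g x)\<^sup>2)" by (simp add: abs_mult)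
  qed
qed simp

lemma L2_norm_nonneg: "0 \<le> L2_norm S f"
  by (simp add: L2_norm_def)

lemma integral_abs_le_sqrt:
  fixes f :: "real \<Rightarrow> real"
  assumes [measurable]: "f \<in> borel_measurable borel" and i: "integrable lborel (\<lambda>x. (f x)\<^sup>2)"
    and z: "\<And>x. x \<notin> {c<..<d} \<Longrightarrow> f x = 0" and cd: "c < d"
  shows "integrable lborel f" "(LBINT x. \<bar>f x\<bar>) \<le> sqrt (d - c) * sqrt (LBINT x. (f x)\<^sup>2)"
proof -
  have I: "integrable lborel (\<lambda>x. (indicator {c<..<d} x :: real)\<^sup>2)"
    by (simp add: power2_eq_square indicator_inter_arith[symmetric] cd)
       (use cd in \<open>auto intro!: integrable_real_indicator\<close>)
  have e: "\<bar>f x\<bar> = \<bar>f x\<bar> * indicator {c<..<d} x" for x using z[of x] by (auto simp: indicator_def)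
  have ia: "integrable lborel (\<lambda>x. \<bar>f x\<bar>)"
    by (subst e, rule integrable_mult_L2) (use i I in auto)
  then show "integrable lborel f" by (rule integrable_abs_cancel) simp
  define A where "A = (LBINT x. \<bar>f x\<bar>)"
  define B where "B = (LBINT x. (f x)\<^sup>2)"
  have "A \<ge> 0" "B \<ge> 0" by (auto simp: A_def B_def)
  \<comment> \<open>Expanding this square, in which \<open>A / (d - c)\<close> is the mean of the
    absolute value, is the Cauchy-Schwarz inequality against the indicator of the interval.\<close>
  have "0 \<le> (LBINT x. (\<bar>f x\<bar> - (A / (d - c)) * indicator {c<..<d} x)\<^sup>2)" by simp
  also have "\<dots> = (LBINT x. (f x)\<^sup>2 - 2 * (A / (d - c)) * \<bar>f x\<bar> + (A / (d - c))\<^sup>2 * indicator {c<..<d} x)"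
    by (rule Bochner_Integration.integral_cong)
       (use z in \<open>auto simp: indicator_def power2_eq_square algebra_simps\<close>)
  also have "\<dots> = B - 2 * (A / (d - c)) * A + (A / (d - c))\<^sup>2 * (d - c)"
  proof -
    have j: "integrable lborel (\<lambda>x. (A / (d - c))\<^sup>2 * (indicator {c<..<d} x :: real))"
      using cd by (intro integrable_mult_right integrable_real_indicator) auto
    have k: "integrable lborel (\<lambda>x. (f x)\<^sup>2 - 2 * (A / (d - c)) * \<bar>f x\<bar>)"
      using i ia by auto
    show ?thesis
      using i ia j k cd by (simp only: Bochner_Integration.integral_add Bochner_Integration.integral_diff
        integrable_mult_right integral_mult_right_zero A_def[symmetric] B_def[symmetric] lebesgue_integral_const)
        simp
  qed
  also have "\<dots> = B - A\<^sup>2 / (d - c)"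
  proof -
    obtain e where e: "d - c = e" "e > 0" using cd by simp
    show ?thesis unfolding e(1) using e(2) by (simp add: power2_eq_square)
  qed
  finally have "A\<^sup>2 / (d - c) \<le> B" by simp
  then have "A\<^sup>2 \<le> (d - c) * B" using cd by (simp add: pos_divide_le_eq mult.commute)
  then have "A \<le> sqrt ((d - c) * B)" by (rule real_le_rsqrt)
  then show "(LBINT x. \<bar>f x\<bar>) \<le> sqrt (d - c) * sqrt (LBINT x. (f x)\<^sup>2)"
    by (simp add: A_def B_def real_sqrt_mult)
qed

lemma L2_interval_representative:
  fixes f :: "real \<Rightarrow> real"
  assumes f: "f \<in> L2 {c<..<d}" and cd: "c < d"
  obtains f' where "f' \<in> borel_measurable borel" "AE x in lborel. x \<in> {c<..<d} \<longrightarrow> f x = f' x"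
    "\<And>x. x \<notin> {c<..<d} \<Longrightarrow> f' x = 0" "integrable lborel (\<lambda>x. (f' x)\<^sup>2)" "integrable lborel f'"
proof -
  obtain f' where f': "f' \<in> borel_measurable borel" "AE x in lborel. x \<in> {c<..<d} \<longrightarrow> f x = f' x"
    "\<And>x. x \<notin> {c<..<d} \<Longrightarrow> f' x = 0" "integrable lborel (\<lambda>x. (f' x)\<^sup>2)"
    using L2_representative[OF f] by auto
  show ?thesis by (rule that[OF f' integral_abs_le_sqrt(1)[OF f'(1,4,3) cd]])
qed

lemma test_fun_deriv:
  assumes "\<phi> \<in> test_fun S"
  shows "deriv \<phi> \<in> test_fun (S :: real set)"
proof -
  obtain K where K: "compact K" "K \<subseteq> S" "\<And>x. x \<notin> K \<Longrightarrow> \<phi> x = 0"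
    using assms by (auto simp: test_fun_def)
  have "deriv \<phi> x = 0" if "x \<notin> K" for x
  proof -
    have "((\<lambda>x. 0) has_real_derivative 0) (at x)" by simp
    then have "(\<phi> has_real_derivative 0) (at x)"
      by (rule has_field_derivative_transform_within_open[where S = "- K"])
         (use that K compact_imp_closed[OF K(1)] in auto)
    then show ?thesis by (rule DERIV_imp_deriv)
  qed
  with K smoothD(2)[OF test_fun_smooth[OF assms]] show ?thesis
    by (auto simp: test_fun_def smooth_def)
qed

lemma smooth_borel [measurable (raw)]: "smooth (f :: real \<Rightarrow> real) \<Longrightarrow> f \<in> borel_measurable borel"
  using smoothD(3) by (intro borel_measurable_continuous_onI)

lemma test_fun_AC:
  assumes "\<phi> \<in> test_fun S"
  shows "AC c d \<phi> (deriv \<phi>)"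
  using smoothD[OF test_fun_smooth[OF assms]] smoothD(3)[OF smoothD(2)[OF test_fun_smooth[OF assms]]]
  by (intro AC_C1) (auto intro: has_field_derivative_at_within continuous_on_subset)

lemma weak_deriv_borel:
  assumes wd: "weak_deriv {c<..<d} m f g"
    and f': "f' \<in> borel_measurable borel" "AE x in lborel. x \<in> {c<..<d} \<longrightarrow> f x = f' x"
    and g': "g' \<in> borel_measurable borel" "AE x in lborel. x \<in> {c<..<d} \<longrightarrow> g x = g' x"
    and \<phi>: "\<phi> \<in> test_fun {c<..<d}"
  shows "(LBINT x:{c<..<d}. f' x * (deriv ^^ m) \<phi> x) = (-1)^m * (LBINT x:{c<..<d}. g' x * \<phi> x)"
proof -
  have "(deriv ^^ m) \<phi> \<in> test_fun {c<..<d}"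
    by (induction m) (use \<phi> test_fun_deriv in auto)
  then have [measurable]: "(deriv ^^ m) \<phi> \<in> borel_measurable borel" "\<phi> \<in> borel_measurable borel"
    using \<phi> test_fun_smooth smooth_borel by blast+
  note [measurable] = f'(1) g'(1)
  have "(LBINT x:{c<..<d}. f' x * (deriv ^^ m) \<phi> x) = (LINT x|lebesgue_on {c<..<d}. f x * (deriv ^^ m) \<phi> x)"
    by (rule lebesgue_on_transfer(1)[symmetric]) (use f'(2) in \<open>auto elim!: eventually_mono\<close>)
  also have "\<dots> = (-1)^m * (LINT x|lebesgue_on {c<..<d}. g x * \<phi> x)"
    using wd \<phi> by (simp add: weak_deriv_def)
  also have "(LINT x|lebesgue_on {c<..<d}. g x * \<phi> x) = (LBINT x:{c<..<d}. g' x * \<phi> x)"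
    by (rule lebesgue_on_transfer(1)) (use g'(2) in \<open>auto elim!: eventually_mono\<close>)
  finally show ?thesis .
qed

lemma set_integrable_test_mult:
  fixes f :: "real \<Rightarrow> real"
  assumes "integrable lborel f" "\<phi> \<in> test_fun {c<..<d}"
  shows "set_integrable lborel {c<..<d} (\<lambda>x. f x * \<phi> x)"
proof -
  have "set_integrable lborel {c..d} f"
    using assms(1) unfolding set_integrable_def by (intro integrable_mult_indicator) auto
  then have "set_integrable lborel {c..d} (\<lambda>x. f x * \<phi> x)"
    by (rule set_integrable_mult_continuous)
       (use smoothD(3)[OF test_fun_smooth[OF assms(2)]] in \<open>auto intro: continuous_on_subset\<close>)
  then show ?thesis by (rule set_integrable_subset) auto
qed

lemma weak_deriv_unique:
  assumes cd: "c < d" and g: "weak_deriv {c<..<d} m f g" and h: "weak_deriv {c<..<d} m f h"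
  shows "AE x in lborel. x \<in> {c<..<d} \<longrightarrow> g x = h x"
proof -
  let ?I = "{c<..<d}"
  have L: "f \<in> L2 ?I" "g \<in> L2 ?I" "h \<in> L2 ?I" using g h by (auto simp: weak_deriv_def)
  obtain f' where f': "f' \<in> borel_measurable borel" "AE x in lborel. x \<in> ?I \<longrightarrow> f x = f' x"
    using L2_interval_representative[OF L(1) cd] by blast
  obtain g' where g': "g' \<in> borel_measurable borel" "AE x in lborel. x \<in> ?I \<longrightarrow> g x = g' x"
    and gi: "integrable lborel g'"
    using L2_interval_representative[OF L(2) cd] by blast
  obtain h' where h': "h' \<in> borel_measurable borel" "AE x in lborel. x \<in> ?I \<longrightarrow> h x = h' x"
    and hi: "integrable lborel h'"
    using L2_interval_representative[OF L(3) cd] by blast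
  have "AE x in lborel. x \<in> ?I \<longrightarrow> g' x - h' x = 0"
  proof (rule rational_bumps_separate[OF cd])
    show "set_integrable lborel ?I (\<lambda>x. g' x - h' x)"
      using gi hi unfolding set_integrable_def
      by (intro integrable_mult_indicator Bochner_Integration.integrable_diff) auto
    fix l u n assume "l \<in> \<rat> \<inter> ?I" "u \<in> \<rat> \<inter> ?I"
    then have b: "bump l u n \<in> test_fun ?I" by (intro bump_test_fun) auto
    have "(-1)^m * (LBINT x:?I. g' x * bump l u n x) = (-1)^m * (LBINT x:?I. h' x * bump l u n x)"
      using weak_deriv_borel[OF g f' g'(1,2) b] weak_deriv_borel[OF h f' h'(1,2) b] by simp
    moreover have "(LBINT x:?I. (g' x - h' x) * bump l u n x) = (LBINT x:?I. g' x * bump l u n x) - (LBINT x:?I. h' x * bump l u n x)"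
      unfolding left_diff_distrib
      by (rule set_integral_diff(2)[OF set_integrable_test_mult[OF gi b] set_integrable_test_mult[OF hi b]])
    ultimately show "(LBINT x:?I. (g' x - h' x) * bump l u n x) = 0" by simp
  qed
  with g'(2) h'(2) show ?thesis by eventually_elim auto
qed

text \<open>\<open>Hs\<close> provides the derivatives of every order of \<open>f\<close> itself.
  Because derivatives of test functions are test functions, consecutive orders are first derivatives
  of one another, which is the form needed to integrate step by step.\<close>

lemma weak_deriv_succ:
  assumes "weak_deriv I m f g" "weak_deriv I (Suc m) f h"
  shows "weak_deriv I 1 g h"
  unfolding weak_deriv_def
proof (intro conjI ballI)
  show "g \<in> L2 I" "h \<in> L2 I" using assms by (auto simp: weak_deriv_def)
  fix \<phi> assume p: "\<phi> \<in> test_fun I"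
  have "(-1)^m * (LINT x|lebesgue_on I. g x * deriv \<phi> x) = (LINT x|lebesgue_on I. f x * (deriv ^^ m) (deriv \<phi>) x)"
    using assms(1) test_fun_deriv[OF p] by (simp add: weak_deriv_def)
  also have "\<dots> = (LINT x|lebesgue_on I. f x * (deriv ^^ Suc m) \<phi> x)"
    by (simp add: funpow_swap1)
  also have "\<dots> = (-1)^(Suc m) * (LINT x|lebesgue_on I. h x * \<phi> x)"
    using assms(2) p by (simp only: weak_deriv_def)
  finally have "(-1)^m * (LINT x|lebesgue_on I. g x * deriv \<phi> x) = (-1)^m * (- (LINT x|lebesgue_on I. h x * \<phi> x))" by simp
  then show "(LINT x|lebesgue_on I. g x * (deriv ^^ 1) \<phi> x) = (-1)^1 * (LINT x|lebesgue_on I. h x * \<phi> x)"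
    by (subst (asm) mult_left_cancel) auto
qed

text \<open>The density \<open>h\<close> is prescribed and not chosen, so that the lemma can be
  iterated downwards from the highest derivative: the primitive just found serves as the density of
  the next one.\<close>

lemma weak_deriv_AC:
  assumes cd: "c < d" and wd: "weak_deriv {c<..<d} 1 f g"
    and h: "AE x in lborel. x \<in> {c<..<d} \<longrightarrow> g x = h x" "set_integrable lborel {c..d} h"
  shows "\<exists>w. AC c d w h \<and> (AE x in lborel. x \<in> {c<..<d} \<longrightarrow> f x = w x)"
proof -
  let ?I = "{c<..<d}"
  have L: "f \<in> L2 ?I" "g \<in> L2 ?I" using wd by (auto simp: weak_deriv_def)
  obtain f' where f': "f' \<in> borel_measurable borel" "AE x in lborel. x \<in> ?I \<longrightarrow> f x = f' x"
    and fi: "integrable lborel f'"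
    using L2_interval_representative[OF L(1) cd] by blast
  obtain g' where g': "g' \<in> borel_measurable borel" "AE x in lborel. x \<in> ?I \<longrightarrow> g x = g' x"
    and gi: "integrable lborel g'"
    using L2_interval_representative[OF L(2) cd] by blast
  have si: "set_integrable lborel ?I f'" "set_integrable lborel ?I g'"
    unfolding set_integrable_def by (intro integrable_mult_indicator fi gi; simp)+
  have "\<exists>C. AE x in lborel. x \<in> ?I \<longrightarrow> f' x = C + (LBINT y:{c<..x}. g' y)"
  proof (rule du_Bois_Reymond[OF cd], goal_cases)
    case (1 F)
    show ?case
    proof (rule 1(3)[OF si])
      fix \<theta> assume "\<theta> \<in> F"
      then have "\<theta> \<in> test_fun ?I" using 1(2) by auto
      from weak_deriv_borel[OF wd f'(1,2) g'(1,2) this]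
      show "(LBINT x:?I. f' x * deriv \<theta> x) = - (LBINT x:?I. g' x * \<theta> x)" by simp
    qed
  qed
  then obtain C where C: "AE x in lborel. x \<in> ?I \<longrightarrow> f' x = C + (LBINT y:{c<..x}. g' y)" ..
  define w where "w x = C + (LBINT y:{c..x}. h y)" for x
  have hg: "(LBINT y:{c..x}. h y) = (LBINT y:{c<..x}. g' y)" if "x \<in> ?I" for x
  proof -
    have "set_integrable lborel {c..x} h" by (rule set_integrable_subinterval[OF h(2)]) (use that in auto)
    then have m: "(\<lambda>y. indicator {c..x} y *\<^sub>R h y) \<in> borel_measurable lborel"
      by (auto simp: set_integrable_def dest: borel_measurable_integrable)
    show ?thesis
      unfolding set_lebesgue_integral_def
    proof (rule integral_cong_AE[OF m])
      show "(\<lambda>y. indicator {c<..x} y *\<^sub>R g' y) \<in> borel_measurable lborel" using g'(1) by simp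
      show "AE y in lborel. indicator {c..x} y *\<^sub>R h y = indicator {c<..x} y *\<^sub>R g' y"
        using h(1) g'(2) AE_lborel_singleton[of c]
        by eventually_elim (use that in \<open>auto simp: indicator_def\<close>)
    qed
  qed
  have "AC c d w h"
    using h(2) AE_lborel_singleton[of c]
    by (auto simp: AC_def w_def set_lebesgue_integral_def indicator_def elim!: eventually_mono intro!: integral_eq_zero_AE)
  moreover have "AE x in lborel. x \<in> ?I \<longrightarrow> f x = w x"
    using f'(2) C by eventually_elim (use hg in \<open>auto simp: w_def\<close>)
  ultimately show ?thesis by blast
qed

section \<open>Traces\<close>

lemma LBINT_Icc_eq_Ioo: "(LBINT x:{c..d}. f x) = (LBINT x:{c<..<d}. f x)" for f :: "real \<Rightarrow> real"
  by (rule set_integral_discrete_difference[where X = "{c, d}"]) auto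

lemma continuous_AE_eq:
  fixes w v :: "real \<Rightarrow> real"
  assumes cd: "c < d" and w: "continuous_on {c..d} w" and v: "continuous_on {c..d} v"
    and eq: "AE x in lborel. x \<in> {c<..<d} \<longrightarrow> w x = v x" and x: "x \<in> {c..d}"
  shows "w x = v x"
proof -
  define C where "C = {c..d} \<inter> (\<lambda>x. w x - v x) -` {0}"
  have C: "closed C" unfolding C_def
    by (intro continuous_closed_preimage continuous_intros w v)
  have "{c<..<d} \<subseteq> C"
  proof
    fix y assume y: "y \<in> {c<..<d}"
    have "AE x\<in>{c<..<d} in lebesgue. x \<in> C"
      unfolding AE_completion_iff using eq by (rule eventually_mono) (auto simp: C_def)
    then show "y \<in> C" using mem_closed_if_AE_lebesgue_open[OF _ C _ y] by auto
  qed
  then have "closure {c<..<d} \<subseteq> C" using C by (rule closure_minimal)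
  then show ?thesis using x cd by (auto simp: C_def)
qed

lemma trace_eq:
  assumes cd: "c < d" and w: "continuous_on {c..d} w"
    and eq: "AE x in lborel. x \<in> {c<..<d} \<longrightarrow> f x = w x" and y: "y \<in> {c..d}"
  shows "trace {c<..<d} f y = w y"
  unfolding trace_def
proof (rule the_equality)
  have cl: "closure {c<..<d} = {c..d}" using cd by simp
  show "\<exists>w'. continuous_on (closure {c<..<d}) w' \<and> (AE x in lebesgue_on {c<..<d}. w' x = f x) \<and> w' y = w y"
    using w eq by (intro exI[of _ w]) (auto simp: cl AE_lebesgue_on_iff elim!: eventually_mono)
  fix e assume "\<exists>w. continuous_on (closure {c<..<d}) w \<and> (AE x in lebesgue_on {c<..<d}. w x = f x) \<and> w y = e"
  then obtain v where v: "continuous_on {c..d} v" "AE x in lborel. x \<in> {c<..<d} \<longrightarrow> v x = f x" "v y = e"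
    by (auto simp: cl AE_lebesgue_on_iff)
  have "AE x in lborel. x \<in> {c<..<d} \<longrightarrow> v x = w x" using v(2) eq by eventually_elim auto
  from continuous_AE_eq[OF cd v(1) w this y] v(3) show "e = w y" by simp
qed

section \<open>Linearity of weak derivatives, and boundary values\<close>

lemma L2_add:
  assumes "f \<in> L2 S" "g \<in> L2 S"
  shows "(\<lambda>x. f x + g x) \<in> L2 S"
proof -
  have m: "f \<in> borel_measurable (lebesgue_on S)" "g \<in> borel_measurable (lebesgue_on S)"
    and i: "integrable (lebesgue_on S) (\<lambda>x. (f x)\<^sup>2)" "integrable (lebesgue_on S) (\<lambda>x. (g x)\<^sup>2)"
    using assms by (auto simp: L2_def)
  have "integrable (lebesgue_on S) (\<lambda>x. (f x)\<^sup>2 + (g x)\<^sup>2 + 2 * (f x * g x))"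
    by (intro Bochner_Integration.integrable_add integrable_mult_right i integrable_mult_L2 m)
  then show ?thesis using m by (simp add: L2_def power2_sum mult.assoc)
qed

lemma L2_cmult: "f \<in> L2 S \<Longrightarrow> (\<lambda>x. c * f x) \<in> L2 S"
  by (auto simp: L2_def power_mult_distrib)

lemma L2_integrable_mult:
  assumes "f \<in> L2 S" "g \<in> L2 S"
  shows "integrable (lebesgue_on S) (\<lambda>x. f x * g x)"
  using assms by (intro integrable_mult_L2) (auto simp: L2_def)

lemma test_fun_L2:
  fixes c d :: real
  assumes "\<phi> \<in> test_fun {c<..<d}"
  shows "\<phi> \<in> L2 {c<..<d}"
proof -
  have s: "smooth \<phi>" by (rule test_fun_smooth[OF assms])
  have "continuous_on {c..d} (\<lambda>x. (\<phi> x)\<^sup>2)"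
    using smoothD(3)[OF s] by (intro continuous_intros continuous_on_subset[OF smoothD(3)[OF s]]) auto
  then have "set_integrable lborel {c..d} (\<lambda>x. (\<phi> x)\<^sup>2)"
    unfolding set_integrable_def by (intro borel_integrable_compact) auto
  then have "set_integrable lborel {c<..<d} (\<lambda>x. (\<phi> x)\<^sup>2)" by (rule set_integrable_subset) auto
  then show ?thesis by (intro L2_I(1)[OF smooth_borel[OF s]]) auto
qed

lemma test_fun_deriv_n: "\<phi> \<in> test_fun S \<Longrightarrow> (deriv ^^ m) \<phi> \<in> test_fun (S :: real set)"
  by (induction m) (auto simp: test_fun_deriv)

lemma weak_deriv_L2: "weak_deriv I m f g \<Longrightarrow> f \<in> L2 I" "weak_deriv I m f g \<Longrightarrow> g \<in> L2 I"
  by (auto simp: weak_deriv_def)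

lemma weak_deriv_add:
  assumes f: "weak_deriv {c<..<d} m f f'" and g: "weak_deriv {c<..<d} m g g'"
  shows "weak_deriv {c<..<d} m (\<lambda>x. f x + g x) (\<lambda>x. f' x + g' x)"
  unfolding weak_deriv_def
proof (intro conjI ballI L2_add weak_deriv_L2[OF f] weak_deriv_L2[OF g])
  let ?I = "{c<..<d}"
  fix \<phi> assume p: "\<phi> \<in> test_fun ?I"
  note i = L2_integrable_mult[OF weak_deriv_L2(1)[OF f] test_fun_L2[OF test_fun_deriv_n[OF p, of m]]]
    L2_integrable_mult[OF weak_deriv_L2(1)[OF g] test_fun_L2[OF test_fun_deriv_n[OF p, of m]]]
    L2_integrable_mult[OF weak_deriv_L2(2)[OF f] test_fun_L2[OF p]]
    L2_integrable_mult[OF weak_deriv_L2(2)[OF g] test_fun_L2[OF p]]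
  have "(LINT x|lebesgue_on ?I. f x * (deriv ^^ m) \<phi> x) = (- 1) ^ m * (LINT x|lebesgue_on ?I. f' x * \<phi> x)"
    "(LINT x|lebesgue_on ?I. g x * (deriv ^^ m) \<phi> x) = (- 1) ^ m * (LINT x|lebesgue_on ?I. g' x * \<phi> x)"
    using f g p by (auto simp: weak_deriv_def)
  then show "(LINT x|lebesgue_on ?I. (f x + g x) * (deriv ^^ m) \<phi> x) = (- 1) ^ m * (LINT x|lebesgue_on ?I. (f' x + g' x) * \<phi> x)"
    unfolding distrib_right using i by (simp add: Bochner_Integration.integral_add distrib_left)
qed

lemma weak_deriv_cmult:
  assumes "weak_deriv I m f f'"
  shows "weak_deriv I m (\<lambda>x. e * f x) (\<lambda>x. e * f' x)"
  using assms unfolding weak_deriv_def by (auto simp: L2_cmult mult.assoc)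

lemma weak_deriv_diff:
  assumes "weak_deriv {c<..<d} m f f'" "weak_deriv {c<..<d} m g g'"
  shows "weak_deriv {c<..<d} m (\<lambda>x. f x - g x) (\<lambda>x. f' x - g' x)"
  using weak_deriv_add[OF assms(1) weak_deriv_cmult[OF assms(2), of "-1"]] by simp

lemma weak_deriv_zero: "weak_deriv I m (\<lambda>x. 0) (\<lambda>x. 0)"
  by (auto simp: weak_deriv_def L2_def)

lemma weak_deriv_sum:
  fixes n :: nat
  assumes "\<And>i. i < n \<Longrightarrow> weak_deriv {c<..<d} m (f i) (f' i)"
  shows "weak_deriv {c<..<d} m (\<lambda>x. \<Sum>i<n. f i x) (\<lambda>x. \<Sum>i<n. f' i x)"
  using assms
proof (induction n)
  case 0
  then show ?case using weak_deriv_zero by simp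
next
  case (Suc n)
  then show ?case using weak_deriv_add[of c d m "\<lambda>x. \<Sum>i<n. f i x" "\<lambda>x. \<Sum>i<n. f' i x" "f n" "f' n"] by simp
qed

lemma weak_deriv_refl: "f \<in> L2 I \<Longrightarrow> weak_deriv I 0 f f"
  by (simp add: weak_deriv_def)

lemma weak_deriv_wderiv: "weak_deriv I m f g \<Longrightarrow> weak_deriv I m f (wderiv I m f)"
  unfolding wderiv_def by (rule someI[of "weak_deriv I m f"])

lemma wderiv_AE_eq:
  "c < d \<Longrightarrow> weak_deriv {c<..<d} m f g \<Longrightarrow> AE x in lborel. x \<in> {c<..<d} \<longrightarrow> wderiv {c<..<d} m f x = g x"
  using weak_deriv_unique weak_deriv_wderiv by blast

lemma L2_norm_cong_AE:
  assumes "f \<in> L2 S" "g \<in> L2 S" "S \<in> sets borel" "AE x in lborel. x \<in> S \<longrightarrow> f x = g x"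
  shows "L2_norm S f = L2_norm S g"
proof -
  have "(LINT x|lebesgue_on S. (f x)\<^sup>2) = (LINT x|lebesgue_on S. (g x)\<^sup>2)"
  proof (rule integral_cong_AE)
    show "AE x in lebesgue_on S. (f x)\<^sup>2 = (g x)\<^sup>2"
      using assms(3,4) by (auto simp: AE_lebesgue_on_iff elim!: eventually_mono)
  qed (use assms in \<open>auto simp: L2_def\<close>)
  then show ?thesis by (simp add: L2_norm_def)
qed

lemma L2_norm_wderiv:
  assumes "c < d" "weak_deriv {c<..<d} m f g"
  shows "L2_norm {c<..<d} (wderiv {c<..<d} m f) = L2_norm {c<..<d} g"
  using weak_deriv_L2(2)[OF weak_deriv_wderiv[OF assms(2)]] weak_deriv_L2(2)[OF assms(2)] _
    wderiv_AE_eq[OF assms]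
  by (rule L2_norm_cong_AE) simp

lemma weak_deriv_test_fun:
  assumes cd: "c < d" and p: "\<phi> \<in> test_fun {c<..<d}"
  shows "weak_deriv {c<..<d} 1 \<phi> (deriv \<phi>)"
  unfolding weak_deriv_def
proof (intro conjI ballI)
  let ?I = "{c<..<d}"
  show "\<phi> \<in> L2 ?I" "deriv \<phi> \<in> L2 ?I" using test_fun_L2 p test_fun_deriv by auto
  fix \<psi> assume q: "\<psi> \<in> test_fun ?I"
  have b: "smooth \<phi>" "smooth \<psi>" "smooth (deriv \<phi>)" "smooth (deriv \<psi>)"
    using p q test_fun_deriv test_fun_smooth by blast+
  note [measurable] = b[THEN smooth_borel]
  have i: "set_integrable lborel {c..d} (\<lambda>x. deriv \<phi> x * \<psi> x)" "set_integrable lborel {c..d} (\<lambda>x. \<phi> x * deriv \<psi> x)"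
    unfolding set_integrable_def
    by (intro borel_integrable_compact continuous_intros compact_Icc;
        use b[THEN smoothD(3)] in \<open>auto intro: continuous_on_subset\<close>)+
  have "(LBINT x:{c..d}. deriv \<phi> x * \<psi> x + \<phi> x * deriv \<psi> x) = 0"
    using AC_integral[OF AC_mult[OF test_fun_AC[OF p] test_fun_AC[OF q]]] cd
      test_fun_zero[OF p, of c] test_fun_zero[OF p, of d] by simp
  then have "(LBINT x:{c..d}. \<phi> x * deriv \<psi> x) = - (LBINT x:{c..d}. deriv \<phi> x * \<psi> x)"
    using set_integral_add(2)[OF i] by simp
  moreover have "(LINT x|lebesgue_on ?I. \<phi> x * deriv \<psi> x) = (LBINT x:?I. \<phi> x * deriv \<psi> x)"
    "(LINT x|lebesgue_on ?I. deriv \<phi> x * \<psi> x) = (LBINT x:?I. deriv \<phi> x * \<psi> x)"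
    by (rule lebesgue_on_transfer; simp)+
  ultimately show "(LINT x|lebesgue_on ?I. \<phi> x * (deriv ^^ 1) \<psi> x) = (-1)^1 * (LINT x|lebesgue_on ?I. deriv \<phi> x * \<psi> x)"
    by (simp add: LBINT_Icc_eq_Ioo)
qed

text \<open>Average the bound of \<open>|h y|\<close> by \<open>|h x|\<close> plus the total
  variation over all \<open>x\<close>. This is the one-dimensional Sobolev embedding in its
  \<open>L1\<close> form.\<close>

lemma AC_sup_bound:
  assumes AC: "AC c d h h'" and cd: "c < d" and y: "y \<in> {c..d}"
  shows "(d - c) * \<bar>h y\<bar> \<le> (LBINT x:{c..d}. \<bar>h x\<bar>) + (d - c) * (LBINT x:{c..d}. \<bar>h' x\<bar>)"
proof -
  define A where "A = (LBINT x:{c..d}. \<bar>h' x\<bar>)"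
  have i: "set_integrable lborel {c..d} h'" by (rule AC_integrable[OF AC])
  have ih: "set_integrable lborel {c..d} h"
    unfolding set_integrable_def by (intro borel_integrable_compact AC_continuous[OF AC]) auto
  have le: "\<bar>h y\<bar> \<le> \<bar>h x\<bar> + A" if x: "x \<in> {c..d}" for x
  proof -
    have s: "set_integrable lborel {c..y} h'" "set_integrable lborel {c..x} h'"
      by (rule set_integrable_subinterval[OF i]; use x y in auto)+
    have "h y - h x = (LBINT s:{c..y}. h' s) - (LBINT s:{c..x}. h' s)"
      using AC x y by (auto simp: AC_def)
    also have "\<dots> = (LBINT s. indicator {c..y} s *\<^sub>R h' s - indicator {c..x} s *\<^sub>R h' s)"
      unfolding set_lebesgue_integral_def using s
      by (intro Bochner_Integration.integral_diff[symmetric]) (auto simp: set_integrable_def)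
    also have "\<bar>\<dots>\<bar> \<le> A"
      unfolding A_def set_lebesgue_integral_def real_norm_def[symmetric]
      by (rule Bochner_Integration.integral_norm_bound_integral)
         (use s set_integrable_abs[OF i] x y in \<open>auto simp: set_integrable_def indicator_def\<close>)
    finally show ?thesis by linarith
  qed
  have "(d - c) * \<bar>h y\<bar> = (LBINT x:{c..d}. \<bar>h y\<bar>)"
    using cd by (simp add: set_lebesgue_integral_def)
  also have "\<dots> \<le> (LBINT x:{c..d}. \<bar>h x\<bar> + A)"
  proof (rule set_integral_mono)
    show "set_integrable lborel {c..d} (\<lambda>x. \<bar>h y\<bar>)" using cd by (simp add: set_integrable_def)
    show "set_integrable lborel {c..d} (\<lambda>x. \<bar>h x\<bar> + A)"
      using ih cd by (intro set_integral_add(1) set_integrable_abs) (auto simp: set_integrable_def)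
  qed (use le in auto)
  also have "\<dots> = (LBINT x:{c..d}. \<bar>h x\<bar>) + (LBINT x:{c..d}. A)"
    using ih cd by (intro set_integral_add(2) set_integrable_abs) (auto simp: set_integrable_def)
  also have "(LBINT x:{c..d}. A) = (d - c) * A" using cd by (simp add: set_lebesgue_integral_def)
  finally show ?thesis by (simp add: A_def)
qed

lemma L1_le_L2_norm:
  assumes "f \<in> L2 {c<..<d}" "AE x in lborel. x \<in> {c<..<d} \<longrightarrow> f x = g x" "set_integrable lborel {c..d} g" "c < d"
  shows "(LBINT x:{c..d}. \<bar>g x\<bar>) \<le> sqrt (d - c) * L2_norm {c<..<d} f"
proof -
  obtain f' where f': "f' \<in> borel_measurable borel" "AE x in lborel. x \<in> {c<..<d} \<longrightarrow> f x = f' x"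
    "\<And>x. x \<notin> {c<..<d} \<Longrightarrow> f' x = 0" "integrable lborel (\<lambda>x. (f' x)\<^sup>2)"
    "(L2_norm {c<..<d} f)\<^sup>2 = (LBINT x. (f' x)\<^sup>2)"
    using L2_representative[OF assms(1)] by auto
  have "(LBINT x:{c..d}. \<bar>g x\<bar>) = (LBINT x. \<bar>f' x\<bar>)"
    unfolding set_lebesgue_integral_def
  proof (rule integral_cong_AE)
    show "(\<lambda>x. indicator {c..d} x *\<^sub>R \<bar>g x\<bar>) \<in> borel_measurable lborel"
      using set_integrable_abs[OF assms(3)] by (auto simp: set_integrable_def dest: borel_measurable_integrable)
    show "AE x in lborel. indicator {c..d} x *\<^sub>R \<bar>g x\<bar> = \<bar>f' x\<bar>"
      using assms(2) f'(2) AE_lborel_singleton[of c] AE_lborel_singleton[of d]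
      by eventually_elim (use f'(3) in \<open>force simp: indicator_def\<close>)
  qed (use f'(1) in simp)
  also have "\<dots> \<le> sqrt (d - c) * sqrt (LBINT x. (f' x)\<^sup>2)"
    by (rule integral_abs_le_sqrt(2)[OF f'(1,4,3) assms(4)])
  also have "sqrt (LBINT x. (f' x)\<^sup>2) = L2_norm {c<..<d} f"
    using f'(5) L2_norm_nonneg by (metis real_sqrt_abs abs_of_nonneg)
  finally show ?thesis .
qed

lemma Hs_norm_ge:
  assumes "c < d" "weak_deriv {c<..<d} i f g" "i \<le> m"
  shows "L2_norm {c<..<d} g \<le> Hs_norm m {c<..<d} f"
proof -
  have "(L2_norm {c<..<d} g)\<^sup>2 \<le> (\<Sum>i\<le>m. (L2_norm {c<..<d} (wderiv {c<..<d} i f))\<^sup>2)"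
    unfolding L2_norm_wderiv[OF assms(1,2), symmetric]
    by (rule member_le_sum) (use assms(3) in auto)
  then show ?thesis unfolding Hs_norm_def by (rule real_le_rsqrt)
qed

text \<open>Test functions vanish at the end points, and \<open>AC_sup_bound\<close> makes end point
  values continuous in the norm of \<open>Hs 1\<close>, so they vanish for the limits that define
  \<open>H10\<close> as well.\<close>

lemma H10_boundary:
  assumes f: "f \<in> H10 {c<..<d}" and cd: "c < d"
  obtains w where "continuous_on {c..d} w" "AE x in lborel. x \<in> {c<..<d} \<longrightarrow> f x = w x" "w c = 0" "w d = 0"
proof -
  let ?I = "{c<..<d}"
  obtain g where g: "weak_deriv ?I 1 f g" using f by (auto simp: H10_def Hs_def)
  obtain g' where g': "g' \<in> borel_measurable borel" "AE x in lborel. x \<in> ?I \<longrightarrow> g x = g' x" "integrable lborel g'"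
    using L2_interval_representative[OF weak_deriv_L2(2)[OF g] cd] by blast
  have si: "set_integrable lborel {c..d} g'"
    unfolding set_integrable_def by (rule integrable_mult_indicator[OF _ g'(3)]) simp
  obtain w where w: "AC c d w g'" "AE x in lborel. x \<in> ?I \<longrightarrow> f x = w x"
    using weak_deriv_AC[OF cd g g'(2) si] by blast
  have "w y = 0" if y: "y \<in> {c, d}" for y
  proof (rule ccontr)
    assume "w y \<noteq> 0"
    \<comment> \<open>\<open>K\<close> is the constant with which the \<open>Hs 1\<close> norm
      controls \<open>d - c\<close> times the supremum, and \<open>e\<close> is chosen to make
      \<open>K * e\<close> equal to \<open>(d - c) * |w y|\<close>, so that the approximation
      contradicts itself.\<close>
    define K where "K = sqrt (d - c) + (d - c) * sqrt (d - c)"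
    have K: "K > 0" using cd by (simp add: K_def add_pos_pos)
    define e where "e = (d - c) * \<bar>w y\<bar> / K"
    have "e > 0" using \<open>w y \<noteq> 0\<close> K cd by (simp add: e_def)
    then obtain \<phi> where p: "\<phi> \<in> test_fun ?I" and lt: "Hs_norm 1 ?I (\<lambda>x. f x - \<phi> x) < e"
      using f by (auto simp: H10_def)
    have wd: "weak_deriv ?I 1 (\<lambda>x. f x - \<phi> x) (\<lambda>x. g x - deriv \<phi> x)"
      by (rule weak_deriv_diff[OF g weak_deriv_test_fun[OF cd p]])
    have wd0: "weak_deriv ?I 0 (\<lambda>x. f x - \<phi> x) (\<lambda>x. f x - \<phi> x)"
      by (rule weak_deriv_refl[OF weak_deriv_L2(1)[OF wd]])
    have AC: "AC c d (\<lambda>x. w x - \<phi> x) (\<lambda>x. g' x - deriv \<phi> x)"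
      by (rule AC_diff[OF w(1) test_fun_AC[OF p]])
    have "(d - c) * \<bar>w y - \<phi> y\<bar> \<le> (LBINT x:{c..d}. \<bar>w x - \<phi> x\<bar>) + (d - c) * (LBINT x:{c..d}. \<bar>g' x - deriv \<phi> x\<bar>)"
      by (rule AC_sup_bound[OF AC cd]) (use y cd in auto)
    also have "\<dots> \<le> sqrt (d - c) * L2_norm ?I (\<lambda>x. f x - \<phi> x) + (d - c) * (sqrt (d - c) * L2_norm ?I (\<lambda>x. g x - deriv \<phi> x))"
    proof (intro add_mono mult_left_mono L1_le_L2_norm weak_deriv_L2(2)[OF wd] weak_deriv_L2(1)[OF wd] cd AC_integrable[OF AC])
      show "set_integrable lborel {c..d} (\<lambda>x. w x - \<phi> x)"
        unfolding set_integrable_def by (intro borel_integrable_compact AC_continuous[OF AC]) auto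
    qed (use w(2) g'(2) cd in \<open>auto elim!: eventually_mono\<close>)
    also have "\<dots> \<le> sqrt (d - c) * Hs_norm 1 ?I (\<lambda>x. f x - \<phi> x) + (d - c) * (sqrt (d - c) * Hs_norm 1 ?I (\<lambda>x. f x - \<phi> x))"
      by (intro add_mono mult_left_mono Hs_norm_ge[OF cd wd] Hs_norm_ge[OF cd wd0]) (use cd in auto)
    also have "\<dots> = K * Hs_norm 1 ?I (\<lambda>x. f x - \<phi> x)" by (simp add: K_def algebra_simps)
    also have "\<dots> < K * e" using K lt by simp
    also have "\<dots> = (d - c) * \<bar>w y\<bar>" using K by (simp add: e_def)
    also have "\<phi> y = 0" by (rule test_fun_zero[OF p]) (use y in auto)
    finally show False by simp
  qed
  then show ?thesis using that[OF AC_continuous[OF w(1)] w(2)] by auto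
qed

lemma H3_chain:
  assumes cd: "c < d" and g: "weak_deriv {c<..<d} 1 f g1" "weak_deriv {c<..<d} 2 f g2" "weak_deriv {c<..<d} 3 f g3"
    and h: "AE x in lborel. x \<in> {c<..<d} \<longrightarrow> g3 x = h x" "set_integrable lborel {c..d} h"
  obtains w0 w1 w2 where "AC c d w0 w1" "AC c d w1 w2" "AC c d w2 h"
    "AE x in lborel. x \<in> {c<..<d} \<longrightarrow> f x = w0 x"
    "AE x in lborel. x \<in> {c<..<d} \<longrightarrow> g1 x = w1 x"
    "AE x in lborel. x \<in> {c<..<d} \<longrightarrow> g2 x = w2 x"
proof -
  have ci: "set_integrable lborel {c..d} w" if "AC c d w w'" for w w'
    unfolding set_integrable_def by (intro borel_integrable_compact AC_continuous[OF that]) auto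
  have "weak_deriv {c<..<d} 1 g2 g3" "weak_deriv {c<..<d} 1 g1 g2"
    using weak_deriv_succ[of _ 2] weak_deriv_succ[of _ 1] g by (auto simp: numeral_eq_Suc)
  note wd = this
  obtain w2 where w2: "AC c d w2 h" "AE x in lborel. x \<in> {c<..<d} \<longrightarrow> g2 x = w2 x"
    using weak_deriv_AC[OF cd wd(1) h] by blast
  obtain w1 where w1: "AC c d w1 w2" "AE x in lborel. x \<in> {c<..<d} \<longrightarrow> g1 x = w1 x"
    using weak_deriv_AC[OF cd wd(2) w2(2) ci[OF w2(1)]] by blast
  obtain w0 where w0: "AC c d w0 w1" "AE x in lborel. x \<in> {c<..<d} \<longrightarrow> f x = w0 x"
    using weak_deriv_AC[OF cd g(1) w1(2) ci[OF w1(1)]] by blast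
  show ?thesis by (rule that[OF w0(1) w1(1) w2(1) w0(2) w1(2) w2(2)])
qed

section \<open>Representatives of functions in time and space\<close>

lemma partition_mono:
  assumes "is_partition L N a" "i \<le> k" "k \<le> N"
  shows "a i \<le> a k"
  using assms(2,3)
proof (induction k rule: dec_induct)
  case (step n)
  then have "a n < a (Suc n)" using assms(1) by (auto simp: is_partition_def)
  with step show ?case by simp
qed simp

lemma partition_subint:
  assumes "is_partition L N a" "k < N"
  shows "a k < a (Suc k)" "0 \<le> a k" "a (Suc k) \<le> L" "subint a k \<subseteq> {0<..<L}"
proof -
  show 1: "a k < a (Suc k)" "0 \<le> a k" "a (Suc k) \<le> L"
    using assms partition_mono[OF assms(1), of 0 k] partition_mono[OF assms(1), of "Suc k" N]
    by (auto simp: is_partition_def)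
  then show "subint a k \<subseteq> {0<..<L}" by (auto simp: subint_def)
qed

lemma partition_cover:
  assumes "is_partition L N a" "x \<in> {0<..<L}" "x \<notin> a ` {..N}"
  shows "\<exists>k<N. x \<in> subint a k"
proof -
  have a: "a 0 = 0" "a N = L" using assms(1) by (auto simp: is_partition_def)
  have "x < a n \<Longrightarrow> \<exists>k<n. a k \<le> x \<and> x < a (Suc k)" for n
  proof (induction n)
    case 0
    then show ?case using a assms(2) by simp
  next
    case (Suc n)
    then show ?case by (cases "x < a n") (auto simp: less_Suc_eq)
  qed
  from this[of N] obtain k where k: "k < N" "a k \<le> x" "x < a (Suc k)" using a assms(2) by auto
  then have "a k \<noteq> x" using assms(3) by auto
  then show ?thesis using k by (auto simp: subint_def)
qed

lemma partition_disjoint: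
  assumes "is_partition L N a" "k < N" "l < N" "x \<in> subint a k" "x \<in> subint a l"
  shows "k = l"
proof (rule ccontr)
  assume "k \<noteq> l"
  then consider "Suc k \<le> l" | "Suc l \<le> k" by linarith
  then show False
    by cases (use assms partition_mono[OF assms(1), of "Suc k" l] partition_mono[OF assms(1), of "Suc l" k]
      in \<open>auto simp: subint_def\<close>)
qed

lemma AE_not_node: "AE x in lborel. (x::real) \<notin> a ` {..N::nat}"
  by (rule AE_not_in) (auto intro: finite_imp_null_set_lborel)

text \<open>Traces, boundary values and derivatives defined almost everywhere become end point
  values of absolutely continuous functions. The third derivative keeps the given representative
  \<open>h\<close> on all subintervals, because it will be a section of one function of time and
  space.\<close>

lemma regular_slice:
  assumes part: "is_partition L N a" and f3: "f \<in> Hpw 3 L N a" and f0: "f \<in> H10 {0<..<L}"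
    and tr: "transmission N a p f"
    and G: "\<And>k i. k < N \<Longrightarrow> i \<in> {1,2,3} \<Longrightarrow> weak_deriv (subint a k) i f (G i)"
    and h: "\<And>k. k < N \<Longrightarrow> AE x in lborel. x \<in> subint a k \<longrightarrow> G 3 x = h x" "integrable lborel h"
  obtains w0 w1 w2 where
    "\<And>k. k < N \<Longrightarrow> AC (a k) (a (Suc k)) (w0 k) (w1 k)"
    "\<And>k. k < N \<Longrightarrow> AC (a k) (a (Suc k)) (w1 k) (w2 k)"
    "\<And>k. k < N \<Longrightarrow> AC (a k) (a (Suc k)) (w2 k) h"
    "\<And>k. k < N \<Longrightarrow> AE x in lborel. x \<in> subint a k \<longrightarrow> f x = w0 k x"
    "\<And>k. k < N \<Longrightarrow> AE x in lborel. x \<in> subint a k \<longrightarrow> G 1 x = w1 k x"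
    "\<And>k. k < N \<Longrightarrow> AE x in lborel. x \<in> subint a k \<longrightarrow> G 2 x = w2 k x"
    "\<And>k. k \<in> {1..<N} \<Longrightarrow> w0 (k - 1) (a k) = w0 k (a k)"
    "\<And>k. k \<in> {1..<N} \<Longrightarrow> sqrt (p (k - 1)) * w1 (k - 1) (a k) = sqrt (p k) * w1 k (a k)"
    "\<And>k. k \<in> {1..<N} \<Longrightarrow> p (k - 1) * w2 (k - 1) (a k) = p k * w2 k (a k)"
    "w0 0 0 = 0" "w0 (N - 1) L = 0"
proof -
  have N: "N \<ge> 1" "a 0 = 0" "a N = L" using part by (auto simp: is_partition_def)
  note lt = partition_subint(1)[OF part]
  define Q where "Q k w0 w1 w2 \<longleftrightarrow> AC (a k) (a (Suc k)) w0 w1 \<and> AC (a k) (a (Suc k)) w1 w2 \<and> AC (a k) (a (Suc k)) w2 h \<and>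
    (AE x in lborel. x \<in> subint a k \<longrightarrow> f x = w0 x) \<and>
    (AE x in lborel. x \<in> subint a k \<longrightarrow> G 1 x = w1 x) \<and>
    (AE x in lborel. x \<in> subint a k \<longrightarrow> G 2 x = w2 x)" for k w0 w1 w2
  have "\<exists>w0 w1 w2. Q k w0 w1 w2" if k: "k < N" for k
  proof -
    have si: "set_integrable lborel {a k..a (Suc k)} h"
      unfolding set_integrable_def by (rule integrable_mult_indicator[OF _ h(2)]) simp
    obtain w0 w1 w2 where w: "AC (a k) (a (Suc k)) w0 w1" "AC (a k) (a (Suc k)) w1 w2" "AC (a k) (a (Suc k)) w2 h"
      "AE x in lborel. x \<in> {a k<..<a (Suc k)} \<longrightarrow> f x = w0 x"
      "AE x in lborel. x \<in> {a k<..<a (Suc k)} \<longrightarrow> G 1 x = w1 x"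
      "AE x in lborel. x \<in> {a k<..<a (Suc k)} \<longrightarrow> G 2 x = w2 x"
    proof (rule H3_chain[OF lt[OF k] _ _ _ _ si])
      show "weak_deriv {a k<..<a (Suc k)} 1 f (G 1)" using G[OF k, of 1] by (simp add: subint_def)
      show "weak_deriv {a k<..<a (Suc k)} 2 f (G 2)" using G[OF k, of 2] by (simp add: subint_def)
      show "weak_deriv {a k<..<a (Suc k)} 3 f (G 3)" using G[OF k, of 3] by (simp add: subint_def)
      show "AE x in lborel. x \<in> {a k<..<a (Suc k)} \<longrightarrow> G 3 x = h x" using h(1)[OF k] unfolding subint_def .
    qed (rule that)
    have "Q k w0 w1 w2" unfolding Q_def subint_def by (intro conjI w)
    then show ?thesis by blast
  qed
  then obtain w0 w1 w2 where Q: "\<And>k. k < N \<Longrightarrow> Q k (w0 k) (w1 k) (w2 k)" by metis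
  note Q' = Q[unfolded Q_def]
  note w = Q'[THEN conjunct1] Q'[THEN conjunct2, THEN conjunct1]
    Q'[THEN conjunct2, THEN conjunct2, THEN conjunct1]
    Q'[THEN conjunct2, THEN conjunct2, THEN conjunct2, THEN conjunct1]
    Q'[THEN conjunct2, THEN conjunct2, THEN conjunct2, THEN conjunct2, THEN conjunct1]
    Q'[THEN conjunct2, THEN conjunct2, THEN conjunct2, THEN conjunct2, THEN conjunct2]
  have tr0: "trace (subint a k) f y = w0 k y" if "k < N" "y \<in> {a k..a (Suc k)}" for k y
    unfolding subint_def
    by (rule trace_eq[OF lt[OF that(1)] AC_continuous[OF w(1)[OF that(1)]] w(4)[OF that(1), unfolded subint_def] that(2)])
  have wd: "AE x in lborel. x \<in> subint a k \<longrightarrow> wderiv (subint a k) i f x = G i x" if "k < N" "i \<in> {1,2,3}" for k i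
    unfolding subint_def by (rule wderiv_AE_eq[OF lt[OF that(1)] G[OF that, unfolded subint_def]])
  have tr1: "trace (subint a k) (wderiv (subint a k) 1 f) y = w1 k y" if k: "k < N" "y \<in> {a k..a (Suc k)}" for k y
  proof -
    have "AE x in lborel. x \<in> subint a k \<longrightarrow> wderiv (subint a k) 1 f x = w1 k x"
      using wd[OF k(1), of 1, simplified] w(5)[OF k(1)] by eventually_elim auto
    then show ?thesis unfolding subint_def
      by (rule trace_eq[OF lt[OF k(1)] AC_continuous[OF w(2)[OF k(1)]] _ k(2)])
  qed
  have tr2: "trace (subint a k) (wderiv (subint a k) 2 f) y = w2 k y" if k: "k < N" "y \<in> {a k..a (Suc k)}" for k y
  proof -
    have "AE x in lborel. x \<in> subint a k \<longrightarrow> wderiv (subint a k) 2 f x = w2 k x"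
      using wd[OF k(1), of 2, simplified] w(6)[OF k(1)] by eventually_elim auto
    then show ?thesis unfolding subint_def
      by (rule trace_eq[OF lt[OF k(1)] AC_continuous[OF w(3)[OF k(1)]] _ k(2)])
  qed
  have tk: "w0 (k - 1) (a k) = w0 k (a k)" "sqrt (p (k - 1)) * w1 (k - 1) (a k) = sqrt (p k) * w1 k (a k)"
     "p (k - 1) * w2 (k - 1) (a k) = p k * w2 k (a k)" if k: "k \<in> {1..<N}" for k
  proof -
    have k': "k - 1 < N" "a k \<in> {a (k - 1)..a (Suc (k - 1))}" "k < N" "a k \<in> {a k..a (Suc k)}"
      using k lt[of "k - 1"] lt[of k] by (auto simp: less_imp_diff_less)
    have *: "w0 (k - 1) (a k) = w0 k (a k) \<and> sqrt (p (k - 1)) * w1 (k - 1) (a k) = sqrt (p k) * w1 k (a k) \<and>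
     p (k - 1) * w2 (k - 1) (a k) = p k * w2 k (a k)"
      using tr[unfolded transmission_def Let_def, THEN bspec, OF k]
      unfolding tr0[OF k'(1,2)] tr0[OF k'(3,4)] tr1[OF k'(1,2)] tr1[OF k'(3,4)] tr2[OF k'(1,2)] tr2[OF k'(3,4)] .
    show "w0 (k - 1) (a k) = w0 k (a k)" by (rule *[THEN conjunct1])
    show "sqrt (p (k - 1)) * w1 (k - 1) (a k) = sqrt (p k) * w1 k (a k)"
      by (rule *[THEN conjunct2, THEN conjunct1])
    show "p (k - 1) * w2 (k - 1) (a k) = p k * w2 k (a k)"
      by (rule *[THEN conjunct2, THEN conjunct2])
  qed
  have L: "0 < L" using N partition_mono[OF part, of 1 N] lt[of 0] by auto
  obtain v where v: "continuous_on {0..L} v" "AE x in lborel. x \<in> {0<..<L} \<longrightarrow> f x = v x" "v 0 = 0" "v L = 0"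
    using H10_boundary[OF f0 L] .
  \<comment> \<open>The zero boundary values belong to a representative on all of
    \<open>{0..L}\<close>; on each closed subinterval it coincides with \<open>w0\<close>.\<close>
  have vw: "w0 k y = v y" if k: "k < N" "y \<in> {a k..a (Suc k)}" for k y
  proof (rule continuous_AE_eq[OF lt[OF k(1)] AC_continuous[OF w(1)[OF k(1)]] _ _ k(2)])
    show "continuous_on {a k..a (Suc k)} v"
      by (rule continuous_on_subset[OF v(1)]) (use partition_subint[OF part k(1)] in auto)
    show "AE x in lborel. x \<in> {a k<..<a (Suc k)} \<longrightarrow> w0 k x = v x"
      using w(4)[OF k(1)] v(2) by eventually_elim (use partition_subint(4)[OF part k(1)] in \<open>auto simp: subint_def\<close>)
  qed
  have "w0 0 0 = 0" using vw[of 0 0] N v lt[of 0] by auto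
  moreover have "w0 (N - 1) L = 0" using vw[of "N - 1" L] N v lt[of "N - 1"] by auto
  ultimately show ?thesis using that[OF w tk] by blast
qed

section \<open>Jointly measurable space derivatives of elements of the Bochner space\<close>

lemma joint_limit:
  fixes S :: "nat \<Rightarrow> real \<Rightarrow> real \<Rightarrow> real"
  assumes [measurable]: "\<And>n. (\<lambda>(t, x). S n t x) \<in> borel_measurable (borel \<Otimes>\<^sub>M borel)"
    and int: "\<And>n t. integrable lborel (S n t)"
  obtains g where "(\<lambda>(t, x). g t x) \<in> borel_measurable (borel \<Otimes>\<^sub>M borel)"
    "\<And>t U. integrable lborel U \<Longrightarrow> (\<lambda>n. LBINT x. \<bar>S n t x - U x\<bar>) \<longlonglongrightarrow> 0 \<Longrightarrow> AE x in lborel. g t x = U x"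
proof -
  define d where "d n m t = (LBINT x. \<bar>S n t x - S m t x\<bar>)" for n m t
  have [measurable]: "d n m \<in> borel_measurable borel" for n m
    unfolding d_def by measurable
  \<comment> \<open>Convergence in \<open>L1\<close> of a slice gives pointwise convergence only
    along a subsequence, which depends on \<open>t\<close>. Taking for each \<open>j\<close> the
    least index from which the slices are Cauchy to within \<open>(1/2)^j\<close> makes this
    dependence measurable, and the differences to the limit become summable.\<close>
  define P where "P j t n \<longleftrightarrow> (\<forall>m\<ge>n. d n m t \<le> (1/2)^j)" for j t and n :: nat
  have [measurable]: "Measurable.pred borel (\<lambda>t. P j t n)" for j n
    unfolding P_def by measurable
  define \<nu> where "\<nu> j t = (LEAST n. P j t n)" for j t
  have [measurable]: "\<nu> j \<in> measurable borel (count_space UNIV)" for j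
    unfolding \<nu>_def by measurable
  have Tm: "(\<lambda>(t, x). S (\<nu> j t) t x) \<in> borel_measurable (borel \<Otimes>\<^sub>M borel)" for j
  proof -
    have "(\<lambda>z. (\<lambda>n z. case z of (t, x) \<Rightarrow> S n t x) (\<nu> j (fst z)) z) \<in> borel_measurable (borel \<Otimes>\<^sub>M borel)"
      by (rule measurable_compose_countable) measurable
    then show ?thesis by (simp add: split_beta')
  qed
  define g where "g t x = lim (\<lambda>j. S (\<nu> j t) t x)" for t x
  show ?thesis
  proof (rule that[of g])
    show "(\<lambda>(t, x). g t x) \<in> borel_measurable (borel \<Otimes>\<^sub>M borel)"
      unfolding g_def split_beta' using Tm unfolding split_beta' by (rule borel_measurable_lim_metric)
    fix t U assume U: "integrable lborel U" and lim: "(\<lambda>n. LBINT x. \<bar>S n t x - U x\<bar>) \<longlonglongrightarrow> 0"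
    have [measurable]: "U \<in> borel_measurable borel" using U by (auto dest: borel_measurable_integrable)
    define e where "e n = (LBINT x. \<bar>S n t x - U x\<bar>)" for n
    have iSU: "integrable lborel (\<lambda>x. \<bar>S n t x - U x\<bar>)" for n using int U by auto
    have iSS: "integrable lborel (\<lambda>x. \<bar>S n t x - S m t x\<bar>)" for n m using int by auto
    have tri: "d n m t \<le> e n + e m" "e n \<le> d n m t + e m" for n m
    proof -
      have "d n m t \<le> (LBINT x. \<bar>S n t x - U x\<bar> + \<bar>S m t x - U x\<bar>)"
        unfolding d_def by (rule integral_mono) (use iSU iSS in auto)
      also have "\<dots> = e n + e m" unfolding e_def by (rule Bochner_Integration.integral_add[OF iSU iSU])
      finally show "d n m t \<le> e n + e m" .
      have "e n \<le> (LBINT x. \<bar>S n t x - S m t x\<bar> + \<bar>S m t x - U x\<bar>)"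
        unfolding e_def by (rule integral_mono) (use iSU iSS in auto)
      also have "\<dots> = d n m t + e m" unfolding e_def d_def by (rule Bochner_Integration.integral_add[OF iSS iSU])
      finally show "e n \<le> d n m t + e m" .
    qed
    have e0: "e \<longlonglongrightarrow> 0" using lim by (simp add: e_def[abs_def])
    have Pex: "\<exists>n. P j t n" for j
    proof -
      have "\<forall>\<^sub>F n in sequentially. e n < (1/2)^j / 2" using e0 by (rule order_tendstoD(2)) simp
      then obtain n0 where n0: "\<And>n. n \<ge> n0 \<Longrightarrow> e n < (1/2)^j / 2" by (auto simp: eventually_sequentially)
      have "d n0 m t \<le> (1/2)^j" if "m \<ge> n0" for m
        using tri(1)[of n0 m] n0[of n0] n0[of m] that by simp
      then show ?thesis by (auto simp: P_def)
    qed
    have el: "e (\<nu> j t) \<le> (1/2)^j" for j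
    proof -
      have P: "P j t (\<nu> j t)" unfolding \<nu>_def by (rule LeastI_ex[OF Pex])
      have "(\<lambda>m. (1/2)^j + e m) \<longlonglongrightarrow> (1/2)^j + 0" by (intro tendsto_add tendsto_const e0)
      moreover have "e (\<nu> j t) \<le> (1/2)^j + e m" if "m \<ge> \<nu> j t" for m
        using P tri(2)[of "\<nu> j t" m] that by (auto simp: P_def intro: order_trans add_right_mono)
      ultimately show ?thesis by (intro LIMSEQ_le_const[of _ "(1/2)^j"]) auto
    qed
    have "(\<integral>\<^sup>+x. (\<Sum>j. ennreal \<bar>S (\<nu> j t) t x - U x\<bar>) \<partial>lborel) = (\<Sum>j. \<integral>\<^sup>+x. ennreal \<bar>S (\<nu> j t) t x - U x\<bar> \<partial>lborel)"
      by (rule nn_integral_suminf) (use int U in auto)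
    also have "\<dots> = (\<Sum>j. ennreal (e (\<nu> j t)))"
      unfolding e_def by (intro suminf_cong nn_integral_eq_integral iSU) auto
    also have "\<dots> \<le> (\<Sum>j. ennreal ((1/2)^j))"
      by (intro suminf_le ennreal_leI el) auto
    also have "\<dots> < \<infinity>"
      by (subst suminf_ennreal2) (auto intro!: summable_geometric)
    finally have fin: "(\<integral>\<^sup>+x. (\<Sum>j. ennreal \<bar>S (\<nu> j t) t x - U x\<bar>) \<partial>lborel) < \<infinity>" .
    have "AE x in lborel. (\<Sum>j. ennreal \<bar>S (\<nu> j t) t x - U x\<bar>) \<noteq> \<infinity>"
      by (rule nn_integral_noteq_infinite) (use fin int U in auto)
    then show "AE x in lborel. g t x = U x"
    proof (rule eventually_mono)
      fix x assume "(\<Sum>j. ennreal \<bar>S (\<nu> j t) t x - U x\<bar>) \<noteq> \<infinity>"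
      then have "summable (\<lambda>j. \<bar>S (\<nu> j t) t x - U x\<bar>)"
        by (intro summable_suminf_not_top) auto
      then have "(\<lambda>j. \<bar>S (\<nu> j t) t x - U x\<bar>) \<longlonglongrightarrow> 0" by (rule summable_LIMSEQ_zero)
      then have "(\<lambda>j. S (\<nu> j t) t x) \<longlonglongrightarrow> U x" by (simp add: LIM_zero_iff tendsto_rabs_zero_iff)
      then show "g t x = U x" unfolding g_def by (rule limI)
    qed
  qed
qed

lemma weak_deriv_cong_AE:
  assumes cd: "c < d" and wd: "weak_deriv {c<..<d} m f g"
    and h: "h \<in> borel_measurable borel" "AE x in lborel. x \<in> {c<..<d} \<longrightarrow> g x = h x"
  shows "weak_deriv {c<..<d} m f h"
proof -
  let ?I = "{c<..<d}"
  have ae: "AE x in lebesgue_on ?I. g x = h x" using h(2) by (simp add: AE_lebesgue_on_iff)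
  have g: "g \<in> borel_measurable (lebesgue_on ?I)" "integrable (lebesgue_on ?I) (\<lambda>x. (g x)\<^sup>2)"
    using weak_deriv_L2(2)[OF wd] by (auto simp: L2_def)
  have hm: "h \<in> borel_measurable (lebesgue_on ?I)"
    by (rule lebesgue_on_borel_measurableI[OF h(1)]) auto
  have "integrable (lebesgue_on ?I) (\<lambda>x. (h x)\<^sup>2)"
    by (rule integrable_cong_AE_imp[OF g(2)]) (use hm ae in \<open>auto elim!: eventually_mono\<close>)
  then have "h \<in> L2 ?I" using hm by (simp add: L2_def)
  moreover have "(LINT x|lebesgue_on ?I. g x * \<phi> x) = (LINT x|lebesgue_on ?I. h x * \<phi> x)" if "\<phi> \<in> test_fun ?I" for \<phi>
  proof (rule integral_cong_AE)
    have "\<phi> \<in> borel_measurable (lebesgue_on ?I)" using test_fun_L2[OF that] by (simp add: L2_def)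
    then show "(\<lambda>x. g x * \<phi> x) \<in> borel_measurable (lebesgue_on ?I)" "(\<lambda>x. h x * \<phi> x) \<in> borel_measurable (lebesgue_on ?I)"
      using g(1) hm by auto
  qed (use ae in \<open>auto elim!: eventually_mono\<close>)
  ultimately show ?thesis using wd unfolding weak_deriv_def by simp
qed

lemma piecewise_weak_deriv:
  assumes part: "is_partition L N a" and wd: "\<And>k. k < N \<Longrightarrow> weak_deriv (subint a k) m f (g k)"
  obtains V where "V \<in> borel_measurable borel" "integrable lborel V"
    "\<And>k. k < N \<Longrightarrow> weak_deriv (subint a k) m f V"
    "\<And>x. x \<notin> (\<Union>k<N. subint a k) \<Longrightarrow> V x = 0"
proof -
  define P where "P k g' \<longleftrightarrow> g' \<in> borel_measurable borel \<and> (AE x in lborel. x \<in> subint a k \<longrightarrow> g k x = g' x) \<and>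
      (\<forall>x. x \<notin> subint a k \<longrightarrow> g' x = 0) \<and> integrable lborel g'" for k g'
  have "\<exists>g'. P k g'" if k: "k < N" for k
  proof -
    obtain g' where "g' \<in> borel_measurable borel" "AE x in lborel. x \<in> {a k<..<a (Suc k)} \<longrightarrow> g k x = g' x"
      "\<And>x. x \<notin> {a k<..<a (Suc k)} \<Longrightarrow> g' x = 0" "integrable lborel g'"
      using L2_interval_representative[OF weak_deriv_L2(2)[OF wd[OF k, unfolded subint_def]] partition_subint(1)[OF part k]]
      by blast
    then have "P k g'" unfolding P_def subint_def by blast
    then show ?thesis by blast
  qed
  then obtain G where P: "\<And>k. k < N \<Longrightarrow> P k (G k)" by metis
  note P' = P[unfolded P_def]
  note G = P'[THEN conjunct1] P'[THEN conjunct2, THEN conjunct1]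
    P'[THEN conjunct2, THEN conjunct2, THEN conjunct1, rule_format]
    P'[THEN conjunct2, THEN conjunct2, THEN conjunct2]
  define V where "V = (\<lambda>x. \<Sum>k<N. G k x)"
  have VG: "V x = G k x" if "k < N" "x \<in> subint a k" for k x
  proof -
    have z: "G i x = 0" if i: "i \<in> {..<N} - {k}" for i
    proof -
      have "x \<notin> subint a i" using partition_disjoint[OF part, of i k x] \<open>k < N\<close> \<open>x \<in> subint a k\<close> i by auto
      then show ?thesis using G(3)[of i x] i by simp
    qed
    have "V x = G k x + (\<Sum>l\<in>{..<N} - {k}. G l x)"
      unfolding V_def by (rule sum.remove) (use \<open>k < N\<close> in auto)
    also have "(\<Sum>l\<in>{..<N} - {k}. G l x) = 0" by (rule sum.neutral) (use z in blast)
    finally show ?thesis by simp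
  qed
  have Vm: "V \<in> borel_measurable borel" unfolding V_def using G(1) by (intro borel_measurable_sum) auto
  show ?thesis
  proof (rule that[OF Vm])
    show "integrable lborel V" unfolding V_def using G(4) by (intro Bochner_Integration.integrable_sum) auto
    show "V x = 0" if "x \<notin> (\<Union>k<N. subint a k)" for x
      unfolding V_def by (rule sum.neutral) (use that G(3) in auto)
    fix k assume k: "k < N"
    show "weak_deriv (subint a k) m f V"
      unfolding subint_def
    proof (rule weak_deriv_cong_AE[OF partition_subint(1)[OF part k] wd[OF k, unfolded subint_def] Vm])
      show "AE x in lborel. x \<in> {a k<..<a (Suc k)} \<longrightarrow> g k x = V x"
        using G(2)[OF k] by (rule eventually_mono) (use VG[OF k] in \<open>auto simp: subint_def\<close>)
    qed
  qed
qed

lemma simple_in_deriv: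
  assumes part: "is_partition L N a" and \<sigma>: "simple_in T X \<sigma>"
    and X: "\<And>v k. v \<in> X \<Longrightarrow> k < N \<Longrightarrow> \<exists>g. weak_deriv (subint a k) m v g"
  obtains S where "(\<lambda>(t, x). S t x) \<in> borel_measurable (borel \<Otimes>\<^sub>M borel)"
    "\<And>t. integrable lborel (S t)"
    "\<And>t x. x \<notin> (\<Union>k<N. subint a k) \<Longrightarrow> S t x = 0"
    "AE t in lborel. t \<in> {0<..<T} \<longrightarrow> (\<forall>k<N. weak_deriv (subint a k) m (\<sigma> t) (S t))"
proof -
  obtain n A v where Av: "\<And>i. i < n \<Longrightarrow> A i \<in> sets (lebesgue_on {0<..<T})" "\<And>i. i < n \<Longrightarrow> v i \<in> X"
    and eq: "\<And>t. t \<in> {0<..<T} \<Longrightarrow> \<sigma> t = (\<lambda>x. \<Sum>i<(n::nat). indicator (A i) t * v i x)"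
    using \<sigma> unfolding simple_in_def by blast
  \<comment> \<open>The sets \<open>A i\<close> are only Lebesgue measurable, so their indicators
    are replaced by Borel functions off a null set of times.\<close>
  define R where "R i \<alpha> \<longleftrightarrow> \<alpha> \<in> borel_measurable borel \<and>
    (AE t in lborel. t \<in> {0<..<T} \<longrightarrow> indicator (A i) t = (\<alpha> t :: real))" for i \<alpha>
  have "\<exists>\<alpha>. R i \<alpha>" if i: "i < n" for i
  proof -
    have "indicat_real (A i) \<in> borel_measurable (lebesgue_on {0<..<T})" using Av(1)[OF i] by simp
    then obtain \<alpha> where "\<alpha> \<in> borel_measurable borel"
      "AE t in lborel. t \<in> {0<..<T} \<longrightarrow> indicator (A i) t = (\<alpha> t :: real)"
      by (rule borel_representative) auto
    then have "R i \<alpha>" unfolding R_def by blast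
    then show ?thesis by blast
  qed
  then obtain \<alpha> where R: "\<And>i. i < n \<Longrightarrow> R i (\<alpha> i)" by metis
  note \<alpha> = R[unfolded R_def, THEN conjunct1] R[unfolded R_def, THEN conjunct2]
  define P where "P i V \<longleftrightarrow> V \<in> borel_measurable borel \<and> integrable lborel V \<and>
    (\<forall>k<N. weak_deriv (subint a k) m (v i) V) \<and> (\<forall>x. x \<notin> (\<Union>k<N. subint a k) \<longrightarrow> V x = 0)" for i V
  have "\<exists>V. P i V" if i: "i < n" for i
  proof -
    obtain g where g: "\<And>k. k < N \<Longrightarrow> weak_deriv (subint a k) m (v i) (g k)"
      using X[OF Av(2)[OF i]] by metis
    obtain V where "V \<in> borel_measurable borel" "integrable lborel V"
      "\<And>k. k < N \<Longrightarrow> weak_deriv (subint a k) m (v i) V" "\<And>x. x \<notin> (\<Union>k<N. subint a k) \<Longrightarrow> V x = 0"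
      using piecewise_weak_deriv[OF part g] by blast
    then have "P i V" unfolding P_def by blast
    then show ?thesis by blast
  qed
  then obtain V where P: "\<And>i. i < n \<Longrightarrow> P i (V i)" by metis
  note P' = P[unfolded P_def]
  note V = P'[THEN conjunct1] P'[THEN conjunct2, THEN conjunct1]
    P'[THEN conjunct2, THEN conjunct2, THEN conjunct1, rule_format]
    P'[THEN conjunct2, THEN conjunct2, THEN conjunct2, rule_format]
  define S where "S = (\<lambda>t x. \<Sum>i<n. \<alpha> i t * V i x)"
  show ?thesis
  proof (rule that[of S])
    show "(\<lambda>(t, x). S t x) \<in> borel_measurable (borel \<Otimes>\<^sub>M borel)"
      unfolding S_def split_beta'
    proof (intro borel_measurable_sum borel_measurable_times)
      fix i assume "i \<in> {..<n}"
      then have [measurable]: "\<alpha> i \<in> borel_measurable borel" "V i \<in> borel_measurable borel" using \<alpha>(1) V(1) by auto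
      show "(\<lambda>z. \<alpha> i (fst z)) \<in> borel_measurable (borel \<Otimes>\<^sub>M borel)" "(\<lambda>z. V i (snd z)) \<in> borel_measurable (borel \<Otimes>\<^sub>M borel)"
        by measurable
    qed
    show "integrable lborel (S t)" for t
      unfolding S_def by (intro Bochner_Integration.integrable_sum integrable_mult_right V(2)) auto
    show "S t x = 0" if "x \<notin> (\<Union>k<N. subint a k)" for t x
      unfolding S_def using V(4) that by (intro sum.neutral) auto
    have "AE t in lborel. \<forall>i\<in>{..<n}. t \<in> {0<..<T} \<longrightarrow> indicator (A i) t = \<alpha> i t"
      by (rule AE_finite_allI) (use \<alpha>(2) in auto)
    then show "AE t in lborel. t \<in> {0<..<T} \<longrightarrow> (\<forall>k<N. weak_deriv (subint a k) m (\<sigma> t) (S t))"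
    proof (rule eventually_mono, intro impI allI)
      fix t k assume t: "\<forall>i\<in>{..<n}. t \<in> {0<..<T} \<longrightarrow> indicator (A i) t = \<alpha> i t" "t \<in> {0<..<T}" and k: "k < N"
      have "\<sigma> t = (\<lambda>x. \<Sum>i<n. \<alpha> i t * v i x)" unfolding eq[OF t(2)] using t by auto
      then show "weak_deriv (subint a k) m (\<sigma> t) (S t)"
        unfolding S_def subint_def
        using V(3)[OF _ k, unfolded subint_def] by (auto intro!: weak_deriv_sum weak_deriv_cmult)
    qed
  qed
qed

lemma Hpw_norm_ge:
  assumes part: "is_partition L N a" and k: "k < N" and wd: "weak_deriv (subint a k) i f g" and i: "i \<le> m"
  shows "L2_norm (subint a k) g \<le> Hpw_norm m N a f"
proof -
  have "L2_norm (subint a k) g \<le> Hs_norm m (subint a k) f"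
    using Hs_norm_ge[OF partition_subint(1)[OF part k] wd[unfolded subint_def] i] by (simp add: subint_def)
  also have "\<dots> \<le> Hpw_norm m N a f"
    unfolding Hpw_norm_def
    by (intro real_le_rsqrt member_le_sum[of k "{..<N}" "\<lambda>k. (Hs_norm m (subint a k) f)\<^sup>2"]) (use k in auto)
  finally show ?thesis .
qed

text \<open>Measurability in both variables comes from the approximating simple functions, whose
  derivatives are finite sums of products. For almost every \<open>t\<close> these converge in
  \<open>L1\<close> to the weak derivative of the slice, so \<open>joint_limit\<close>
  applies.\<close>

lemma joint_weak_derivative:
  assumes part: "is_partition L N a" and u: "u \<in> bochner_L2 T (Hpw 3 L N a \<inter> X) (Hpw_norm 3 N a)" and m: "m \<le> 3"
  obtains g where "(\<lambda>(t, x). g t x) \<in> borel_measurable (borel \<Otimes>\<^sub>M borel)"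
    "AE t in lborel. t \<in> {0<..<T} \<longrightarrow> (\<forall>k<N. weak_deriv (subint a k) m (u t) (g t))"
proof -
  let ?X = "Hpw 3 L N a \<inter> X"
  have Xd: "\<exists>g. weak_deriv (subint a k) m v g" if "v \<in> ?X" "k < N" for v k
    using that m by (auto simp: Hpw_def Hs_def)
  have u': "AE t in lborel. t \<in> {0<..<T} \<longrightarrow> u t \<in> ?X"
    "\<exists>\<sigma>. (\<forall>n. simple_in T ?X (\<sigma> n)) \<and>
        (AE t in lborel. t \<in> {0<..<T} \<longrightarrow> (\<lambda>n. Hpw_norm 3 N a (\<lambda>x. \<sigma> n t x - u t x)) \<longlonglongrightarrow> 0)"
    using u unfolding bochner_L2_def mem_Collect_eq AE_lebesgue_on_iff[OF borel_open[OF open_greaterThanLessThan]]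
    by blast+
  from u'(2) obtain \<sigma> where \<sigma>: "\<forall>n. simple_in T ?X (\<sigma> n)"
    "AE t in lborel. t \<in> {0<..<T} \<longrightarrow> (\<lambda>n. Hpw_norm 3 N a (\<lambda>x. \<sigma> n t x - u t x)) \<longlonglongrightarrow> 0"
    by blast
  note uX = u'(1)
  define P where "P n S \<longleftrightarrow> (\<lambda>(t, x). S t x) \<in> borel_measurable (borel \<Otimes>\<^sub>M borel) \<and> (\<forall>t. integrable lborel (S t)) \<and>
      (\<forall>t x. x \<notin> (\<Union>k<N. subint a k) \<longrightarrow> S t x = 0) \<and>
      (AE t in lborel. t \<in> {0<..<T} \<longrightarrow> (\<forall>k<N. weak_deriv (subint a k) m (\<sigma> n t) (S t)))" for n S
  have "\<exists>S. P n S" for n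
  proof -
    obtain S where "(\<lambda>(t, x). S t x) \<in> borel_measurable (borel \<Otimes>\<^sub>M borel)" "\<And>t. integrable lborel (S t)"
      "\<And>t x. x \<notin> (\<Union>k<N. subint a k) \<Longrightarrow> S t x = 0"
      "AE t in lborel. t \<in> {0<..<T} \<longrightarrow> (\<forall>k<N. weak_deriv (subint a k) m (\<sigma> n t) (S t))"
      using simple_in_deriv[OF part \<sigma>(1)[rule_format, of n] Xd] by blast
    then have "P n S" unfolding P_def by blast
    then show ?thesis by blast
  qed
  then obtain S where P: "\<And>n. P n (S n)" by metis
  note P' = P[unfolded P_def]
  note S = P'[THEN conjunct1] P'[THEN conjunct2, THEN conjunct1, rule_format]
    P'[THEN conjunct2, THEN conjunct2, THEN conjunct1, rule_format]
    P'[THEN conjunct2, THEN conjunct2, THEN conjunct2]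
  obtain g where g: "(\<lambda>(t, x). g t x) \<in> borel_measurable (borel \<Otimes>\<^sub>M borel)"
    "\<And>t U. integrable lborel U \<Longrightarrow> (\<lambda>n. LBINT x. \<bar>S n t x - U x\<bar>) \<longlonglongrightarrow> 0 \<Longrightarrow> AE x in lborel. g t x = U x"
    by (rule joint_limit[OF S(1,2)]) (rule that)
  have all: "AE t in lborel. \<forall>n. t \<in> {0<..<T} \<longrightarrow> (\<forall>k<N. weak_deriv (subint a k) m (\<sigma> n t) (S n t))"
    by (rule AE_all_countable[THEN iffD2]) (use S(4) in blast)
  have "AE t in lborel. t \<in> {0<..<T} \<longrightarrow> (\<forall>k<N. weak_deriv (subint a k) m (u t) (g t))"
    using all \<sigma>(2) uX
  proof (eventually_elim, intro impI)
    fix t assume t: "t \<in> {0<..<T}"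
      and 1: "\<forall>n. t \<in> {0<..<T} \<longrightarrow> (\<forall>k<N. weak_deriv (subint a k) m (\<sigma> n t) (S n t))"
      and 2: "t \<in> {0<..<T} \<longrightarrow> (\<lambda>n. Hpw_norm 3 N a (\<lambda>x. \<sigma> n t x - u t x)) \<longlonglongrightarrow> 0"
      and 3: "t \<in> {0<..<T} \<longrightarrow> u t \<in> ?X"
    obtain g' where "\<And>k. k < N \<Longrightarrow> weak_deriv (subint a k) m (u t) (g' k)"
      using Xd[of "u t"] 3 t by metis
    then obtain U where U: "U \<in> borel_measurable borel" "integrable lborel U"
      "\<And>k. k < N \<Longrightarrow> weak_deriv (subint a k) m (u t) U" "\<And>x. x \<notin> (\<Union>k<N. subint a k) \<Longrightarrow> U x = 0"
      using piecewise_weak_deriv[OF part] by blast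
    \<comment> \<open>By the Cauchy-Schwarz inequality on each subinterval the \<open>L1\<close>
      distance is at most the square root of the length times the \<open>Hpw_norm\<close>;
      \<open>C\<close> adds up these roots.\<close>
    define C where "C = (\<Sum>k<N. sqrt (a (Suc k) - a k))"
    have bound: "(LBINT x. \<bar>S n t x - U x\<bar>) \<le> C * Hpw_norm 3 N a (\<lambda>x. \<sigma> n t x - u t x)" for n
    proof -
      have i: "integrable lborel (\<lambda>x. S n t x - U x)" using S(2) U(2) by auto
      have ik: "set_integrable lborel {a k..a (Suc k)} (\<lambda>x. S n t x - U x)" for k
        unfolding set_integrable_def by (rule integrable_mult_indicator[OF _ i]) simp
      have "(LBINT x. \<bar>S n t x - U x\<bar>) \<le> (LBINT x. (\<Sum>k<N. indicator {a k..a (Suc k)} x *\<^sub>R \<bar>S n t x - U x\<bar>))"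
      proof (rule integral_mono)
        show "integrable lborel (\<lambda>x. \<Sum>k<N. indicator {a k..a (Suc k)} x *\<^sub>R \<bar>S n t x - U x\<bar>)"
          by (intro Bochner_Integration.integrable_sum set_integrable_abs[OF ik, unfolded set_integrable_def])
        fix x
        show "\<bar>S n t x - U x\<bar> \<le> (\<Sum>k<N. indicator {a k..a (Suc k)} x *\<^sub>R \<bar>S n t x - U x\<bar>)"
        proof (cases "x \<in> (\<Union>k<N. subint a k)")
          case True
          then obtain k where k: "k < N" "x \<in> subint a k" by auto
          have "\<bar>S n t x - U x\<bar> = indicator {a k..a (Suc k)} x *\<^sub>R \<bar>S n t x - U x\<bar>"
            using k by (auto simp: subint_def)
          also have "\<dots> \<le> (\<Sum>k<N. indicator {a k..a (Suc k)} x *\<^sub>R \<bar>S n t x - U x\<bar>)"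
            by (rule member_le_sum) (use k in auto)
          finally show ?thesis .
        next
          case False
          then show ?thesis using S(3)[OF False] U(4)[OF False] by simp
        qed
      qed (use i in auto)
      also have "\<dots> = (\<Sum>k<N. LBINT x:{a k..a (Suc k)}. \<bar>S n t x - U x\<bar>)"
        unfolding set_lebesgue_integral_def
        by (rule Bochner_Integration.integral_sum) (use set_integrable_abs[OF ik] in \<open>auto simp: set_integrable_def\<close>)
      also have "\<dots> \<le> (\<Sum>k<N. sqrt (a (Suc k) - a k) * Hpw_norm 3 N a (\<lambda>x. \<sigma> n t x - u t x))"
      proof (rule sum_mono)
        fix k assume "k \<in> {..<N}"
        then have k: "k < N" by simp
        have wd: "weak_deriv {a k<..<a (Suc k)} m (\<lambda>x. \<sigma> n t x - u t x) (\<lambda>x. S n t x - U x)"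
          using 1 t U(3)[OF k] k by (auto simp: subint_def intro!: weak_deriv_diff)
        have "(LBINT x:{a k..a (Suc k)}. \<bar>S n t x - U x\<bar>) \<le> sqrt (a (Suc k) - a k) * L2_norm {a k<..<a (Suc k)} (\<lambda>x. S n t x - U x)"
          by (rule L1_le_L2_norm[OF weak_deriv_L2(2)[OF wd] _ ik partition_subint(1)[OF part k]]) auto
        also have "\<dots> \<le> sqrt (a (Suc k) - a k) * Hpw_norm 3 N a (\<lambda>x. \<sigma> n t x - u t x)"
          using Hpw_norm_ge[OF part k wd[folded subint_def] m] partition_subint(1)[OF part k]
          by (intro mult_left_mono) (auto simp: subint_def)
        finally show "(LBINT x:{a k..a (Suc k)}. \<bar>S n t x - U x\<bar>) \<le> sqrt (a (Suc k) - a k) * Hpw_norm 3 N a (\<lambda>x. \<sigma> n t x - u t x)" .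
      qed
      finally show ?thesis by (simp add: C_def sum_distrib_right)
    qed
    have "(\<lambda>n. C * Hpw_norm 3 N a (\<lambda>x. \<sigma> n t x - u t x)) \<longlonglongrightarrow> C * 0"
      by (rule tendsto_mult[OF tendsto_const 2[rule_format, OF t]])
    then have h0: "(\<lambda>n. C * Hpw_norm 3 N a (\<lambda>x. \<sigma> n t x - u t x)) \<longlonglongrightarrow> 0" by simp
    have "(\<lambda>n. LBINT x. \<bar>S n t x - U x\<bar>) \<longlonglongrightarrow> 0"
    proof (rule tendsto_sandwich[OF _ _ tendsto_const h0])
      show "\<forall>\<^sub>F n in sequentially. 0 \<le> (LBINT x. \<bar>S n t x - U x\<bar>)" by simp
      show "\<forall>\<^sub>F n in sequentially. (LBINT x. \<bar>S n t x - U x\<bar>) \<le> C * Hpw_norm 3 N a (\<lambda>x. \<sigma> n t x - u t x)"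
        using bound by (intro always_eventually allI)
    qed
    from g(2)[OF U(2) this] have gU: "AE x in lborel. g t x = U x" .
    show "\<forall>k<N. weak_deriv (subint a k) m (u t) (g t)"
    proof (intro allI impI)
      fix k assume k: "k < N"
      have "(\<lambda>x. case (t, x) of (t, x) \<Rightarrow> g t x) \<in> borel_measurable borel"
        by (rule measurable_compose[OF measurable_Pair1' g(1)]) simp
      then have gm: "g t \<in> borel_measurable borel" by simp
      show "weak_deriv (subint a k) m (u t) (g t)"
        unfolding subint_def
        by (rule weak_deriv_cong_AE[OF partition_subint(1)[OF part k] U(3)[OF k, unfolded subint_def] gm])
           (use gU in \<open>auto elim!: eventually_mono\<close>)
    qed
  qed
  then show ?thesis using that g(1) by blast
qed

section \<open>Absolute continuity in time from the distributional equation\<close>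

lemma AE_lborel_pairD:
  assumes "AE z in (lborel :: (real \<times> real) measure). P z"
  shows "AE t in lborel. AE x in lborel. P (t, x)" "AE x in lborel. AE t in lborel. P (t, x)"
proof -
  have *: "AE z in lborel \<Otimes>\<^sub>M lborel. P z" using assms unfolding lborel_prod[symmetric] .
  show "AE t in lborel. AE x in lborel. P (t, x)" by (rule lborel_pair.AE_pair[OF *])
  obtain N where N: "N \<in> null_sets (lborel \<Otimes>\<^sub>M lborel)" "{z \<in> space (lborel \<Otimes>\<^sub>M lborel). \<not> P z} \<subseteq> N"
    using * by (auto simp: eventually_ae_filter)
  have [measurable]: "N \<in> sets (lborel \<Otimes>\<^sub>M lborel)" using N(1) by auto
  have "AE z in lborel \<Otimes>\<^sub>M lborel. z \<notin> N" by (rule AE_not_in[OF N(1)])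
  then have "AE t in lborel. AE x in lborel. (t, x) \<notin> N" by (rule lborel_pair.AE_pair)
  then have "AE x in lborel. AE t in lborel. (t, x) \<notin> N"
    by (rule lborel_pair.AE_commute[THEN iffD1, rotated]) measurable
  then show "AE x in lborel. AE t in lborel. P (t, x)"
  proof (rule eventually_mono)
    fix x :: real assume "AE t in lborel. (t, x) \<notin> N"
    then show "AE t in lborel. P (t, x)"
      by (rule eventually_mono) (use N(2) in \<open>auto simp: space_pair_measure\<close>)
  qed
qed

lemma AE_lborel_pairI:
  assumes "{z. P z} \<in> sets (borel :: (real \<times> real) measure)"
    and "AE x in lborel. AE t in lborel. P (t, x)"
  shows "AE z in (lborel :: (real \<times> real) measure). P z"
proof -
  have [measurable]: "Measurable.pred (borel \<Otimes>\<^sub>M borel) P"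
    using assms(1) by (simp add: borel_prod pred_def)
  have "AE t in lborel. AE x in lborel. P (t, x)"
    by (rule lborel_pair.AE_commute[THEN iffD2, rotated, OF assms(2)]) measurable
  then have "AE z in lborel \<Otimes>\<^sub>M lborel. P z"
    by (rule lborel_pair.AE_pair_measure[rotated]) measurable
  then show ?thesis unfolding lborel_prod .
qed

lemma Ck_tensor:
  fixes f g :: "real \<Rightarrow> real"
  assumes "smooth f" "smooth g"
  shows "Ck k (\<lambda>z. f (fst z) * g (snd z))"
  using assms
proof (induction k arbitrary: f g)
  case 0
  have "continuous_on UNIV (\<lambda>z::real \<times> real. f (fst z))" "continuous_on UNIV (\<lambda>z::real \<times> real. g (snd z))"
    by (rule continuous_on_compose2[OF smoothD(3)[OF 0(1)]] continuous_on_compose2[OF smoothD(3)[OF 0(2)]];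
        auto intro: continuous_intros)+
  then show ?case by (simp add: continuous_on_mult)
next
  case (Suc k)
  note f = smoothD[OF Suc.prems(1)] and g = smoothD[OF Suc.prems(2)]
  have der: "((\<lambda>z. f (fst z) * g (snd z)) has_derivative
     (\<lambda>h. f (fst z) * (deriv g (snd z) * snd h) + deriv f (fst z) * fst h * g (snd z))) (at z)" for z :: "real \<times> real"
  proof (rule has_derivative_mult)
    show "((\<lambda>z. f (fst z)) has_derivative (\<lambda>h. deriv f (fst z) * fst h)) (at z)"
      using has_derivative_compose[OF has_derivative_fst[OF has_derivative_ident] f(1)[of "fst z", unfolded has_field_derivative_def]]
      by simp
    show "((\<lambda>z. g (snd z)) has_derivative (\<lambda>h. deriv g (snd z) * snd h)) (at z)"
      using has_derivative_compose[OF has_derivative_snd[OF has_derivative_ident] g(1)[of "snd z", unfolded has_field_derivative_def]]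
      by simp
  qed
  have fd: "frechet_derivative (\<lambda>z. f (fst z) * g (snd z)) (at z) =
     (\<lambda>h. f (fst z) * (deriv g (snd z) * snd h) + deriv f (fst z) * fst h * g (snd z))" for z :: "real \<times> real"
    using frechet_derivative_at[OF der] by simp
  show ?case
    unfolding Ck.simps(2)
  proof (intro conjI allI ballI)
    show "(\<lambda>z. f (fst z) * g (snd z)) differentiable at z" for z :: "real \<times> real"
      using der[of z] unfolding differentiable_def by blast
    fix v :: "real \<times> real" assume "v \<in> Basis"
    then have "v = (1, 0) \<or> v = (0, 1)" by (auto simp: Basis_prod_def)
    then show "Ck k (\<lambda>z. frechet_derivative (\<lambda>z. f (fst z) * g (snd z)) (at z) v)"
      using Suc.IH[OF f(2) Suc.prems(2)] Suc.IH[OF Suc.prems(1) g(2)] by (auto simp: fd)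
  qed
qed

text \<open>The equation on the cylinder is tested with products only. These suffice to freeze the
  space variable and obtain a one-dimensional statement in time.\<close>

lemma test_fun_tensor:
  assumes "\<zeta> \<in> test_fun {0<..<T}" "\<rho> \<in> test_fun {0<..<L}"
  shows "(\<lambda>z. \<zeta> (fst z) * \<rho> (snd z)) \<in> test_fun (cylinder T L)"
proof -
  obtain K where K: "compact K" "K \<subseteq> {0<..<T}" "\<And>x. x \<notin> K \<Longrightarrow> \<zeta> x = 0" using assms(1) by (auto simp: test_fun_def)
  obtain M where M: "compact M" "M \<subseteq> {0<..<L}" "\<And>x. x \<notin> M \<Longrightarrow> \<rho> x = 0" using assms(2) by (auto simp: test_fun_def)
  have "compact (K \<times> M)" "K \<times> M \<subseteq> cylinder T L" using K M by (auto simp: compact_Times cylinder_def)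
  moreover have "\<zeta> (fst z) * \<rho> (snd z) = 0" if "z \<notin> K \<times> M" for z
    using that K(3) M(3) by (cases z) auto
  ultimately show ?thesis
    using Ck_tensor[OF test_fun_smooth[OF assms(1)] test_fun_smooth[OF assms(2)]]
    unfolding test_fun_def by blast
qed

lemma cylinder_borel: "cylinder T L \<in> sets borel"
  by (simp add: cylinder_def open_Times)

lemma emeasure_cylinder_finite: "emeasure lborel (cylinder T L) < \<infinity>"
proof -
  have "bounded (cylinder T L)" unfolding cylinder_def by (intro bounded_Times) auto
  then show ?thesis by (rule emeasure_bounded_finite)
qed

lemma test_fun_bounded:
  fixes S :: "real set"
  assumes th: "\<theta> \<in> test_fun S"
  shows "\<exists>B. \<forall>x. \<bar>\<theta> x\<bar> \<le> B"
proof -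
  obtain K where K: "compact K" "\<And>x. x \<notin> K \<Longrightarrow> \<theta> x = 0" using th by (auto simp: test_fun_def)
  have "compact (\<theta> ` K)"
    by (rule compact_continuous_image[OF continuous_on_subset[OF smoothD(3)[OF test_fun_smooth[OF th]]] K(1)]) auto
  then obtain B where B: "\<forall>y\<in>\<theta> ` K. norm y \<le> B" using compact_imp_bounded bounded_iff by metis
  have "\<bar>\<theta> x\<bar> \<le> max B 0" for x
    using B K(2)[of x] by (cases "x \<in> K") (auto simp: le_max_iff_disj)
  then show ?thesis by blast
qed

lemma integrable_tensor:
  fixes S S' :: "real set"
  assumes W: "integrable (lborel \<Otimes>\<^sub>M lborel) W" and th: "\<theta> \<in> test_fun S" and ch: "\<rho> \<in> test_fun S'"
  shows "integrable (lborel \<Otimes>\<^sub>M lborel) (\<lambda>z. W z * \<theta> (fst z) * \<rho> (snd z))"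
proof -
  have [measurable]: "\<theta> \<in> borel_measurable borel" "\<rho> \<in> borel_measurable borel" "W \<in> borel_measurable (borel \<Otimes>\<^sub>M borel)"
    using smooth_borel[OF test_fun_smooth[OF th]] smooth_borel[OF test_fun_smooth[OF ch]] W
    by (auto dest: borel_measurable_integrable)
  obtain B B' where B: "\<And>x. \<bar>\<theta> x\<bar> \<le> B" "\<And>x. \<bar>\<rho> x\<bar> \<le> B'" using test_fun_bounded[OF th] test_fun_bounded[OF ch] by blast
  have "integrable (lborel \<Otimes>\<^sub>M lborel) (\<lambda>z. B * B' * W z)" using W by auto
  then show ?thesis
  proof (rule Bochner_Integration.integrable_bound)
    show "AE z in lborel \<Otimes>\<^sub>M lborel. norm (W z * \<theta> (fst z) * \<rho> (snd z)) \<le> norm (B * B' * W z)"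
    proof (rule AE_I2)
      fix z :: "real \<times> real"
      have "\<bar>\<theta> (fst z)\<bar> * \<bar>\<rho> (snd z)\<bar> \<le> B * B'"
        by (rule mult_mono) (use B in \<open>auto intro: order_trans[OF abs_ge_zero]\<close>)
      then have "\<bar>W z\<bar> * (\<bar>\<theta> (fst z)\<bar> * \<bar>\<rho> (snd z)\<bar>) \<le> \<bar>W z\<bar> * \<bar>B * B'\<bar>"
        by (intro mult_left_mono) auto
      then show "norm (W z * \<theta> (fst z) * \<rho> (snd z)) \<le> norm (B * B' * W z)"
        by (simp add: abs_mult algebra_simps)
    qed
  qed measurable
qed

text \<open>For one test function in time the tested identity holds for almost every
  \<open>x\<close>. Since \<open>du_Bois_Reymond\<close> needs only countably many test functions,
  one null set of \<open>x\<close> serves for all of them, and outside it the slice in time is a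
  primitive of \<open>Z\<close>.\<close>

lemma time_AC:
  assumes T: "T > 0" and L: "L > 0"
    and U: "U \<in> borel_measurable borel" "integrable lborel U" "\<And>z. z \<notin> cylinder T L \<Longrightarrow> U z = 0"
    and Z: "Z \<in> borel_measurable borel" "integrable lborel Z" "\<And>z. z \<notin> cylinder T L \<Longrightarrow> Z z = 0"
    and eq: "\<And>\<zeta> \<rho>. \<zeta> \<in> test_fun {0<..<T} \<Longrightarrow> \<rho> \<in> test_fun {0<..<L} \<Longrightarrow>
       (LBINT z. U z * deriv \<zeta> (fst z) * \<rho> (snd z)) = - (LBINT z. Z z * \<zeta> (fst z) * \<rho> (snd z))"
  obtains V :: "real \<Rightarrow> real \<Rightarrow> real" where "(\<lambda>(t, x). V t x) \<in> borel_measurable borel"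
    "AE x in lborel. AC 0 T (\<lambda>t. V t x) (\<lambda>t. Z (t, x))"
    "AE z in lborel. z \<in> cylinder T L \<longrightarrow> U z = V (fst z) (snd z)"
proof -
  let ?I = "{0<..<T}" and ?J = "{0<..<L}"
  note [measurable] = U(1) Z(1)
  have [measurable]: "U \<in> borel_measurable (borel \<Otimes>\<^sub>M borel)" "Z \<in> borel_measurable (borel \<Otimes>\<^sub>M borel)"
    by (simp_all add: borel_prod)
  have pi: "integrable (lborel \<Otimes>\<^sub>M lborel) U" "integrable (lborel \<Otimes>\<^sub>M lborel) Z"
    using U(2) Z(2) by (simp_all add: lborel_prod)
  show ?thesis
  proof (rule du_Bois_Reymond[OF T], goal_cases)
  case (1 F)
  note F = this
  \<comment> \<open>With the time factor fixed, the integral in \<open>t\<close> is a function of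
    \<open>x\<close> that vanishes against all rational bumps.\<close>
  have one: "AE x in lborel. x \<in> ?J \<longrightarrow> (LBINT t. U (t, x) * deriv \<theta> t + Z (t, x) * \<theta> t) = 0" if th: "\<theta> \<in> F" for \<theta>
  proof -
    have th: "\<theta> \<in> test_fun ?I" "deriv \<theta> \<in> test_fun ?I" using th F(2) test_fun_deriv by auto
    have [measurable]: "\<theta> \<in> borel_measurable borel" "deriv \<theta> \<in> borel_measurable borel"
      using th smooth_borel test_fun_smooth by blast+
    obtain B where B: "\<And>x. \<bar>\<theta> x\<bar> \<le> B" using test_fun_bounded[OF th(1)] by blast
    obtain B' where B': "\<And>x. \<bar>deriv \<theta> x\<bar> \<le> B'" using test_fun_bounded[OF th(2)] by blast
    have i0: "integrable (lborel \<Otimes>\<^sub>M lborel) (\<lambda>z. U z * deriv \<theta> (fst z) + Z z * \<theta> (fst z))"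
    proof (rule Bochner_Integration.integrable_bound)
      show "integrable (lborel \<Otimes>\<^sub>M lborel) (\<lambda>z. B' * \<bar>U z\<bar> + B * \<bar>Z z\<bar>)" using pi by auto
      show "AE z in lborel \<Otimes>\<^sub>M lborel. norm (U z * deriv \<theta> (fst z) + Z z * \<theta> (fst z)) \<le> norm (B' * \<bar>U z\<bar> + B * \<bar>Z z\<bar>)"
      proof (rule AE_I2)
        fix z :: "real \<times> real"
        have "\<bar>U z * deriv \<theta> (fst z)\<bar> \<le> B' * \<bar>U z\<bar>" "\<bar>Z z * \<theta> (fst z)\<bar> \<le> B * \<bar>Z z\<bar>"
          using mult_right_mono[OF B'[of "fst z"], of "\<bar>U z\<bar>"] mult_right_mono[OF B[of "fst z"], of "\<bar>Z z\<bar>"]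
          by (simp_all add: abs_mult mult.commute)
        then show "norm (U z * deriv \<theta> (fst z) + Z z * \<theta> (fst z)) \<le> norm (B' * \<bar>U z\<bar> + B * \<bar>Z z\<bar>)"
          unfolding real_norm_def by linarith
      qed
    qed measurable
    define h where "h = (\<lambda>x. LBINT t. U (t, x) * deriv \<theta> t + Z (t, x) * \<theta> t)"
    have hi: "integrable lborel h"
      using lborel_pair.integrable_snd[of "\<lambda>t x. U (t, x) * deriv \<theta> t + Z (t, x) * \<theta> t"] i0
      by (simp add: h_def case_prod_beta')
    have "AE x in lborel. x \<in> ?J \<longrightarrow> h x = 0"
    proof (rule rational_bumps_separate[OF L])
      show "set_integrable lborel ?J h" unfolding set_integrable_def
        by (rule integrable_mult_indicator[OF _ hi]) simp
      fix l u n assume "l \<in> \<rat> \<inter> ?J" "u \<in> \<rat> \<inter> ?J"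
      then have b: "bump l u n \<in> test_fun ?J" by (intro bump_test_fun) auto
      let ?\<rho> = "bump l u n"
      have m1: "integrable (lborel \<Otimes>\<^sub>M lborel) (\<lambda>z. U z * deriv \<theta> (fst z) * ?\<rho> (snd z))"
        and m2: "integrable (lborel \<Otimes>\<^sub>M lborel) (\<lambda>z. Z z * \<theta> (fst z) * ?\<rho> (snd z))"
        using integrable_tensor[OF pi(1) th(2) b] integrable_tensor[OF pi(2) th(1) b] by auto
      have m: "integrable (lborel \<Otimes>\<^sub>M lborel) (\<lambda>(t, x). (U (t, x) * deriv \<theta> t + Z (t, x) * \<theta> t) * ?\<rho> x)"
        using Bochner_Integration.integrable_add[OF m1 m2] by (simp add: case_prod_beta' distrib_right)
      have "(LBINT x:?J. h x * ?\<rho> x) = (LBINT x. h x * ?\<rho> x)"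
        unfolding set_lebesgue_integral_def
        by (rule Bochner_Integration.integral_cong) (use test_fun_zero[OF b] in \<open>auto simp: indicator_def\<close>)
      also have "\<dots> = (LBINT x. LBINT t. (U (t, x) * deriv \<theta> t + Z (t, x) * \<theta> t) * ?\<rho> x)"
        by (simp add: h_def)
      also have "\<dots> = (LINT z|(lborel \<Otimes>\<^sub>M lborel). (case z of (t, x) \<Rightarrow> (U (t, x) * deriv \<theta> t + Z (t, x) * \<theta> t) * ?\<rho> x))"
        using lborel_pair.integral_snd[OF m] by simp
      also have "\<dots> = (LINT z|(lborel \<Otimes>\<^sub>M lborel). U z * deriv \<theta> (fst z) * ?\<rho> (snd z) + Z z * \<theta> (fst z) * ?\<rho> (snd z))"
        by (simp add: case_prod_beta' distrib_right)
      also have "\<dots> = 0"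
        using Bochner_Integration.integral_add[OF m1 m2] eq[OF th(1) b] by (simp add: lborel_prod)
      finally show "(LBINT x:?J. h x * ?\<rho> x) = 0" .
    qed
    then show ?thesis by (simp add: h_def)
  qed
  have all: "AE x in lborel. \<forall>\<theta>\<in>F. x \<in> ?J \<longrightarrow> (LBINT t. U (t, x) * deriv \<theta> t + Z (t, x) * \<theta> t) = 0"
    by (rule AE_ball_countable[OF F(1), THEN iffD2]) (use one in blast)
  have ix: "AE x in lborel. integrable lborel (\<lambda>t. U (t, x)) \<and> integrable lborel (\<lambda>t. Z (t, x))"
    using lborel_pair.AE_integrable_snd[of "\<lambda>t x. U (t, x)"] lborel_pair.AE_integrable_snd[of "\<lambda>t x. Z (t, x)"] pi
    by (simp add: case_prod_beta')
  define G where "G t x = (LBINT s. indicator {0<..t} s * Z (s, x))" for t x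
  \<comment> \<open>The constant of integration depends on \<open>x\<close> and must do so
    measurably; the average over time recovers it.\<close>
  define c where "c x = (1 / T) * (LBINT t. indicator ?I t * (U (t, x) - G t x))" for x
  define V where "V t x = c x + G t x" for t x
  have Gm: "(\<lambda>z. G (fst z) (snd z)) \<in> borel_measurable (borel \<Otimes>\<^sub>M borel)"
  proof -
    have "(\<lambda>z. LBINT s. (if 0 < s \<and> s \<le> fst z then Z (s, snd z) else 0)) \<in> borel_measurable (borel \<Otimes>\<^sub>M borel)"
      by measurable
    moreover have "G (fst z) (snd z) = (LBINT s. (if 0 < s \<and> s \<le> fst z then Z (s, snd z) else 0))" for z
      unfolding G_def by (rule Bochner_Integration.integral_cong) (auto simp: indicator_def)
    ultimately show ?thesis by simp
  qed
  have cm: "c \<in> borel_measurable borel"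
  proof -
    have [measurable]: "(\<lambda>(x, t). G t x) \<in> borel_measurable (borel \<Otimes>\<^sub>M borel)"
      using measurable_compose[OF _ Gm, of "\<lambda>z. (snd z, fst z)" "borel \<Otimes>\<^sub>M borel"]
      by (simp add: case_prod_beta')
    show ?thesis unfolding c_def by measurable
  qed
  have Vm: "(\<lambda>z. V (fst z) (snd z)) \<in> borel_measurable (borel \<Otimes>\<^sub>M borel)"
  proof -
    note [measurable] = Gm cm
    show ?thesis unfolding V_def by measurable
  qed
  have good: "AE x in lborel. AC 0 T (\<lambda>t. V t x) (\<lambda>t. Z (t, x)) \<and>
     (x \<in> ?J \<longrightarrow> (AE t in lborel. t \<in> ?I \<longrightarrow> U (t, x) = V t x))"
    using all ix
  proof eventually_elim
    case (elim x)
    have iU: "integrable lborel (\<lambda>t. U (t, x))" and iZ: "integrable lborel (\<lambda>t. Z (t, x))" using elim by auto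
    have G: "G t x = (LBINT s:{0..t}. Z (s, x))" for t
      unfolding G_def set_lebesgue_integral_def
      by (rule Bochner_Integration.integral_cong) (use Z(3)[of "(0, x)"] in \<open>auto simp: indicator_def cylinder_def\<close>)
    have "G 0 x = 0" by (simp add: G_def)
    then have AC: "AC 0 T (\<lambda>t. V t x) (\<lambda>t. Z (t, x))"
      unfolding AC_def
    proof (intro conjI ballI)
      show "set_integrable lborel {0..T} (\<lambda>t. Z (t, x))"
        unfolding set_integrable_def by (rule integrable_mult_indicator[OF _ iZ]) simp
      show "(LBINT s:{0..t}. Z (s, x)) = V t x - V 0 x" for t
        unfolding V_def \<open>G 0 x = 0\<close> by (simp add: G)
    qed
    have "AE t in lborel. t \<in> ?I \<longrightarrow> U (t, x) = V t x" if x: "x \<in> ?J"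
    proof -
      have si: "set_integrable lborel ?I (\<lambda>t. U (t, x))" "set_integrable lborel ?I (\<lambda>t. Z (t, x))"
        unfolding set_integrable_def by (rule integrable_mult_indicator[OF _ iU], simp, rule integrable_mult_indicator[OF _ iZ], simp)
      have "\<exists>C. AE t in lborel. t \<in> ?I \<longrightarrow> U (t, x) = C + (LBINT s:{0<..t}. Z (s, x))"
      proof (rule F(3)[OF si])
        fix \<theta> assume "\<theta> \<in> F"
        then have z: "(LBINT t. U (t, x) * deriv \<theta> t + Z (t, x) * \<theta> t) = 0" and th: "\<theta> \<in> test_fun ?I"
          using elim x F(2) by auto
        have e: "(\<lambda>t. indicator ?I t *\<^sub>R (U (t, x) * deriv \<theta> t)) = (\<lambda>t. U (t, x) * deriv \<theta> t)"
          "(\<lambda>t. indicator ?I t *\<^sub>R (Z (t, x) * \<theta> t)) = (\<lambda>t. Z (t, x) * \<theta> t)"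
          using test_fun_zero[OF th] test_fun_zero[OF test_fun_deriv[OF th]] by (auto simp: indicator_def fun_eq_iff)
        have "integrable lborel (\<lambda>t. U (t, x) * deriv \<theta> t)" "integrable lborel (\<lambda>t. Z (t, x) * \<theta> t)"
          using set_integrable_test_mult[OF iU test_fun_deriv[OF th]] set_integrable_test_mult[OF iZ th]
          unfolding set_integrable_def e by auto
        from Bochner_Integration.integral_add[OF this] z
        show "(LBINT t:?I. U (t, x) * deriv \<theta> t) = - (LBINT t:?I. Z (t, x) * \<theta> t)"
          unfolding set_lebesgue_integral_def e by simp
      qed
      then obtain C where C: "AE t in lborel. t \<in> ?I \<longrightarrow> U (t, x) = C + (LBINT s:{0<..t}. Z (s, x))" by blast
      have C': "AE t in lborel. t \<in> ?I \<longrightarrow> U (t, x) = C + G t x"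
        using C by (rule eventually_mono) (simp add: G_def set_lebesgue_integral_def)
      have [measurable]: "(\<lambda>t. G t x) \<in> borel_measurable borel"
        using measurable_compose[OF measurable_Pair2'[of x] Gm] by simp
      have "(LBINT t. indicator ?I t * (U (t, x) - G t x)) = (LBINT t. indicator ?I t * C)"
        by (rule integral_cong_AE) (use C' in \<open>auto elim!: eventually_mono simp: indicator_def\<close>)
      then have "c x = C" using T by (simp add: c_def)
      then show ?thesis using C' by (simp add: V_def)
    qed
    with AC show ?case by blast
  qed
  show ?thesis
  proof (rule that[of V])
    show "(\<lambda>(t, x). V t x) \<in> borel_measurable borel" using Vm by (simp add: case_prod_beta' borel_prod)
    show "AE x in lborel. AC 0 T (\<lambda>t. V t x) (\<lambda>t. Z (t, x))" using good by (rule eventually_mono) blast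
    show "AE z in lborel. z \<in> cylinder T L \<longrightarrow> U z = V (fst z) (snd z)"
    proof (rule AE_lborel_pairI)
      have [measurable]: "(\<lambda>z. V (fst z) (snd z)) \<in> borel_measurable borel" "cylinder T L \<in> sets borel"
        using Vm cylinder_borel by (simp_all add: borel_prod)
      show "{z. z \<in> cylinder T L \<longrightarrow> U z = V (fst z) (snd z)} \<in> sets borel" by measurable
      show "AE x in lborel. AE t in lborel. (t, x) \<in> cylinder T L \<longrightarrow> U (t, x) = V (fst (t, x)) (snd (t, x))"
        using good
      proof (rule eventually_mono)
        fix x assume x: "AC 0 T (\<lambda>t. V t x) (\<lambda>t. Z (t, x)) \<and> (x \<in> ?J \<longrightarrow> (AE t in lborel. t \<in> ?I \<longrightarrow> U (t, x) = V t x))"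
        show "AE t in lborel. (t, x) \<in> cylinder T L \<longrightarrow> U (t, x) = V (fst (t, x)) (snd (t, x))"
        proof (cases "x \<in> ?J")
          case True
          with x have "AE t in lborel. t \<in> ?I \<longrightarrow> U (t, x) = V t x" by blast
          then show ?thesis by (rule eventually_mono) (auto simp: cylinder_def)
        qed (auto simp: cylinder_def)
      qed
    qed
  qed
qed
qed

text \<open>At a node the derivatives have two one-sided values, so the representatives are indexed
  by subintervals. Only \<open>g3\<close> enters as it stands, as a density; \<open>f\<close>,
  \<open>g1\<close> and \<open>g2\<close> are matched almost everywhere.\<close>

definition chain :: "nat \<Rightarrow> (nat \<Rightarrow> real) \<Rightarrow> (nat \<Rightarrow> real) \<Rightarrow> real \<Rightarrow> (real \<Rightarrow> real) \<Rightarrow> (real \<Rightarrow> real)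
    \<Rightarrow> (real \<Rightarrow> real) \<Rightarrow> (real \<Rightarrow> real) \<Rightarrow> bool" where
  "chain N a p L f g1 g2 g3 \<longleftrightarrow> (\<exists>w0 w1 w2.
     (\<forall>k<N. AC (a k) (a (Suc k)) (w0 k) (w1 k) \<and> AC (a k) (a (Suc k)) (w1 k) (w2 k) \<and>
        AC (a k) (a (Suc k)) (w2 k) g3 \<and>
        (AE x in lborel. x \<in> subint a k \<longrightarrow> f x = w0 k x \<and> g1 x = w1 k x \<and> g2 x = w2 k x)) \<and>
     (\<forall>k\<in>{1..<N}. w0 (k - 1) (a k) = w0 k (a k) \<and>
        sqrt (p (k - 1)) * w1 (k - 1) (a k) = sqrt (p k) * w1 k (a k) \<and>
        p (k - 1) * w2 (k - 1) (a k) = p k * w2 k (a k)) \<and>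
     w0 0 0 = 0 \<and> w0 (N - 1) L = 0)"

lemma chain_cong:
  assumes "chain N a p L f g1 g2 g3" "AE x in lborel. x \<in> {0<..<L} \<longrightarrow> f x = f' x" "is_partition L N a"
  shows "chain N a p L f' g1 g2 g3"
proof -
  obtain w0 w1 w2 where w: "\<forall>k<N. AC (a k) (a (Suc k)) (w0 k) (w1 k) \<and> AC (a k) (a (Suc k)) (w1 k) (w2 k) \<and>
        AC (a k) (a (Suc k)) (w2 k) g3 \<and>
        (AE x in lborel. x \<in> subint a k \<longrightarrow> f x = w0 k x \<and> g1 x = w1 k x \<and> g2 x = w2 k x)"
     "(\<forall>k\<in>{1..<N}. w0 (k - 1) (a k) = w0 k (a k) \<and>
        sqrt (p (k - 1)) * w1 (k - 1) (a k) = sqrt (p k) * w1 k (a k) \<and>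
        p (k - 1) * w2 (k - 1) (a k) = p k * w2 k (a k)) \<and>
     w0 0 0 = 0 \<and> w0 (N - 1) L = 0"
    using assms(1) unfolding chain_def by blast
  have "\<forall>k<N. AC (a k) (a (Suc k)) (w0 k) (w1 k) \<and> AC (a k) (a (Suc k)) (w1 k) (w2 k) \<and>
        AC (a k) (a (Suc k)) (w2 k) g3 \<and>
        (AE x in lborel. x \<in> subint a k \<longrightarrow> f' x = w0 k x \<and> g1 x = w1 k x \<and> g2 x = w2 k x)"
  proof (intro allI impI conjI)
    fix k assume k: "k < N"
    note wk = w(1)[rule_format, OF k]
    show "AC (a k) (a (Suc k)) (w0 k) (w1 k)" "AC (a k) (a (Suc k)) (w1 k) (w2 k)" "AC (a k) (a (Suc k)) (w2 k) g3"
      by (rule wk[THEN conjunct1] wk[THEN conjunct2, THEN conjunct1] wk[THEN conjunct2, THEN conjunct2, THEN conjunct1])+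
    have 1: "AE x in lborel. x \<in> subint a k \<longrightarrow> f x = w0 k x \<and> g1 x = w1 k x \<and> g2 x = w2 k x"
      by (rule wk[THEN conjunct2, THEN conjunct2, THEN conjunct2])
    show "AE x in lborel. x \<in> subint a k \<longrightarrow> f' x = w0 k x \<and> g1 x = w1 k x \<and> g2 x = w2 k x"
      using 1 assms(2)
    proof eventually_elim
      fix x assume 1: "x \<in> subint a k \<longrightarrow> f x = w0 k x \<and> g1 x = w1 k x \<and> g2 x = w2 k x"
        and 2: "x \<in> {0<..<L} \<longrightarrow> f x = f' x"
      show "x \<in> subint a k \<longrightarrow> f' x = w0 k x \<and> g1 x = w1 k x \<and> g2 x = w2 k x"
      proof
        assume x: "x \<in> subint a k"
        then have "x \<in> {0<..<L}" using partition_subint(4)[OF assms(3) k] by blast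
        with 1 2 x show "f' x = w0 k x \<and> g1 x = w1 k x \<and> g2 x = w2 k x" by simp
      qed
    qed
  qed
  then show ?thesis unfolding chain_def using w(2) by blast
qed

lemma cylinder_representative:
  assumes f: "(\<lambda>(t, x). f t x) \<in> borel_measurable (lebesgue_on (cylinder T L))"
  obtains v :: "real \<Rightarrow> real \<Rightarrow> real" where "(\<lambda>(t, x). v t x) \<in> borel_measurable (borel \<Otimes>\<^sub>M borel)"
    "\<And>t x. (t, x) \<notin> cylinder T L \<Longrightarrow> v t x = 0"
    "AE z in lborel. z \<in> cylinder T L \<longrightarrow> f (fst z) (snd z) = v (fst z) (snd z)"
proof -
  obtain v' where v': "v' \<in> borel_measurable borel" "AE z in lborel. z \<in> cylinder T L \<longrightarrow> (case z of (t, x) \<Rightarrow> f t x) = v' z"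
    "\<And>z. z \<notin> cylinder T L \<Longrightarrow> v' z = 0"
    using borel_representative[OF f cylinder_borel] by blast
  show ?thesis
    by (rule that[of "\<lambda>t x. v' (t, x)"]) (use v' in \<open>auto simp: borel_prod case_prod_beta'\<close>)
qed

lemma AE_cylinder_slice:
  assumes "AE z in lborel. z \<in> cylinder T L \<longrightarrow> P (fst z) (snd z)"
  shows "AE t in lborel. t \<in> {0<..<T} \<longrightarrow> (AE x in lborel. x \<in> {0<..<L} \<longrightarrow> P t x)"
  using AE_lborel_pairD(1)[OF assms]
proof (rule eventually_mono, intro impI)
  fix t assume t: "AE x in lborel. (t, x) \<in> cylinder T L \<longrightarrow> P (fst (t, x)) (snd (t, x))" "t \<in> {0<..<T}"
  show "AE x in lborel. x \<in> {0<..<L} \<longrightarrow> P t x"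
    using t(1) by (rule eventually_mono) (use t(2) in \<open>auto simp: cylinder_def\<close>)
qed

text \<open>The choice in \<open>pw_dx\<close> is legitimate because of
  \<open>joint_weak_derivative\<close>. Its square is integrable over the cylinder because each of
  the \<open>N\<close> subintervals of a slice contributes at most the square of the
  \<open>Hpw_norm\<close>, which the Bochner space makes integrable in time.\<close>

lemma joint_representative:
  assumes part: "is_partition L N a" and u: "u \<in> bochner_L2 T (Hpw 3 L N a \<inter> X) (Hpw_norm 3 N a)" and m: "m \<le> 3"
  obtains v :: "real \<Rightarrow> real \<Rightarrow> real" where "(\<lambda>(t, x). v t x) \<in> borel_measurable (borel \<Otimes>\<^sub>M borel)"
    "\<And>t x. (t, x) \<notin> cylinder T L \<Longrightarrow> v t x = 0"
    "AE z in lborel. z \<in> cylinder T L \<longrightarrow> pw_dx m T L N a u (fst z) (snd z) = v (fst z) (snd z)"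
    "AE t in lborel. t \<in> {0<..<T} \<longrightarrow> (\<forall>k<N. weak_deriv (subint a k) m (u t) (v t))"
    "integrable lborel (\<lambda>z. (v (fst z) (snd z))\<^sup>2)"
proof -
  let ?Q = "\<lambda>g. (\<lambda>(t, x). g t x) \<in> borel_measurable (lebesgue_on (cylinder T L)) \<and>
     (AE t in lebesgue_on {0<..<T}. \<forall>k<N. weak_deriv (subint a k) m (u t) (g t))"
  obtain g0 where g0: "(\<lambda>(t, x). g0 t x) \<in> borel_measurable (borel \<Otimes>\<^sub>M borel)"
    "AE t in lborel. t \<in> {0<..<T} \<longrightarrow> (\<forall>k<N. weak_deriv (subint a k) m (u t) (g0 t))"
    by (rule joint_weak_derivative[OF part u m]) (rule that)
  have "?Q g0"
  proof
    show "(\<lambda>(t, x). g0 t x) \<in> borel_measurable (lebesgue_on (cylinder T L))"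
      by (rule lebesgue_on_borel_measurableI[OF g0(1)[unfolded borel_prod] cylinder_borel]) simp
    show "AE t in lebesgue_on {0<..<T}. \<forall>k<N. weak_deriv (subint a k) m (u t) (g0 t)"
      unfolding AE_lebesgue_on_iff[OF borel_open[OF open_greaterThanLessThan]] by (rule g0(2))
  qed
  then have Q: "?Q (pw_dx m T L N a u)" unfolding pw_dx_def by (rule someI[of ?Q g0])
  obtain v :: "real \<Rightarrow> real \<Rightarrow> real" where v: "(\<lambda>(t, x). v t x) \<in> borel_measurable (borel \<Otimes>\<^sub>M borel)"
    "\<And>t x. (t, x) \<notin> cylinder T L \<Longrightarrow> v t x = 0"
    "AE z in lborel. z \<in> cylinder T L \<longrightarrow> pw_dx m T L N a u (fst z) (snd z) = v (fst z) (snd z)"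
    by (rule cylinder_representative[OF Q[THEN conjunct1]]) (rule that)
  have vt: "v t \<in> borel_measurable borel" for t
    using measurable_compose[OF measurable_Pair1' v(1), of t] by simp
  have wd: "AE t in lborel. t \<in> {0<..<T} \<longrightarrow> (\<forall>k<N. weak_deriv (subint a k) m (u t) (v t))"
    using Q[THEN conjunct2, unfolded AE_lebesgue_on_iff[OF borel_open[OF open_greaterThanLessThan]]] AE_cylinder_slice[OF v(3)]
  proof (eventually_elim, intro impI allI)
    fix t k
    assume 1: "t \<in> {0<..<T} \<longrightarrow> (\<forall>k<N. weak_deriv (subint a k) m (u t) (pw_dx m T L N a u t))"
      and 2: "t \<in> {0<..<T} \<longrightarrow> (AE x in lborel. x \<in> {0<..<L} \<longrightarrow> pw_dx m T L N a u t x = v t x)"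
      and t: "t \<in> {0<..<T}" and k: "k < N"
    show "weak_deriv (subint a k) m (u t) (v t)"
      unfolding subint_def
    proof (rule weak_deriv_cong_AE[OF partition_subint(1)[OF part k] 1[rule_format, OF t k, unfolded subint_def] vt])
      show "AE x in lborel. x \<in> {a k<..<a (Suc k)} \<longrightarrow> pw_dx m T L N a u t x = v t x"
        using 2[rule_format, OF t] by (rule eventually_mono)
          (use partition_subint(4)[OF part k] in \<open>auto simp: subint_def subset_eq\<close>)
    qed
  qed
  have "integrable (lebesgue_on {0<..<T}) (\<lambda>t. (Hpw_norm 3 N a (u t))\<^sup>2)"
    using u by (simp add: bochner_L2_def)
  moreover obtain n where n: "n \<in> borel_measurable borel" "AE t in lborel. t \<in> {0<..<T} \<longrightarrow> (Hpw_norm 3 N a (u t))\<^sup>2 = n t"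
    "\<And>t. t \<notin> {0<..<T} \<Longrightarrow> n t = 0"
    by (rule borel_representative[OF borel_measurable_integrable[OF calculation] borel_open[OF open_greaterThanLessThan]]) (rule that)
  ultimately have "set_integrable lborel {0<..<T} n"
    using lebesgue_on_transfer(2)[OF n(1) borel_open[OF open_greaterThanLessThan] n(2)] by simp
  moreover have "(\<lambda>t. indicator {0<..<T} t *\<^sub>R n t) = n" using n(3) by (auto simp: indicator_def fun_eq_iff)
  ultimately have ni: "integrable lborel n" by (simp add: set_integrable_def)
  have [measurable]: "(\<lambda>z. v (fst z) (snd z)) \<in> borel_measurable (borel \<Otimes>\<^sub>M borel)"
    using v(1) by (simp add: case_prod_beta')
  have bound: "AE t in lborel. (\<integral>\<^sup>+x. ennreal ((v t x)\<^sup>2) \<partial>lborel) \<le> ennreal (real N * \<bar>n t\<bar>)"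
    using wd n(2)
  proof eventually_elim
    fix t
    assume 1: "t \<in> {0<..<T} \<longrightarrow> (\<forall>k<N. weak_deriv (subint a k) m (u t) (v t))"
      and 2: "t \<in> {0<..<T} \<longrightarrow> (Hpw_norm 3 N a (u t))\<^sup>2 = n t"
    show "(\<integral>\<^sup>+x. ennreal ((v t x)\<^sup>2) \<partial>lborel) \<le> ennreal (real N * \<bar>n t\<bar>)"
    proof (cases "t \<in> {0<..<T}")
      case False
      then have "v t x = 0" for x using v(2)[of t x] by (auto simp: cylinder_def)
      then show ?thesis by simp
    next
      case True
      note [measurable] = vt[of t]
      have k: "(\<integral>\<^sup>+x. ennreal (indicator (subint a k) x * (v t x)\<^sup>2) \<partial>lborel) \<le> ennreal \<bar>n t\<bar>" if k: "k < N" for k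
      proof -
        have wdk: "weak_deriv (subint a k) m (u t) (v t)" using 1 True k by blast
        have sb: "subint a k \<in> sets borel" by (simp add: subint_def)
        have L: "v t \<in> L2 (subint a k)" by (rule weak_deriv_L2(2)[OF wdk])
        have si: "set_integrable lborel (subint a k) (\<lambda>x. (v t x)\<^sup>2)"
          using L lebesgue_on_transfer(2)[OF _ sb, of "\<lambda>x. (v t x)\<^sup>2" "\<lambda>x. (v t x)\<^sup>2"] by (simp add: L2_def)
        have "(\<integral>\<^sup>+x. ennreal (indicator (subint a k) x * (v t x)\<^sup>2) \<partial>lborel) = ennreal (LBINT x:subint a k. (v t x)\<^sup>2)"
          using si by (subst nn_integral_eq_integral) (auto simp: set_integrable_def set_lebesgue_integral_def)
        also have "(LBINT x:subint a k. (v t x)\<^sup>2) = (L2_norm (subint a k) (v t))\<^sup>2"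
          using L2_I(2)[OF vt sb _ si] by (simp add: set_lebesgue_integral_def)
        also have "\<dots> \<le> (Hpw_norm 3 N a (u t))\<^sup>2"
          by (rule power_mono[OF Hpw_norm_ge[OF part k wdk m] L2_norm_nonneg])
        also have "\<dots> = n t" using 2 True by blast
        finally show ?thesis by (metis abs_ge_self ennreal_leI order_trans)
      qed
      have "(\<integral>\<^sup>+x. ennreal ((v t x)\<^sup>2) \<partial>lborel) \<le> (\<integral>\<^sup>+x. (\<Sum>k<N. ennreal (indicator (subint a k) x * (v t x)\<^sup>2)) \<partial>lborel)"
      proof (rule nn_integral_mono_AE)
        show "AE x in lborel. ennreal ((v t x)\<^sup>2) \<le> (\<Sum>k<N. ennreal (indicator (subint a k) x * (v t x)\<^sup>2))"
          using AE_not_node[of a N]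
        proof (rule eventually_mono)
          fix x assume x: "x \<notin> a ` {..N}"
          show "ennreal ((v t x)\<^sup>2) \<le> (\<Sum>k<N. ennreal (indicator (subint a k) x * (v t x)\<^sup>2))"
          proof (cases "x \<in> {0<..<L}")
            case True
            then obtain k where k: "k < N" "x \<in> subint a k" using partition_cover[OF part True x] by blast
            have "ennreal ((v t x)\<^sup>2) = ennreal (indicator (subint a k) x * (v t x)\<^sup>2)" using k by simp
            also have "\<dots> \<le> (\<Sum>k<N. ennreal (indicator (subint a k) x * (v t x)\<^sup>2))"
              by (rule member_le_sum) (use k in auto)
            finally show ?thesis .
          qed (use v(2)[of t x] in \<open>auto simp: cylinder_def\<close>)
        qed
      qed
      also have "\<dots> = (\<Sum>k<N. \<integral>\<^sup>+x. ennreal (indicator (subint a k) x * (v t x)\<^sup>2) \<partial>lborel)"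
        by (rule nn_integral_sum) (simp add: subint_def)
      also have "\<dots> \<le> (\<Sum>k<N. ennreal \<bar>n t\<bar>)" by (rule sum_mono) (use k in auto)
      also have "\<dots> = ennreal (real N * \<bar>n t\<bar>)" by (simp add: ennreal_of_nat_eq_real_of_nat ennreal_mult)
      finally show ?thesis .
    qed
  qed
  have "(\<integral>\<^sup>+z. ennreal ((v (fst z) (snd z))\<^sup>2) \<partial>(lborel \<Otimes>\<^sub>M lborel)) = (\<integral>\<^sup>+t. (\<integral>\<^sup>+x. ennreal ((v t x)\<^sup>2) \<partial>lborel) \<partial>lborel)"
    by (subst lborel.nn_integral_fst[symmetric]) simp_all
  also have "\<dots> \<le> (\<integral>\<^sup>+t. ennreal (real N * \<bar>n t\<bar>) \<partial>lborel)" by (rule nn_integral_mono_AE[OF bound])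
  also have "\<dots> = ennreal (LBINT t. real N * \<bar>n t\<bar>)" by (rule nn_integral_eq_integral) (use ni in auto)
  finally have "(\<integral>\<^sup>+z. ennreal ((v (fst z) (snd z))\<^sup>2) \<partial>(lborel \<Otimes>\<^sub>M lborel)) < \<infinity>"
    by (rule order.strict_trans1) simp
  then have "integrable (lborel \<Otimes>\<^sub>M lborel) (\<lambda>z. (v (fst z) (snd z))\<^sup>2)"
    by (intro integrableI_bounded) auto
  then have "integrable lborel (\<lambda>z. (v (fst z) (snd z))\<^sup>2)" unfolding lborel_prod .
  with v wd show ?thesis using that by blast
qed

lemma indicator_sq_integrable:
  fixes v :: "real \<times> real \<Rightarrow> real"
  assumes m: "v \<in> borel_measurable borel" and z: "\<And>z. z \<notin> cylinder T L \<Longrightarrow> v z = 0"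
    and i: "integrable lborel (\<lambda>z. (v z)\<^sup>2)"
  shows "integrable lborel v"
proof -
  have "integrable lborel (indicator (cylinder T L) :: _ \<Rightarrow> real)"
    using emeasure_cylinder_finite cylinder_borel by (intro integrable_real_indicator) auto
  moreover have "(\<lambda>z. (indicator (cylinder T L) z :: real)\<^sup>2) = indicator (cylinder T L)"
    by (auto simp: indicator_def fun_eq_iff)
  ultimately have "integrable lborel (\<lambda>z. v z * indicator (cylinder T L) z)"
    using m i cylinder_borel by (intro integrable_mult_L2) auto
  moreover have "v z * indicator (cylinder T L) z = v z" for z using z[of z] by (auto simp: indicator_def)
  ultimately show ?thesis by simp
qed

lemma Linf_representative:
  assumes "(\<lambda>(t, x). b t x) \<in> Linf (cylinder T L)"
  obtains B :: "real \<Rightarrow> real \<Rightarrow> real" and M where "(\<lambda>(t, x). B t x) \<in> borel_measurable (borel \<Otimes>\<^sub>M borel)"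
    "AE z in lborel. z \<in> cylinder T L \<longrightarrow> b (fst z) (snd z) = B (fst z) (snd z)"
    "M \<ge> 0" "\<And>t x. \<bar>B t x\<bar> \<le> M"
proof -
  obtain M where b: "(\<lambda>(t, x). b t x) \<in> borel_measurable (lebesgue_on (cylinder T L))"
    and M: "AE z in lebesgue_on (cylinder T L). \<bar>case z of (t, x) \<Rightarrow> b t x\<bar> \<le> M"
    using assms unfolding Linf_def by blast
  obtain B0 :: "real \<Rightarrow> real \<Rightarrow> real" where B0: "(\<lambda>(t, x). B0 t x) \<in> borel_measurable (borel \<Otimes>\<^sub>M borel)"
    "AE z in lborel. z \<in> cylinder T L \<longrightarrow> b (fst z) (snd z) = B0 (fst z) (snd z)"
    by (rule cylinder_representative[OF b]) (rule that)
  have [measurable]: "(\<lambda>z. B0 (fst z) (snd z)) \<in> borel_measurable (borel \<Otimes>\<^sub>M borel)"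
    using B0(1) by (simp add: case_prod_beta')
  \<comment> \<open>Truncation turns the essential bound into a bound at every point without
    changing the class.\<close>
  define B where "B = (\<lambda>t x. max (- \<bar>M\<bar>) (min \<bar>M\<bar> (B0 t x)))"
  show ?thesis
  proof (rule that[of B "\<bar>M\<bar>"])
    show "(\<lambda>(t, x). B t x) \<in> borel_measurable (borel \<Otimes>\<^sub>M borel)"
      unfolding B_def case_prod_beta' by measurable
    show "\<bar>B t x\<bar> \<le> \<bar>M\<bar>" for t x by (auto simp: B_def)
    show "AE z in lborel. z \<in> cylinder T L \<longrightarrow> b (fst z) (snd z) = B (fst z) (snd z)"
      using M[unfolded AE_lebesgue_on_iff[OF cylinder_borel]] B0(2)
      by eventually_elim (auto simp: B_def)
  qed simp
qed

lemma sq_integrable_cmult_bounded: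
  fixes f g :: "'a \<Rightarrow> real"
  assumes [measurable]: "f \<in> borel_measurable M" "g \<in> borel_measurable M"
    and i: "integrable M (\<lambda>z. (g z)\<^sup>2)" and b: "\<And>z. \<bar>f z\<bar> \<le> K"
  shows "integrable M (\<lambda>z. (f z * g z)\<^sup>2)"
proof (rule Bochner_Integration.integrable_bound)
  show "integrable M (\<lambda>z. K\<^sup>2 * (g z)\<^sup>2)" by (rule integrable_mult_right[OF i])
  show "AE z in M. norm ((f z * g z)\<^sup>2) \<le> norm (K\<^sup>2 * (g z)\<^sup>2)"
  proof (intro AE_I2)
    fix z
    have "(f z)\<^sup>2 \<le> K\<^sup>2" using power_mono[OF b[of z], of 2] by simp
    then show "norm ((f z * g z)\<^sup>2) \<le> norm (K\<^sup>2 * (g z)\<^sup>2)"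
      by (simp add: power_mult_distrib mult_right_mono)
  qed
qed measurable

lemma sq_integrable_add:
  fixes f g :: "'a \<Rightarrow> real"
  assumes "f \<in> borel_measurable M" "g \<in> borel_measurable M"
    and "integrable M (\<lambda>z. (f z)\<^sup>2)" "integrable M (\<lambda>z. (g z)\<^sup>2)"
  shows "integrable M (\<lambda>z. (f z + g z)\<^sup>2)"
proof -
  have "integrable M (\<lambda>z. (f z)\<^sup>2 + (g z)\<^sup>2 + 2 * (f z * g z))"
    by (intro Bochner_Integration.integrable_add integrable_mult_right integrable_mult_L2 assms)
  then show ?thesis by (simp add: power2_sum mult.assoc)
qed

lemma pcoef_borel [measurable]: "pcoef N a p \<in> borel_measurable borel"
  unfolding pcoef_def by measurable

lemma pcoef_bounded: "\<bar>pcoef N a p x\<bar> \<le> (\<Sum>k<N. \<bar>p k\<bar>)"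
  unfolding pcoef_def
  by (rule order_trans[OF sum_abs]) (auto intro!: sum_mono simp: indicator_def)

lemma pcoef_eq:
  assumes part: "is_partition L N a" and k: "k < N" "x \<in> subint a k"
  shows "pcoef N a p x = p k"
proof -
  have z: "indicator {a i..<a (Suc i)} x = (0 :: real)" if "i < N" "i \<noteq> k" for i
  proof -
    consider "Suc i \<le> k" | "Suc k \<le> i" using \<open>i \<noteq> k\<close> by linarith
    then show ?thesis
      by cases (use that k partition_mono[OF part, of "Suc i" k] partition_mono[OF part, of "Suc k" i]
        in \<open>auto simp: subint_def indicator_def\<close>)
  qed
  have "pcoef N a p x = p k * indicator {a k..<a (Suc k)} x + (\<Sum>i\<in>{..<N} - {k}. p i * indicator {a i..<a (Suc i)} x)"
    unfolding pcoef_def by (rule sum.remove) (use k in auto)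
  also have "(\<Sum>i\<in>{..<N} - {k}. p i * indicator {a i..<a (Suc i)} x) = 0"
    by (rule sum.neutral) (use z in auto)
  finally show ?thesis using k by (auto simp: subint_def indicator_def)
qed

text \<open>Membership of \<open>L u\<close> in \<open>L2\<close> is used here only: the space terms
  are square integrable too, so their difference \<open>Z\<close> is a square integrable time
  derivative of \<open>u\<close>. Everything afterwards works with these Borel functions and their
  two families of slices.\<close>

lemma Vspace_data:
  assumes T: "T > 0" and L: "L > 0" and part: "is_partition L N a"
    and B: "(\<lambda>(t, x). B t x) \<in> borel_measurable (borel \<Otimes>\<^sub>M borel)"
    "AE z in lborel. z \<in> cylinder T L \<longrightarrow> b (fst z) (snd z) = B (fst z) (snd z)"
    "\<And>t x. \<bar>B t x\<bar> \<le> M"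
    and D: "(\<lambda>(t, x). D t x) \<in> borel_measurable (borel \<Otimes>\<^sub>M borel)"
    "AE z in lborel. z \<in> cylinder T L \<longrightarrow> d (fst z) (snd z) = D (fst z) (snd z)"
    "\<And>t x. \<bar>D t x\<bar> \<le> M"
    and u: "u \<in> Vspace T L N a p b d"
  obtains U Z u1 u2 u3 :: "real \<Rightarrow> real \<Rightarrow> real" where
    "(\<lambda>(t, x). U t x) \<in> borel_measurable (borel \<Otimes>\<^sub>M borel)" "(\<lambda>(t, x). Z t x) \<in> borel_measurable (borel \<Otimes>\<^sub>M borel)"
    "(\<lambda>(t, x). u1 t x) \<in> borel_measurable (borel \<Otimes>\<^sub>M borel)" "(\<lambda>(t, x). u2 t x) \<in> borel_measurable (borel \<Otimes>\<^sub>M borel)"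
    "(\<lambda>(t, x). u3 t x) \<in> borel_measurable (borel \<Otimes>\<^sub>M borel)"
    "integrable lborel (\<lambda>z. (indicator (cylinder T L) z * U (fst z) (snd z))\<^sup>2)"
    "integrable lborel (\<lambda>z. (Z (fst z) (snd z))\<^sup>2)" "integrable lborel (\<lambda>z. (u1 (fst z) (snd z))\<^sup>2)"
    "integrable lborel (\<lambda>z. (u2 (fst z) (snd z))\<^sup>2)" "integrable lborel (\<lambda>z. (u3 (fst z) (snd z))\<^sup>2)"
    "AE x in lborel. AC 0 T (\<lambda>t. U t x) (\<lambda>t. Z t x)"
    "AE t in lborel. t \<in> {0<..<T} \<longrightarrow> chain N a p L (U t) (u1 t) (u2 t) (u3 t)"
    "AE z in lborel. z \<in> cylinder T L \<longrightarrow> u (fst z) (snd z) = U (fst z) (snd z)"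
    "AE z in lborel. z \<in> cylinder T L \<longrightarrow> pw_dx 1 T L N a u (fst z) (snd z) = u1 (fst z) (snd z)"
    "AE z in lborel. z \<in> cylinder T L \<longrightarrow> pw_dx 2 T L N a u (fst z) (snd z) = u2 (fst z) (snd z)"
    "AE z in lborel. z \<in> cylinder T L \<longrightarrow> Lop T L N a p b d u (fst z) (snd z) = Z (fst z) (snd z) +
       pcoef N a p (snd z) * u3 (fst z) (snd z) + B (fst z) (snd z) * u1 (fst z) (snd z) + D (fst z) (snd z) * U (fst z) (snd z)"
proof -
  let ?X = "Hpw 3 L N a \<inter> H10 {0<..<L}" and ?C = "cylinder T L"
  let ?Lop = "Lop T L N a p b d u"
  have uL: "(\<lambda>(t, x). u t x) \<in> L2 ?C" and ub: "u \<in> bochner_L2 T ?X (Hpw_norm 3 N a)"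
    and ex: "\<exists>g. (\<lambda>(t, x). g t x) \<in> L2 ?C \<and> is_Lop T L N a p b d u g"
    and tr: "AE t in lborel. t \<in> {0<..<T} \<longrightarrow> transmission N a p (u t)"
    using u by (auto simp: Vspace_def AE_lebesgue_on_iff)
  have Lop: "(\<lambda>(t, x). ?Lop t x) \<in> L2 ?C" "is_Lop T L N a p b d u ?Lop"
    using someI_ex[OF ex] unfolding Lop_def by blast+
  obtain u1 where u1: "(\<lambda>(t, x). u1 t x) \<in> borel_measurable (borel \<Otimes>\<^sub>M borel)"
    "\<And>t x. (t, x) \<notin> ?C \<Longrightarrow> u1 t x = 0"
    "AE z in lborel. z \<in> ?C \<longrightarrow> pw_dx 1 T L N a u (fst z) (snd z) = u1 (fst z) (snd z)"
    "AE t in lborel. t \<in> {0<..<T} \<longrightarrow> (\<forall>k<N. weak_deriv (subint a k) 1 (u t) (u1 t))"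
    "integrable lborel (\<lambda>z. (u1 (fst z) (snd z))\<^sup>2)"
    by (rule joint_representative[OF part ub, of 1]) (simp, rule that)
  obtain u2 where u2: "(\<lambda>(t, x). u2 t x) \<in> borel_measurable (borel \<Otimes>\<^sub>M borel)"
    "\<And>t x. (t, x) \<notin> ?C \<Longrightarrow> u2 t x = 0"
    "AE z in lborel. z \<in> ?C \<longrightarrow> pw_dx 2 T L N a u (fst z) (snd z) = u2 (fst z) (snd z)"
    "AE t in lborel. t \<in> {0<..<T} \<longrightarrow> (\<forall>k<N. weak_deriv (subint a k) 2 (u t) (u2 t))"
    "integrable lborel (\<lambda>z. (u2 (fst z) (snd z))\<^sup>2)"
    by (rule joint_representative[OF part ub, of 2]) (simp, rule that)
  obtain u3 where u3: "(\<lambda>(t, x). u3 t x) \<in> borel_measurable (borel \<Otimes>\<^sub>M borel)"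
    "\<And>t x. (t, x) \<notin> ?C \<Longrightarrow> u3 t x = 0"
    "AE z in lborel. z \<in> ?C \<longrightarrow> pw_dx 3 T L N a u (fst z) (snd z) = u3 (fst z) (snd z)"
    "AE t in lborel. t \<in> {0<..<T} \<longrightarrow> (\<forall>k<N. weak_deriv (subint a k) 3 (u t) (u3 t))"
    "integrable lborel (\<lambda>z. (u3 (fst z) (snd z))\<^sup>2)"
    by (rule joint_representative[OF part ub, of 3]) (simp, rule that)
  obtain U0 where U0: "U0 \<in> borel_measurable borel" "AE z in lborel. z \<in> ?C \<longrightarrow> (case z of (t, x) \<Rightarrow> u t x) = U0 z"
    "\<And>z. z \<notin> ?C \<Longrightarrow> U0 z = 0" "integrable lborel (\<lambda>z. (U0 z)\<^sup>2)"
    by (rule L2_representative[OF uL cylinder_borel]) (rule that)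
  obtain G where G: "G \<in> borel_measurable borel" "AE z in lborel. z \<in> ?C \<longrightarrow> (case z of (t, x) \<Rightarrow> ?Lop t x) = G z"
    "\<And>z. z \<notin> ?C \<Longrightarrow> G z = 0" "integrable lborel (\<lambda>z. (G z)\<^sup>2)"
    by (rule L2_representative[OF Lop(1) cylinder_borel]) (rule that)
  define v1 where "v1 = (\<lambda>z::real \<times> real. u1 (fst z) (snd z))"
  define v3 where "v3 = (\<lambda>z::real \<times> real. u3 (fst z) (snd z))"
  define Bz where "Bz = (\<lambda>z::real \<times> real. B (fst z) (snd z))"
  define Dz where "Dz = (\<lambda>z::real \<times> real. D (fst z) (snd z))"
  define P where "P = (\<lambda>z::real \<times> real. pcoef N a p (snd z))"
  have m [measurable]: "v1 \<in> borel_measurable borel" "v3 \<in> borel_measurable borel"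
    "Bz \<in> borel_measurable borel" "Dz \<in> borel_measurable borel" "P \<in> borel_measurable borel"
    using u1(1) u3(1) B(1) D(1) unfolding v1_def v3_def Bz_def Dz_def P_def
    by (simp_all add: case_prod_beta' borel_prod measurable_compose[OF _ pcoef_borel] flip: borel_prod)
  note [measurable] = U0(1) G(1)
  define R where "R = (\<lambda>z. P z * v3 z + Bz z * v1 z + Dz z * U0 z)"
  have Rm [measurable]: "R \<in> borel_measurable borel" unfolding R_def by measurable
  have R2: "integrable lborel (\<lambda>z. (R z)\<^sup>2)"
    unfolding R_def
  proof (intro sq_integrable_add)
    show "integrable lborel (\<lambda>z. (P z * v3 z)\<^sup>2)"
      by (rule sq_integrable_cmult_bounded[where K = "\<Sum>k<N. \<bar>p k\<bar>"]) (use m in simp, use m in simp, use u3(5) in \<open>simp add: v3_def\<close>, use pcoef_bounded in \<open>simp add: P_def\<close>)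
    show "integrable lborel (\<lambda>z. (Bz z * v1 z)\<^sup>2)"
      by (rule sq_integrable_cmult_bounded[where K = M]) (use m in simp, use m in simp, use u1(5) in \<open>simp add: v1_def\<close>, use B(3) in \<open>simp add: Bz_def\<close>)
    show "integrable lborel (\<lambda>z. (Dz z * U0 z)\<^sup>2)"
      by (rule sq_integrable_cmult_bounded[where K = M]) (use m in simp, use U0(1) in simp, use U0(4) in simp, use D(3) in \<open>simp add: Dz_def\<close>)
  qed measurable
  \<comment> \<open>The time derivative is what remains of \<open>L u\<close> after removing the
    space terms \<open>R\<close>.\<close>
  define Zz where "Zz = (\<lambda>z. G z - R z)"
  have Rz: "R z = 0" if "z \<notin> ?C" for z
    using u1(2)[of "fst z" "snd z"] u3(2)[of "fst z" "snd z"] U0(3)[of z] that by (simp add: R_def v1_def v3_def)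
  have Zm [measurable]: "Zz \<in> borel_measurable borel" unfolding Zz_def by measurable
  have Z2: "integrable lborel (\<lambda>z. (Zz z)\<^sup>2)"
    using sq_integrable_add[of G lborel "\<lambda>z. - R z"] G R2 Rm by (simp add: Zz_def)
  have Zz0: "Zz z = 0" if "z \<notin> ?C" for z using that G(3) Rz by (simp add: Zz_def)
  have U0i: "integrable lborel U0" by (rule indicator_sq_integrable[OF U0(1,3,4)])
  have Zi: "integrable lborel Zz" by (rule indicator_sq_integrable[OF Zm Zz0 Z2])
  have Gi: "integrable lborel G" by (rule indicator_sq_integrable[OF G(1,3,4)])
  have Ri: "integrable lborel R" by (rule indicator_sq_integrable[OF Rm Rz R2])
  have eq: "(LBINT z. U0 z * deriv \<zeta> (fst z) * \<rho> (snd z)) = - (LBINT z. Zz z * \<zeta> (fst z) * \<rho> (snd z))"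
    if ze: "\<zeta> \<in> test_fun {0<..<T}" and rh: "\<rho> \<in> test_fun {0<..<L}" for \<zeta> \<rho>
  proof -
    have dz: "deriv (\<lambda>\<tau>. \<zeta> \<tau> * \<rho> x) t = deriv \<zeta> t * \<rho> x" for t x
      using smoothD(1)[OF test_fun_smooth[OF ze], of t] by (intro DERIV_imp_deriv) (auto intro!: derivative_eq_intros)
    have [measurable]: "\<zeta> \<in> borel_measurable borel" "\<rho> \<in> borel_measurable borel" "deriv \<zeta> \<in> borel_measurable borel"
      using smooth_borel test_fun_smooth ze rh test_fun_deriv by blast+
    have pm: "(\<lambda>z::real\<times>real. \<zeta> (fst z)) \<in> borel_measurable borel" "(\<lambda>z::real\<times>real. \<rho> (snd z)) \<in> borel_measurable borel"
      "(\<lambda>z::real\<times>real. deriv \<zeta> (fst z)) \<in> borel_measurable borel"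
      unfolding borel_prod[symmetric] by measurable
    note [measurable] = pm
    have it: "integrable lborel (\<lambda>z. W z * \<theta> (fst z) * \<rho> (snd z))"
      if "integrable lborel W" "\<theta> \<in> test_fun {0<..<T}" for W \<theta>
      using integrable_tensor[of W \<theta> _ \<rho>] that rh unfolding lborel_prod by blast
    have "(LINT z|lebesgue_on ?C. (case z of (t, x) \<Rightarrow> ?Lop t x * (\<zeta> t * \<rho> x))) =
       (LINT z|lebesgue_on ?C. (case z of (t, x) \<Rightarrow> - u t x * (deriv \<zeta> t * \<rho> x) +
        (pcoef N a p x * pw_dx 3 T L N a u t x + b t x * pw_dx 1 T L N a u t x + d t x * u t x) * (\<zeta> t * \<rho> x)))"
      using Lop(2)[unfolded is_Lop_def, THEN bspec, OF test_fun_tensor[OF ze rh]] by (simp add: dz)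
    also have "(LINT z|lebesgue_on ?C. (case z of (t, x) \<Rightarrow> ?Lop t x * (\<zeta> t * \<rho> x))) =
       (LBINT z:?C. G z * (\<zeta> (fst z) * \<rho> (snd z)))"
    proof (rule lebesgue_on_transfer(1)[OF _ cylinder_borel])
      show "AE z in lborel. z \<in> ?C \<longrightarrow> (case z of (t, x) \<Rightarrow> ?Lop t x * (\<zeta> t * \<rho> x)) = G z * (\<zeta> (fst z) * \<rho> (snd z))"
        using G(2) by (rule eventually_mono) (auto simp: case_prod_beta')
    qed measurable
    also have "(LINT z|lebesgue_on ?C. (case z of (t, x) \<Rightarrow> - u t x * (deriv \<zeta> t * \<rho> x) +
        (pcoef N a p x * pw_dx 3 T L N a u t x + b t x * pw_dx 1 T L N a u t x + d t x * u t x) * (\<zeta> t * \<rho> x))) =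
       (LBINT z:?C. - U0 z * (deriv \<zeta> (fst z) * \<rho> (snd z)) + R z * (\<zeta> (fst z) * \<rho> (snd z)))"
    proof (rule lebesgue_on_transfer(1)[OF _ cylinder_borel])
      show "AE z in lborel. z \<in> ?C \<longrightarrow> (case z of (t, x) \<Rightarrow> - u t x * (deriv \<zeta> t * \<rho> x) +
        (pcoef N a p x * pw_dx 3 T L N a u t x + b t x * pw_dx 1 T L N a u t x + d t x * u t x) * (\<zeta> t * \<rho> x)) =
        - U0 z * (deriv \<zeta> (fst z) * \<rho> (snd z)) + R z * (\<zeta> (fst z) * \<rho> (snd z))"
        using U0(2) u1(3) u3(3) B(2) D(2)
        by eventually_elim (auto simp: case_prod_beta' R_def v1_def v3_def Bz_def Dz_def P_def)
    qed measurable
    also have "(LBINT z:?C. G z * (\<zeta> (fst z) * \<rho> (snd z))) = (LBINT z. G z * \<zeta> (fst z) * \<rho> (snd z))"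
      unfolding set_lebesgue_integral_def
      by (rule Bochner_Integration.integral_cong) (use G(3) in \<open>auto simp: indicator_def\<close>)
    also have "(LBINT z:?C. - U0 z * (deriv \<zeta> (fst z) * \<rho> (snd z)) + R z * (\<zeta> (fst z) * \<rho> (snd z))) =
      (LBINT z. R z * \<zeta> (fst z) * \<rho> (snd z) - U0 z * deriv \<zeta> (fst z) * \<rho> (snd z))"
      unfolding set_lebesgue_integral_def
      by (rule Bochner_Integration.integral_cong) (use U0(3) Rz in \<open>auto simp: indicator_def\<close>)
    also have "\<dots> = (LBINT z. R z * \<zeta> (fst z) * \<rho> (snd z)) - (LBINT z. U0 z * deriv \<zeta> (fst z) * \<rho> (snd z))"
      by (rule Bochner_Integration.integral_diff[OF it[OF Ri ze] it[OF U0i test_fun_deriv[OF ze]]])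
    finally have "(LBINT z. U0 z * deriv \<zeta> (fst z) * \<rho> (snd z)) =
      - ((LBINT z. G z * \<zeta> (fst z) * \<rho> (snd z)) - (LBINT z. R z * \<zeta> (fst z) * \<rho> (snd z)))" by simp
    also have "(LBINT z. G z * \<zeta> (fst z) * \<rho> (snd z)) - (LBINT z. R z * \<zeta> (fst z) * \<rho> (snd z)) =
       (LBINT z. G z * \<zeta> (fst z) * \<rho> (snd z) - R z * \<zeta> (fst z) * \<rho> (snd z))"
      by (rule Bochner_Integration.integral_diff[OF it[OF Gi ze] it[OF Ri ze], symmetric])
    also have "\<dots> = (LBINT z. Zz z * \<zeta> (fst z) * \<rho> (snd z))" by (simp add: Zz_def left_diff_distrib)
    finally show ?thesis .
  qed
  obtain V :: "real \<Rightarrow> real \<Rightarrow> real" where V: "(\<lambda>(t, x). V t x) \<in> borel_measurable borel"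
    "AE x in lborel. AC 0 T (\<lambda>t. V t x) (\<lambda>t. Zz (t, x))"
    "AE z in lborel. z \<in> ?C \<longrightarrow> U0 z = V (fst z) (snd z)"
    by (rule time_AC[OF T L U0(1) U0i U0(3) Zm Zi Zz0 eq]) (assumption | rule that)+
  have Vm: "(\<lambda>z. V (fst z) (snd z)) \<in> borel_measurable borel" using V(1) by (simp add: case_prod_beta')
  have uV: "AE z in lborel. z \<in> ?C \<longrightarrow> u (fst z) (snd z) = V (fst z) (snd z)"
    using U0(2) V(3) by eventually_elim (auto simp: case_prod_beta')
  show ?thesis
  proof (rule that[of V "\<lambda>t x. Zz (t, x)" u1 u2 u3])
    show "(\<lambda>(t, x). V t x) \<in> borel_measurable (borel \<Otimes>\<^sub>M borel)" using V(1) by (simp add: borel_prod)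
    show "(\<lambda>(t, x). Zz (t, x)) \<in> borel_measurable (borel \<Otimes>\<^sub>M borel)" by (simp add: borel_prod case_prod_beta')
    show "integrable lborel (\<lambda>z. (indicator ?C z * V (fst z) (snd z))\<^sup>2)"
    proof (rule integrable_cong_AE_imp[OF U0(4)])
      note [measurable] = Vm cylinder_borel
      show "(\<lambda>z. (indicator ?C z * V (fst z) (snd z))\<^sup>2) \<in> borel_measurable lborel" by measurable
      show "AE z in lborel. (U0 z)\<^sup>2 = (indicator ?C z * V (fst z) (snd z))\<^sup>2"
        using V(3) by (rule eventually_mono) (use U0(3) in \<open>auto simp: indicator_def\<close>)
    qed
    show "integrable lborel (\<lambda>z. (Zz (fst z, snd z))\<^sup>2)" using Z2 by simp
    show "AE z in lborel. z \<in> ?C \<longrightarrow> ?Lop (fst z) (snd z) = Zz (fst z, snd z) +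
       pcoef N a p (snd z) * u3 (fst z) (snd z) + B (fst z) (snd z) * u1 (fst z) (snd z) + D (fst z) (snd z) * V (fst z) (snd z)"
      using G(2) V(3)
      by eventually_elim (auto simp: Zz_def R_def v1_def v3_def Bz_def Dz_def P_def)
    have uX: "AE t in lborel. t \<in> {0<..<T} \<longrightarrow> u t \<in> ?X"
      using ub unfolding bochner_L2_def mem_Collect_eq AE_lebesgue_on_iff[OF borel_open[OF open_greaterThanLessThan]]
      by blast
    have u3i: "AE t in lborel. integrable lborel (u3 t)"
    proof -
      have z: "v3 z = 0" if "z \<notin> ?C" for z using u3(2)[of "fst z" "snd z"] that by (simp add: v3_def)
      have v32: "integrable lborel (\<lambda>z. (v3 z)\<^sup>2)" using u3(5) by (simp add: v3_def)
      have "integrable lborel v3"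
        by (rule indicator_sq_integrable[OF m(2) z v32])
      then have "integrable (lborel \<Otimes>\<^sub>M lborel) v3" unfolding lborel_prod .
      from lborel_pair.AE_integrable_fst'[OF this] show ?thesis by (simp add: v3_def)
    qed
    show "AE t in lborel. t \<in> {0<..<T} \<longrightarrow> chain N a p L (V t) (u1 t) (u2 t) (u3 t)"
      using uX tr u1(4) u2(4) u3(4) u3i AE_cylinder_slice[OF uV]
    proof (eventually_elim, intro impI)
      fix t assume t: "t \<in> {0<..<T}"
        and 1: "t \<in> {0<..<T} \<longrightarrow> u t \<in> ?X" and 2: "t \<in> {0<..<T} \<longrightarrow> transmission N a p (u t)"
        and w1: "t \<in> {0<..<T} \<longrightarrow> (\<forall>k<N. weak_deriv (subint a k) 1 (u t) (u1 t))"
        and w2: "t \<in> {0<..<T} \<longrightarrow> (\<forall>k<N. weak_deriv (subint a k) 2 (u t) (u2 t))"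
        and w3: "t \<in> {0<..<T} \<longrightarrow> (\<forall>k<N. weak_deriv (subint a k) 3 (u t) (u3 t))"
        and i3: "integrable lborel (u3 t)"
        and uv: "t \<in> {0<..<T} \<longrightarrow> (AE x in lborel. x \<in> {0<..<L} \<longrightarrow> u t x = V t x)"
      define g where "g = (\<lambda>i::nat. if i = 1 then u1 t else if i = 2 then u2 t else u3 t)"
      have f: "u t \<in> Hpw 3 L N a" "u t \<in> H10 {0<..<L}" "transmission N a p (u t)" using 1 2 t by auto
      have wd: "weak_deriv (subint a k) i (u t) (g i)" if "k < N" "i \<in> {1, 2, 3}" for k i
        using that w1 w2 w3 t by (auto simp: g_def)
      obtain w0 w1 w2 where w:
        "\<And>k. k < N \<Longrightarrow> AC (a k) (a (Suc k)) (w0 k) (w1 k)"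
        "\<And>k. k < N \<Longrightarrow> AC (a k) (a (Suc k)) (w1 k) (w2 k)"
        "\<And>k. k < N \<Longrightarrow> AC (a k) (a (Suc k)) (w2 k) (u3 t)"
        "\<And>k. k < N \<Longrightarrow> AE x in lborel. x \<in> subint a k \<longrightarrow> u t x = w0 k x"
        "\<And>k. k < N \<Longrightarrow> AE x in lborel. x \<in> subint a k \<longrightarrow> g 1 x = w1 k x"
        "\<And>k. k < N \<Longrightarrow> AE x in lborel. x \<in> subint a k \<longrightarrow> g 2 x = w2 k x"
        "\<And>k. k \<in> {1..<N} \<Longrightarrow> w0 (k - 1) (a k) = w0 k (a k)"
        "\<And>k. k \<in> {1..<N} \<Longrightarrow> sqrt (p (k - 1)) * w1 (k - 1) (a k) = sqrt (p k) * w1 k (a k)"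
        "\<And>k. k \<in> {1..<N} \<Longrightarrow> p (k - 1) * w2 (k - 1) (a k) = p k * w2 k (a k)"
        "w0 0 0 = 0" "w0 (N - 1) L = 0"
      proof (rule regular_slice[OF part f wd _ i3])
        show "AE x in lborel. x \<in> subint a k \<longrightarrow> g 3 x = u3 t x" for k by (simp add: g_def)
      qed (assumption | rule that)+
      have ae: "AE x in lborel. x \<in> subint a k \<longrightarrow> u t x = w0 k x \<and> u1 t x = w1 k x \<and> u2 t x = w2 k x" if k: "k < N" for k
        using w(4)[OF k] w(5)[OF k] w(6)[OF k] by eventually_elim (auto simp: g_def)
      have "chain N a p L (u t) (u1 t) (u2 t) (u3 t)"
        unfolding chain_def by (intro exI[of _ w0] exI[of _ w1] exI[of _ w2] conjI allI impI ballI w ae)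
      then show "chain N a p L (V t) (u1 t) (u2 t) (u3 t)"
        by (rule chain_cong[OF _ uv[rule_format, OF t] part])
    qed
  qed (fact u1 u2 u3 V uV)+
qed

section \<open>Time independent symmetric operators\<close>

lemma integral_Cauchy_Schwarz:
  fixes f g :: "'a \<Rightarrow> real"
  assumes m: "f \<in> borel_measurable M" "g \<in> borel_measurable M"
    and f: "integrable M (\<lambda>x. (f x)\<^sup>2)" and g: "integrable M (\<lambda>x. (g x)\<^sup>2)"
  shows "\<bar>LINT x|M. f x * g x\<bar> \<le> sqrt (LINT x|M. (f x)\<^sup>2) * sqrt (LINT x|M. (g x)\<^sup>2)"
proof -
  define A where "A = (LINT x|M. (f x)\<^sup>2)"
  define B where "B = (LINT x|M. (g x)\<^sup>2)"
  define X where "X = (LINT x|M. f x * g x)"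
  have AB: "A \<ge> 0" "B \<ge> 0" by (simp_all add: A_def B_def)
  have fg: "integrable M (\<lambda>x. f x * g x)" by (rule integrable_mult_L2[OF m f g])
  have q: "0 \<le> t\<^sup>2 * A + 2 * t * X + B" for t
  proof -
    have "0 \<le> (LINT x|M. (t * f x + g x)\<^sup>2)" by simp
    also have "\<dots> = (LINT x|M. t\<^sup>2 * (f x)\<^sup>2 + 2 * t * (f x * g x) + (g x)\<^sup>2)"
      by (rule Bochner_Integration.integral_cong) (simp_all add: power2_sum power_mult_distrib algebra_simps)
    also have "\<dots> = (LINT x|M. t\<^sup>2 * (f x)\<^sup>2 + 2 * t * (f x * g x)) + B"
      unfolding B_def by (intro Bochner_Integration.integral_add Bochner_Integration.integrable_add integrable_mult_right f g fg)
    also have "(LINT x|M. t\<^sup>2 * (f x)\<^sup>2 + 2 * t * (f x * g x)) = (LINT x|M. t\<^sup>2 * (f x)\<^sup>2) + (LINT x|M. 2 * t * (f x * g x))"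
      by (intro Bochner_Integration.integral_add integrable_mult_right f fg)
    finally show ?thesis by (simp add: A_def X_def)
  qed
  have "X\<^sup>2 \<le> A * B"
  proof (cases "A = 0")
    case True
    have "X = 0"
    proof (rule ccontr)
      assume "X \<noteq> 0"
      \<comment> \<open>If \<open>A = 0\<close>, the polynomial in \<open>q\<close> is affine, and
        this argument makes its value \<open>- 1\<close>.\<close>
      then show False using q[of "- (B + 1) / (2 * X)"] True AB by (simp add: field_simps)
    qed
    then show ?thesis using True by simp
  next
    case False
    then have A: "A > 0" using AB by simp
    have "0 \<le> B - X\<^sup>2 / A" using q[of "- X / A"] A by (simp add: power2_eq_square field_simps)
    then have "X\<^sup>2 / A \<le> B" by simp
    then show ?thesis using A by (simp add: pos_divide_le_eq mult.commute)
  qed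
  then have "\<bar>X\<bar> \<le> sqrt (A * B)" by (metis real_sqrt_abs real_sqrt_le_mono)
  then show ?thesis by (simp add: A_def B_def X_def real_sqrt_mult)
qed

lemma integral_translate:
  fixes f :: "'a::euclidean_space \<Rightarrow> real"
  assumes [measurable]: "f \<in> borel_measurable borel"
  shows "(LINT z|lborel. f (z + h)) = (LINT z|lborel. f z)"
    "integrable lborel (\<lambda>z. f (z + h)) \<longleftrightarrow> integrable lborel f"
proof -
  have d: "lborel = distr lborel borel (\<lambda>z::'a. h + z)" by (simp add: lborel_distr_plus)
  have "(LINT z|lborel. f z) = (LINT z|distr lborel borel (\<lambda>z. h + z). f z)" using d by simp
  also have "\<dots> = (LINT z|lborel. f (h + z))" by (rule integral_distr) auto
  finally show "(LINT z|lborel. f (z + h)) = (LINT z|lborel. f z)" by (simp add: add.commute)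
  have "integrable lborel f \<longleftrightarrow> integrable (distr lborel borel (\<lambda>z. h + z)) f" using d by simp
  also have "\<dots> \<longleftrightarrow> integrable lborel (\<lambda>z. f (h + z))" by (rule integrable_distr_eq) auto
  finally show "integrable lborel (\<lambda>z. f (z + h)) \<longleftrightarrow> integrable lborel f" by (simp add: add.commute)
qed

text \<open>Continuity of translations in mean square, stated along sequences because it is proved
  by dominated convergence.\<close>

definition trans_cont :: "('a::euclidean_space \<Rightarrow> real) \<Rightarrow> bool" where
  "trans_cont f \<longleftrightarrow> (\<forall>h. h \<longlonglongrightarrow> 0 \<longrightarrow> (\<lambda>n. LINT z|lborel. (f (z + h n) - f z)\<^sup>2) \<longlonglongrightarrow> 0)"

definition sq_int :: "('a::euclidean_space \<Rightarrow> real) \<Rightarrow> bool" where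
  "sq_int f \<longleftrightarrow> f \<in> borel_measurable borel \<and> integrable lborel (\<lambda>z. (f z)\<^sup>2)"

lemma sq_int_add: "sq_int f \<Longrightarrow> sq_int g \<Longrightarrow> sq_int (\<lambda>z. f z + g z)"
  unfolding sq_int_def by (auto intro: sq_integrable_add)

lemma sq_int_cmult: "sq_int f \<Longrightarrow> sq_int (\<lambda>z. c * f z)"
  unfolding sq_int_def by (auto simp: power_mult_distrib)

lemma sq_int_diff: "sq_int f \<Longrightarrow> sq_int g \<Longrightarrow> sq_int (\<lambda>z. f z - g z)"
  using sq_int_add[of f "\<lambda>z. (-1) * g z"] sq_int_cmult[of g "-1"] by simp

lemma sq_int_translate: "sq_int f \<Longrightarrow> sq_int (\<lambda>z. f (z + h))"
  unfolding sq_int_def using integral_translate(2)[of "\<lambda>z. (f z)\<^sup>2" h] by auto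

lemma sq_int_mult_integrable: "sq_int f \<Longrightarrow> sq_int g \<Longrightarrow> integrable lborel (\<lambda>z. f z * g z)"
  unfolding sq_int_def by (intro integrable_mult_L2) auto

lemma trans_cont_add:
  assumes f: "trans_cont f" "sq_int f" and g: "trans_cont g" "sq_int g"
  shows "trans_cont (\<lambda>z. f z + g z)"
  unfolding trans_cont_def
proof (intro allI impI)
  fix h :: "nat \<Rightarrow> 'a" assume h: "h \<longlonglongrightarrow> 0"
  have i: "integrable lborel (\<lambda>z. (f (z + h n) - f z)\<^sup>2)" "integrable lborel (\<lambda>z. (g (z + h n) - g z)\<^sup>2)" for n
    using sq_int_diff[OF sq_int_translate[OF f(2)] f(2)] sq_int_diff[OF sq_int_translate[OF g(2)] g(2)] by (auto simp: sq_int_def)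
  have s: "sq_int (\<lambda>z. f z + g z)" by (rule sq_int_add[OF f(2) g(2)])
  have "(\<lambda>n. 2 * (LINT z|lborel. (f (z + h n) - f z)\<^sup>2) + 2 * (LINT z|lborel. (g (z + h n) - g z)\<^sup>2)) \<longlonglongrightarrow> 2 * 0 + 2 * 0"
    using f(1) g(1) h unfolding trans_cont_def by (intro tendsto_intros) auto
  then have l: "(\<lambda>n. 2 * (LINT z|lborel. (f (z + h n) - f z)\<^sup>2) + 2 * (LINT z|lborel. (g (z + h n) - g z)\<^sup>2)) \<longlonglongrightarrow> 0" by simp
  show "(\<lambda>n. LINT z|lborel. (f (z + h n) + g (z + h n) - (f z + g z))\<^sup>2) \<longlonglongrightarrow> 0"
  proof (rule tendsto_sandwich[OF _ _ tendsto_const l])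
    show "\<forall>\<^sub>F n in sequentially. (LINT z|lborel. (f (z + h n) + g (z + h n) - (f z + g z))\<^sup>2) \<le>
       2 * (LINT z|lborel. (f (z + h n) - f z)\<^sup>2) + 2 * (LINT z|lborel. (g (z + h n) - g z)\<^sup>2)"
    proof (intro always_eventually allI)
      fix n
      have "(LINT z|lborel. (f (z + h n) + g (z + h n) - (f z + g z))\<^sup>2) \<le>
         (LINT z|lborel. 2 * (f (z + h n) - f z)\<^sup>2 + 2 * (g (z + h n) - g z)\<^sup>2)"
      proof (rule integral_mono)
        show "integrable lborel (\<lambda>z. (f (z + h n) + g (z + h n) - (f z + g z))\<^sup>2)"
          using sq_int_diff[OF sq_int_translate[OF s] s] by (simp add: sq_int_def)
        show "integrable lborel (\<lambda>z. 2 * (f (z + h n) - f z)\<^sup>2 + 2 * (g (z + h n) - g z)\<^sup>2)" using i by auto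
        fix z
        have "(a + b)\<^sup>2 \<le> 2 * a\<^sup>2 + 2 * b\<^sup>2" for a b :: real
          using zero_le_power2[of "a - b"] by (simp add: power2_sum power2_diff)
        from this[of "f (z + h n) - f z" "g (z + h n) - g z"]
        show "(f (z + h n) + g (z + h n) - (f z + g z))\<^sup>2 \<le> 2 * (f (z + h n) - f z)\<^sup>2 + 2 * (g (z + h n) - g z)\<^sup>2"
          by (simp add: algebra_simps)
      qed
      also have "\<dots> = 2 * (LINT z|lborel. (f (z + h n) - f z)\<^sup>2) + 2 * (LINT z|lborel. (g (z + h n) - g z)\<^sup>2)"
        using i by simp
      finally show "(LINT z|lborel. (f (z + h n) + g (z + h n) - (f z + g z))\<^sup>2) \<le>
       2 * (LINT z|lborel. (f (z + h n) - f z)\<^sup>2) + 2 * (LINT z|lborel. (g (z + h n) - g z)\<^sup>2)" .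
    qed
  qed auto
qed

lemma trans_cont_cmult:
  assumes f: "trans_cont f"
  shows "trans_cont (\<lambda>z. c * f z)"
  unfolding trans_cont_def
proof (intro allI impI)
  fix h :: "nat \<Rightarrow> 'a" assume h: "h \<longlonglongrightarrow> 0"
  have "(\<lambda>n. c\<^sup>2 * (LINT z|lborel. (f (z + h n) - f z)\<^sup>2)) \<longlonglongrightarrow> c\<^sup>2 * 0"
    using f h unfolding trans_cont_def by (intro tendsto_intros) auto
  then show "(\<lambda>n. LINT z|lborel. (c * f (z + h n) - c * f z)\<^sup>2) \<longlonglongrightarrow> 0"
    by (simp flip: right_diff_distrib add: power_mult_distrib)
qed

text \<open>Translations are isometries, so the property is closed under limits in
  \<open>L2\<close>. Three terms, each with the factor 3 from the square of a sum, explain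
  \<open>e / 9\<close>.\<close>

lemma trans_cont_approx:
  assumes f: "sq_int f" and ap: "\<And>e. e > 0 \<Longrightarrow> \<exists>g. sq_int g \<and> trans_cont g \<and> (LINT z|lborel. (f z - g z)\<^sup>2) < e"
  shows "trans_cont f"
  unfolding trans_cont_def
proof (intro allI impI)
  fix h :: "nat \<Rightarrow> 'a" assume h: "h \<longlonglongrightarrow> 0"
  show "(\<lambda>n. LINT z|lborel. (f (z + h n) - f z)\<^sup>2) \<longlonglongrightarrow> 0"
  proof (rule LIMSEQ_I)
    fix e :: real assume e: "e > 0"
    obtain g where g: "sq_int g" "trans_cont g" "(LINT z|lborel. (f z - g z)\<^sup>2) < e / 9"
      using ap[of "e / 9"] e by auto
    have "(\<lambda>n. LINT z|lborel. (g (z + h n) - g z)\<^sup>2) \<longlonglongrightarrow> 0" using g(2) h by (simp add: trans_cont_def)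
    then have "\<forall>\<^sub>F n in sequentially. (LINT z|lborel. (g (z + h n) - g z)\<^sup>2) < e / 9"
      by (rule order_tendstoD(2)) (use e in simp)
    then obtain n0 where n0: "\<And>n. n \<ge> n0 \<Longrightarrow> (LINT z|lborel. (g (z + h n) - g z)\<^sup>2) < e / 9"
      by (auto simp: eventually_sequentially)
    have "norm ((LINT z|lborel. (f (z + h n) - f z)\<^sup>2) - 0) < e" if n: "n \<ge> n0" for n
    proof -
      have fg: "sq_int (\<lambda>z. f z - g z)" by (rule sq_int_diff[OF f g(1)])
      have i1: "integrable lborel (\<lambda>z. (f (z + h n) - g (z + h n))\<^sup>2)"
        using sq_int_translate[OF fg, of "h n"] by (simp add: sq_int_def)
      have i2: "integrable lborel (\<lambda>z. (g (z + h n) - g z)\<^sup>2)"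
        using sq_int_diff[OF sq_int_translate[OF g(1)] g(1)] by (simp add: sq_int_def)
      have i3: "integrable lborel (\<lambda>z. (f z - g z)\<^sup>2)" using fg by (simp add: sq_int_def)
      have "(LINT z|lborel. (f (z + h n) - f z)\<^sup>2) \<le>
         (LINT z|lborel. 3 * (f (z + h n) - g (z + h n))\<^sup>2 + 3 * (g (z + h n) - g z)\<^sup>2 + 3 * (f z - g z)\<^sup>2)"
      proof (rule integral_mono)
        show "integrable lborel (\<lambda>z. (f (z + h n) - f z)\<^sup>2)"
          using sq_int_diff[OF sq_int_translate[OF f] f] by (simp add: sq_int_def)
        show "integrable lborel (\<lambda>z. 3 * (f (z + h n) - g (z + h n))\<^sup>2 + 3 * (g (z + h n) - g z)\<^sup>2 + 3 * (f z - g z)\<^sup>2)"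
          using i1 i2 i3 by auto
        fix z
        have "(a + b - c)\<^sup>2 \<le> 3 * a\<^sup>2 + 3 * b\<^sup>2 + 3 * c\<^sup>2" for a b c :: real
          using zero_le_power2[of "a - b"] zero_le_power2[of "a + c"] zero_le_power2[of "b + c"]
          by (simp add: power2_eq_square algebra_simps)
        from this[of "f (z + h n) - g (z + h n)" "g (z + h n) - g z" "f z - g z"]
        show "(f (z + h n) - f z)\<^sup>2 \<le> 3 * (f (z + h n) - g (z + h n))\<^sup>2 + 3 * (g (z + h n) - g z)\<^sup>2 + 3 * (f z - g z)\<^sup>2"
          by simp
      qed
      also have "\<dots> = 3 * (LINT z|lborel. (f (z + h n) - g (z + h n))\<^sup>2) + 3 * (LINT z|lborel. (g (z + h n) - g z)\<^sup>2) + 3 * (LINT z|lborel. (f z - g z)\<^sup>2)"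
        using i1 i2 i3 by simp
      also have "(LINT z|lborel. (f (z + h n) - g (z + h n))\<^sup>2) = (LINT z|lborel. (f z - g z)\<^sup>2)"
        using borel_measurable_integrable[OF i3] by (intro integral_translate(1)[of "\<lambda>z. (f z - g z)\<^sup>2" "h n"]) simp
      also have "3 * (LINT z|lborel. (f z - g z)\<^sup>2) + 3 * (LINT z|lborel. (g (z + h n) - g z)\<^sup>2) + 3 * (LINT z|lborel. (f z - g z)\<^sup>2) < e"
        using g(3) n0[OF n] by simp
      finally show ?thesis by simp
    qed
    then show "\<exists>n0. \<forall>n\<ge>n0. norm ((LINT z|lborel. (f (z + h n) - f z)\<^sup>2) - 0) < e" by blast
  qed
qed

lemma indicator_sq: "(indicator A z :: real)\<^sup>2 = indicator A z"
  by (simp add: indicator_def)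

lemma sq_int_indicator: "A \<in> sets borel \<Longrightarrow> emeasure lborel A < \<infinity> \<Longrightarrow> sq_int (indicator A)"
  by (auto simp: sq_int_def indicator_sq)

text \<open>Expanding the square leaves only the correlation to be studied: for \<open>z\<close> in
  the open set the translates of \<open>z\<close> eventually stay in it, and for other
  \<open>z\<close> the product is zero.\<close>

lemma trans_cont_open:
  fixes G :: "'a::euclidean_space set"
  assumes G: "open G" "emeasure lborel G < \<infinity>"
  shows "trans_cont (indicator G)"
  unfolding trans_cont_def
proof (intro allI impI)
  fix h :: "nat \<Rightarrow> 'a" assume h: "h \<longlonglongrightarrow> 0"
  have [measurable]: "G \<in> sets borel" using G(1) by simp
  let ?I = "indicator G :: 'a \<Rightarrow> real"
  have i: "integrable lborel ?I" using G by auto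
  have ih: "integrable lborel (\<lambda>z. ?I (z + h n))" for n using i integral_translate(2)[of ?I] by simp
  have ip: "integrable lborel (\<lambda>z. ?I (z + h n) * ?I z)" for n
    by (rule sq_int_mult_integrable[OF sq_int_translate[OF sq_int_indicator] sq_int_indicator]) (use G in auto)
  have "(\<lambda>n. LINT z|lborel. ?I (z + h n) * ?I z) \<longlonglongrightarrow> (LINT z|lborel. ?I z)"
  proof (rule integral_dominated_convergence[where w = ?I])
    show "AE z in lborel. (\<lambda>n. ?I (z + h n) * ?I z) \<longlonglongrightarrow> ?I z"
    proof (rule AE_I2)
      fix z
      show "(\<lambda>n. ?I (z + h n) * ?I z) \<longlonglongrightarrow> ?I z"
      proof (cases "z \<in> G")
        case True
        have "(\<lambda>n. z + h n) \<longlonglongrightarrow> z + 0" by (intro tendsto_intros h)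
        then have "\<forall>\<^sub>F n in sequentially. z + h n \<in> G" using G(1) True by (auto dest: topological_tendstoD)
        then have "\<forall>\<^sub>F n in sequentially. 1 = ?I (z + h n) * ?I z" by (rule eventually_mono) (use True in simp)
        then have "(\<lambda>n. ?I (z + h n) * ?I z) \<longlonglongrightarrow> 1" by (rule Lim_transform_eventually[OF tendsto_const])
        with True show ?thesis by simp
      qed simp
    qed
  qed (use i in \<open>auto simp: indicator_def\<close>)
  then have "(\<lambda>n. 2 * (LINT z|lborel. ?I z) - 2 * (LINT z|lborel. ?I (z + h n) * ?I z)) \<longlonglongrightarrow> 2 * (LINT z|lborel. ?I z) - 2 * (LINT z|lborel. ?I z)"
    by (intro tendsto_intros)
  moreover have "(LINT z|lborel. (?I (z + h n) - ?I z)\<^sup>2) = 2 * (LINT z|lborel. ?I z) - 2 * (LINT z|lborel. ?I (z + h n) * ?I z)" for n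
  proof -
    have "(LINT z|lborel. (?I (z + h n) - ?I z)\<^sup>2) = (LINT z|lborel. ?I (z + h n) + ?I z - 2 * (?I (z + h n) * ?I z))"
      by (rule Bochner_Integration.integral_cong) (auto simp: indicator_def)
    also have "\<dots> = (LINT z|lborel. ?I (z + h n)) + (LINT z|lborel. ?I z) - 2 * (LINT z|lborel. ?I (z + h n) * ?I z)"
      using i ih ip by (simp only: Bochner_Integration.integral_diff Bochner_Integration.integral_add
         Bochner_Integration.integrable_add integrable_mult_right integral_mult_right_zero)
    also have "(LINT z|lborel. ?I (z + h n)) = (LINT z|lborel. ?I z)" by (rule integral_translate(1)) simp
    finally show ?thesis by simp
  qed
  ultimately show "(\<lambda>n. LINT z|lborel. (?I (z + h n) - ?I z)\<^sup>2) \<longlonglongrightarrow> 0" by simp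
qed

lemma trans_cont_indicator:
  fixes A :: "'a::euclidean_space set"
  assumes A: "A \<in> sets borel" "emeasure lborel A < \<infinity>"
  shows "trans_cont (indicator A)"
proof (rule trans_cont_approx[OF sq_int_indicator[OF A]])
  fix e :: real assume e: "e > 0"
  obtain U where U: "open U" "A \<subseteq> U" "emeasure lborel (U - A) < ennreal e"
    using outer_regular_lborel[of A e] A(1) e by auto
  have Ub: "U \<in> sets borel" using U(1) by simp
  have "emeasure lborel U \<le> emeasure lborel (U - A) + emeasure lborel A"
    using emeasure_subadditive[of "U - A" lborel A] Ub A U(2) by (simp add: Un_absorb2)
  also have "\<dots> < \<infinity>" using U(3) A(2) by (simp add: order.strict_trans)
  finally have fin: "emeasure lborel U < \<infinity>" .
  have "(LINT z|lborel. (indicator A z - indicator U z :: real)\<^sup>2) = (LINT z|lborel. indicator (U - A) z)"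
    by (rule Bochner_Integration.integral_cong) (use U(2) in \<open>auto simp: indicator_def\<close>)
  also have "\<dots> = measure lborel (U - A)" using Ub A by simp
  also have "\<dots> < e" using U(3) e by (metis emeasure_eq_ennreal_measure ennreal_less_iff measure_nonneg not_less_iff_gr_or_eq top.not_eq_extremum ennreal_less_top order.strict_trans)
  finally show "\<exists>g. sq_int g \<and> trans_cont g \<and> (LINT z|lborel. (indicator A z - g z)\<^sup>2) < e"
    using sq_int_indicator[OF Ub fin] trans_cont_open[OF U(1) fin] by blast
qed

lemma trans_cont_sum:
  assumes "finite Y" "\<And>y. y \<in> Y \<Longrightarrow> trans_cont (f y)" "\<And>y. y \<in> Y \<Longrightarrow> sq_int (f y)"
  shows "trans_cont (\<lambda>z. \<Sum>y\<in>Y. f y z) \<and> sq_int (\<lambda>z. \<Sum>y\<in>Y. f y z)"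
  using assms
proof (induction Y rule: finite_induct)
  case empty
  then show ?case by (simp add: trans_cont_def sq_int_def)
next
  case (insert y Y)
  then show ?case by (simp add: trans_cont_add sq_int_add)
qed

text \<open>By density: indicators of open sets, then of Borel sets of finite measure by outer
  regularity, then simple functions that approximate \<open>f\<close> in \<open>L2\<close>.\<close>

theorem sq_int_trans_cont:
  fixes f :: "'a::euclidean_space \<Rightarrow> real"
  assumes f: "sq_int f"
  shows "trans_cont f"
proof (rule trans_cont_approx[OF f])
  fix e :: real assume e: "e > 0"
  have fm [measurable]: "f \<in> borel_measurable borel" and fi: "integrable lborel (\<lambda>z. (f z)\<^sup>2)" using f by (auto simp: sq_int_def)
  have fml: "f \<in> borel_measurable lborel" by simp
  obtain s where s: "\<And>i. simple_function lborel (s i)" "\<And>z. (\<lambda>i. s i z) \<longlonglongrightarrow> f z" "\<And>i z. norm (s i z) \<le> 2 * norm (f z)"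
    using borel_measurable_implies_sequence_metric[OF fml, of 0] by (auto simp: dist_real_def)
  have sm [measurable]: "s i \<in> borel_measurable borel" for i
    using borel_measurable_simple_function[OF s(1)[of i]] by simp
  have "(\<lambda>i. LINT z|lborel. (f z - s i z)\<^sup>2) \<longlonglongrightarrow> (LINT z::'a|lborel. (0::real))"
  proof (rule integral_dominated_convergence[where w = "\<lambda>z. 9 * (f z)\<^sup>2"])
    show "AE z in lborel. (\<lambda>i. (f z - s i z)\<^sup>2) \<longlonglongrightarrow> 0"
    proof (rule AE_I2)
      fix z
      have "(\<lambda>i. (f z - s i z)\<^sup>2) \<longlonglongrightarrow> (f z - f z)\<^sup>2" by (intro tendsto_intros s)
      then show "(\<lambda>i. (f z - s i z)\<^sup>2) \<longlonglongrightarrow> 0" by simp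
    qed
    show "AE z in lborel. norm ((f z - s i z)\<^sup>2) \<le> 9 * (f z)\<^sup>2" for i
    proof (rule AE_I2)
      fix z
      have "\<bar>f z - s i z\<bar> \<le> 3 * \<bar>f z\<bar>" using s(3)[of i z] by simp
      then have "\<bar>f z - s i z\<bar>\<^sup>2 \<le> (3 * \<bar>f z\<bar>)\<^sup>2" by (rule power_mono) simp
      then show "norm ((f z - s i z)\<^sup>2) \<le> 9 * (f z)\<^sup>2" by (simp add: power_mult_distrib)
    qed
  qed (use fi in auto)
  then have "\<forall>\<^sub>F i in sequentially. (LINT z|lborel. (f z - s i z)\<^sup>2) < e"
    using e by (intro order_tendstoD(2)) auto
  then obtain i where i: "(LINT z|lborel. (f z - s i z)\<^sup>2) < e" by (auto dest: eventually_happens)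
  have si: "integrable lborel (\<lambda>z. (s i z)\<^sup>2)"
  proof (rule Bochner_Integration.integrable_bound[OF integrable_mult_right[OF fi, of 4]])
    show "AE z in lborel. norm ((s i z)\<^sup>2) \<le> norm (4 * (f z)\<^sup>2)"
    proof (rule AE_I2)
      fix z
      have "\<bar>s i z\<bar>\<^sup>2 \<le> (2 * \<bar>f z\<bar>)\<^sup>2" using s(3)[of i z] by (intro power_mono) auto
      then show "norm ((s i z)\<^sup>2) \<le> norm (4 * (f z)\<^sup>2)" by (simp add: power_mult_distrib)
    qed
  qed simp
  define Y where "Y = range (s i) - {0}"
  have Y: "finite Y" using simple_functionD(1)[OF s(1)[of i]] by (simp add: Y_def)
  have lev [measurable]: "s i -` {y} \<in> sets borel" for y
    using measurable_sets[OF sm, of "{y}"] by simp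
  have levfin: "emeasure lborel (s i -` {y}) < \<infinity>" if y: "y \<in> Y" for y
  proof -
    have "integrable lborel (\<lambda>z. y\<^sup>2 * indicator (s i -` {y}) z)"
      by (rule Bochner_Integration.integrable_bound[OF si]) (auto simp: indicator_def)
    then have "integrable lborel (indicator (s i -` {y}) :: _ \<Rightarrow> real)" using y by (simp add: Y_def)
    then show ?thesis by (simp add: integrable_indicator_iff)
  qed
  have rep: "s i = (\<lambda>z. \<Sum>y\<in>Y. y * indicator (s i -` {y}) z)"
  proof
    fix z
    show "s i z = (\<Sum>y\<in>Y. y * indicator (s i -` {y}) z)"
    proof (cases "s i z = 0")
      case True
      then have "(\<Sum>y\<in>Y. y * indicator (s i -` {y}) z) = 0" by (intro sum.neutral) (auto simp: indicator_def)
      with True show ?thesis by simp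
    next
      case False
      then have "s i z \<in> Y" by (simp add: Y_def)
      then have "(\<Sum>y\<in>Y. y * indicator (s i -` {y}) z) = s i z * indicator (s i -` {s i z}) z + (\<Sum>y\<in>Y - {s i z}. y * indicator (s i -` {y}) z)"
        by (rule sum.remove[OF Y])
      also have "(\<Sum>y\<in>Y - {s i z}. y * indicator (s i -` {y}) z) = 0"
        by (intro sum.neutral) (auto simp: indicator_def)
      finally show ?thesis by simp
    qed
  qed
  have "trans_cont (s i) \<and> sq_int (s i)"
    by (subst (1 2) rep, rule trans_cont_sum[OF Y])
       (auto intro!: trans_cont_cmult sq_int_cmult trans_cont_indicator sq_int_indicator levfin)
  with i show "\<exists>g. sq_int g \<and> trans_cont g \<and> (LINT z|lborel. (f z - g z)\<^sup>2) < e" by blast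
qed

lemma correlation_tendsto:
  fixes f g :: "'a::euclidean_space \<Rightarrow> real"
  assumes f: "sq_int f" and g: "sq_int g" and h: "h \<longlonglongrightarrow> 0"
  shows "(\<lambda>n. LINT z|lborel. f (z + h n) * g z) \<longlonglongrightarrow> (LINT z|lborel. f z * g z)"
proof -
  define r where "r n = sqrt (LINT z|lborel. (f (z + h n) - f z)\<^sup>2) * sqrt (LINT z|lborel. (g z)\<^sup>2)" for n
  have "(\<lambda>n. LINT z|lborel. (f (z + h n) - f z)\<^sup>2) \<longlonglongrightarrow> 0"
    using sq_int_trans_cont[OF f] h by (simp add: trans_cont_def)
  then have "r \<longlonglongrightarrow> sqrt 0 * sqrt (LINT z|lborel. (g z)\<^sup>2)"
    unfolding r_def by (intro tendsto_intros)
  then have r: "r \<longlonglongrightarrow> 0" by simp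
  have le: "\<bar>(LINT z|lborel. f (z + h n) * g z) - (LINT z|lborel. f z * g z)\<bar> \<le> r n" for n
  proof -
    have d: "sq_int (\<lambda>z. f (z + h n) - f z)" by (rule sq_int_diff[OF sq_int_translate[OF f] f])
    have "(LINT z|lborel. f (z + h n) * g z) - (LINT z|lborel. f z * g z) = (LINT z|lborel. (f (z + h n) - f z) * g z)"
      unfolding left_diff_distrib
      by (rule Bochner_Integration.integral_diff[symmetric, OF sq_int_mult_integrable[OF sq_int_translate[OF f] g] sq_int_mult_integrable[OF f g]])
    also have "\<bar>\<dots>\<bar> \<le> r n"
      unfolding r_def by (rule integral_Cauchy_Schwarz) (use d g in \<open>auto simp: sq_int_def\<close>)
    finally show ?thesis .
  qed
  have "(\<lambda>n. (LINT z|lborel. f (z + h n) * g z) - (LINT z|lborel. f z * g z)) \<longlonglongrightarrow> 0"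
    by (rule Lim_null_comparison[OF _ r]) (use le in auto)
  then show ?thesis by (simp add: LIM_zero_iff)
qed

lemma AE_snd:
  assumes "AE x in lborel. Q (x::real)"
  shows "AE z in (lborel :: (real \<times> real) measure). Q (snd z)"
proof -
  obtain N where N: "N \<in> null_sets lborel" "{x \<in> space lborel. \<not> Q x} \<subseteq> N"
    using assms by (auto simp: eventually_ae_filter)
  have [measurable]: "N \<in> sets borel" using N(1) by auto
  have "Measurable.pred (borel \<Otimes>\<^sub>M borel) (\<lambda>z :: real \<times> real. snd z \<notin> N)"
    by measurable
  then have "{z :: real \<times> real. snd z \<notin> N} \<in> sets (borel \<Otimes>\<^sub>M borel)"
    by (simp add: pred_def space_pair_measure)
  then have "AE z in (lborel :: (real \<times> real) measure). snd z \<notin> N"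
    unfolding borel_prod by (intro AE_lborel_pairI) (use AE_not_in[OF N(1)] in \<open>auto elim: eventually_mono\<close>)
  then show ?thesis by (rule eventually_mono) (use N(2) in auto)
qed

lemma integral_pair_iterated:
  fixes f :: "real \<times> real \<Rightarrow> real"
  assumes "integrable lborel f"
  shows "(LINT z|lborel. f z) = (LBINT t. LBINT x. f (t, x))"
proof -
  have "integrable (lborel \<Otimes>\<^sub>M lborel) f" using assms unfolding lborel_prod .
  from lborel_pair.integral_fst'[OF this] show ?thesis by (simp add: lborel_prod)
qed

text \<open>Here \<open>W\<close> is the image of \<open>w\<close> under a symmetric operator that does not depend on time. By
  symmetry the correlation
  \<open>h \<mapsto> \<integral>\<integral> w(t + h) W(t)\<close> is even, so the average of \<open>h \<mapsto> \<integral>\<integral> w\<^sub>t(t + h) W(t)\<close> over symmetric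
  intervals is zero, and this function is continuous at zero.\<close>

lemma symmetric_evolution:
  fixes w wt W :: "real \<times> real \<Rightarrow> real"
  assumes w: "sq_int w" and wt: "sq_int wt" and W: "sq_int W"
    and ac: "AE x in lborel. \<forall>t h. h > 0 \<longrightarrow> w (t + h, x) - w (t - h, x) = (LBINT s:{t - h..t + h}. wt (s, x))"
    and P: "AE t in lborel. P t"
    and sym: "\<And>t t'. P t \<Longrightarrow> P t' \<Longrightarrow> (LBINT x. w (t, x) * W (t', x)) = (LBINT x. w (t', x) * W (t, x))"
  shows "(LINT z|lborel. wt z * W z) = 0"
proof -
  have [measurable]: "w \<in> borel_measurable borel" "wt \<in> borel_measurable borel" "W \<in> borel_measurable borel"
    using w wt W by (auto simp: sq_int_def)
  have tr: "z + (h, 0) = (fst z + h, snd z)" for z :: "real \<times> real" and h by (cases z) simp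
  obtain N where N: "N \<in> null_sets lborel" "{t \<in> space lborel. \<not> P t} \<subseteq> N"
    using P by (auto simp: eventually_ae_filter)
  have Nb [measurable]: "N \<in> sets borel" using N(1) by auto
  have PN: "P t" if "t \<notin> N" for t using N(2) that by auto
  \<comment> \<open>The symmetry compares two good times; for fixed \<open>h\<close> both
    \<open>t\<close> and \<open>t + h\<close> are good for almost every \<open>t\<close>.\<close>
  have ev: "(LINT z|lborel. w (z + (h, 0)) * W z) = (LINT z|lborel. w z * W (z + (h, 0)))" for h
  proof -
    have "AE t in lborel. h + 1 * t \<notin> N"
      by (rule AE_borel_affine) (use AE_not_in[OF N(1)] in auto)
    then have sh: "AE t in lborel. t + h \<notin> N" by (simp add: add.commute)
    have i: "integrable lborel (\<lambda>z. w (z + (h, 0)) * W z)" "integrable lborel (\<lambda>z. w z * W (z + (h, 0)))"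
      by (rule sq_int_mult_integrable[OF sq_int_translate[OF w] W], rule sq_int_mult_integrable[OF w sq_int_translate[OF W]])
    have ip: "integrable (lborel \<Otimes>\<^sub>M lborel) (\<lambda>z. w (z + (h, 0)) * W z)" "integrable (lborel \<Otimes>\<^sub>M lborel) (\<lambda>z. w z * W (z + (h, 0)))"
      using i unfolding lborel_prod .
    have "(LINT z|lborel. w (z + (h, 0)) * W z) = (LBINT t. LBINT x. w (t + h, x) * W (t, x))"
      using integral_pair_iterated[OF i(1)] by simp
    also have "\<dots> = (LBINT t. LBINT x. w (t, x) * W (t + h, x))"
    proof (rule integral_cong_AE)
      show "(\<lambda>t. LBINT x. w (t + h, x) * W (t, x)) \<in> borel_measurable lborel"
        using borel_measurable_integrable[OF lborel_pair.integrable_fst'[OF ip(1)]] by simp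
      show "(\<lambda>t. LBINT x. w (t, x) * W (t + h, x)) \<in> borel_measurable lborel"
        using borel_measurable_integrable[OF lborel_pair.integrable_fst'[OF ip(2)]] by simp
      show "AE t in lborel. (LBINT x. w (t + h, x) * W (t, x)) = (LBINT x. w (t, x) * W (t + h, x))"
        using sh AE_not_in[OF N(1)] by eventually_elim (rule sym[OF PN PN])
    qed
    also have "\<dots> = (LINT z|lborel. w z * W (z + (h, 0)))"
      using integral_pair_iterated[OF i(2)] by simp
    finally show ?thesis .
  qed
  \<comment> \<open>Translating the right-hand side of \<open>ev\<close> back by \<open>h\<close>
    shows that the correlations at \<open>h\<close> and at \<open>- h\<close> coincide.\<close>
  have zero: "(LINT z|lborel. (w (z + (h, 0)) - w (z + (- h, 0))) * W z) = 0" for h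
  proof -
    have i: "integrable lborel (\<lambda>z. w (z + (h, 0)) * W z)" "integrable lborel (\<lambda>z. w (z + (- h, 0)) * W z)"
      by (rule sq_int_mult_integrable[OF sq_int_translate[OF w] W])+
    have "(LINT z|lborel. w z * W (z + (h, 0))) = (LINT z|lborel. w ((z + (h, 0)) + (- h, 0)) * W (z + (h, 0)))"
      by (simp add: tr)
    also have "\<dots> = (LINT z|lborel. w (z + (- h, 0)) * W z)"
      by (rule integral_translate(1)[of "\<lambda>z. w (z + (- h, 0)) * W z"]) simp
    finally show ?thesis unfolding left_diff_distrib
      using Bochner_Integration.integral_diff[OF i] ev[of h] by simp
  qed
  define c where "c \<tau> = (LINT z|lborel. wt (z + (\<tau>, 0)) * W z)" for \<tau>
  define K where "K = sqrt (LINT z|lborel. (wt z)\<^sup>2) * sqrt (LINT z|lborel. (W z)\<^sup>2)"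
  have cK: "\<bar>c \<tau>\<bar> \<le> K" for \<tau>
  proof -
    have "\<bar>c \<tau>\<bar> \<le> sqrt (LINT z|lborel. (wt (z + (\<tau>, 0)))\<^sup>2) * sqrt (LINT z|lborel. (W z)\<^sup>2)"
      unfolding c_def by (rule integral_Cauchy_Schwarz) (use sq_int_translate[OF wt, of "(\<tau>, 0)"] W in \<open>auto simp: sq_int_def\<close>)
    also have "(LINT z|lborel. (wt (z + (\<tau>, 0)))\<^sup>2) = (LINT z|lborel. (wt z)\<^sup>2)"
      by (rule integral_translate(1)[of "\<lambda>z. (wt z)\<^sup>2"]) simp
    finally show ?thesis by (simp add: K_def)
  qed
  \<comment> \<open>This is the mean of \<open>c\<close> over \<open>[- h, h]\<close>, rescaled to a
    fixed interval. By Fubini the integral over the scaled variable acts on \<open>wt\<close> alone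
    and gives the symmetric increment of \<open>w\<close> divided by \<open>h\<close>, whose product
    with \<open>W\<close> integrates to zero.\<close>
  have avg: "integrable lborel (\<lambda>\<sigma>. indicator {-1..1} \<sigma> * c (h * \<sigma>)) \<and> (LBINT \<sigma>. indicator {-1..1} \<sigma> * c (h * \<sigma>)) = 0"
    if h: "h > 0" for h
  proof -
    define F where "F = (\<lambda>(\<sigma>, z). indicator {-1..1} \<sigma> * (wt (z + (h * \<sigma>, 0)) * W z))"
    have Fm [measurable]: "F \<in> borel_measurable (lborel \<Otimes>\<^sub>M lborel)"
      unfolding F_def case_prod_beta' by measurable
    have Fs: "integrable lborel (\<lambda>z. F (\<sigma>, z))" for \<sigma>
      unfolding F_def using sq_int_mult_integrable[OF sq_int_translate[OF wt] W, of "(h * \<sigma>, 0)"] by simp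
    have Fi: "integrable (lborel \<Otimes>\<^sub>M lborel) F"
    proof (rule lborel_pair.Fubini_integrable[OF Fm])
      show "AE \<sigma> in lborel. integrable lborel (\<lambda>z. F (\<sigma>, z))" using Fs by simp
      define A where "A = (LINT z|lborel. (wt z)\<^sup>2) + (LINT z|lborel. (W z)\<^sup>2)"
      have "integrable lborel (\<lambda>\<sigma>. A * indicator {-1..1::real} \<sigma>)" by (intro integrable_mult_right integrable_real_indicator) auto
      then show "integrable lborel (\<lambda>\<sigma>. LINT z|lborel. norm (F (\<sigma>, z)))"
      proof (rule Bochner_Integration.integrable_bound)
        show "(\<lambda>\<sigma>. LINT z|lborel. norm (F (\<sigma>, z))) \<in> borel_measurable lborel" by measurable
        show "AE \<sigma> in lborel. norm (LINT z|lborel. norm (F (\<sigma>, z))) \<le> norm (A * indicator {-1..1} \<sigma>)"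
        proof (rule AE_I2)
          fix \<sigma> :: real
          have it: "integrable lborel (\<lambda>z. (wt (z + (h * \<sigma>, 0)))\<^sup>2)" "integrable lborel (\<lambda>z. (W z)\<^sup>2)"
            using sq_int_translate[OF wt] W by (auto simp: sq_int_def)
          have "(LINT z|lborel. norm (F (\<sigma>, z))) \<le> (LINT z|lborel. indicator {-1..1} \<sigma> * ((wt (z + (h * \<sigma>, 0)))\<^sup>2 + (W z)\<^sup>2))"
          proof (rule integral_mono)
            show "integrable lborel (\<lambda>z. norm (F (\<sigma>, z)))" using Fs by (rule integrable_norm)
            show "integrable lborel (\<lambda>z. indicator {-1..1} \<sigma> * ((wt (z + (h * \<sigma>, 0)))\<^sup>2 + (W z)\<^sup>2))"
              by (intro integrable_mult_right Bochner_Integration.integrable_add it)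
            fix z
            have "\<bar>x * y\<bar> \<le> x\<^sup>2 + y\<^sup>2" for x y :: real
            proof -
              have "2 * (\<bar>x\<bar> * \<bar>y\<bar>) \<le> x\<^sup>2 + y\<^sup>2" using sum_squares_bound[of "\<bar>x\<bar>" "\<bar>y\<bar>"] by simp
              moreover have "0 \<le> \<bar>x\<bar> * \<bar>y\<bar>" by simp
              ultimately show ?thesis unfolding abs_mult by linarith
            qed
            then show "norm (F (\<sigma>, z)) \<le> indicator {-1..1} \<sigma> * ((wt (z + (h * \<sigma>, 0)))\<^sup>2 + (W z)\<^sup>2)"
              by (auto simp: F_def indicator_def)
          qed
          also have "\<dots> = indicator {-1..1} \<sigma> * ((LINT z|lborel. (wt (z + (h * \<sigma>, 0)))\<^sup>2) + (LINT z|lborel. (W z)\<^sup>2))"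
            using it by simp
          also have "(LINT z|lborel. (wt (z + (h * \<sigma>, 0)))\<^sup>2) = (LINT z|lborel. (wt z)\<^sup>2)"
            by (rule integral_translate(1)[of "\<lambda>z. (wt z)\<^sup>2"]) simp
          finally have "(LINT z|lborel. norm (F (\<sigma>, z))) \<le> A * indicator {-1..1} \<sigma>" by (simp add: A_def mult.commute)
          moreover have "0 \<le> (LINT z|lborel. norm (F (\<sigma>, z)))" by simp
          ultimately show "norm (LINT z|lborel. norm (F (\<sigma>, z))) \<le> norm (A * indicator {-1..1} \<sigma>)"
            unfolding real_norm_def by linarith
        qed
      qed
    qed
    have cF: "(LINT z|lborel. F (\<sigma>, z)) = indicator {-1..1} \<sigma> * c (h * \<sigma>)" for \<sigma>
      unfolding F_def c_def by simp
    have i1: "integrable lborel (\<lambda>\<sigma>. indicator {-1..1} \<sigma> * c (h * \<sigma>))"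
      using lborel_pair.integrable_fst'[OF Fi] unfolding cF .
    have "(LBINT \<sigma>. indicator {-1..1} \<sigma> * c (h * \<sigma>)) = (LBINT \<sigma>. (LINT z|lborel. F (\<sigma>, z)))" unfolding cF ..
    also have "\<dots> = (LINT z|lborel. (LBINT \<sigma>. F (\<sigma>, z)))"
      using lborel_pair.Fubini_integral[of "\<lambda>\<sigma> z. F (\<sigma>, z)"] Fi by simp
    also have "\<dots> = (LINT z|lborel. (1 / h) * ((w (z + (h, 0)) - w (z + (- h, 0))) * W z))"
    proof (rule integral_cong_AE)
      have "(\<lambda>(z, \<sigma>). F (\<sigma>, z)) \<in> borel_measurable (lborel \<Otimes>\<^sub>M lborel)"
        unfolding F_def case_prod_beta' by measurable
      then show "(\<lambda>z. LBINT \<sigma>. F (\<sigma>, z)) \<in> borel_measurable lborel" by measurable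
      show "(\<lambda>z. (1 / h) * ((w (z + (h, 0)) - w (z + (- h, 0))) * W z)) \<in> borel_measurable lborel" by measurable
      show "AE z in lborel. (LBINT \<sigma>. F (\<sigma>, z)) = (1 / h) * ((w (z + (h, 0)) - w (z + (- h, 0))) * W z)"
        using AE_snd[OF ac]
      proof (rule eventually_mono)
        fix z :: "real \<times> real"
        assume z: "\<forall>t h. h > 0 \<longrightarrow> w (t + h, snd z) - w (t - h, snd z) = (LBINT s:{t - h..t + h}. wt (s, snd z))"
        let ?t = "fst z" and ?x = "snd z"
        have "w (z + (h, 0)) - w (z + (- h, 0)) = (LBINT s:{?t - h..?t + h}. wt (s, ?x))"
          using z h by (simp add: tr)
        also have "\<dots> = (LBINT s. indicator {?t - h..?t + h} s *\<^sub>R wt (s, ?x))" by (simp add: set_lebesgue_integral_def)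
        also have "\<dots> = \<bar>h\<bar> *\<^sub>R (LBINT \<sigma>. indicator {?t - h..?t + h} (?t + h * \<sigma>) *\<^sub>R wt (?t + h * \<sigma>, ?x))"
          by (rule lborel_integral_real_affine) (use h in simp)
        also have "(LBINT \<sigma>. indicator {?t - h..?t + h} (?t + h * \<sigma>) *\<^sub>R wt (?t + h * \<sigma>, ?x)) = (LBINT \<sigma>. indicator {-1..1} \<sigma> * wt (z + (h * \<sigma>, 0)))"
        proof (rule Bochner_Integration.integral_cong[OF refl])
          fix \<sigma> :: real
          have "?t + h * \<sigma> \<in> {?t - h..?t + h} \<longleftrightarrow> \<sigma> \<in> {-1..1}"
          proof -
            have "- h \<le> h * \<sigma> \<longleftrightarrow> -1 \<le> \<sigma>" "h * \<sigma> \<le> h \<longleftrightarrow> \<sigma> \<le> 1"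
              using mult_le_cancel_left_pos[OF h, of "-1" \<sigma>] mult_le_cancel_left_pos[OF h, of \<sigma> 1] by simp_all
            then show ?thesis by auto
          qed
          then show "indicator {?t - h..?t + h} (?t + h * \<sigma>) *\<^sub>R wt (?t + h * \<sigma>, ?x) = indicator {-1..1} \<sigma> * wt (z + (h * \<sigma>, 0))"
            by (simp add: tr indicator_def)
        qed
        finally have e: "w (z + (h, 0)) - w (z + (- h, 0)) = h * (LBINT \<sigma>. indicator {-1..1} \<sigma> * wt (z + (h * \<sigma>, 0)))"
          using h by simp
        have "(LBINT \<sigma>. F (\<sigma>, z)) = (LBINT \<sigma>. indicator {-1..1} \<sigma> * wt (z + (h * \<sigma>, 0))) * W z"
          unfolding F_def by (simp flip: mult.assoc)
        then show "(LBINT \<sigma>. F (\<sigma>, z)) = (1 / h) * ((w (z + (h, 0)) - w (z + (- h, 0))) * W z)"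
          using e h by simp
      qed
    qed
    also have "\<dots> = (1 / h) * (LINT z|lborel. (w (z + (h, 0)) - w (z + (- h, 0))) * W z)" by (rule integral_mult_right_zero)
    also have "\<dots> = 0" using zero[of h] by simp
    finally show ?thesis using i1 by simp
  qed
  \<comment> \<open>Continuity of \<open>c\<close> at zero is all that is needed: the vanishing
    means over shrinking intervals tend to \<open>2 * c 0\<close>. No differentiability of
    \<open>W\<close> in time enters.\<close>
  have "(\<lambda>n. LBINT \<sigma>. indicator {-1..1} \<sigma> * c ((1 / real (Suc n)) * \<sigma>)) \<longlonglongrightarrow> (LBINT \<sigma>. indicator {-1..1::real} \<sigma> * c 0)"
  proof (rule integral_dominated_convergence[where w = "\<lambda>\<sigma>::real. K * indicator {-1..1} \<sigma>"])
    show "(\<lambda>\<sigma>. indicator {-1..1} \<sigma> * c ((1 / real (Suc n)) * \<sigma>)) \<in> borel_measurable lborel" for n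
      using avg[of "1 / real (Suc n)"] by (auto dest: borel_measurable_integrable)
    show "AE \<sigma> in lborel. (\<lambda>n. indicator {-1..1} \<sigma> * c ((1 / real (Suc n)) * \<sigma>)) \<longlonglongrightarrow> indicator {-1..1} \<sigma> * c 0"
    proof (intro AE_I2 tendsto_mult tendsto_const)
      fix \<sigma> :: real
      have "(\<lambda>n. ((1 / real (Suc n)) * \<sigma>, 0::real)) \<longlonglongrightarrow> (0 * \<sigma>, 0)"
        by (intro tendsto_Pair tendsto_mult tendsto_const LIMSEQ_Suc[OF lim_1_over_n])
      then have "(\<lambda>n. ((1 / real (Suc n)) * \<sigma>, 0::real)) \<longlonglongrightarrow> 0" by (simp add: zero_prod_def)
      from correlation_tendsto[OF wt W this]
      show "(\<lambda>n. c ((1 / real (Suc n)) * \<sigma>)) \<longlonglongrightarrow> c 0" unfolding c_def by (simp add: zero_prod_def[symmetric])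
    qed
    show "AE \<sigma> in lborel. norm (indicator {-1..1} \<sigma> * c ((1 / real (Suc n)) * \<sigma>)) \<le> K * indicator {-1..1} \<sigma>" for n
      using cK by (auto simp: indicator_def)
    show "integrable lborel (\<lambda>\<sigma>. K * indicator {-1..1::real} \<sigma>)"
      by (intro integrable_mult_right integrable_real_indicator) auto
  qed simp
  moreover have "(LBINT \<sigma>. indicator {-1..1} \<sigma> * c ((1 / real (Suc n)) * \<sigma>)) = 0" for n
    using avg[of "1 / real (Suc n)"] by (simp del: of_nat_Suc)
  ultimately have "(LBINT \<sigma>. indicator {-1..1::real} \<sigma> * c 0) = 0"
    by (simp only: LIMSEQ_const_iff)
  then have "c 0 = 0" by simp
  then show ?thesis by (simp add: c_def zero_prod_def[symmetric])
qed

section \<open>The product of the two parts of the conjugated operator\<close>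

lemma telescope_nodes:
  fixes F :: "nat \<Rightarrow> 'a \<Rightarrow> real"
  shows "(\<Sum>k<Suc n. F k (a (Suc k)) - F k (a k)) =
    F n (a (Suc n)) - F 0 (a 0) + (\<Sum>k\<in>{1..<Suc n}. F (k - 1) (a k) - F k (a k))"
  by (induction n) (auto simp: atLeastLessThanSuc)

lemma telescope_partition:
  assumes part: "is_partition L N a"
  shows "(\<Sum>k<N. F k (a (Suc k)) - F k (a k)) =
    F (N - 1) L - F 0 (0::real) + (\<Sum>k\<in>{1..<N}. F (k - 1) (a k) - F k (a k) :: real)"
proof -
  obtain n where n: "N = Suc n" using part by (cases N) (auto simp: is_partition_def)
  show ?thesis using telescope_nodes[of F a n] part unfolding n by (simp add: is_partition_def)
qed

lemma partition_integral:
  fixes f :: "real \<Rightarrow> real" and g :: "nat \<Rightarrow> real \<Rightarrow> real"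
  assumes part: "is_partition L N a" and f: "f \<in> borel_measurable borel"
    and i: "\<And>k. k < N \<Longrightarrow> set_integrable lborel {a k..a (Suc k)} (g k)"
    and eq: "\<And>k. k < N \<Longrightarrow> AE x in lborel. x \<in> subint a k \<longrightarrow> f x = g k x"
  shows "set_integrable lborel {0<..<L} f"
    "(LBINT x:{0<..<L}. f x) = (\<Sum>k<N. LBINT x:{a k..a (Suc k)}. g k x)"
proof -
  have all: "AE x in lborel. \<forall>k\<in>{..<N}. x \<in> subint a k \<longrightarrow> f x = g k x"
    by (rule AE_finite_allI) (use eq in auto)
  have int: "integrable lborel (\<lambda>x. \<Sum>k<N. indicator {a k..a (Suc k)} x *\<^sub>R g k x)"
    using i unfolding set_integrable_def by (intro Bochner_Integration.integrable_sum) auto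
  have ae: "AE x in lborel. (\<Sum>k<N. indicator {a k..a (Suc k)} x *\<^sub>R g k x) = indicator {0<..<L} x *\<^sub>R f x"
    using all AE_not_node[of a N]
  proof eventually_elim
    fix x assume x: "\<forall>k\<in>{..<N}. x \<in> subint a k \<longrightarrow> f x = g k x" "x \<notin> a ` {..N}"
    have ind: "indicator {a k..a (Suc k)} x = (indicator (subint a k) x :: real)" if "k < N" for k
      using x(2) that by (force simp: subint_def indicator_def)
    have "(\<Sum>k<N. indicator {a k..a (Suc k)} x *\<^sub>R g k x) = (\<Sum>k<N. indicator (subint a k) x * f x)"
      by (rule sum.cong) (use ind x(1) in \<open>auto simp: indicator_def\<close>)
    also have "\<dots> = indicator {0<..<L} x * f x"
    proof (cases "x \<in> {0<..<L}")
      case True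
      obtain k where k: "k < N" "x \<in> subint a k" using partition_cover[OF part True x(2)] by blast
      have "(\<Sum>k<N. indicator (subint a k) x * f x) = indicator (subint a k) x * f x + (\<Sum>l\<in>{..<N} - {k}. indicator (subint a l) x * f x)"
        by (rule sum.remove) (use k in auto)
      also have "(\<Sum>l\<in>{..<N} - {k}. indicator (subint a l) x * f x) = 0"
      proof (rule sum.neutral, rule ballI)
        fix l assume "l \<in> {..<N} - {k}"
        then have "x \<notin> subint a l" using partition_disjoint[OF part, of l k x] k by auto
        then show "indicator (subint a l) x * f x = 0" by simp
      qed
      finally show ?thesis using k True by simp
    next
      case False
      then have "x \<notin> subint a k" if "k < N" for k using partition_subint(4)[OF part that] by blast
      with False show ?thesis by simp
    qed
    finally show "(\<Sum>k<N. indicator {a k..a (Suc k)} x *\<^sub>R g k x) = indicator {0<..<L} x *\<^sub>R f x" by simp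
  qed
  note [measurable] = f
  show "set_integrable lborel {0<..<L} f"
    unfolding set_integrable_def by (rule integrable_cong_AE_imp[OF int _ ae]) simp
  have "(LBINT x:{0<..<L}. f x) = (LBINT x. \<Sum>k<N. indicator {a k..a (Suc k)} x *\<^sub>R g k x)"
    unfolding set_lebesgue_integral_def
    by (rule integral_cong_AE) (use ae int in \<open>auto dest: borel_measurable_integrable elim: eventually_mono\<close>)
  also have "\<dots> = (\<Sum>k<N. LBINT x:{a k..a (Suc k)}. g k x)"
    unfolding set_lebesgue_integral_def
    by (rule Bochner_Integration.integral_sum) (use i in \<open>auto simp: set_integrable_def\<close>)
  finally show "(LBINT x:{0<..<L}. f x) = (\<Sum>k<N. LBINT x:{a k..a (Suc k)}. g k x)" .
qed

text \<open>The product of the two parts of the conjugated operator is an exact derivative up to a form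
  whose leading part is definite.\<close>

definition flux :: "real \<Rightarrow> real \<Rightarrow> real \<Rightarrow> real \<Rightarrow> real \<Rightarrow> real" where
  "flux M M1 v0 v1 v2 = 3 / 2 * (M * (v2 * v2)) + 3 * (M1 * (v1 * v2)) + M * (M * (M * (v0 * v2)))
     + 4 * (M * (M * (M * (v1 * v1)))) + 6 * (M * (M * (M1 * (v0 * v1)))) + 3 / 2 * (M * (M * (M * (M * (M * (v0 * v0))))))"

definition bulk :: "real \<Rightarrow> real \<Rightarrow> real \<Rightarrow> real \<Rightarrow> real \<Rightarrow> real \<Rightarrow> real" where
  "bulk M M1 M2 v0 v1 v2 = - (9 / 2) * M1 * v2^2 - 9 * M^2 * M1 * v1^2 - 9 / 2 * M^4 * M1 * v0^2
     - 3 * M2 * v1 * v2 - 6 * (2 * M * M1^2 + M^2 * M2) * v0 * v1 + 9 * M * M1^2 * v0 * v1"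

text \<open>The product of the space parts of \<open>L\<^sub>A\<close> and \<open>L\<^sub>B\<close>,
  each with its factor \<open>p\<close> removed; \<open>v1\<close>, \<open>v2\<close>,
  \<open>v3\<close> are the space derivatives of \<open>v0\<close>.\<close>

definition product_form :: "real \<Rightarrow> real \<Rightarrow> real \<Rightarrow> real \<Rightarrow> real \<Rightarrow> real \<Rightarrow> real" where
  "product_form M M1 v0 v1 v2 v3 = (v3 + 3 * M^2 * v1 + 3 * M * M1 * v0) * (3 * M * v2 + 3 * M1 * v1 + M^3 * v0)"

text \<open>Each product of different derivatives is integrated by parts once. For example
  \<open>3 M v2 v3\<close> and \<open>3 M1 v1 v3\<close> leave behind \<open>- 3/2 M1 v2^2\<close>
  and \<open>- 3 M1 v2^2\<close>, which add up to the first coefficient \<open>- 9/2\<close> of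
  \<open>bulk\<close>; the terms with \<open>M2\<close> arise when the derivative falls on
  \<open>M1\<close>.\<close>

lemma flux_identity:
  assumes v0: "AC a b v0 v1" and v1: "AC a b v1 v2" and v2: "AC a b v2 v3"
    and M: "AC a b M M1" and M1: "AC a b M1 M2"
  shows "AC a b (\<lambda>x. flux (M x) (M1 x) (v0 x) (v1 x) (v2 x))
    (\<lambda>x. product_form (M x) (M1 x) (v0 x) (v1 x) (v2 x) (v3 x) - bulk (M x) (M1 x) (M2 x) (v0 x) (v1 x) (v2 x))"
proof -
  note t1 = AC_cmult[OF AC_mult[OF M AC_mult[OF v2 v2]], of "3 / 2"]
  note t2 = AC_cmult[OF AC_mult[OF M1 AC_mult[OF v1 v2]], of 3]
  note t3 = AC_mult[OF M AC_mult[OF M AC_mult[OF M AC_mult[OF v0 v2]]]]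
  note t4 = AC_cmult[OF AC_mult[OF M AC_mult[OF M AC_mult[OF M AC_mult[OF v1 v1]]]], of 4]
  note t5 = AC_cmult[OF AC_mult[OF M AC_mult[OF M AC_mult[OF M1 AC_mult[OF v0 v1]]]], of 6]
  note t6 = AC_cmult[OF AC_mult[OF M AC_mult[OF M AC_mult[OF M AC_mult[OF M AC_mult[OF M AC_mult[OF v0 v0]]]]]], of "3 / 2"]
  show ?thesis
    unfolding flux_def
    by (rule AC_cong_simple[OF AC_add[OF AC_add[OF AC_add[OF AC_add[OF AC_add[OF t1 t2] t3] t4] t5] t6]])
       (simp_all add: product_form_def bulk_def power2_eq_square power3_eq_cube power4_eq_xxxx algebra_simps)
qed

text \<open>In the variables \<open>X = v2\<close>, \<open>Y = M v1\<close>,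
  \<open>Z = M^2 v0\<close> with \<open>q = M1 / M^2\<close> this is the flux divided by
  \<open>M\<close>. For \<open>q = 0\<close> the form is positive definite, and \<open>1 / 6\<close>
  is small enough to absorb the two mixed terms.\<close>

lemma flux_factor:
  assumes q: "\<bar>q\<bar> \<le> 1 / 6"
  shows "0 \<le> 3 / 2 * X^2 + X * Z + 3 / 2 * Z^2 + 4 * Y^2 + 3 * q * Y * X + 6 * q * Y * (Z::real)"
proof -
  have "\<bar>3 * q * Y * X\<bar> = 3 * \<bar>q\<bar> * \<bar>Y * X\<bar>" by (simp add: abs_mult)
  also have "\<dots> \<le> 1 / 2 * \<bar>Y * X\<bar>" using mult_right_mono[OF q, of "\<bar>Y * X\<bar>"] by simp
  finally have 1: "\<bar>3 * q * Y * X\<bar> \<le> 1 / 2 * \<bar>Y * X\<bar>" .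
  have "\<bar>6 * q * Y * Z\<bar> = 6 * \<bar>q\<bar> * \<bar>Y * Z\<bar>" by (simp add: abs_mult)
  also have "\<dots> \<le> \<bar>Y * Z\<bar>" using mult_right_mono[OF q, of "\<bar>Y * Z\<bar>"] by simp
  finally have 2: "\<bar>6 * q * Y * Z\<bar> \<le> \<bar>Y * Z\<bar>" .
  have 3: "2 * \<bar>Y * X\<bar> \<le> Y^2 + X^2" "2 * \<bar>Y * Z\<bar> \<le> Y^2 + Z^2" "2 * \<bar>X * Z\<bar> \<le> X^2 + Z^2"
    using sum_squares_bound[of "\<bar>Y\<bar>" "\<bar>X\<bar>"] sum_squares_bound[of "\<bar>Y\<bar>" "\<bar>Z\<bar>"] sum_squares_bound[of "\<bar>X\<bar>" "\<bar>Z\<bar>"]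
    by (simp_all add: abs_mult)
  have 4: "0 \<le> X^2" "0 \<le> Y^2" "0 \<le> Z^2" by simp_all
  show ?thesis using 1 2 3 4 by linarith
qed

lemma flux_sign:
  assumes M: "M \<noteq> 0" and M1: "\<bar>M1\<bar> \<le> M^2 / 6"
  shows "0 \<le> M * flux M M1 v0 v1 v2"
proof -
  define q where "q = M1 / M^2"
  have M1q: "M1 = q * M^2" using M by (simp add: q_def)
  have q: "\<bar>q\<bar> \<le> 1 / 6" using M1 M by (simp add: q_def abs_divide pos_divide_le_eq)
  have "M * flux M M1 v0 v1 v2 = M^2 * (3 / 2 * v2^2 + v2 * (M^2 * v0) + 3 / 2 * (M^2 * v0)^2 + 4 * (M * v1)^2
     + 3 * q * (M * v1) * v2 + 6 * q * (M * v1) * (M^2 * v0))"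
    unfolding flux_def M1q by (simp add: power2_eq_square algebra_simps)
  also have "\<dots> \<ge> 0" using flux_factor[OF q] by (intro mult_nonneg_nonneg) auto
  finally show ?thesis .
qed

text \<open>Homogeneity of degree five when \<open>M\<close> and \<open>v1\<close> count once,
  \<open>M1\<close> and \<open>v2\<close> twice and \<open>v0\<close> not at all. For
  \<open>c = sqrt p\<close> the conditions at a node say that the scaled arguments agree on both
  sides.\<close>

lemma flux_scale:
  assumes "c > 0"
  shows "c^4 * flux M M1 v0 v1 v2 = flux (c * M) (c^2 * M1) v0 (c * v1) (c^2 * v2) / c"
  using assms unfolding flux_def by (simp add: field_simps power2_eq_square power4_eq_xxxx)

text \<open>At a node the two sides share the scaled flux \<open>G\<close> and differ by the factor
  \<open>1 / c - 1 / c'\<close>; the sign of \<open>M\<close> there decides the sign of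
  \<open>G\<close>. At the outer ends the sign comes from the weight alone: \<open>M\<close> is
  negative at 0 and positive at \<open>L\<close>, so \<open>flux_sign\<close> settles both
  terms.\<close>

lemma space_flux_nonneg:
  assumes part: "is_partition L N a" and p: "\<And>k. k < N \<Longrightarrow> p k > 0"
    and v: "\<And>k. k \<in> {1..<N} \<Longrightarrow> v0 (k - 1) (a k) = v0 k (a k)"
      "\<And>k. k \<in> {1..<N} \<Longrightarrow> sqrt (p (k - 1)) * v1 (k - 1) (a k) = sqrt (p k) * v1 k (a k)"
      "\<And>k. k \<in> {1..<N} \<Longrightarrow> p (k - 1) * v2 (k - 1) (a k) = p k * v2 k (a k)"
      "v0 0 0 = 0" "v0 (N - 1) L = 0"
    and M: "\<And>k. k \<in> {1..<N} \<Longrightarrow> sqrt (p (k - 1)) * M (k - 1) (a k) = sqrt (p k) * M k (a k)"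
      "\<And>k. k \<in> {1..<N} \<Longrightarrow> p (k - 1) * M1 (k - 1) (a k) = p k * M1 k (a k)"
      "\<And>k. k \<in> {1..<N} \<Longrightarrow> p (k - 1) > p k \<and> M k (a k) < 0 \<or> p (k - 1) < p k \<and> M k (a k) > 0"
      "\<And>k. k \<in> {1..<N} \<Longrightarrow> \<bar>M1 k (a k)\<bar> \<le> (M k (a k))^2 / 6"
      "M 0 0 < 0" "\<bar>M1 0 0\<bar> \<le> (M 0 0)^2 / 6" "M (N - 1) L > 0" "\<bar>M1 (N - 1) L\<bar> \<le> (M (N - 1) L)^2 / 6"
  shows "0 \<le> (\<Sum>k<N. (p k)^2 * flux (M k (a (Suc k))) (M1 k (a (Suc k))) (v0 k (a (Suc k))) (v1 k (a (Suc k))) (v2 k (a (Suc k)))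
      - (p k)^2 * flux (M k (a k)) (M1 k (a k)) (v0 k (a k)) (v1 k (a k)) (v2 k (a k)))"
proof -
  define F where "F k x = (p k)^2 * flux (M k x) (M1 k x) (v0 k x) (v1 k x) (v2 k x)" for k x
  have node: "0 \<le> F (k - 1) (a k) - F k (a k)" if k: "k \<in> {1..<N}" for k
  proof -
    define c where "c = sqrt (p (k - 1))"
    define c' where "c' = sqrt (p k)"
    have pk: "p (k - 1) > 0" "p k > 0" using p k by auto
    have c: "c > 0" "c' > 0" "c^2 = p (k - 1)" "c'^2 = p k" using pk by (auto simp: c_def c'_def)
    have c4: "(p (k - 1))^2 = c^4" "(p k)^2 = c'^4" unfolding c(3,4)[symmetric] by simp_all
    let ?m = "c' * M k (a k)" and ?m1 = "c'^2 * M1 k (a k)" and ?y1 = "c' * v1 k (a k)" and ?y2 = "c'^2 * v2 k (a k)"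
    define G where "G = flux ?m ?m1 (v0 k (a k)) ?y1 ?y2"
    have e: "c * M (k - 1) (a k) = ?m" "c * v1 (k - 1) (a k) = ?y1"
      "c^2 * M1 (k - 1) (a k) = ?m1" "c^2 * v2 (k - 1) (a k) = ?y2"
      using v(2)[OF k] M(1)[OF k] v(3)[OF k] M(2)[OF k] by (simp_all only: c_def[symmetric] c'_def[symmetric] c(3,4))
    have "F (k - 1) (a k) = G / c"
      unfolding F_def c4 flux_scale[OF c(1)] G_def e v(1)[OF k] ..
    moreover have "F k (a k) = G / c'"
      unfolding F_def c4 flux_scale[OF c(2)] G_def ..
    ultimately have e: "F (k - 1) (a k) - F k (a k) = G * (1 / c - 1 / c')" by (simp add: algebra_simps)
    have b: "\<bar>?m1\<bar> \<le> ?m^2 / 6"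
      using mult_left_mono[OF M(4)[OF k], of "c'^2"] by (simp add: abs_mult power_mult_distrib)
    have "?m \<noteq> 0" using M(3)[OF k] c by auto
    from flux_sign[OF this b] have s: "0 \<le> ?m * G" by (simp add: G_def)
    from M(3)[OF k] show ?thesis
    proof
      assume h: "p (k - 1) > p k \<and> M k (a k) < 0"
      then have "c' < c" by (simp add: c_def c'_def)
      then have "1 / c - 1 / c' \<le> 0" using c by (simp add: field_simps)
      moreover have "G \<le> 0" using s h c by (simp add: zero_le_mult_iff mult_less_0_iff)
      ultimately show ?thesis unfolding e by (simp add: mult_nonpos_nonpos)
    next
      assume h: "p (k - 1) < p k \<and> M k (a k) > 0"
      then have "c < c'" by (simp add: c_def c'_def)
      then have "1 / c - 1 / c' \<ge> 0" using c by (simp add: field_simps)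
      moreover have "?m > 0" using h c by simp
      then have "G \<ge> 0" using s zero_le_mult_iff[of ?m G] by auto
      ultimately show ?thesis unfolding e by simp
    qed
  qed
  have "0 \<le> F (N - 1) L"
  proof -
    have "0 \<le> M (N - 1) L * flux (M (N - 1) L) (M1 (N - 1) L) (v0 (N - 1) L) (v1 (N - 1) L) (v2 (N - 1) L)"
      by (rule flux_sign) (use M(7,8) in auto)
    then have "0 \<le> flux (M (N - 1) L) (M1 (N - 1) L) (v0 (N - 1) L) (v1 (N - 1) L) (v2 (N - 1) L)"
      using M(7) by (simp add: zero_le_mult_iff)
    then show ?thesis by (simp add: F_def)
  qed
  moreover have "F 0 0 \<le> 0"
  proof -
    have "0 \<le> M 0 0 * flux (M 0 0) (M1 0 0) (v0 0 0) (v1 0 0) (v2 0 0)"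
      by (rule flux_sign) (use M(5,6) in auto)
    then have "flux (M 0 0) (M1 0 0) (v0 0 0) (v1 0 0) (v2 0 0) \<le> 0"
      using M(5) by (simp add: zero_le_mult_iff)
    then show ?thesis by (simp add: F_def mult_nonneg_nonpos)
  qed
  moreover have "0 \<le> (\<Sum>k\<in>{1..<N}. F (k - 1) (a k) - F k (a k))" by (rule sum_nonneg) (rule node)
  ultimately have "0 \<le> F (N - 1) L - F 0 0 + (\<Sum>k\<in>{1..<N}. F (k - 1) (a k) - F k (a k))" by linarith
  then show ?thesis using telescope_partition[OF part, of F] by (simp add: F_def)
qed

text \<open>Green's identity for the operator that sends \<open>y\<close> to
  \<open>p (\<mu> y')'\<close>. Its flux carries one factor \<open>p\<close>, which splits into
  \<open>sqrt p\<close> for \<mu> and \<open>sqrt p\<close> for the derivative, so the flux is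
  continuous across the nodes; at the outer ends it vanishes with \<open>y0\<close> and
  \<open>z0\<close>.\<close>

lemma symmetric_slices:
  assumes part: "is_partition L N a" and p: "\<And>k. k < N \<Longrightarrow> p k > 0"
    and \<mu>: "\<And>k. k < N \<Longrightarrow> AC (a k) (a (Suc k)) (\<mu> k) (\<mu>1 k)"
      "\<And>k. k \<in> {1..<N} \<Longrightarrow> sqrt (p (k - 1)) * \<mu> (k - 1) (a k) = sqrt (p k) * \<mu> k (a k)"
    and y: "\<And>k. k < N \<Longrightarrow> AC (a k) (a (Suc k)) (y0 k) (y1 k)" "\<And>k. k < N \<Longrightarrow> AC (a k) (a (Suc k)) (y1 k) (y2 k)"
      "\<And>k. k \<in> {1..<N} \<Longrightarrow> y0 (k - 1) (a k) = y0 k (a k)"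
      "\<And>k. k \<in> {1..<N} \<Longrightarrow> sqrt (p (k - 1)) * y1 (k - 1) (a k) = sqrt (p k) * y1 k (a k)"
      "y0 0 0 = 0" "y0 (N - 1) L = 0"
    and z: "\<And>k. k < N \<Longrightarrow> AC (a k) (a (Suc k)) (z0 k) (z1 k)" "\<And>k. k < N \<Longrightarrow> AC (a k) (a (Suc k)) (z1 k) (z2 k)"
      "\<And>k. k \<in> {1..<N} \<Longrightarrow> z0 (k - 1) (a k) = z0 k (a k)"
      "\<And>k. k \<in> {1..<N} \<Longrightarrow> sqrt (p (k - 1)) * z1 (k - 1) (a k) = sqrt (p k) * z1 k (a k)"
      "z0 0 0 = 0" "z0 (N - 1) L = 0"
  shows "(\<Sum>k<N. LBINT x:{a k..a (Suc k)}. p k * (y0 k x * (\<mu>1 k x * z1 k x + \<mu> k x * z2 k x)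
     - z0 k x * (\<mu>1 k x * y1 k x + \<mu> k x * y2 k x))) = 0"
    "\<And>k. k < N \<Longrightarrow> set_integrable lborel {a k..a (Suc k)} (\<lambda>x. y0 k x * (\<mu>1 k x * z1 k x + \<mu> k x * z2 k x))"
    "\<And>k. k < N \<Longrightarrow> set_integrable lborel {a k..a (Suc k)} (\<lambda>x. z0 k x * (\<mu>1 k x * y1 k x + \<mu> k x * y2 k x))"
proof -
  define F where "F k x = p k * (y0 k x * (\<mu> k x * z1 k x) - z0 k x * (\<mu> k x * y1 k x))" for k x
  have AC: "AC (a k) (a (Suc k)) (F k) (\<lambda>x. p k * (y0 k x * (\<mu>1 k x * z1 k x + \<mu> k x * z2 k x)
     - z0 k x * (\<mu>1 k x * y1 k x + \<mu> k x * y2 k x)))" if k: "k < N" for k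
  proof -
    note 1 = AC_mult[OF y(1)[OF k] AC_mult[OF \<mu>(1)[OF k] z(2)[OF k]]]
    note 2 = AC_mult[OF z(1)[OF k] AC_mult[OF \<mu>(1)[OF k] y(2)[OF k]]]
    show ?thesis
      by (rule AC_cong_simple[OF AC_cmult[OF AC_diff[OF 1 2], of "p k"]]) (simp_all add: F_def algebra_simps)
  qed
  have lt: "a k \<le> a (Suc k)" if "k < N" for k using partition_subint(1)[OF part that] by simp
  have "(\<Sum>k<N. LBINT x:{a k..a (Suc k)}. p k * (y0 k x * (\<mu>1 k x * z1 k x + \<mu> k x * z2 k x)
     - z0 k x * (\<mu>1 k x * y1 k x + \<mu> k x * y2 k x))) = (\<Sum>k<N. F k (a (Suc k)) - F k (a k))"
    by (rule sum.cong) (use AC_integral[OF AC lt] in auto)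
  also have "\<dots> = F (N - 1) L - F 0 0 + (\<Sum>k\<in>{1..<N}. F (k - 1) (a k) - F k (a k))"
    by (rule telescope_partition[OF part])
  also have "\<dots> = 0"
  proof -
    have "F (k - 1) (a k) = F k (a k)" if k: "k \<in> {1..<N}" for k
    proof -
      have pk: "p (k - 1) > 0" "p k > 0" using p k by auto
      obtain c where c: "sqrt (p (k - 1)) = c" "p (k - 1) = c * c" using pk by (metis less_imp_le real_sqrt_mult_self abs_of_nonneg)
      obtain c' where c': "sqrt (p k) = c'" "p k = c' * c'" using pk by (metis less_imp_le real_sqrt_mult_self abs_of_nonneg)
      have "F (k - 1) (a k) = y0 k (a k) * ((c * \<mu> (k - 1) (a k)) * (c * z1 (k - 1) (a k)))
         - z0 k (a k) * ((c * \<mu> (k - 1) (a k)) * (c * y1 (k - 1) (a k)))"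
        unfolding F_def y(3)[OF k] z(3)[OF k] c(2) by (simp add: algebra_simps)
      also have "\<dots> = F k (a k)"
        unfolding F_def \<mu>(2)[OF k, unfolded c(1) c'(1)] y(4)[OF k, unfolded c(1) c'(1)] z(4)[OF k, unfolded c(1) c'(1)] c'(2)
        by (simp add: algebra_simps)
      finally show ?thesis .
    qed
    then show ?thesis using y(5,6) z(5,6) by (simp add: F_def)
  qed
  finally show "(\<Sum>k<N. LBINT x:{a k..a (Suc k)}. p k * (y0 k x * (\<mu>1 k x * z1 k x + \<mu> k x * z2 k x)
     - z0 k x * (\<mu>1 k x * y1 k x + \<mu> k x * y2 k x))) = 0" .
  have i: "set_integrable lborel {a k..a (Suc k)} (\<lambda>x. f x * (\<mu>1 k x * g1 x + \<mu> k x * g2 x))"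
    if k: "k < N" and f: "AC (a k) (a (Suc k)) f f'" and g: "AC (a k) (a (Suc k)) g1 g2" for k f f' g1 g2
    using set_integrable_mult_continuous[OF AC_integrable[OF AC_mult[OF \<mu>(1)[OF k] g]] AC_continuous[OF f]]
    by (simp add: mult.commute)
  show "set_integrable lborel {a k..a (Suc k)} (\<lambda>x. y0 k x * (\<mu>1 k x * z1 k x + \<mu> k x * z2 k x))"
    "set_integrable lborel {a k..a (Suc k)} (\<lambda>x. z0 k x * (\<mu>1 k x * y1 k x + \<mu> k x * y2 k x))" if k: "k < N" for k
    by (rule i[OF k y(1)[OF k] z(2)[OF k]], rule i[OF k z(1)[OF k] y(2)[OF k]])
qed

section \<open>Pointwise bounds for the quadratic forms\<close>

lemma abs_mult_le: "\<bar>x\<bar> \<le> a \<Longrightarrow> \<bar>y\<bar> \<le> b \<Longrightarrow> \<bar>x * y\<bar> \<le> a * (b::real)"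
  unfolding abs_mult by (intro mult_mono) auto

lemma abs_triangle_3: "\<bar>\<alpha> * x + \<beta> * y + z\<bar> \<le> \<bar>\<alpha>\<bar> * \<bar>x\<bar> + \<bar>\<beta>\<bar> * \<bar>y\<bar> + \<bar>z :: real\<bar>"
  unfolding abs_mult[symmetric] by linarith

text \<open>In the variables \<open>X = v2\<close>, \<open>Y = \<sigma> v1\<close>,
  \<open>Z = \<sigma>^2 v0\<close> the leading part carries one power of \<sigma> and the remaining
  terms none, so that the orders can be compared by their factors alone.\<close>

lemma bulk_scaled:
  assumes "\<sigma> > 0"
  shows "bulk (- \<sigma> * b1) (- \<sigma> * g) (- \<sigma> * n) (Z / \<sigma>^2) (Y / \<sigma>) X =
    9 / 2 * \<sigma> * g * (X^2 + 2 * b1^2 * Y^2 + b1^4 * Z^2) + 3 * n * (X * Y) + (6 * b1^2 * n + 3 * b1 * g^2) * (Y * Z)"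
  using assms unfolding bulk_def
  by (simp add: field_simps power2_eq_square power4_eq_xxxx power3_eq_cube)

text \<open>When \<open>b1\<close>, \<open>b2\<close>, \<open>b3\<close> are the derivatives of
  \<beta>, the two expressions are the first and second derivatives of
  \<open>exp (l \<beta>) * b1\<close>, divided by \<open>exp (l \<beta>)\<close>.\<close>

lemma weight_derivative_bounds:
  assumes K: "K \<ge> 1" and l: "l \<ge> (1::real)" and b: "\<bar>b1\<bar> \<le> K" "\<bar>b2\<bar> \<le> K" "\<bar>b3\<bar> \<le> K"
  shows "\<bar>l * b1^2 + b2\<bar> \<le> 2 * K^2 * l" "\<bar>l^2 * b1^3 + 3 * l * b1 * b2 + b3\<bar> \<le> 5 * K^3 * l^2"
proof -
  have pw: "\<bar>b1^2\<bar> \<le> K^2" "\<bar>b1^3\<bar> \<le> K^3"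
    using power_mono[OF b(1), of 2] power_mono[OF b(1), of 3] by (simp_all add: power_abs)
  have Kp: "K \<le> K^2" "K \<le> K^3" "K^2 \<le> K^3" using K by (simp_all add: self_le_power power_increasing)
  have lp: "l \<le> l^2" "1 \<le> l^2" using l by (simp_all add: self_le_power)
  have "\<bar>l * b1^2\<bar> \<le> l * K^2" using pw(1) l by (intro abs_mult_le) auto
  moreover have "K \<le> l * K^2" using mult_mono[of 1 l K "K^2"] l Kp K by simp
  ultimately show "\<bar>l * b1^2 + b2\<bar> \<le> 2 * K^2 * l" using b(2) by (simp add: algebra_simps)
  have 1: "\<bar>l^2 * b1^3\<bar> \<le> l^2 * K^3" using pw(2) by (intro abs_mult_le) auto
  have "\<bar>l * (b1 * b2)\<bar> \<le> l * (K * K)" using b l by (intro abs_mult_le) auto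
  also have "\<dots> \<le> l^2 * K^3" using mult_mono[of l "l^2" "K * K" "K^3"] lp Kp K l by (simp add: power2_eq_square)
  finally have 2: "\<bar>l * (b1 * b2)\<bar> \<le> l^2 * K^3" .
  have 3: "K \<le> l^2 * K^3" using mult_mono[of 1 "l^2" K "K^3"] lp Kp K by simp
  have "\<bar>l^2 * b1^3 + 3 * l * b1 * b2 + b3\<bar> \<le> \<bar>l^2 * b1^3\<bar> + 3 * \<bar>l * (b1 * b2)\<bar> + \<bar>b3\<bar>"
    using abs_triangle_3[of 1 "l^2 * b1^3" 3 "l * (b1 * b2)" b3] by (simp only: mult.assoc abs_one mult_1 abs_numeral)
  also have "\<dots> \<le> 5 * (l^2 * K^3)" using 1 2 3 b(3) by linarith
  finally show "\<bar>l^2 * b1^3 + 3 * l * b1 * b2 + b3\<bar> \<le> 5 * K^3 * l^2" by (simp add: mult.commute mult.left_commute)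
qed

lemma abs_mult_le_sum_sq:
  "\<bar>X * Y\<bar> \<le> X^2 + Y^2 + (Z::real)^2" "\<bar>X * Z\<bar> \<le> X^2 + Y^2 + Z^2" "\<bar>Y * Z\<bar> \<le> X^2 + Y^2 + Z^2"
proof -
  have 3: "2 * \<bar>X * Y\<bar> \<le> X^2 + Y^2" "2 * \<bar>Y * Z\<bar> \<le> Y^2 + Z^2" "2 * \<bar>X * Z\<bar> \<le> X^2 + Z^2"
    using sum_squares_bound[of "\<bar>X\<bar>" "\<bar>Y\<bar>"] sum_squares_bound[of "\<bar>Y\<bar>" "\<bar>Z\<bar>"] sum_squares_bound[of "\<bar>X\<bar>" "\<bar>Z\<bar>"]
    by (simp_all add: abs_mult)
  have 4: "0 \<le> X^2" "0 \<le> Y^2" "0 \<le> Z^2" "0 \<le> \<bar>X * Y\<bar>" "0 \<le> \<bar>X * Z\<bar>" "0 \<le> \<bar>Y * Z\<bar>" by simp_all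
  show "\<bar>X * Y\<bar> \<le> X^2 + Y^2 + Z^2" "\<bar>X * Z\<bar> \<le> X^2 + Y^2 + Z^2" "\<bar>Y * Z\<bar> \<le> X^2 + Y^2 + Z^2"
    using 3 4 by linarith+
qed

text \<open>The constant 57 is \<open>3 * 5\<close> from the first product plus
  \<open>6 * 5 + 3 * 4\<close> from the second. The bound has order \<open>l^2\<close> and is beaten
  by a leading part of order \<open>\<sigma> l\<close> once \<sigma> is a large multiple of
  \<open>l\<close>.\<close>

lemma bulk_lower_order:
  assumes K: "K \<ge> 1" and l: "l \<ge> (1::real)" and b: "\<bar>b1\<bar> \<le> K"
    and g: "\<bar>g\<bar> \<le> 2 * K^2 * l" and n: "\<bar>n\<bar> \<le> 5 * K^3 * l^2"
  shows "\<bar>3 * n * (X * Y) + (6 * b1^2 * n + 3 * b1 * g^2) * (Y * Z)\<bar> \<le> 57 * K^5 * l^2 * (X^2 + Y^2 + Z^2)"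
proof -
  define S where "S = X^2 + Y^2 + Z^2"
  have S: "S \<ge> 0" by (simp add: S_def)
  have pw: "\<bar>b1^2\<bar> \<le> K^2" using power_mono[OF b, of 2] by simp
  have g2: "\<bar>g^2\<bar> \<le> 4 * K^4 * l^2"
    using power_mono[OF g, of 2] by (simp add: power_mult_distrib)
  have 1: "\<bar>n * (X * Y)\<bar> \<le> 5 * K^3 * l^2 * S" using n abs_mult_le_sum_sq(1)[of X Y Z] by (intro abs_mult_le) (auto simp: S_def)
  have "5 * K^3 * l^2 * S \<le> 5 * K^5 * l^2 * S" using K S by (intro mult_right_mono mult_left_mono power_increasing) auto
  with 1 have 1: "\<bar>n * (X * Y)\<bar> \<le> 5 * K^5 * l^2 * S" by linarith
  have "\<bar>b1^2 * n\<bar> \<le> K^2 * (5 * K^3 * l^2)" using pw n by (intro abs_mult_le)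
  also have "\<dots> = 5 * K^5 * l^2" by (simp add: eval_nat_numeral)
  finally have a2: "\<bar>b1^2 * n\<bar> \<le> 5 * K^5 * l^2" .
  have "\<bar>b1 * g^2\<bar> \<le> K * (4 * K^4 * l^2)" using b g2 by (intro abs_mult_le)
  also have "\<dots> = 4 * K^5 * l^2" by (simp add: eval_nat_numeral)
  finally have a3: "\<bar>b1 * g^2\<bar> \<le> 4 * K^5 * l^2" .
  have "\<bar>6 * b1^2 * n + 3 * b1 * g^2\<bar> \<le> 6 * \<bar>b1^2 * n\<bar> + 3 * \<bar>b1 * g^2\<bar>"
    using abs_triangle_3[of 6 "b1^2 * n" 3 "b1 * g^2" 0] by (simp only: mult.assoc abs_numeral abs_zero add_0_right)
  also have "\<dots> \<le> 42 * K^5 * l^2" using a2 a3 by linarith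
  finally have "\<bar>(6 * b1^2 * n + 3 * b1 * g^2) * (Y * Z)\<bar> \<le> 42 * K^5 * l^2 * S"
    using abs_mult_le_sum_sq(3)[of Y Z X] by (intro abs_mult_le) (auto simp: S_def)
  moreover have "\<bar>3 * n * (X * Y)\<bar> = 3 * \<bar>n * (X * Y)\<bar>" by (simp add: abs_mult)
  ultimately show ?thesis using 1 unfolding S_def[symmetric]
    by (simp add: abs_le_iff)
qed

text \<open>Assumption \<open>l0\<close> makes \<open>l b1^2\<close> win over \<open>b2\<close>, so
  that \<open>g \<ge> l \<rho>^2 / 2\<close> and the leading part is at least \<open>9 / 4\<close>
  of the claimed bound. By \<open>s0\<close> the lower order terms cost at most one such unit, and
  \<open>5 / 4\<close> remains.\<close>

lemma bulk_lower:
  assumes K: "K \<ge> 1" and l: "l \<ge> (1::real)" and b: "\<bar>b1\<bar> \<le> K" "\<bar>b2\<bar> \<le> K" "\<bar>b3\<bar> \<le> K" and \<sigma>: "\<sigma> > 0"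
    and \<rho>: "0 < \<rho>" "\<rho> \<le> 1" "\<rho> \<le> \<bar>b1\<bar>" and l0: "2 * K \<le> l * \<rho>^2" and s0: "57 * K^5 * l \<le> \<rho>^6 * \<sigma>"
  shows "\<rho>^6 * \<sigma> * l * (X^2 + Y^2 + Z^2) \<le> bulk (- \<sigma> * b1) (- \<sigma> * (l * b1^2 + b2))
     (- \<sigma> * (l^2 * b1^3 + 3 * l * b1 * b2 + b3)) (Z / \<sigma>^2) (Y / \<sigma>) X"
proof -
  define S where "S = X^2 + Y^2 + Z^2"
  define g where "g = l * b1^2 + b2"
  define n where "n = l^2 * b1^3 + 3 * l * b1 * b2 + b3"
  have S: "S \<ge> 0" by (simp add: S_def)
  note gn = weight_derivative_bounds[OF K l b, folded g_def n_def]
  have r2: "\<rho>^2 \<le> b1^2" using power_mono[OF \<rho>(3), of 2] \<rho> by simp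
  have r4: "\<rho>^4 \<le> b1^4" using power_mono[OF \<rho>(3), of 4] \<rho> by simp
  have rr: "\<rho>^4 \<le> 1" "\<rho>^4 \<le> \<rho>^2" using \<rho> by (simp_all add: power_le_one power_decreasing)
  have "l * \<rho>^2 \<le> l * b1^2" using r2 l by simp
  then have g: "l * \<rho>^2 / 2 \<le> g" using l0 b(2) unfolding g_def by (simp add: abs_le_iff)
  have q: "\<rho>^4 * S \<le> X^2 + 2 * b1^2 * Y^2 + b1^4 * Z^2"
  proof -
    have "\<rho>^4 * X^2 \<le> 1 * X^2" "\<rho>^4 * Y^2 \<le> b1^2 * Y^2" "\<rho>^4 * Z^2 \<le> b1^4 * Z^2" "0 \<le> b1^2 * Y^2"
      by (rule mult_right_mono; use rr r2 r4 in simp)+ simp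
    then show ?thesis unfolding S_def distrib_left by linarith
  qed
  have "9 / 4 * \<rho>^6 * \<sigma> * l * S = 9 / 2 * \<sigma> * ((l * \<rho>^2 / 2) * (\<rho>^4 * S))" by (simp add: eval_nat_numeral)
  also have "\<dots> \<le> 9 / 2 * \<sigma> * (g * (X^2 + 2 * b1^2 * Y^2 + b1^4 * Z^2))"
  proof (intro mult_left_mono mult_mono g q)
    show "0 \<le> g" using g l by (smt (verit) zero_le_power2 mult_nonneg_nonneg divide_nonneg_pos)
  qed (use \<sigma> S in auto)
  finally have main: "9 / 4 * \<rho>^6 * \<sigma> * l * S \<le> 9 / 2 * \<sigma> * g * (X^2 + 2 * b1^2 * Y^2 + b1^4 * Z^2)"
    by (simp add: mult.assoc)
  have "57 * K^5 * l^2 * S \<le> \<rho>^6 * \<sigma> * l * S"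
    using mult_right_mono[OF s0, of "l * S"] l S by (simp add: power2_eq_square mult.assoc)
  moreover have "9 / 4 * \<rho>^6 * \<sigma> * l * S - 57 * K^5 * l^2 * S \<le> bulk (- \<sigma> * b1) (- \<sigma> * g) (- \<sigma> * n) (Z / \<sigma>^2) (Y / \<sigma>) X"
    using main abs_le_D2[OF bulk_lower_order[OF K l b(1) gn, of X Y Z]] unfolding bulk_scaled[OF \<sigma>] S_def[symmetric]
    by linarith
  moreover have "0 \<le> \<rho>^6 * \<sigma> * l * S" using \<rho> \<sigma> l S by simp
  ultimately show ?thesis unfolding S_def g_def n_def by linarith
qed

text \<open>For use where \<open>b1\<close> may vanish and the form has no sign. The constant is 18
  from the leading part plus 57 from the lower order terms.\<close>

lemma bulk_upper:
  assumes K: "K \<ge> 1" and l: "l \<ge> (1::real)" and b: "\<bar>b1\<bar> \<le> K" "\<bar>b2\<bar> \<le> K" "\<bar>b3\<bar> \<le> K" and \<sigma>: "\<sigma> \<ge> l"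
  shows "- (75 * K^6 * \<sigma> * l * (X^2 + Y^2 + Z^2)) \<le> bulk (- \<sigma> * b1) (- \<sigma> * (l * b1^2 + b2))
     (- \<sigma> * (l^2 * b1^3 + 3 * l * b1 * b2 + b3)) (Z / \<sigma>^2) (Y / \<sigma>) X"
proof -
  define S where "S = X^2 + Y^2 + Z^2"
  define g where "g = l * b1^2 + b2"
  define n where "n = l^2 * b1^3 + 3 * l * b1 * b2 + b3"
  have S: "S \<ge> 0" by (simp add: S_def)
  have s: "\<sigma> > 0" using \<sigma> l by simp
  note gn = weight_derivative_bounds[OF K l b, folded g_def n_def]
  have b2: "b1^2 \<le> K^2" "b1^4 \<le> K^4" using power_mono[OF b(1), of 2] power_mono[OF b(1), of 4] by simp_all
  have K4: "1 \<le> K^4" "K^2 \<le> K^4" using K by (simp_all add: power_increasing)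
  have q: "\<bar>X^2 + 2 * b1^2 * Y^2 + b1^4 * Z^2\<bar> \<le> 2 * K^4 * S"
  proof -
    have "1 * X^2 \<le> (2 * K^4) * X^2" "(2 * b1^2) * Y^2 \<le> (2 * K^4) * Y^2" "b1^4 * Z^2 \<le> (2 * K^4) * Z^2"
      by (rule mult_right_mono; use b2 K4 in simp)+
    moreover have "0 \<le> X^2 + 2 * b1^2 * Y^2 + b1^4 * Z^2" by simp
    ultimately show ?thesis unfolding S_def by (simp add: distrib_left)
  qed
  have "\<bar>g * (X^2 + 2 * b1^2 * Y^2 + b1^4 * Z^2)\<bar> \<le> 2 * K^2 * l * (2 * K^4 * S)" by (rule abs_mult_le[OF gn(1) q])
  then have "\<bar>9 / 2 * \<sigma> * (g * (X^2 + 2 * b1^2 * Y^2 + b1^4 * Z^2))\<bar> \<le> 9 / 2 * \<sigma> * (2 * K^2 * l * (2 * K^4 * S))"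
    by (rule abs_mult_le[rotated]) (use s in auto)
  also have "\<dots> = 18 * K^6 * \<sigma> * l * S" by (simp add: eval_nat_numeral)
  finally have 1: "\<bar>9 / 2 * \<sigma> * g * (X^2 + 2 * b1^2 * Y^2 + b1^4 * Z^2)\<bar> \<le> 18 * K^6 * \<sigma> * l * S" by (simp add: mult.assoc)
  have "57 * K^5 * l^2 * S \<le> 57 * K^6 * \<sigma> * l * S"
  proof -
    have "K^5 * l^2 \<le> K^6 * (\<sigma> * l)"
      using K l \<sigma> by (intro mult_mono power_increasing) (auto simp: power2_eq_square)
    from mult_right_mono[OF this S] show ?thesis by simp
  qed
  then show ?thesis
    using abs_le_D2[OF 1] abs_le_D2[OF bulk_lower_order[OF K l b(1) gn, of X Y Z]]
    unfolding bulk_scaled[OF s] S_def[symmetric] g_def[symmetric] n_def[symmetric]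
    by linarith
qed

text \<open>The factor 30 is \<open>27 + 2 + 1\<close>, collected from the coefficient of
  \<open>z^2\<close>; the other two coefficients are smaller.\<close>

lemma quad_form_bound:
  assumes K: "K \<ge> (1::real)" and b: "\<bar>\<alpha>\<bar> \<le> 2 * K" "\<bar>\<beta>\<bar> \<le> 3 * K^2" "\<bar>\<delta>\<bar> \<le> K"
  shows "(x + \<alpha> * y + \<beta> * z)^2 + (y + \<delta> * z)^2 + z^2 \<le> 30 * K^4 * (x^2 + y^2 + z^2)"
proof -
  have sq: "\<alpha>^2 \<le> 4 * K^2" "\<beta>^2 \<le> 9 * K^4" "\<delta>^2 \<le> K^2"
    using power_mono[OF b(1), of 2] power_mono[OF b(2), of 2] power_mono[OF b(3), of 2]
    by (simp_all add: power_mult_distrib)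
  have K4: "1 \<le> K^4" "K^2 \<le> K^4" using K by (simp_all add: power_increasing)
  have "(p + q + r)^2 \<le> 3 * p^2 + 3 * q^2 + 3 * r^2" for p q r :: real
    using zero_le_power2[of "p - q"] zero_le_power2[of "p - r"] zero_le_power2[of "q - r"]
    by (simp add: power2_eq_square algebra_simps)
  from this[of x "\<alpha> * y" "\<beta> * z"]
  have 1: "(x + \<alpha> * y + \<beta> * z)^2 \<le> 3 * x^2 + 3 * (\<alpha>^2 * y^2) + 3 * (\<beta>^2 * z^2)" by (simp add: power_mult_distrib)
  have "(p + q)^2 \<le> 2 * p^2 + 2 * q^2" for p q :: real
    using zero_le_power2[of "p - q"] by (simp add: power2_eq_square algebra_simps)
  from this[of y "\<delta> * z"]
  have 2: "(y + \<delta> * z)^2 \<le> 2 * y^2 + 2 * (\<delta>^2 * z^2)" by (simp add: power_mult_distrib)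
  have 3: "\<alpha>^2 * y^2 \<le> 4 * K^4 * y^2" "\<beta>^2 * z^2 \<le> 9 * K^4 * z^2" "\<delta>^2 * z^2 \<le> K^4 * z^2"
    "1 * x^2 \<le> K^4 * x^2" "1 * y^2 \<le> K^4 * y^2" "1 * z^2 \<le> K^4 * z^2"
    by (rule mult_right_mono; use sq K4 in simp)+
  have 4: "0 \<le> K^4 * x^2" "0 \<le> K^4 * y^2" "0 \<le> K^4 * z^2" by simp_all
  have "(x + \<alpha> * y + \<beta> * z)^2 + (y + \<delta> * z)^2 + z^2 \<le> 30 * (K^4 * x^2) + 30 * (K^4 * y^2) + 30 * (K^4 * z^2)"
    using 1 2 3 4 by linarith
  then show ?thesis by (simp add: distrib_left)
qed

text \<open>After scaling, the passage from \<open>m u2\<close>, \<open>\<sigma> m u1\<close>,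
  \<open>\<sigma>^2 m u0\<close> to \<open>v2\<close>, \<open>\<sigma> v1\<close>,
  \<open>\<sigma>^2 v0\<close> is triangular with ones on the diagonal and bounded coefficients. Its
  inverse has the same shape, which gives both inequalities from
  \<open>quad_form_bound\<close>.\<close>

lemma energy_equivalence:
  fixes m u0 u1 u2 :: real
  assumes K: "K \<ge> (1::real)" and \<sigma>: "\<sigma> > 0" and b: "\<bar>b1\<bar> \<le> K" and g: "\<bar>g\<bar> \<le> 2 * K^2 * \<sigma>"
  defines "v0 \<equiv> m * u0" and "v1 \<equiv> m * (u1 - (- \<sigma> * b1) * u0)"
    and "v2 \<equiv> m * (u2 - 2 * (- \<sigma> * b1) * u1 + ((- \<sigma> * b1)^2 - (- \<sigma> * g)) * u0)"
  shows "m^2 * (\<sigma>^4 * u0^2 + \<sigma>^2 * u1^2 + u2^2) \<le> 30 * K^4 * (v2^2 + (\<sigma> * v1)^2 + (\<sigma>^2 * v0)^2)"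
    "v2^2 + (\<sigma> * v1)^2 + (\<sigma>^2 * v0)^2 \<le> 30 * K^4 * (m^2 * (\<sigma>^4 * u0^2 + \<sigma>^2 * u1^2 + u2^2))"
proof -
  define A where "A = \<sigma>^2 * m * u0"
  define B where "B = \<sigma> * m * u1"
  define C where "C = m * u2"
  define \<gamma> where "\<gamma> = g / \<sigma>"
  have g': "g = \<gamma> * \<sigma>" using \<sigma> by (simp add: \<gamma>_def)
  have ga: "\<bar>\<gamma>\<bar> \<le> 2 * K^2" using g \<sigma> by (simp add: \<gamma>_def abs_divide pos_divide_le_eq)
  have b2: "\<bar>b1^2\<bar> \<le> K^2" using power_mono[OF b, of 2] by simp
  have Z: "\<sigma>^2 * v0 = A" by (simp add: v0_def A_def)
  have Y: "\<sigma> * v1 = B + b1 * A" unfolding v1_def A_def B_def by (simp add: algebra_simps power2_eq_square)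
  have X: "v2 = C + 2 * b1 * B + (b1^2 + \<gamma>) * A"
    unfolding v2_def A_def B_def C_def g' by (simp add: algebra_simps power2_eq_square)
  have E: "m^2 * (\<sigma>^4 * u0^2 + \<sigma>^2 * u1^2 + u2^2) = C^2 + B^2 + A^2"
    unfolding A_def B_def C_def by (simp add: algebra_simps power_mult_distrib eval_nat_numeral)
  have bg: "\<bar>b1^2 + \<gamma>\<bar> \<le> 3 * K^2" "\<bar>b1^2 - \<gamma>\<bar> \<le> 3 * K^2" using b2 ga zero_le_power2[of b1] unfolding abs_le_iff by linarith+
  show "v2^2 + (\<sigma> * v1)^2 + (\<sigma>^2 * v0)^2 \<le> 30 * K^4 * (m^2 * (\<sigma>^4 * u0^2 + \<sigma>^2 * u1^2 + u2^2))"
    unfolding E X Y Z by (rule quad_form_bound[OF K _ bg(1) b]) (use b in \<open>simp add: abs_mult\<close>)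
  have c: "C = v2 + (- 2 * b1) * (\<sigma> * v1) + (b1^2 - \<gamma>) * (\<sigma>^2 * v0)" "B = \<sigma> * v1 + (- b1) * (\<sigma>^2 * v0)"
    unfolding X Y Z by (simp_all add: algebra_simps power2_eq_square)
  show "m^2 * (\<sigma>^4 * u0^2 + \<sigma>^2 * u1^2 + u2^2) \<le> 30 * K^4 * (v2^2 + (\<sigma> * v1)^2 + (\<sigma>^2 * v0)^2)"
    unfolding E Z[symmetric] unfolding c by (rule quad_form_bound[OF K _ bg(2)]) (use b in \<open>simp_all add: abs_mult\<close>)
qed

text \<open>Each of the three products is of order \<open>1 / \<sigma>\<close> in the scaled
  variables, and \<tau> is at most \<open>T \<sigma>\<close>, so the error has order zero in
  \<sigma>.\<close>

lemma time_error_bound: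
  assumes K: "K \<ge> (1::real)" and \<sigma>: "\<sigma> > 0" and b: "\<bar>b1\<bar> \<le> K" and g: "\<bar>g\<bar> \<le> 2 * K^2 * \<sigma>"
    and \<tau>: "\<bar>\<tau>\<bar> \<le> T * \<sigma>" and p: "0 \<le> p"
  shows "\<bar>3 / 2 * p * \<tau> * (Z / \<sigma>^2 * (- \<sigma> * g) * (Y / \<sigma>) + Z / \<sigma>^2 * (- \<sigma> * b1) * X + (- \<sigma> * b1)^3 * (Z / \<sigma>^2)^2)\<bar>
     \<le> 6 * p * T * K^3 * (X^2 + Y^2 + Z^2)"
proof -
  define S where "S = X^2 + Y^2 + Z^2"
  define \<gamma> where "\<gamma> = g / \<sigma>"
  define t where "t = \<tau> / \<sigma>"
  have g': "g = \<gamma> * \<sigma>" and t': "\<tau> = t * \<sigma>" using \<sigma> by (simp_all add: \<gamma>_def t_def)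
  have ga: "\<bar>\<gamma>\<bar> \<le> 2 * K^2" using g \<sigma> by (simp add: \<gamma>_def abs_divide pos_divide_le_eq)
  have ta: "\<bar>t\<bar> \<le> T" using \<tau> \<sigma> by (simp add: t_def abs_divide pos_divide_le_eq)
  have b3: "\<bar>b1^3\<bar> \<le> K^3" using power_mono[OF b, of 3] by (simp add: power_abs)
  have Kp: "K \<le> K^3" "K^2 \<le> K^3" using K by (simp_all add: self_le_power power_increasing)
  have S: "S \<ge> 0" "Z^2 \<le> S" by (auto simp: S_def)
  have e: "3 / 2 * p * \<tau> * (Z / \<sigma>^2 * (- \<sigma> * g) * (Y / \<sigma>) + Z / \<sigma>^2 * (- \<sigma> * b1) * X + (- \<sigma> * b1)^3 * (Z / \<sigma>^2)^2)
    = (3 / 2 * p) * (t * (- (\<gamma> * (Y * Z)) - b1 * (X * Z) - b1^3 * Z^2))"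
    unfolding g' t' using \<sigma> by (simp add: field_simps eval_nat_numeral)
  have 1: "\<bar>\<gamma> * (Y * Z)\<bar> \<le> 2 * K^2 * S" "\<bar>b1 * (X * Z)\<bar> \<le> K * S" "\<bar>b1^3 * Z^2\<bar> \<le> K^3 * S"
    by (rule abs_mult_le; use ga b b3 abs_mult_le_sum_sq(2)[of X Z Y] abs_mult_le_sum_sq(3)[of Y Z X] S in \<open>simp add: S_def\<close>)+
  have "K * S \<le> K^3 * S" "K^2 * S \<le> K^3 * S" using Kp S by (auto intro!: mult_right_mono)
  then have "\<bar>- (\<gamma> * (Y * Z)) - b1 * (X * Z) - b1^3 * Z^2\<bar> \<le> 4 * (K^3 * S)" using 1 by linarith
  then have "\<bar>t * (- (\<gamma> * (Y * Z)) - b1 * (X * Z) - b1^3 * Z^2)\<bar> \<le> T * (4 * (K^3 * S))" by (rule abs_mult_le[OF ta])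
  then have "\<bar>(3 / 2 * p) * (t * (- (\<gamma> * (Y * Z)) - b1 * (X * Z) - b1^3 * Z^2))\<bar> \<le> (3 / 2 * p) * (T * (4 * (K^3 * S)))"
    by (rule abs_mult_le[rotated]) (use p in simp)
  moreover have "(3 / 2 * p) * (T * (4 * (K^3 * S))) = 6 * p * T * K^3 * S" by simp
  ultimately show ?thesis unfolding e S_def[symmetric] by (simp only:)
qed

text \<open>The terms of the conjugated operator outside both parts. The term with \<open>e\<close>
  is bounded because \<open>|e| \<le> T \<sigma>^2\<close>; the term with \<open>n\<close>, which
  comes from the second derivative of \<open>M\<close>, is of order
  \<open>l^2 / \<sigma> \<le> l\<close> and causes the factor \<open>l^2\<close> of the
  square.\<close>

lemma residual_bound:
  assumes K: "K \<ge> (1::real)" and l: "l \<ge> 1" and \<sigma>: "\<sigma> \<ge> l" and b: "\<bar>b1\<bar> \<le> K" and n: "\<bar>n\<bar> \<le> 5 * K^3 * l^2"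
    and B: "\<bar>B\<bar> \<le> Mb" "\<bar>D\<bar> \<le> Mb" and e: "\<bar>e\<bar> \<le> T * \<sigma>^2" and p: "0 \<le> p" "p \<le> pM" and T: "T \<ge> 0"
  shows "(- B * (Y / \<sigma> + (- \<sigma> * b1) * (Z / \<sigma>^2)) - D * (Z / \<sigma>^2) - e * (Z / \<sigma>^2) - p * (- \<sigma> * n) * (Z / \<sigma>^2))^2
     \<le> 2 * (2 * Mb * K + T + 5 * pM * K^3)^2 * l^2 * (X^2 + Y^2 + Z^2)"
proof -
  define C where "C = 2 * Mb * K + T + 5 * pM * K^3"
  have s1: "\<sigma> \<ge> 1" using \<sigma> l by simp
  have Mb: "Mb \<ge> 0" using B by linarith
  have i1: "\<bar>1 / \<sigma>\<bar> \<le> 1" "\<bar>1 / \<sigma>^2\<bar> \<le> 1" using s1 by (simp_all add: divide_le_eq one_le_power)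
  have "- B * (Y / \<sigma> + (- \<sigma> * b1) * (Z / \<sigma>^2)) - D * (Z / \<sigma>^2) - e * (Z / \<sigma>^2) - p * (- \<sigma> * n) * (Z / \<sigma>^2)
    = - (B * (1 / \<sigma>)) * Y + (B * (b1 * (1 / \<sigma>)) - D * (1 / \<sigma>^2) - e / \<sigma>^2 + p * (n / \<sigma>)) * Z" (is "?R = _")
    using s1 by (simp add: field_simps power2_eq_square)
  moreover have a1: "\<bar>- (B * (1 / \<sigma>))\<bar> \<le> C * l"
  proof -
    have "\<bar>B * (1 / \<sigma>)\<bar> \<le> Mb * 1" by (rule abs_mult_le[OF B(1) i1(1)])
    also have "\<dots> \<le> 2 * Mb * K" using Mb K mult_left_mono[of 1 K Mb] by simp
    also have "\<dots> \<le> C" using T p K by (simp add: C_def)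
    also have "C \<le> C * l"
    proof -
      have "0 \<le> C" unfolding C_def using Mb T p K by (intro add_nonneg_nonneg mult_nonneg_nonneg) auto
      from mult_left_mono[OF l this] show ?thesis by simp
    qed
    finally show ?thesis by simp
  qed
  moreover have a2: "\<bar>B * (b1 * (1 / \<sigma>)) - D * (1 / \<sigma>^2) - e / \<sigma>^2 + p * (n / \<sigma>)\<bar> \<le> C * l"
  proof -
    have 1: "\<bar>B * (b1 * (1 / \<sigma>))\<bar> \<le> Mb * (K * 1)" by (intro abs_mult_le B b i1)
    have 2: "\<bar>D * (1 / \<sigma>^2)\<bar> \<le> Mb * 1" by (intro abs_mult_le B i1)
    have 3: "\<bar>e / \<sigma>^2\<bar> \<le> T" using e s1 by (simp add: abs_divide pos_divide_le_eq)
    have "\<bar>n\<bar> \<le> (5 * K^3 * l) * \<sigma>"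
    proof -
      have "5 * K^3 * l^2 \<le> (5 * K^3 * l) * \<sigma>" using mult_left_mono[OF \<sigma>, of "5 * K^3 * l"] K l
        by (simp add: power2_eq_square mult.assoc)
      then show ?thesis using n by linarith
    qed
    then have "\<bar>n / \<sigma>\<bar> \<le> 5 * K^3 * l" using s1 by (simp add: abs_divide pos_divide_le_eq)
    then have 4: "\<bar>p * (n / \<sigma>)\<bar> \<le> pM * (5 * K^3 * l)" using p by (intro abs_mult_le) auto
    have "Mb \<le> Mb * K" using Mb K mult_left_mono[of 1 K Mb] by simp
    then have "\<bar>B * (b1 * (1 / \<sigma>)) - D * (1 / \<sigma>^2) - e / \<sigma>^2 + p * (n / \<sigma>)\<bar> \<le> 2 * (Mb * K) + T + pM * (5 * K^3 * l)"
      using 1 2 3 4 by linarith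
    also have "\<dots> \<le> C * l"
    proof -
      have "2 * (Mb * K) + T \<le> (2 * (Mb * K) + T) * l" using l Mb K T mult_left_mono[of 1 l "2 * (Mb * K) + T"] by simp
      then show ?thesis by (simp add: C_def algebra_simps)
    qed
    finally show ?thesis .
  qed
  ultimately have "\<bar>?R\<bar> \<le> C * l * \<bar>Y\<bar> + C * l * \<bar>Z\<bar>"
  proof -
    assume R: "?R = - (B * (1 / \<sigma>)) * Y + (B * (b1 * (1 / \<sigma>)) - D * (1 / \<sigma>^2) - e / \<sigma>^2 + p * (n / \<sigma>)) * Z"
    have "\<bar>- (B * (1 / \<sigma>)) * Y\<bar> \<le> C * l * \<bar>Y\<bar>" by (rule abs_mult_le[OF a1]) simp
    moreover have "\<bar>(B * (b1 * (1 / \<sigma>)) - D * (1 / \<sigma>^2) - e / \<sigma>^2 + p * (n / \<sigma>)) * Z\<bar> \<le> C * l * \<bar>Z\<bar>"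
      by (rule abs_mult_le[OF a2]) simp
    ultimately show ?thesis unfolding R by linarith
  qed
  then have "?R^2 \<le> (C * l * \<bar>Y\<bar> + C * l * \<bar>Z\<bar>)^2" using power_mono[of "\<bar>?R\<bar>" _ 2] by simp
  also have "\<dots> = (C * l)^2 * (\<bar>Y\<bar> + \<bar>Z\<bar>)^2" by (simp add: power_mult_distrib[symmetric] distrib_left)
  also have "\<dots> \<le> (C * l)^2 * (2 * (X^2 + Y^2 + Z^2))"
  proof (rule mult_left_mono)
    have "(\<bar>Y\<bar> + \<bar>Z\<bar>)^2 \<le> 2 * Y^2 + 2 * Z^2"
      using zero_le_power2[of "\<bar>Y\<bar> - \<bar>Z\<bar>"] by (simp add: power2_sum power2_diff)
    then show "(\<bar>Y\<bar> + \<bar>Z\<bar>)^2 \<le> 2 * (X^2 + Y^2 + Z^2)" by (rule order_trans) simp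
  qed simp
  also have "\<dots> = 2 * C^2 * l^2 * (X^2 + Y^2 + Z^2)" by (simp only: power_mult_distrib mult_ac)
  finally show ?thesis unfolding C_def .
qed

text \<open>\<open>LA\<close> and \<open>LB\<close> are the two parts of the conjugated operator; the estimate comes from
  \<open>4 LA LB \<le> (LA + LB)\<^sup>2\<close>, and \<open>y\<close> collects the terms of nonnegative integral.\<close>

lemma carleman_pointwise:
  fixes K \<rho> pm pM Mb T \<kappa> l \<sigma> p :: real
  defines "CR \<equiv> 24 * pM * T * K^3 + 4 * (2 * Mb * K + T + 5 * pM * K^3)^2"
  assumes K: "K \<ge> 1" and \<rho>: "0 < \<rho>" "\<rho> \<le> 1" and T: "T \<ge> 0"
    and \<kappa>: "\<kappa> \<ge> 1" "57 * K^5 \<le> \<rho>^6 * \<kappa>" "CR \<le> pm^2 * \<rho>^6 * \<kappa>"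
    and l: "l \<ge> 1" "2 * K \<le> l * \<rho>^2" and \<sigma>: "\<kappa> * l \<le> \<sigma>"
    and p: "0 < pm" "pm \<le> p" "p \<le> pM" and B: "\<bar>B\<bar> \<le> Mb" "\<bar>D\<bar> \<le> Mb"
    and b: "\<bar>b1\<bar> \<le> K" "\<bar>b2\<bar> \<le> K" "\<bar>b3\<bar> \<le> K" and \<tau>: "\<bar>\<tau>\<bar> \<le> T * \<sigma>" and e: "\<bar>e\<bar> \<le> T * \<sigma>^2"
    and M: "M = - \<sigma> * b1" "M1 = - \<sigma> * (l * b1^2 + b2)" "M2 = - \<sigma> * (l^2 * b1^3 + 3 * l * b1 * b2 + b3)"
    and v: "v0 = m * u0" "v1 = m * (u1 - M * u0)" "v2 = m * (u2 - 2 * M * u1 + (M^2 - M1) * u0)"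
    and sum: "LA + LB = F - B * (v1 + M * v0) - D * v0 - e * v0 - p * M2 * v0"
    and prod: "LA * LB = y + p^2 * bulk M M1 M2 v0 v1 v2 - 3 / 2 * p * \<tau> * (v0 * M1 * v1 + v0 * M * v2 + M^3 * v0^2)"
  defines "\<Phi> \<equiv> l * \<sigma> * (m^2 * (\<sigma>^4 * u0^2 + \<sigma>^2 * u1^2 + u2^2))"
  shows "pm^2 * \<rho>^6 / (10 * K^4) * \<Phi> + 4 * y \<le> 2 * F^2 + (if \<rho> \<le> \<bar>b1\<bar> then 0
     else (pm^2 * \<rho>^6 / (10 * K^4) + 30 * K^4 * (pm^2 * \<rho>^6 + 300 * pM^2 * K^6)) * \<Phi>)"
proof -
  define X where "X = v2"
  define Y where "Y = \<sigma> * v1"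
  define Z where "Z = \<sigma>^2 * v0"
  define S where "S = X^2 + Y^2 + Z^2"
  define g where "g = l * b1^2 + b2"
  define n where "n = l^2 * b1^3 + 3 * l * b1 * b2 + b3"
  define Q where "Q = \<sigma> * l * S"
  have \<sigma>l: "\<sigma> \<ge> l" using \<sigma> mult_right_mono[OF \<kappa>(1), of l] l(1) by linarith
  have s: "\<sigma> > 0" using \<sigma>l l by simp
  have vv: "v1 = Y / \<sigma>" "v0 = Z / \<sigma>^2" "v2 = X" using s by (simp_all add: X_def Y_def Z_def)
  have S0: "S \<ge> 0" by (simp add: S_def)
  have Q0: "Q \<ge> 0" using S0 s l by (simp add: Q_def)
  note gn = weight_derivative_bounds[OF K l(1) b, folded g_def n_def]
  have g\<sigma>: "\<bar>g\<bar> \<le> 2 * K^2 * \<sigma>" using gn(1) mult_left_mono[OF \<sigma>l, of "2 * K^2"] by simp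
  have p0: "0 \<le> p" using p by linarith
  have pM: "0 < pM" using p by linarith
  define R where "R = - B * (v1 + M * v0) - D * v0 - e * v0 - p * M2 * v0"
  define Er where "Er = 3 / 2 * p * \<tau> * (v0 * M1 * v1 + v0 * M * v2 + M^3 * v0^2)"
  define bk where "bk = bulk M M1 M2 v0 v1 v2"
  have Rb: "R^2 \<le> 2 * (2 * Mb * K + T + 5 * pM * K^3)^2 * l^2 * S"
    unfolding R_def S_def M vv n_def[symmetric]
    by (rule residual_bound[OF K l(1) \<sigma>l b(1) gn(2) B e p0 p(3) T])
  have Eb: "\<bar>Er\<bar> \<le> 6 * pM * T * K^3 * S"
  proof -
    have "\<bar>Er\<bar> \<le> 6 * p * T * K^3 * S"
      unfolding Er_def S_def M vv g_def[symmetric] by (rule time_error_bound[OF K s b(1) g\<sigma> \<tau> p0])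
    also have "\<dots> \<le> 6 * pM * T * K^3 * S" using p T K S0 by (intro mult_right_mono mult_left_mono) auto
    finally show ?thesis .
  qed
  have CR0: "0 \<le> CR" using pM T K by (simp add: CR_def)
  \<comment> \<open>All errors are of order \<open>l^2 * S\<close>, while
    \<open>Q = \<sigma> l S\<close> is at least \<open>\<kappa> l^2 S\<close>; this is the origin of
    the condition that \<kappa> be large compared with \<open>CR\<close>.\<close>
  have err: "2 * R^2 + 4 * \<bar>Er\<bar> \<le> pm^2 * \<rho>^6 * Q"
  proof -
    have l2: "1 \<le> l^2" using l by simp
    have "4 * \<bar>Er\<bar> \<le> 24 * pM * T * K^3 * S" using Eb by linarith
    also have "\<dots> \<le> 24 * pM * T * K^3 * l^2 * S"
      using mult_right_mono[OF mult_left_mono[OF l2, of "24 * pM * T * K^3"] S0] pM T K by simp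
    finally have "2 * R^2 + 4 * \<bar>Er\<bar> \<le> CR * (l^2 * S)" using Rb unfolding CR_def by (simp add: algebra_simps)
    also have "\<dots> \<le> (pm^2 * \<rho>^6 * \<kappa>) * (l^2 * S)" using \<kappa>(3) S0 by (intro mult_right_mono) auto
    also have "\<dots> = (pm^2 * \<rho>^6) * ((\<kappa> * l) * (l * S))" by (simp add: power2_eq_square)
    also have "\<dots> \<le> (pm^2 * \<rho>^6) * (\<sigma> * (l * S))"
      using \<sigma> l S0 \<rho> by (intro mult_left_mono mult_right_mono) auto
    finally show ?thesis by (simp add: Q_def mult.assoc)
  qed
  have "4 * (LA * LB) \<le> (LA + LB)^2" using zero_le_power2[of "LA - LB"] by (simp add: power2_eq_square algebra_simps)
  also have "\<dots> = (F + R)^2" unfolding sum R_def by (simp add: algebra_simps)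
  also have "\<dots> \<le> 2 * F^2 + 2 * R^2" using zero_le_power2[of "F - R"] by (simp add: power2_eq_square algebra_simps)
  finally have "4 * y + 4 * (p^2 * bk) - 4 * Er \<le> 2 * F^2 + 2 * R^2" unfolding prod bk_def Er_def by simp
  then have key: "4 * y + 4 * (p^2 * bk) \<le> 2 * F^2 + pm^2 * \<rho>^6 * Q" using err by linarith
  have en: "\<Phi> \<le> 30 * K^4 * Q" "Q \<le> 30 * K^4 * \<Phi>"
  proof -
    have v2': "v2 = m * (u2 - 2 * (- \<sigma> * b1) * u1 + ((- \<sigma> * b1)^2 - (- \<sigma> * g)) * u0)" using v(3) unfolding M g_def .
    have v1': "v1 = m * (u1 - (- \<sigma> * b1) * u0)" using v(2) unfolding M .
    note en = energy_equivalence[OF K s b(1) g\<sigma>, where m = m and ?u0.0 = u0 and ?u1.0 = u1 and ?u2.0 = u2, folded v1' v2' v(1)]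
    have ls: "0 \<le> l * \<sigma>" using l s by simp
    show "\<Phi> \<le> 30 * K^4 * Q" using mult_left_mono[OF en(1) ls] unfolding \<Phi>_def Q_def S_def X_def Y_def Z_def by (simp add: mult_ac)
    show "Q \<le> 30 * K^4 * \<Phi>" using mult_left_mono[OF en(2) ls] unfolding \<Phi>_def Q_def S_def X_def Y_def Z_def by (simp add: mult_ac)
  qed
  have K4: "K^4 > 0" using K by simp
  \<comment> \<open>Of the four copies of the bulk form one pays for \<open>err\<close>. The other
    three, combined with \<open>\<Phi> \<le> 30 K^4 Q\<close>, give the coefficient
    \<open>1 / (10 K^4)\<close>.\<close>
  have c\<Phi>: "pm^2 * \<rho>^6 / (10 * K^4) * \<Phi> \<le> 3 * (pm^2 * \<rho>^6 * Q)"
  proof -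
    have "pm^2 * \<rho>^6 / (10 * K^4) * \<Phi> \<le> pm^2 * \<rho>^6 / (10 * K^4) * (30 * K^4 * Q)"
      using K4 \<rho> by (intro mult_left_mono en(1)) auto
    also have "\<dots> = 3 * (pm^2 * \<rho>^6 * Q)" using K4 K by simp
    finally show ?thesis .
  qed
  have pp: "pm^2 \<le> p^2" "p^2 \<le> pM^2" using p by (auto intro!: power_mono)
  show ?thesis
  proof (cases "\<rho> \<le> \<bar>b1\<bar>")
    case True
    have "57 * K^5 * l \<le> \<rho>^6 * \<kappa> * l" using \<kappa>(2) l by (intro mult_right_mono) auto
    also have "\<dots> \<le> \<rho>^6 * \<sigma>" using mult_left_mono[OF \<sigma>, of "\<rho>^6"] \<rho> by (simp add: mult.assoc)
    finally have s0: "57 * K^5 * l \<le> \<rho>^6 * \<sigma>" .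
    have "\<rho>^6 * Q \<le> bk"
      using bulk_lower[OF K l(1) b s \<rho> True l(2) s0, of X Y Z]
      unfolding bk_def M vv Q_def S_def by (simp add: mult.assoc)
    then have "pm^2 * (\<rho>^6 * Q) \<le> p^2 * bk" using pp(1) Q0 \<rho> by (intro mult_mono) auto
    then have "pm^2 * \<rho>^6 / (10 * K^4) * \<Phi> + 4 * y \<le> 2 * F^2" using key c\<Phi> by (simp add: mult.assoc)
    with True show ?thesis by simp
  next
    case False
    \<comment> \<open>Here the form may be negative, and the loss together with the errors is
      charged to \<Phi>, to be paid by the local energy. The extra first summand of the constant
      only cancels the multiple of \<Phi> on the left.\<close>
    have "- (75 * K^6 * Q) \<le> bk"
      using bulk_upper[OF K l(1) b \<sigma>l, of X Y Z] unfolding bk_def M vv Q_def S_def by (simp add: mult.assoc)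
    then have "p^2 * (- (75 * K^6 * Q)) \<le> p^2 * bk" by (intro mult_left_mono) auto
    moreover have "p^2 * (75 * K^6 * Q) \<le> pM^2 * (75 * K^6 * Q)" using pp(2) Q0 K by (intro mult_right_mono) auto
    ultimately have "- (300 * pM^2 * K^6 * Q) \<le> 4 * (p^2 * bk)" by linarith
    then have "4 * y \<le> 2 * F^2 + (pm^2 * \<rho>^6 + 300 * pM^2 * K^6) * Q" using key unfolding distrib_right by linarith
    also have "(pm^2 * \<rho>^6 + 300 * pM^2 * K^6) * Q \<le> (pm^2 * \<rho>^6 + 300 * pM^2 * K^6) * (30 * K^4 * \<Phi>)"
      using \<rho> K by (intro mult_left_mono en(2)) auto
    finally have "4 * y \<le> 2 * F^2 + (30 * K^4 * (pm^2 * \<rho>^6 + 300 * pM^2 * K^6)) * \<Phi>" by (simp only: mult_ac)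
    then show ?thesis unfolding if_not_P[OF False] distrib_right[of "pm^2 * \<rho>^6 / (10 * K^4)"] by simp
  qed
qed

section \<open>Weights singular at the ends of the time interval\<close>

text \<open>Makes one Borel function on the line from functions given on closed subintervals; the
  nodes, where two values compete, get the value zero.\<close>

definition glue :: "nat \<Rightarrow> (nat \<Rightarrow> real) \<Rightarrow> (nat \<Rightarrow> real \<Rightarrow> real) \<Rightarrow> real \<Rightarrow> real" where
  "glue N a f x = (\<Sum>k<N. indicator (subint a k) x * f k x)"

lemma glue_eq:
  assumes part: "is_partition L N a" and k: "k < N" and x: "x \<in> subint a k"
  shows "glue N a f x = f k x"
proof -
  have "indicator (subint a i) x * f i x = (if i = k then f k x else 0)" if "i < N" for i
    using partition_disjoint[OF part that k] x by (auto simp: indicator_def)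
  then show ?thesis using k unfolding glue_def by simp
qed

lemma glue_bounded:
  assumes part: "is_partition L N a" and K: "K \<ge> 0"
    and f: "\<And>k x. k < N \<Longrightarrow> x \<in> {a k..a (Suc k)} \<Longrightarrow> \<bar>f k x\<bar> \<le> K"
  shows "\<bar>glue N a f x\<bar> \<le> K"
proof (cases "\<exists>k<N. x \<in> subint a k")
  case True
  then obtain k where k: "k < N" "x \<in> subint a k" by blast
  show ?thesis using f[OF k(1), of x] k(2) unfolding glue_eq[OF part k] by (auto simp: subint_def)
next
  case False
  then have "glue N a f x = 0" unfolding glue_def by (intro sum.neutral) auto
  then show ?thesis using K by simp
qed

lemma glue_measurable:
  assumes "\<And>k. k < N \<Longrightarrow> continuous_on {a k..a (Suc k)} (f k)"
  shows "glue N a f \<in> borel_measurable borel"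
proof -
  have "(\<lambda>x. indicator (subint a k) x * f k x) \<in> borel_measurable borel" if "k < N" for k
  proof -
    have "continuous_on (subint a k) (f k)"
      by (rule continuous_on_subset[OF assms[OF that]]) (auto simp: subint_def)
    then have "(\<lambda>x. indicator (subint a k) x *\<^sub>R f k x) \<in> borel_measurable borel"
      by (rule borel_measurable_continuous_on_indicator[rotated]) (simp add: subint_def)
    then show ?thesis by simp
  qed
  then show ?thesis unfolding glue_def[abs_def] by (intro borel_measurable_sum) auto
qed

text \<open>Supplies the increments over arbitrary intervals that \<open>symmetric_evolution\<close>
  asks for. Clamping both end points to \<open>{0..T}\<close> reduces them to increments of
  \<open>f\<close>, since \<open>f\<close> vanishes at 0 and \<open>T\<close>.\<close>

lemma AC_zero_extension:
  assumes ac: "AC 0 T f f'" and T: "T > 0" and z: "f 0 = 0" "f T = 0" and le: "x \<le> y"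
  shows "indicator {0<..<T} y * f y - indicator {0<..<T} x * f x = (LBINT t:{x..y}. indicator {0<..<T} t * f' t)"
proof -
  have i: "set_integrable lborel {0..T} f'" by (rule AC_integrable[OF ac])
  have F: "(LBINT t:{0..y}. f' t) = f y" if "y \<in> {0..T}" for y using ac that z(1) by (simp add: AC_def)
  define c where "c x = max 0 (min T x)" for x
  have c: "c x \<in> {0..T}" "indicator {0<..<T} x * f x = f (c x)" for x
    using T z by (auto simp: c_def max_def min_def indicator_def)
  have cc: "c x \<le> c y" using le by (auto simp: c_def)
  have ix: "set_integrable lborel {0..c x} f'" by (rule set_integrable_subinterval[OF i]) (use c(1)[of x] in auto)
  have iy: "set_integrable lborel {c x..c y} f'" by (rule set_integrable_subinterval[OF i]) (use c(1)[of x] c(1)[of y] in auto)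
  have "(LBINT t:{0..c y}. f' t) = (LINT t|lborel. indicator {0..c x} t *\<^sub>R f' t + indicator {c x..c y} t *\<^sub>R f' t)"
    unfolding set_lebesgue_integral_def
  proof (rule integral_cong_AE)
    show "AE t in lborel. indicator {0..c y} t *\<^sub>R f' t = indicator {0..c x} t *\<^sub>R f' t + indicator {c x..c y} t *\<^sub>R f' t"
      using AE_lborel_singleton[of "c x"]
    proof eventually_elim
      case (elim t) then show ?case using cc c(1)[of x] by (auto simp: indicator_def)
    qed
    have "set_integrable lborel {0..c y} f'" by (rule set_integrable_subinterval[OF i]) (use c(1)[of y] in auto)
    then show "(\<lambda>t. indicator {0..c y} t *\<^sub>R f' t) \<in> borel_measurable lborel"
      unfolding set_integrable_def by (rule borel_measurable_integrable)
    show "(\<lambda>t. indicator {0..c x} t *\<^sub>R f' t + indicator {c x..c y} t *\<^sub>R f' t) \<in> borel_measurable lborel"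
      using ix iy unfolding set_integrable_def by (intro borel_measurable_add borel_measurable_integrable)
  qed
  also have "\<dots> = (LBINT t:{0..c x}. f' t) + (LBINT t:{c x..c y}. f' t)"
    unfolding set_lebesgue_integral_def
    by (rule Bochner_Integration.integral_add) (use ix iy in \<open>simp_all add: set_integrable_def\<close>)
  finally have "f (c y) - f (c x) = (LBINT t:{c x..c y}. f' t)" using F[OF c(1)] by simp
  also have "\<dots> = (LBINT t:{x..y}. indicator {0<..<T} t * f' t)"
    unfolding set_lebesgue_integral_def
  proof (rule integral_cong_AE)
    have ae: "AE t in lborel. indicator {c x..c y} t *\<^sub>R f' t = indicator {x..y} t *\<^sub>R (indicator {0<..<T} t * f' t)"
      using AE_lborel_singleton[of 0] AE_lborel_singleton[of T]
    proof eventually_elim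
      case (elim t) then show ?case using le T by (auto simp: indicator_def c_def)
    qed
    then show "AE t in lborel. indicator {c x..c y} t *\<^sub>R f' t = indicator {x..y} t *\<^sub>R (indicator {0<..<T} t * f' t)" .
    show "(\<lambda>t. indicator {c x..c y} t *\<^sub>R f' t) \<in> borel_measurable lborel"
      using iy unfolding set_integrable_def by (rule borel_measurable_integrable)
    have "(\<lambda>t. indicator {x..y} t *\<^sub>R (indicator {0<..<T} t * (indicator {0..T} t *\<^sub>R f' t))) \<in> borel_measurable lborel"
      using borel_measurable_integrable[OF i[unfolded set_integrable_def]] by measurable
    also have "(\<lambda>t. indicator {x..y} t *\<^sub>R (indicator {0<..<T} t * (indicator {0..T} t *\<^sub>R f' t))) =
      (\<lambda>t. indicator {x..y} t *\<^sub>R (indicator {0<..<T} t * f' t))" by (auto simp: indicator_def)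
    finally show "(\<lambda>t. indicator {x..y} t *\<^sub>R (indicator {0<..<T} t * f' t)) \<in> borel_measurable lborel" .
  qed
  finally show ?thesis by (simp only: c(2))
qed

lemma power_exp_bounded:
  assumes c: "c > (0::real)"
  obtains C where "C > 0" "\<And>y. y \<ge> 0 \<Longrightarrow> (1 + y) ^ n * exp (- c * y) \<le> C"
proof -
  \<comment> \<open>The exponent is shared out so that \<open>1 + y \<le> A * exp (d * y)\<close>
    can be raised to the power \<open>n\<close> without exceeding
    \<open>exp (c * y)\<close>.\<close>
  define d where "d = c / (1 + real n)"
  define A where "A = max 1 (1 / d)"
  have d: "d > 0" using c by (simp add: d_def)
  have A: "A \<ge> 1" "A * d \<ge> 1"
    using d mult_right_mono[of "1 / d" "max 1 (1 / d)" d] by (simp_all add: A_def)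
  have "(1 + y) ^ n * exp (- c * y) \<le> A ^ n" if y: "y \<ge> 0" for y
  proof -
    have "(1 + y) ^ n \<le> (A * exp (d * y)) ^ n"
    proof (rule power_mono)
      have "1 + y \<le> A * (1 + d * y)" using A mult_right_mono[OF A(2) y] by (simp add: distrib_left mult.assoc)
      also have "\<dots> \<le> A * exp (d * y)" using A by (intro mult_left_mono exp_ge_add_one_self) auto
      finally show "1 + y \<le> A * exp (d * y)" .
    qed (use y in simp)
    also have "\<dots> = A ^ n * exp (real n * (d * y))" by (simp add: power_mult_distrib exp_of_nat_mult)
    also have "\<dots> \<le> A ^ n * exp (c * y)"
    proof -
      have "real n * d \<le> c" using c by (simp add: d_def field_simps)
      from mult_right_mono[OF this y] have "real n * (d * y) \<le> c * y" by (simp add: mult.assoc)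
      then show ?thesis using A by (intro mult_left_mono) auto
    qed
    finally have "(1 + y) ^ n * exp (- c * y) \<le> A ^ n * exp (c * y) * exp (- c * y)" by (rule mult_right_mono) simp
    also have "\<dots> = A ^ n" by (simp add: mult.assoc flip: exp_add)
    finally show ?thesis .
  qed
  then show thesis using that[of "A ^ n"] A by simp
qed

definition \<theta> :: "real \<Rightarrow> real \<Rightarrow> real" where "\<theta> T t = 1 / (t * (T - t))"

text \<open>The logarithmic derivative of \<theta>. It is bounded by \<open>T * \<theta>\<close>, so
  differentiating the weights in time costs one factor \<theta>.\<close>

definition \<tau> :: "real \<Rightarrow> real \<Rightarrow> real" where "\<tau> T t = - (T - 2 * t) * \<theta> T t"

lemma \<theta>_deriv:
  assumes "t \<in> {0<..<T}"
  shows "(\<theta> T has_real_derivative \<tau> T t * \<theta> T t) (at t)"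
  unfolding \<theta>_def[abs_def] \<tau>_def using assms
  by (auto intro!: derivative_eq_intros simp: field_simps power2_eq_square)

lemma \<theta>_pos: "t \<in> {0<..<T} \<Longrightarrow> \<theta> T t > 0" by (simp add: \<theta>_def)

lemma \<theta>_ge: "t \<in> {0<..<T} \<Longrightarrow> \<theta> T t \<ge> 4 / T^2"
proof -
  assume t: "t \<in> {0<..<T}"
  have "4 * (t * (T - t)) \<le> T^2" using zero_le_power2[of "T - 2 * t"] by (simp add: power2_eq_square algebra_simps)
  then show ?thesis using t by (simp add: \<theta>_def field_simps)
qed

lemma \<tau>_bound: "t \<in> {0<..<T} \<Longrightarrow> \<bar>\<tau> T t\<bar> \<le> T * \<theta> T t"
  using \<theta>_pos[of t T] unfolding \<tau>_def by (auto simp: abs_mult intro!: mult_right_mono)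

lemma \<theta>_measurable [measurable]: "\<theta> T \<in> borel_measurable borel" "\<tau> T \<in> borel_measurable borel"
  unfolding \<theta>_def[abs_def] \<tau>_def[abs_def] by measurable

text \<open>At 0 and \<open>T\<close> division by zero yields \<open>\<theta> = 0\<close> and
  \<open>0 powr \<alpha> = 0\<close>, which is also the limit of the weight, because the exponential
  beats every power of \<theta>. The derivative is bounded for the same reason.\<close>

lemma AC_time_weight:
  assumes T: "T > 0" and c: "c > 0" and \<alpha>: "\<alpha> > 0"
  shows "AC 0 T (\<lambda>t. \<theta> T t powr \<alpha> * exp (- c * \<theta> T t))
    (\<lambda>t. \<theta> T t powr \<alpha> * exp (- c * \<theta> T t) * ((\<alpha> - c * \<theta> T t) * \<tau> T t))"
proof (rule AC_interior)
  let ?q = "\<lambda>t. \<theta> T t powr \<alpha> * exp (- c * \<theta> T t)"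
  define \<phi> where "\<phi> y = (if y = 0 then 0 else (1 / y) powr \<alpha> * exp (- c * (1 / y)))" for y
  have "continuous (at y within {0..}) \<phi>" if "y \<ge> 0" for y
  proof (cases "y = 0")
    case True
    have "((\<lambda>y. (1 / y) powr \<alpha> * exp (- c * (1 / y))) \<longlongrightarrow> 0) (at_right 0)" using \<alpha> c by real_asymp
    then have "(\<phi> \<longlongrightarrow> 0) (at_right 0)"
      by (rule filterlim_cong[THEN iffD1, rotated 3])
         (auto simp: \<phi>_def eventually_at_filter)
    then show ?thesis using True by (simp add: continuous_within \<phi>_def at_within_Ici_at_right)
  next
    case False
    have "isCont (\<lambda>y. (1 / y) powr \<alpha> * exp (- c * (1 / y))) y" using False that by (intro continuous_intros) auto
    moreover have "\<forall>\<^sub>F x in nhds y. \<phi> x = (1 / x) powr \<alpha> * exp (- c * (1 / x))"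
      using False t1_space_nhds[of y 0] by (auto simp: \<phi>_def elim!: eventually_mono)
    ultimately have "isCont \<phi> y" by (simp add: isCont_cong)
    then show ?thesis by (rule continuous_at_imp_continuous_at_within)
  qed
  then have "continuous_on {0..} \<phi>" by (simp add: continuous_on_eq_continuous_within)
  then have "continuous_on {0..T} (\<lambda>t. \<phi> (t * (T - t)))"
    by (rule continuous_on_compose2) (auto intro!: continuous_intros)
  moreover have "\<phi> (t * (T - t)) = ?q t" for t by (auto simp: \<phi>_def \<theta>_def)
  ultimately show "continuous_on {0..T} ?q" by simp
  show "(?q has_real_derivative ?q t * ((\<alpha> - c * \<theta> T t) * \<tau> T t)) (at t)" if t: "t \<in> {0<..<T}" for t
  proof -
    have th: "\<theta> T t > 0" by (rule \<theta>_pos[OF t])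
    have "((\<lambda>t. \<theta> T t powr \<alpha>) has_real_derivative \<alpha> * \<theta> T t powr (\<alpha> - 1) * (\<tau> T t * \<theta> T t)) (at t)"
      by (rule DERIV_fun_powr[OF \<theta>_deriv[OF t] th, of \<alpha>, simplified])
    moreover have "\<theta> T t powr (\<alpha> - 1) * \<theta> T t = \<theta> T t powr \<alpha>" using th by (simp add: powr_diff)
    ultimately have "((\<lambda>t. \<theta> T t powr \<alpha>) has_real_derivative \<alpha> * \<theta> T t powr \<alpha> * \<tau> T t) (at t)"
      by (simp add: mult_ac)
    moreover have "((\<lambda>t. exp (- c * \<theta> T t)) has_real_derivative exp (- c * \<theta> T t) * (- c * (\<tau> T t * \<theta> T t))) (at t)"
      by (rule DERIV_chain'[OF DERIV_cmult[OF \<theta>_deriv[OF t]] DERIV_exp])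
    ultimately show ?thesis by (rule DERIV_mult[THEN DERIV_cong]) (simp add: algebra_simps)
  qed
  obtain n where n: "\<alpha> \<le> real n" using real_arch_simple by blast
  obtain C where C: "C > 0" "\<And>y. y \<ge> 0 \<Longrightarrow> (1 + y) ^ (n + 2) * exp (- c * y) \<le> C"
    using power_exp_bounded[OF c, of "n + 2"] by blast
  have bd: "\<bar>?q t * ((\<alpha> - c * \<theta> T t) * \<tau> T t)\<bar> \<le> (\<alpha> + c) * T * C" if t: "t \<in> {0<..<T}" for t
  proof -
    define y where "y = \<theta> T t"
    have y: "y > 0" using \<theta>_pos[OF t] by (simp add: y_def)
    have "y powr \<alpha> \<le> (1 + y) powr \<alpha>" using y \<alpha> by (intro powr_mono2) auto
    also have "\<dots> \<le> (1 + y) powr real n" using y n by (intro powr_mono) auto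
    finally have 1: "y powr \<alpha> \<le> (1 + y) ^ n" using y by (simp add: powr_realpow)
    have "\<bar>\<alpha> - c * y\<bar> \<le> \<alpha> + c * y" using y \<alpha> c by (auto simp: abs_le_iff)
    also have "\<dots> \<le> (\<alpha> + c) * (1 + y)" using y \<alpha> c by (simp add: algebra_simps)
    finally have 2: "\<bar>\<alpha> - c * y\<bar> \<le> (\<alpha> + c) * (1 + y)" .
    have 3: "\<bar>\<tau> T t\<bar> \<le> T * (1 + y)" using \<tau>_bound[OF t] T by (simp add: y_def distrib_left)
    have "\<bar>(y powr \<alpha> * exp (- c * y)) * ((\<alpha> - c * y) * \<tau> T t)\<bar> \<le> ((1 + y) ^ n * exp (- c * y)) * ((\<alpha> + c) * (1 + y) * (T * (1 + y)))"
      by (intro abs_mult_le 2 3) (use 1 in \<open>simp_all add: abs_mult\<close>)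
    also have "\<dots> = (\<alpha> + c) * T * ((1 + y) ^ (n + 2) * exp (- c * y))" by simp
    also have "\<dots> \<le> (\<alpha> + c) * T * C" using C(2)[of y] y \<alpha> c T by (intro mult_left_mono) auto
    finally show ?thesis by (simp add: y_def)
  qed
  show "set_integrable lborel {0..T} (\<lambda>t. ?q t * ((\<alpha> - c * \<theta> T t) * \<tau> T t))"
    unfolding set_integrable_def
  proof (rule integrableI_bounded_set_indicator)
    show "AE t in lborel. t \<in> {0..T} \<longrightarrow> norm (?q t * ((\<alpha> - c * \<theta> T t) * \<tau> T t)) \<le> (\<alpha> + c) * T * C"
      using AE_lborel_singleton[of 0] AE_lborel_singleton[of T]
    proof eventually_elim
      case (elim t) then show ?case using bd[of t] by auto
    qed
  qed (use T in \<open>auto simp: emeasure_lborel_Icc_eq\<close>)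
qed

section \<open>Integrability of products with singular weights\<close>

definition poly_growth :: "real \<Rightarrow> (real \<times> real \<Rightarrow> real) \<Rightarrow> bool" where
  "poly_growth T g \<longleftrightarrow> g \<in> borel_measurable borel \<and>
     (\<exists>C n. \<forall>t\<in>{0<..<T}. \<forall>x. \<bar>g (t, x)\<bar> \<le> C * (1 + \<theta> T t) ^ n)"

lemma poly_growthI:
  assumes "g \<in> borel_measurable borel" "\<And>t x. t \<in> {0<..<T} \<Longrightarrow> \<bar>g (t, x)\<bar> \<le> C * (1 + \<theta> T t) ^ n"
  shows "poly_growth T g"
  using assms unfolding poly_growth_def by blast

lemma poly_growth_bounded:
  assumes "g \<in> borel_measurable borel" "\<And>t x. \<bar>g (t, x)\<bar> \<le> C"
  shows "poly_growth T g"
  by (rule poly_growthI[of g T C 0]) (use assms in auto)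

lemma poly_growth_const: "poly_growth T (\<lambda>z. c)"
  by (rule poly_growth_bounded[of _ "\<bar>c\<bar>"]) auto

lemma poly_growth_time:
  assumes "f \<in> borel_measurable borel" "\<And>t. t \<in> {0<..<T} \<Longrightarrow> \<bar>f t\<bar> \<le> C * (1 + \<theta> T t)"
  shows "poly_growth T (\<lambda>z. f (fst z))"
proof (rule poly_growthI[of _ T C 1])
  have [measurable]: "f \<in> borel_measurable borel" by fact
  have "(\<lambda>z. f (fst z)) \<in> borel_measurable (borel \<Otimes>\<^sub>M borel :: (real \<times> real) measure)" by measurable
  then show "(\<lambda>z :: real \<times> real. f (fst z)) \<in> borel_measurable borel" unfolding borel_prod .
qed (use assms in auto)

lemma poly_growth_space:
  assumes "f \<in> borel_measurable borel" "\<And>x. \<bar>f x\<bar> \<le> C"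
  shows "poly_growth T (\<lambda>z. f (snd z))"
proof (rule poly_growth_bounded[of _ C])
  have [measurable]: "f \<in> borel_measurable borel" by fact
  have "(\<lambda>z. f (snd z)) \<in> borel_measurable (borel \<Otimes>\<^sub>M borel :: (real \<times> real) measure)" by measurable
  then show "(\<lambda>z :: real \<times> real. f (snd z)) \<in> borel_measurable borel" unfolding borel_prod .
qed (use assms in auto)

lemma poly_growth_mult:
  assumes "poly_growth T f" "poly_growth T g"
  shows "poly_growth T (\<lambda>z. f z * g z)"
proof -
  obtain C n C' n' where b: "\<And>t x. t \<in> {0<..<T} \<Longrightarrow> \<bar>f (t, x)\<bar> \<le> C * (1 + \<theta> T t) ^ n"
    "\<And>t x. t \<in> {0<..<T} \<Longrightarrow> \<bar>g (t, x)\<bar> \<le> C' * (1 + \<theta> T t) ^ n'"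
    using assms unfolding poly_growth_def by blast
  have "\<bar>f (t, x) * g (t, x)\<bar> \<le> (C * C') * (1 + \<theta> T t) ^ (n + n')" if "t \<in> {0<..<T}" for t x
    using abs_mult_le[OF b(1)[OF that, of x] b(2)[OF that, of x]] by (simp add: power_add mult_ac)
  moreover have "(\<lambda>z. f z * g z) \<in> borel_measurable borel" using assms by (auto simp: poly_growth_def)
  ultimately show ?thesis by (rule poly_growthI[rotated])
qed

lemma poly_growth_add:
  assumes "poly_growth T f" "poly_growth T g"
  shows "poly_growth T (\<lambda>z. f z + g z)"
proof -
  obtain C n C' n' where b: "\<And>t x. t \<in> {0<..<T} \<Longrightarrow> \<bar>f (t, x)\<bar> \<le> C * (1 + \<theta> T t) ^ n"
    "\<And>t x. t \<in> {0<..<T} \<Longrightarrow> \<bar>g (t, x)\<bar> \<le> C' * (1 + \<theta> T t) ^ n'"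
    using assms unfolding poly_growth_def by blast
  have "\<bar>f (t, x) + g (t, x)\<bar> \<le> (\<bar>C\<bar> + \<bar>C'\<bar>) * (1 + \<theta> T t) ^ (n + n')" if t: "t \<in> {0<..<T}" for t x
  proof -
    have y: "1 + \<theta> T t \<ge> 1" using \<theta>_pos[OF t] by simp
    have 1: "C * (1 + \<theta> T t) ^ n \<le> \<bar>C\<bar> * (1 + \<theta> T t) ^ (n + n')"
      using y by (intro mult_mono power_increasing) auto
    have 2: "C' * (1 + \<theta> T t) ^ n' \<le> \<bar>C'\<bar> * (1 + \<theta> T t) ^ (n + n')"
      using y by (intro mult_mono power_increasing) auto
    have "\<bar>f (t, x) + g (t, x)\<bar> \<le> \<bar>f (t, x)\<bar> + \<bar>g (t, x)\<bar>" by (rule abs_triangle_ineq)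
    then show ?thesis using b(1)[OF t, of x] b(2)[OF t, of x] 1 2 unfolding distrib_right by linarith
  qed
  moreover have "(\<lambda>z. f z + g z) \<in> borel_measurable borel" using assms by (auto simp: poly_growth_def)
  ultimately show ?thesis by (rule poly_growthI[rotated])
qed

lemma poly_growth_minus: "poly_growth T f \<Longrightarrow> poly_growth T (\<lambda>z. - f z)"
  by (simp add: poly_growth_def)

lemma poly_growth_diff: "poly_growth T f \<Longrightarrow> poly_growth T g \<Longrightarrow> poly_growth T (\<lambda>z. f z - g z)"
  using poly_growth_add[OF _ poly_growth_minus, of T f g] by simp

lemma poly_growth_power: "poly_growth T f \<Longrightarrow> poly_growth T (\<lambda>z. f z ^ n)"
  by (induction n) (simp_all add: poly_growth_const poly_growth_mult)

lemma poly_growth_\<theta>: "poly_growth T (\<lambda>z. \<theta> T (fst z))"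
  by (rule poly_growth_time[of _ T 1]) (use \<theta>_pos in \<open>auto simp: less_imp_le\<close>)

lemma poly_growth_\<tau>: "poly_growth T (\<lambda>z. \<tau> T (fst z))"
proof (rule poly_growth_time[of _ T T])
  fix t assume t: "t \<in> {0<..<T}"
  show "\<bar>\<tau> T t\<bar> \<le> T * (1 + \<theta> T t)" using \<tau>_bound[OF t] t by (simp add: distrib_left)
qed measurable

lemma poly_growth_sqrt: "poly_growth T (\<lambda>z. \<theta> T (fst z) powr (1 / 2))"
proof (rule poly_growth_time[of _ T 1])
  fix t assume t: "t \<in> {0<..<T}"
  have "\<theta> T t powr (1 / 2) \<le> (1 + \<theta> T t) powr (1 / 2)" using \<theta>_pos[OF t] by (intro powr_mono2) auto
  also have "\<dots> \<le> (1 + \<theta> T t) powr 1" using \<theta>_pos[OF t] by (intro powr_mono) auto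
  finally show "\<bar>\<theta> T t powr (1 / 2)\<bar> \<le> 1 * (1 + \<theta> T t)" using \<theta>_pos[OF t] by simp
qed measurable

lemmas poly_growth_intros = poly_growth_mult poly_growth_add poly_growth_minus poly_growth_diff
  poly_growth_power poly_growth_const poly_growth_\<theta> poly_growth_\<tau> poly_growth_sqrt

text \<open>Decay at the ends of the time interval in the manner of Schwartz functions: it survives
  every factor that grows like a power of \<theta>. Integrability of all products in the estimate
  then follows from closure rules.\<close>

definition rapid :: "real \<Rightarrow> real \<Rightarrow> (real \<times> real \<Rightarrow> real) \<Rightarrow> bool" where
  "rapid T L f \<longleftrightarrow> (\<forall>z. z \<notin> cylinder T L \<longrightarrow> f z = 0) \<and> (\<forall>g. poly_growth T g \<longrightarrow> sq_int (\<lambda>z. g z * f z))"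

lemma rapid_sq_int: "rapid T L f \<Longrightarrow> sq_int f"
  using poly_growth_const[of T 1] unfolding rapid_def by force

lemma rapid_mult: "poly_growth T g \<Longrightarrow> rapid T L f \<Longrightarrow> rapid T L (\<lambda>z. g z * f z)"
  unfolding rapid_def by (auto simp: mult.assoc[symmetric] intro: poly_growth_mult)

lemma rapid_add: "rapid T L f \<Longrightarrow> rapid T L g \<Longrightarrow> rapid T L (\<lambda>z. f z + g z)"
  unfolding rapid_def by (auto simp: distrib_left intro: sq_int_add)

lemma rapid_diff: "rapid T L f \<Longrightarrow> rapid T L g \<Longrightarrow> rapid T L (\<lambda>z. f z - g z)"
  unfolding rapid_def by (auto simp: right_diff_distrib intro: sq_int_diff)

lemma rapid_integrable: "rapid T L f \<Longrightarrow> rapid T L g \<Longrightarrow> integrable lborel (\<lambda>z. f z * g z)"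
  by (intro sq_int_mult_integrable rapid_sq_int)

lemma rapid_exp:
  assumes u: "sq_int (\<lambda>z. indicator (cylinder T L) z * u z)" and m: "m \<in> borel_measurable borel" and c: "c > 0"
    and b: "\<And>t x. t \<in> {0<..<T} \<Longrightarrow> \<bar>m (t, x)\<bar> \<le> exp (- c * \<theta> T t)"
  shows "rapid T L (\<lambda>z. indicator (cylinder T L) z * (m z * u z))"
  unfolding rapid_def
proof (intro conjI allI impI)
  fix g assume g: "poly_growth T g"
  then obtain C n where gb: "\<And>t x. t \<in> {0<..<T} \<Longrightarrow> \<bar>g (t, x)\<bar> \<le> C * (1 + \<theta> T t) ^ n"
    and [measurable]: "g \<in> borel_measurable borel" unfolding poly_growth_def by blast
  have [measurable]: "m \<in> borel_measurable borel" "cylinder T L \<in> sets borel" by (fact m, fact cylinder_borel)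
  obtain D where D: "D > 0" "\<And>y. y \<ge> 0 \<Longrightarrow> (1 + y) ^ n * exp (- c * y) \<le> D" using power_exp_bounded[OF c, of n] by blast
  have bd: "\<bar>indicator (cylinder T L) z * (g z * m z)\<bar> \<le> \<bar>C\<bar> * D" for z
  proof (cases "z \<in> cylinder T L")
    case True
    then obtain t x where z: "z = (t, x)" and t: "t \<in> {0<..<T}" by (cases z) (auto simp: cylinder_def)
    have "\<bar>g z * m z\<bar> \<le> (C * (1 + \<theta> T t) ^ n) * exp (- c * \<theta> T t)" unfolding z by (rule abs_mult_le[OF gb[OF t] b[OF t]])
    also have "\<dots> = C * ((1 + \<theta> T t) ^ n * exp (- c * \<theta> T t))" by simp
    also have "\<dots> \<le> \<bar>C\<bar> * D" using D(2)[of "\<theta> T t"] \<theta>_pos[OF t] by (intro mult_mono) auto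
    finally show ?thesis using True by simp
  qed (use D in simp)
  have "sq_int (\<lambda>z. (indicator (cylinder T L) z * (g z * m z)) * (indicator (cylinder T L) z * u z))"
    using u bd unfolding sq_int_def by (auto intro!: sq_integrable_cmult_bounded)
  also have "(\<lambda>z. (indicator (cylinder T L) z * (g z * m z)) * (indicator (cylinder T L) z * u z)) =
    (\<lambda>z. g z * (indicator (cylinder T L) z * (m z * u z)))" by (auto simp: indicator_def)
  finally show "sq_int (\<lambda>z. g z * (indicator (cylinder T L) z * (m z * u z)))" .
qed simp

section \<open>The conjugated function\<close>

text \<open>\<open>conj1\<close>, \<open>conj2\<close>, \<open>conj3\<close> are the first three
  space derivatives of \<open>m * w0\<close> when \<open>m' = - M * m\<close>, the case of
  \<open>m = exp (- s \<eta>)\<close> and \<open>M = s \<eta>_x\<close>.\<close>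

definition conj1 :: "real \<Rightarrow> real \<Rightarrow> real \<Rightarrow> real \<Rightarrow> real" where
  "conj1 m M w0 w1 = m * (w1 - M * w0)"

definition conj2 :: "real \<Rightarrow> real \<Rightarrow> real \<Rightarrow> real \<Rightarrow> real \<Rightarrow> real \<Rightarrow> real" where
  "conj2 m M M1 w0 w1 w2 = m * (w2 - 2 * M * w1 + (M^2 - M1) * w0)"

definition conj3 :: "real \<Rightarrow> real \<Rightarrow> real \<Rightarrow> real \<Rightarrow> real \<Rightarrow> real \<Rightarrow> real \<Rightarrow> real \<Rightarrow> real" where
  "conj3 m M M1 M2 w0 w1 w2 w3 =
     m * (w3 - 3 * M * w2 + 3 * (M^2 - M1) * w1 + (- (M^3) + 3 * M * M1 - M2) * w0)"

lemma AC_conj: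
  assumes m: "AC a b m (\<lambda>x. - M x * m x)" and M: "AC a b M M1" and M1: "AC a b M1 M2"
    and w: "AC a b w0 w1" "AC a b w1 w2" "AC a b w2 w3"
  shows "AC a b (\<lambda>x. m x * w0 x) (\<lambda>x. conj1 (m x) (M x) (w0 x) (w1 x))"
    "AC a b (\<lambda>x. conj1 (m x) (M x) (w0 x) (w1 x)) (\<lambda>x. conj2 (m x) (M x) (M1 x) (w0 x) (w1 x) (w2 x))"
    "AC a b (\<lambda>x. conj2 (m x) (M x) (M1 x) (w0 x) (w1 x) (w2 x))
       (\<lambda>x. conj3 (m x) (M x) (M1 x) (M2 x) (w0 x) (w1 x) (w2 x) (w3 x))"
proof -
  show "AC a b (\<lambda>x. m x * w0 x) (\<lambda>x. conj1 (m x) (M x) (w0 x) (w1 x))"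
    by (rule AC_cong_simple[OF AC_mult[OF m w(1)]]) (simp_all add: conj1_def algebra_simps)
  show "AC a b (\<lambda>x. conj1 (m x) (M x) (w0 x) (w1 x)) (\<lambda>x. conj2 (m x) (M x) (M1 x) (w0 x) (w1 x) (w2 x))"
    by (rule AC_cong_simple[OF AC_mult[OF m AC_diff[OF w(2) AC_mult[OF M w(1)]]]])
       (simp_all add: conj1_def conj2_def power2_eq_square algebra_simps)
  note MM = AC_diff[OF AC_mult[OF M M] M1]
  show "AC a b (\<lambda>x. conj2 (m x) (M x) (M1 x) (w0 x) (w1 x) (w2 x))
       (\<lambda>x. conj3 (m x) (M x) (M1 x) (M2 x) (w0 x) (w1 x) (w2 x) (w3 x))"
    by (rule AC_cong_simple[OF AC_mult[OF m AC_add[OF AC_diff[OF w(3) AC_cmult[OF AC_mult[OF M w(2)], of 2]] AC_mult[OF MM w(1)]]]])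
       (simp_all add: conj2_def conj3_def power2_eq_square power3_eq_cube algebra_simps)
qed

text \<open>The conditions are homogeneous: a first derivative carries \<open>sqrt p\<close> and a
  second one \<open>p\<close>. As \<open>M\<close> and \<open>M1\<close> obey them as well, every
  term of \<open>conj1\<close> has weight one and every term of \<open>conj2\<close> weight
  two.\<close>

lemma conj_interface:
  assumes "sqrt p * M = sqrt p' * M'" "p * M1 = p' * M1'" "w0 = w0'" "sqrt p * w1 = sqrt p' * w1'" "p * w2 = p' * w2'"
    and pos: "p > 0" "p' > 0"
  shows "sqrt p * conj1 m M w0 w1 = sqrt p' * conj1 m M' w0' w1'"
    "p * conj2 m M M1 w0 w1 w2 = p' * conj2 m M' M1' w0' w1' w2'"
proof -
  have "sqrt p * conj1 m M w0 w1 = m * (sqrt p * w1 - (sqrt p * M) * w0)" by (simp add: conj1_def algebra_simps)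
  also have "\<dots> = sqrt p' * conj1 m M' w0' w1'" unfolding assms(1,3,4) by (simp add: conj1_def algebra_simps)
  finally show "sqrt p * conj1 m M w0 w1 = sqrt p' * conj1 m M' w0' w1'" .
  have e: "q * conj2 m M M1 w0 w1 w2 = m * (q * w2 - 2 * (sqrt q * M) * (sqrt q * w1) + ((sqrt q * M)^2 - q * M1) * w0)"
    if "q > 0" for q M M1 w0 w1 w2 :: real
  proof -
    have "sqrt q * sqrt q = q" using that by simp
    then show ?thesis by (simp add: conj2_def power2_eq_square algebra_simps)
  qed
  show "p * conj2 m M M1 w0 w1 w2 = p' * conj2 m M' M1' w0' w1' w2'"
    unfolding e[OF pos(1)] e[OF pos(2)] assms(1-5) ..
qed

text \<open>The function \<open>\<beta>\<close> is extended continuously to the line; \<open>E\<close> is \<open>exp (\<kappa> l \<parallel>\<beta>\<parallel>)\<close> in the notation of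
  the paper, whereas \<open>\<kappa>\<close> below is a lower bound for \<open>s \<xi>\<close>, and \<open>\<omega>\<close> plays the role of the inner set.\<close>

locale carleman_weight =
  fixes T L :: real and N :: nat and a p :: "nat \<Rightarrow> real" and \<beta> :: "real \<Rightarrow> real"
    and b1 b2 b3 :: "nat \<Rightarrow> real \<Rightarrow> real" and K \<rho> \<kappa> s l E c0 :: real and \<omega> :: "real set"
  assumes T: "T > 0" and part: "is_partition L N a" and p: "\<And>k. k < N \<Longrightarrow> p k > 0"
    and \<beta>: "continuous_on UNIV \<beta>" "\<And>x. 0 \<le> \<beta> x"
    and E: "c0 > 0" "\<And>x. exp (l * \<beta> x) + c0 \<le> E" "\<And>x. E \<le> (exp (l * \<beta> x))^2"
    and s: "s \<ge> 1" and l: "l \<ge> 1"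
    and d: "\<And>k x. k < N \<Longrightarrow> x \<in> {a k..a (Suc k)} \<Longrightarrow> (\<beta> has_real_derivative b1 k x) (at x within {a k..a (Suc k)})"
      "\<And>k x. k < N \<Longrightarrow> x \<in> {a k..a (Suc k)} \<Longrightarrow> (b1 k has_real_derivative b2 k x) (at x within {a k..a (Suc k)})"
      "\<And>k x. k < N \<Longrightarrow> x \<in> {a k..a (Suc k)} \<Longrightarrow> (b2 k has_real_derivative b3 k x) (at x within {a k..a (Suc k)})"
      "\<And>k. k < N \<Longrightarrow> continuous_on {a k..a (Suc k)} (b3 k)"
    and K: "K \<ge> 1" "\<And>k x. k < N \<Longrightarrow> x \<in> {a k..a (Suc k)} \<Longrightarrow> \<bar>b1 k x\<bar> \<le> K"
      "\<And>k x. k < N \<Longrightarrow> x \<in> {a k..a (Suc k)} \<Longrightarrow> \<bar>b2 k x\<bar> \<le> K"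
      "\<And>k x. k < N \<Longrightarrow> x \<in> {a k..a (Suc k)} \<Longrightarrow> \<bar>b3 k x\<bar> \<le> K"
    and \<rho>: "0 < \<rho>" "\<rho> \<le> 1" "\<And>k x. k < N \<Longrightarrow> x \<in> {a k..a (Suc k)} \<Longrightarrow> x \<notin> \<omega> \<Longrightarrow> \<rho> \<le> \<bar>b1 k x\<bar>"
    and nodes: "\<And>k. k \<in> {1..<N} \<Longrightarrow> sqrt (p (k - 1)) * b1 (k - 1) (a k) = sqrt (p k) * b1 k (a k)"
      "\<And>k. k \<in> {1..<N} \<Longrightarrow> p (k - 1) * b2 (k - 1) (a k) = p k * b2 k (a k)"
    and sgn: "\<And>k. k \<in> {1..<N} \<Longrightarrow> p (k - 1) > p k \<and> b1 k (a k) > 0 \<or> p (k - 1) < p k \<and> b1 k (a k) < 0"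
      "b1 0 0 > 0" "b1 (N - 1) L < 0"
    and \<omega>: "\<omega> \<in> sets borel" "\<And>k. k \<le> N \<Longrightarrow> a k \<notin> \<omega>"
    and \<kappa>: "12 * K^2 \<le> \<kappa> * \<rho>^2" "\<kappa> * T^2 \<le> 4 * s"
begin

definition G :: "real \<Rightarrow> real" where "G x = exp (l * \<beta> x)"

text \<open>The argument \<open>h\<close> stands for \<open>1 / (t (T - t))\<close>; with \<open>h = 1\<close> one gets the time independent
  factor of the weights. Then \<open>sg\<close> is \<open>s l \<xi>\<close>, \<open>mm\<close> is \<open>exp (- s \<eta>)\<close>, and \<open>mu\<close>, \<open>mu1\<close>, \<open>mu2\<close>
  are \<open>s \<eta>\<^sub>x\<close> and its first two derivatives, with \<open>c1\<close>, \<open>c2\<close>, \<open>c3\<close> for the derivatives of \<open>\<beta>\<close>.\<close>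

definition sg :: "real \<Rightarrow> real \<Rightarrow> real" where "sg h x = s * l * h * G x"
definition mm :: "real \<Rightarrow> real \<Rightarrow> real" where "mm h x = exp (- (s * (E - G x)) * h)"
definition mu :: "real \<Rightarrow> real \<Rightarrow> real \<Rightarrow> real" where "mu h x c1 = - sg h x * c1"
definition mu1 :: "real \<Rightarrow> real \<Rightarrow> real \<Rightarrow> real \<Rightarrow> real" where "mu1 h x c1 c2 = - sg h x * (l * c1^2 + c2)"
definition mu2 :: "real \<Rightarrow> real \<Rightarrow> real \<Rightarrow> real \<Rightarrow> real \<Rightarrow> real" where
  "mu2 h x c1 c2 c3 = - sg h x * (l^2 * c1^3 + 3 * l * c1 * c2 + c3)"

lemma G_bounds: "1 \<le> G x" "G x \<le> E" "c0 \<le> E - G x" "E \<le> (G x)^2"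
  using \<beta>(2)[of x] l E(1) E(2)[of x] E(3)[of x] unfolding G_def by auto

lemma G_deriv:
  assumes "k < N" "x \<in> {a k..a (Suc k)}"
  shows "(G has_real_derivative G x * (l * b1 k x)) (at x within {a k..a (Suc k)})"
  unfolding G_def[abs_def]
  by (rule DERIV_chain'[OF DERIV_cmult[OF d(1)[OF assms]] DERIV_exp[THEN has_field_derivative_at_within], simplified])

lemma b_continuous: "k < N \<Longrightarrow> continuous_on {a k..a (Suc k)} (b1 k)" "k < N \<Longrightarrow> continuous_on {a k..a (Suc k)} (b2 k)"
  by (rule DERIV_continuous_on, rule d, assumption+)+

lemma G_continuous: "continuous_on A G"
  unfolding G_def[abs_def] by (intro continuous_intros continuous_on_subset[OF \<beta>(1)]) auto

lemma AC_weights: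
  assumes k: "k < N"
  shows "AC (a k) (a (Suc k)) (mm h) (\<lambda>x. - mu h x (b1 k x) * mm h x)"
    "AC (a k) (a (Suc k)) (\<lambda>x. mu h x (b1 k x)) (\<lambda>x. mu1 h x (b1 k x) (b2 k x))"
    "AC (a k) (a (Suc k)) (\<lambda>x. mu1 h x (b1 k x) (b2 k x)) (\<lambda>x. mu2 h x (b1 k x) (b2 k x) (b3 k x))"
proof -
  let ?J = "{a k..a (Suc k)}" and ?c = "- (s * l * h)"
  note c = continuous_on_mult continuous_on_add continuous_on_const continuous_on_power continuous_on_minus
    continuous_on_exp continuous_on_diff G_continuous[of ?J] b_continuous[OF k] d(4)[OF k]
  have eq: "(\<lambda>x. mu h x (b1 k x)) = (\<lambda>x. ?c * (G x * b1 k x))"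
    "(\<lambda>x. mu1 h x (b1 k x) (b2 k x)) = (\<lambda>x. ?c * (G x * (l * (b1 k x * b1 k x) + b2 k x)))"
    "mm h = (\<lambda>x. exp (s * h * G x + - (s * h * E)))"
    by (simp_all add: fun_eq_iff mu_def mu1_def mm_def sg_def power2_eq_square algebra_simps)
  show "AC (a k) (a (Suc k)) (mm h) (\<lambda>x. - mu h x (b1 k x) * mm h x)"
  proof (rule AC_C1)
    fix x assume x: "x \<in> ?J"
    note D = DERIV_chain'[OF DERIV_add[OF DERIV_cmult[OF G_deriv[OF k x], of "s * h"] DERIV_const[of "- (s * h * E)"]] DERIV_exp]
    show "(mm h has_real_derivative - mu h x (b1 k x) * mm h x) (at x within ?J)"
      unfolding eq(3) by (rule D[THEN DERIV_cong]) (simp add: mu_def sg_def)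
  next
    show "continuous_on ?J (\<lambda>x. - mu h x (b1 k x) * mm h x)"
      unfolding mu_def sg_def mm_def by (intro c)
  qed
  show "AC (a k) (a (Suc k)) (\<lambda>x. mu h x (b1 k x)) (\<lambda>x. mu1 h x (b1 k x) (b2 k x))"
  proof (rule AC_C1)
    fix x assume x: "x \<in> ?J"
    note D = DERIV_cmult[OF DERIV_mult[OF G_deriv[OF k x] d(2)[OF k x]], of ?c]
    show "((\<lambda>x. mu h x (b1 k x)) has_real_derivative mu1 h x (b1 k x) (b2 k x)) (at x within ?J)"
      unfolding eq(1) by (rule D[THEN DERIV_cong]) (simp add: mu1_def sg_def power2_eq_square algebra_simps)
  next
    show "continuous_on ?J (\<lambda>x. mu1 h x (b1 k x) (b2 k x))"
      unfolding mu1_def sg_def by (intro c)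
  qed
  show "AC (a k) (a (Suc k)) (\<lambda>x. mu1 h x (b1 k x) (b2 k x)) (\<lambda>x. mu2 h x (b1 k x) (b2 k x) (b3 k x))"
  proof (rule AC_C1)
    fix x assume x: "x \<in> ?J"
    note D = DERIV_cmult[OF DERIV_mult[OF G_deriv[OF k x]
      DERIV_add[OF DERIV_cmult[OF DERIV_mult[OF d(2)[OF k x] d(2)[OF k x]], of l] d(3)[OF k x]]], of ?c]
    show "((\<lambda>x. mu1 h x (b1 k x) (b2 k x)) has_real_derivative mu2 h x (b1 k x) (b2 k x) (b3 k x)) (at x within ?J)"
      unfolding eq(2)
      by (rule D[THEN DERIV_cong]) (simp add: mu2_def sg_def power2_eq_square power3_eq_cube algebra_simps)
  next
    show "continuous_on ?J (\<lambda>x. mu2 h x (b1 k x) (b2 k x) (b3 k x))"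
      unfolding mu2_def sg_def by (intro c)
  qed
qed

text \<open>In the second identity the term \<open>p * l * b1^2\<close> equals
  \<open>l * (sqrt p * b1)^2\<close>, so the condition on the first derivative of \<beta> enters
  there as well.\<close>

lemma mu_interface:
  assumes k: "k \<in> {1..<N}"
  shows "sqrt (p (k - 1)) * mu h (a k) (b1 (k - 1) (a k)) = sqrt (p k) * mu h (a k) (b1 k (a k))"
    "p (k - 1) * mu1 h (a k) (b1 (k - 1) (a k)) (b2 (k - 1) (a k)) = p k * mu1 h (a k) (b1 k (a k)) (b2 k (a k))"
proof -
  have pos: "p (k - 1) > 0" "p k > 0" using k p by auto
  note n = nodes[OF k]
  have "sqrt (p (k - 1)) * mu h (a k) (b1 (k - 1) (a k)) = - sg h (a k) * (sqrt (p (k - 1)) * b1 (k - 1) (a k))"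
    by (simp add: mu_def)
  then show "sqrt (p (k - 1)) * mu h (a k) (b1 (k - 1) (a k)) = sqrt (p k) * mu h (a k) (b1 k (a k))"
    unfolding n by (simp add: mu_def)
  have sq: "p i * mu1 h (a k) c1 c2 = - sg h (a k) * (l * (sqrt (p i) * c1)^2 + p i * c2)" if "p i > 0" for i c1 c2
    using that by (simp add: mu1_def power_mult_distrib algebra_simps)
  show "p (k - 1) * mu1 h (a k) (b1 (k - 1) (a k)) (b2 (k - 1) (a k)) = p k * mu1 h (a k) (b1 k (a k)) (b2 k (a k))"
    unfolding sq[OF pos(1)] sq[OF pos(2)] n ..
qed

text \<open>The minimum of \<theta> is \<open>4 / T^2\<close>, attained at \<open>T / 2\<close>;
  this is how the largeness of \<open>s\<close> is measured by \<open>T\<close>.\<close>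

lemma sg_ge: "t \<in> {0<..<T} \<Longrightarrow> \<kappa> * l \<le> sg (\<theta> T t) x"
proof -
  assume t: "t \<in> {0<..<T}"
  have "\<kappa> \<le> s * (4 / T^2)" using \<kappa>(2) T by (simp add: pos_le_divide_eq mult.commute)
  also have "\<dots> \<le> s * \<theta> T t" using \<theta>_ge[OF t] s by (intro mult_left_mono) auto
  finally have "\<kappa> * l \<le> s * \<theta> T t * l" using l by (intro mult_right_mono) auto
  also have "\<dots> \<le> s * \<theta> T t * l * G x"
    using mult_left_mono[OF G_bounds(1)[of x], of "s * \<theta> T t * l"] s l \<theta>_pos[OF t] by simp
  finally show ?thesis by (simp add: sg_def mult_ac)
qed

lemma sg_pos: "h > 0 \<Longrightarrow> sg h x > 0"
  using s l G_bounds(1)[of x] by (simp add: sg_def)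

text \<open>The square of \<open>mu\<close> is quadratic in \<open>sg\<close> and \<open>mu1\<close>
  is linear, so the smallness required by \<open>flux_sign\<close> holds once \<open>sg\<close> is
  at least \<open>\<kappa> * l\<close> with
  \<open>\<kappa> * \<rho>^2 \<ge> 6 * 2 * K^2\<close>.\<close>

lemma mu1_small:
  assumes t: "t \<in> {0<..<T}" and k: "k < N" "x \<in> {a k..a (Suc k)}" "x \<notin> \<omega>"
  shows "\<bar>mu1 (\<theta> T t) x (b1 k x) (b2 k x)\<bar> \<le> (mu (\<theta> T t) x (b1 k x))^2 / 6"
proof -
  let ?\<sigma> = "sg (\<theta> T t) x"
  have \<sigma>: "?\<sigma> > 0" by (rule sg_pos[OF \<theta>_pos[OF t]])
  have "\<bar>l * (b1 k x)^2 + b2 k x\<bar> \<le> 2 * K^2 * l"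
    by (rule weight_derivative_bounds(1)[OF K(1) l K(2-4)]) (use k in auto)
  then have "6 * \<bar>l * (b1 k x)^2 + b2 k x\<bar> \<le> 6 * (2 * K^2 * l)" by (rule mult_left_mono) simp
  also have "6 * (2 * K^2 * l) = 12 * K^2 * l" by simp
  also have "\<dots> \<le> \<kappa> * \<rho>^2 * l" using \<kappa>(1) l by (intro mult_right_mono) auto
  also have "\<dots> \<le> ?\<sigma> * \<rho>^2" using mult_right_mono[OF sg_ge[OF t, of x], of "\<rho>^2"] by (simp add: mult_ac)
  also have "\<dots> \<le> ?\<sigma> * (b1 k x)^2"
    using power_mono[OF \<rho>(3)[OF k], of 2] \<rho>(1) \<sigma> by (intro mult_left_mono) auto
  finally have "?\<sigma> * (6 * \<bar>l * (b1 k x)^2 + b2 k x\<bar>) \<le> ?\<sigma> * (?\<sigma> * (b1 k x)^2)" using \<sigma> by (intro mult_left_mono) auto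
  then show ?thesis using \<sigma> by (simp add: mu1_def mu_def abs_mult power2_eq_square mult_ac)
qed

lemma partition_ends: "N \<ge> 1" "a 0 = 0" "a N = L" "Suc (N - 1) = N" "N - 1 < N" "0 < N" "L > 0"
  using part partition_subint(1)[OF part, of 0] partition_mono[OF part, of 1 N] by (auto simp: is_partition_def)

text \<open>Unlike in \<open>chain\<close>, the third derivative is indexed by subintervals as well:
  for the conjugated function it contains the one-sided derivatives of \<beta>.\<close>

definition slice :: "(nat \<Rightarrow> real \<Rightarrow> real) \<Rightarrow> (nat \<Rightarrow> real \<Rightarrow> real) \<Rightarrow> (nat \<Rightarrow> real \<Rightarrow> real) \<Rightarrow> (nat \<Rightarrow> real \<Rightarrow> real) \<Rightarrow> bool" where
  "slice y0 y1 y2 y3 \<longleftrightarrow>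
     (\<forall>k<N. AC (a k) (a (Suc k)) (y0 k) (y1 k) \<and> AC (a k) (a (Suc k)) (y1 k) (y2 k) \<and> AC (a k) (a (Suc k)) (y2 k) (y3 k)) \<and>
     (\<forall>k\<in>{1..<N}. y0 (k - 1) (a k) = y0 k (a k) \<and> sqrt (p (k - 1)) * y1 (k - 1) (a k) = sqrt (p k) * y1 k (a k) \<and>
        p (k - 1) * y2 (k - 1) (a k) = p k * y2 k (a k)) \<and>
     y0 0 0 = 0 \<and> y0 (N - 1) L = 0"

lemma slice_conj:
  assumes c: "chain N a p L f g1 g2 g3"
  obtains y0 y1 y2 y3 where "slice y0 y1 y2 y3"
    "\<And>k. k < N \<Longrightarrow> AE x in lborel. x \<in> subint a k \<longrightarrow>
       mm h x * f x = y0 k x \<and> conj1 (mm h x) (mu h x (b1 k x)) (f x) (g1 x) = y1 k x \<and>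
       conj2 (mm h x) (mu h x (b1 k x)) (mu1 h x (b1 k x) (b2 k x)) (f x) (g1 x) (g2 x) = y2 k x \<and>
       conj3 (mm h x) (mu h x (b1 k x)) (mu1 h x (b1 k x) (b2 k x)) (mu2 h x (b1 k x) (b2 k x) (b3 k x)) (f x) (g1 x) (g2 x) (g3 x) = y3 k x"
proof -
  from c obtain w0 w1 w2 where w:
    "\<forall>k<N. AC (a k) (a (Suc k)) (w0 k) (w1 k) \<and> AC (a k) (a (Suc k)) (w1 k) (w2 k) \<and>
        AC (a k) (a (Suc k)) (w2 k) g3 \<and>
        (AE x in lborel. x \<in> subint a k \<longrightarrow> f x = w0 k x \<and> g1 x = w1 k x \<and> g2 x = w2 k x)"
    "\<forall>k\<in>{1..<N}. w0 (k - 1) (a k) = w0 k (a k) \<and>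
        sqrt (p (k - 1)) * w1 (k - 1) (a k) = sqrt (p k) * w1 k (a k) \<and>
        p (k - 1) * w2 (k - 1) (a k) = p k * w2 k (a k)"
    and e: "w0 0 0 = 0" "w0 (N - 1) L = 0"
    unfolding chain_def by (elim exE conjE) (rule that)
  note ac = w(1)[rule_format, THEN conjunct1] w(1)[rule_format, THEN conjunct2, THEN conjunct1]
    w(1)[rule_format, THEN conjunct2, THEN conjunct2, THEN conjunct1]
  note ae = w(1)[rule_format, THEN conjunct2, THEN conjunct2, THEN conjunct2]
  note i = w(2)[rule_format, THEN conjunct1] w(2)[rule_format, THEN conjunct2, THEN conjunct1]
    w(2)[rule_format, THEN conjunct2, THEN conjunct2]
  define y0 where "y0 k x = mm h x * w0 k x" for k x
  define y1 where "y1 k x = conj1 (mm h x) (mu h x (b1 k x)) (w0 k x) (w1 k x)" for k x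
  define y2 where "y2 k x = conj2 (mm h x) (mu h x (b1 k x)) (mu1 h x (b1 k x) (b2 k x)) (w0 k x) (w1 k x) (w2 k x)" for k x
  define y3 where "y3 k x = conj3 (mm h x) (mu h x (b1 k x)) (mu1 h x (b1 k x) (b2 k x)) (mu2 h x (b1 k x) (b2 k x) (b3 k x))
    (w0 k x) (w1 k x) (w2 k x) (g3 x)" for k x
  show thesis
  proof (rule that)
    show "slice y0 y1 y2 y3" unfolding slice_def
    proof (intro conjI allI impI ballI)
      fix k assume k: "k < N"
      note A = AC_conj[OF AC_weights(1,2,3)[OF k, of h] ac(1,2,3)[OF k]]
      show "AC (a k) (a (Suc k)) (y0 k) (y1 k)" using A(1) unfolding y0_def[abs_def] y1_def[abs_def] .
      show "AC (a k) (a (Suc k)) (y1 k) (y2 k)" using A(2) unfolding y1_def[abs_def] y2_def[abs_def] .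
      show "AC (a k) (a (Suc k)) (y2 k) (y3 k)" using A(3) unfolding y2_def[abs_def] y3_def[abs_def] .
    next
      fix k assume k: "k \<in> {1..<N}"
      have pos: "p (k - 1) > 0" "p k > 0" using k p by auto
      note I = conj_interface[OF mu_interface[OF k] i(1,2,3)[OF k] pos]
      show "y0 (k - 1) (a k) = y0 k (a k)" unfolding y0_def i(1)[OF k] ..
      show "sqrt (p (k - 1)) * y1 (k - 1) (a k) = sqrt (p k) * y1 k (a k)" unfolding y1_def by (rule I(1))
      show "p (k - 1) * y2 (k - 1) (a k) = p k * y2 k (a k)" unfolding y2_def by (rule I(2))
    qed (simp_all add: y0_def e e[simplified])
    fix k assume k: "k < N"
    show "AE x in lborel. x \<in> subint a k \<longrightarrow>
       mm h x * f x = y0 k x \<and> conj1 (mm h x) (mu h x (b1 k x)) (f x) (g1 x) = y1 k x \<and>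
       conj2 (mm h x) (mu h x (b1 k x)) (mu1 h x (b1 k x) (b2 k x)) (f x) (g1 x) (g2 x) = y2 k x \<and>
       conj3 (mm h x) (mu h x (b1 k x)) (mu1 h x (b1 k x) (b2 k x)) (mu2 h x (b1 k x) (b2 k x) (b3 k x)) (f x) (g1 x) (g2 x) (g3 x) = y3 k x"
      using ae[OF k] by (rule eventually_mono) (simp add: y0_def y1_def y2_def y3_def)
  qed
qed

lemma slice_flux:
  assumes t: "t \<in> {0<..<T}" and S: "slice y0 y1 y2 y3"
    and X: "X \<in> borel_measurable borel"
    and eq: "\<And>k. k < N \<Longrightarrow> AE x in lborel. x \<in> subint a k \<longrightarrow> X x = (p k)^2 *
       (product_form (mu h x (b1 k x)) (mu1 h x (b1 k x) (b2 k x)) (y0 k x) (y1 k x) (y2 k x) (y3 k x)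
        - bulk (mu h x (b1 k x)) (mu1 h x (b1 k x) (b2 k x)) (mu2 h x (b1 k x) (b2 k x) (b3 k x)) (y0 k x) (y1 k x) (y2 k x))"
    and h: "h = \<theta> T t"
  shows "0 \<le> (LBINT x:{0<..<L}. X x)"
proof -
  have ac: "\<And>k. k < N \<Longrightarrow> AC (a k) (a (Suc k)) (y0 k) (y1 k)" "\<And>k. k < N \<Longrightarrow> AC (a k) (a (Suc k)) (y1 k) (y2 k)"
      "\<And>k. k < N \<Longrightarrow> AC (a k) (a (Suc k)) (y2 k) (y3 k)"
    and i: "\<And>k. k \<in> {1..<N} \<Longrightarrow> y0 (k - 1) (a k) = y0 k (a k)"
      "\<And>k. k \<in> {1..<N} \<Longrightarrow> sqrt (p (k - 1)) * y1 (k - 1) (a k) = sqrt (p k) * y1 k (a k)"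
      "\<And>k. k \<in> {1..<N} \<Longrightarrow> p (k - 1) * y2 (k - 1) (a k) = p k * y2 k (a k)"
    and e: "y0 0 0 = 0" "y0 (N - 1) L = 0"
    using S unfolding slice_def by blast+
  have A: "AC (a k) (a (Suc k)) (\<lambda>x. (p k)^2 * flux (mu h x (b1 k x)) (mu1 h x (b1 k x) (b2 k x)) (y0 k x) (y1 k x) (y2 k x))
     (\<lambda>x. (p k)^2 * (product_form (mu h x (b1 k x)) (mu1 h x (b1 k x) (b2 k x)) (y0 k x) (y1 k x) (y2 k x) (y3 k x)
        - bulk (mu h x (b1 k x)) (mu1 h x (b1 k x) (b2 k x)) (mu2 h x (b1 k x) (b2 k x) (b3 k x)) (y0 k x) (y1 k x) (y2 k x)))"
    if k: "k < N" for k
    by (rule AC_cmult[OF flux_identity[OF ac[OF k] AC_weights(2,3)[OF k]]])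
  have th: "h > 0" unfolding h by (rule \<theta>_pos[OF t])
  have neg: "mu h x c < 0 \<longleftrightarrow> c > 0" "mu h x c > 0 \<longleftrightarrow> c < 0" for x c
    using sg_pos[OF th, of x] by (simp_all add: mu_def zero_less_mult_iff mult_less_0_iff)
  have "0 \<le> (\<Sum>k<N. (p k)^2 * flux (mu h (a (Suc k)) (b1 k (a (Suc k)))) (mu1 h (a (Suc k)) (b1 k (a (Suc k))) (b2 k (a (Suc k)))) (y0 k (a (Suc k))) (y1 k (a (Suc k))) (y2 k (a (Suc k)))
      - (p k)^2 * flux (mu h (a k) (b1 k (a k))) (mu1 h (a k) (b1 k (a k)) (b2 k (a k))) (y0 k (a k)) (y1 k (a k)) (y2 k (a k)))"
  proof (rule space_flux_nonneg[OF part p i e, where M = "\<lambda>k x. mu h x (b1 k x)" and ?M1.0 = "\<lambda>k x. mu1 h x (b1 k x) (b2 k x)"])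
    show "p (k - 1) > p k \<and> mu h (a k) (b1 k (a k)) < 0 \<or> p (k - 1) < p k \<and> mu h (a k) (b1 k (a k)) > 0"
      if "k \<in> {1..<N}" for k using sgn(1)[OF that] unfolding neg .
    show "\<bar>mu1 h (a k) (b1 k (a k)) (b2 k (a k))\<bar> \<le> (mu h (a k) (b1 k (a k)))^2 / 6" if "k \<in> {1..<N}" for k
      unfolding h by (rule mu1_small[OF t]) (use that \<omega>(2)[of k] partition_subint(1)[OF part, of k] in auto)
    show "\<bar>mu1 h 0 (b1 0 0) (b2 0 0)\<bar> \<le> (mu h 0 (b1 0 0))^2 / 6"
      unfolding h by (rule mu1_small[OF t]) (use \<omega>(2)[of 0] partition_ends partition_subint(1)[OF part, of 0] in auto)
    show "\<bar>mu1 h L (b1 (N - 1) L) (b2 (N - 1) L)\<bar> \<le> (mu h L (b1 (N - 1) L))^2 / 6"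
      unfolding h by (rule mu1_small[OF t]) (use \<omega>(2)[of N] partition_ends partition_subint(1)[OF part, of "N - 1"] in auto)
  qed (use mu_interface sgn(2,3) in \<open>simp_all add: neg\<close>)
  also have "\<dots> = (\<Sum>k<N. LBINT x:{a k..a (Suc k)}. (p k)^2 *
       (product_form (mu h x (b1 k x)) (mu1 h x (b1 k x) (b2 k x)) (y0 k x) (y1 k x) (y2 k x) (y3 k x)
        - bulk (mu h x (b1 k x)) (mu1 h x (b1 k x) (b2 k x)) (mu2 h x (b1 k x) (b2 k x) (b3 k x)) (y0 k x) (y1 k x) (y2 k x)))"
    by (intro sum.cong refl AC_integral[OF A, symmetric]) (use partition_subint(1)[OF part] in \<open>auto simp: less_imp_le\<close>)
  also have "\<dots> = (LBINT x:{0<..<L}. X x)"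
    by (rule partition_integral(2)[OF part X AC_integrable[OF A] eq, symmetric]) auto
  finally show ?thesis .
qed

text \<open>The two slices may belong to different times, because the operator is formed with
  \<open>h = 1\<close> and does not see the time; the constant \<open>c\<close> takes up the time
  dependent factors.\<close>

lemma slice_symmetric:
  assumes S: "slice y0 y1 y2 y3" and S': "slice z0 z1 z2 z3"
    and X: "X \<in> borel_measurable borel" "Y \<in> borel_measurable borel"
    and eq: "\<And>k. k < N \<Longrightarrow> AE x in lborel. x \<in> subint a k \<longrightarrow>
        X x = c * (p k * (y0 k x * (mu1 1 x (b1 k x) (b2 k x) * z1 k x + mu 1 x (b1 k x) * z2 k x)))"
      "\<And>k. k < N \<Longrightarrow> AE x in lborel. x \<in> subint a k \<longrightarrow>
        Y x = c * (p k * (z0 k x * (mu1 1 x (b1 k x) (b2 k x) * y1 k x + mu 1 x (b1 k x) * y2 k x)))"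
  shows "(LBINT x:{0<..<L}. X x) = (LBINT x:{0<..<L}. Y x)"
proof -
  have ac: "\<And>k. k < N \<Longrightarrow> AC (a k) (a (Suc k)) (y0 k) (y1 k)" "\<And>k. k < N \<Longrightarrow> AC (a k) (a (Suc k)) (y1 k) (y2 k)"
    and i: "\<And>k. k \<in> {1..<N} \<Longrightarrow> y0 (k - 1) (a k) = y0 k (a k)"
      "\<And>k. k \<in> {1..<N} \<Longrightarrow> sqrt (p (k - 1)) * y1 (k - 1) (a k) = sqrt (p k) * y1 k (a k)"
    and e: "y0 0 0 = 0" "y0 (N - 1) L = 0"
    using S unfolding slice_def by blast+
  have ac': "\<And>k. k < N \<Longrightarrow> AC (a k) (a (Suc k)) (z0 k) (z1 k)" "\<And>k. k < N \<Longrightarrow> AC (a k) (a (Suc k)) (z1 k) (z2 k)"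
    and i': "\<And>k. k \<in> {1..<N} \<Longrightarrow> z0 (k - 1) (a k) = z0 k (a k)"
      "\<And>k. k \<in> {1..<N} \<Longrightarrow> sqrt (p (k - 1)) * z1 (k - 1) (a k) = sqrt (p k) * z1 k (a k)"
    and e': "z0 0 0 = 0" "z0 (N - 1) L = 0"
    using S' unfolding slice_def by blast+
  note sym = symmetric_slices[OF part p AC_weights(2)[where h = 1] mu_interface(1)[where h = 1] ac i e ac' i' e']
  let ?f = "\<lambda>k x. y0 k x * (mu1 1 x (b1 k x) (b2 k x) * z1 k x + mu 1 x (b1 k x) * z2 k x)"
  let ?g = "\<lambda>k x. z0 k x * (mu1 1 x (b1 k x) (b2 k x) * y1 k x + mu 1 x (b1 k x) * y2 k x)"
  have int: "set_integrable lborel {a k..a (Suc k)} (\<lambda>x. c * (p k * ?f k x))"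
    "set_integrable lborel {a k..a (Suc k)} (\<lambda>x. c * (p k * ?g k x))" if "k < N" for k
  proof -
    show "set_integrable lborel {a k..a (Suc k)} (\<lambda>x. c * (p k * ?f k x))"
      by (intro set_integrable_mult_right impI, rule sym(2)) (use that in auto)
    show "set_integrable lborel {a k..a (Suc k)} (\<lambda>x. c * (p k * ?g k x))"
      by (intro set_integrable_mult_right impI, rule sym(3)) (use that in auto)
  qed
  have "(LBINT x:{0<..<L}. X x) - (LBINT x:{0<..<L}. Y x)
    = (\<Sum>k<N. (LBINT x:{a k..a (Suc k)}. c * (p k * ?f k x)) - (LBINT x:{a k..a (Suc k)}. c * (p k * ?g k x)))"
    unfolding partition_integral(2)[OF part X(1) int(1) eq(1), simplified] partition_integral(2)[OF part X(2) int(2) eq(2), simplified]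
    by (simp add: sum_subtractf)
  also have "\<dots> = (\<Sum>k<N. c * (LBINT x:{a k..a (Suc k)}. p k * (?f k x - ?g k x)))"
  proof (rule sum.cong[OF refl])
    fix k assume "k \<in> {..<N}"
    then have k: "k < N" by simp
    have "(LBINT x:{a k..a (Suc k)}. c * (p k * ?f k x)) - (LBINT x:{a k..a (Suc k)}. c * (p k * ?g k x))
      = (LBINT x:{a k..a (Suc k)}. c * (p k * ?f k x) - c * (p k * ?g k x))"
      by (rule set_integral_diff(2)[OF int[OF k], symmetric])
    also have "\<dots> = (LBINT x:{a k..a (Suc k)}. c * (p k * (?f k x - ?g k x)))"
      by (simp only: right_diff_distrib)
    also have "\<dots> = c * (LBINT x:{a k..a (Suc k)}. p k * (?f k x - ?g k x))" by (rule set_integral_mult_right)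
    finally show "(LBINT x:{a k..a (Suc k)}. c * (p k * ?f k x)) - (LBINT x:{a k..a (Suc k)}. c * (p k * ?g k x))
      = c * (LBINT x:{a k..a (Suc k)}. p k * (?f k x - ?g k x))" .
  qed
  also have "\<dots> = 0"
  proof -
    have "(\<Sum>k<N. LBINT x:{a k..a (Suc k)}. p k * (?f k x - ?g k x)) = 0" by (rule sym(1)) auto
    then show ?thesis by (simp only: sum_distrib_left[symmetric] mult_zero_right)
  qed
  finally show ?thesis by simp
qed

end

section \<open>The integral identities for a function of the solution space\<close>

lemma borel_slice:
  fixes f :: "real \<times> real \<Rightarrow> real"
  assumes "f \<in> borel_measurable borel"
  shows "(\<lambda>x. f (t, x)) \<in> borel_measurable borel" "(\<lambda>t. f (t, x)) \<in> borel_measurable borel"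
proof -
  have [measurable]: "f \<in> borel_measurable (borel \<Otimes>\<^sub>M borel)" using assms by (simp add: borel_prod)
  show "(\<lambda>x. f (t, x)) \<in> borel_measurable borel" "(\<lambda>t. f (t, x)) \<in> borel_measurable borel" by measurable
qed

lemma integral_pair_iterated_swap:
  fixes f :: "real \<times> real \<Rightarrow> real"
  assumes "integrable lborel f"
  shows "(LINT z|lborel. f z) = (LBINT x. LBINT t. f (t, x))"
proof -
  have "integrable (lborel \<Otimes>\<^sub>M lborel) f" using assms unfolding lborel_prod .
  from lborel_pair.integral_snd[of "\<lambda>t x. f (t, x)", simplified, OF this] show ?thesis by (simp add: lborel_prod)
qed

lemma poly_growth_divide: "poly_growth T f \<Longrightarrow> poly_growth T (\<lambda>z. f z / c)"
  unfolding divide_inverse by (intro poly_growth_mult poly_growth_const)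

locale carleman_solution = carleman_weight +
  fixes U Z u1 u2 u3 B D :: "real \<times> real \<Rightarrow> real" and Mb :: real
  assumes U: "sq_int (\<lambda>z. indicator (cylinder T L) z * U z)" and Z: "sq_int Z" and u: "sq_int u1" "sq_int u2" "sq_int u3"
    and BD: "B \<in> borel_measurable borel" "D \<in> borel_measurable borel" "\<And>z. \<bar>B z\<bar> \<le> Mb" "\<And>z. \<bar>D z\<bar> \<le> Mb"
    and time: "AE x in lborel. AC 0 T (\<lambda>t. U (t, x)) (\<lambda>t. Z (t, x))"
    and space: "AE t in lborel. t \<in> {0<..<T} \<longrightarrow>
      chain N a p L (\<lambda>x. U (t, x)) (\<lambda>x. u1 (t, x)) (\<lambda>x. u2 (t, x)) (\<lambda>x. u3 (t, x))"
begin

abbreviation I :: "real \<times> real \<Rightarrow> real" where "I z \<equiv> indicator (cylinder T L) z"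
abbreviation P :: "real \<times> real \<Rightarrow> real" where "P z \<equiv> pcoef N a p (snd z)"

definition h :: "real \<times> real \<Rightarrow> real" where "h z = \<theta> T (fst z)"
definition c1 :: "real \<times> real \<Rightarrow> real" where "c1 z = glue N a b1 (snd z)"
definition c2 :: "real \<times> real \<Rightarrow> real" where "c2 z = glue N a b2 (snd z)"
definition c3 :: "real \<times> real \<Rightarrow> real" where "c3 z = glue N a b3 (snd z)"
definition m :: "real \<times> real \<Rightarrow> real" where "m z = mm (h z) (snd z)"
definition M :: "real \<times> real \<Rightarrow> real" where "M z = mu (h z) (snd z) (c1 z)"
definition M1 :: "real \<times> real \<Rightarrow> real" where "M1 z = mu1 (h z) (snd z) (c1 z) (c2 z)"
definition M2 :: "real \<times> real \<Rightarrow> real" where "M2 z = mu2 (h z) (snd z) (c1 z) (c2 z) (c3 z)"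
definition tau :: "real \<times> real \<Rightarrow> real" where "tau z = \<tau> T (fst z)"
text \<open>This is \<open>s \<eta>_t\<close>, since \<open>tau * h\<close> is the time derivative
  of \<open>h\<close>.\<close>

definition e :: "real \<times> real \<Rightarrow> real" where "e z = s * (E - G (snd z)) * (tau z * h z)"

definition v0 :: "real \<times> real \<Rightarrow> real" where "v0 z = I z * (m z * U z)"
definition v1 :: "real \<times> real \<Rightarrow> real" where "v1 z = I z * conj1 (m z) (M z) (U z) (u1 z)"
definition v2 :: "real \<times> real \<Rightarrow> real" where "v2 z = I z * conj2 (m z) (M z) (M1 z) (U z) (u1 z) (u2 z)"
definition v3 :: "real \<times> real \<Rightarrow> real" where "v3 z = I z * conj3 (m z) (M z) (M1 z) (M2 z) (U z) (u1 z) (u2 z) (u3 z)"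
definition vt :: "real \<times> real \<Rightarrow> real" where "vt z = I z * (m z * (Z z - e z * U z))"

text \<open>The integral of \<open>X1\<close> vanishes by symmetry in space and that of \<open>X2\<close> because \<open>X2\<close> is a time
  derivative; \<open>X3\<close> is a space derivative whose boundary terms have a sign.\<close>

definition X1 :: "real \<times> real \<Rightarrow> real" where
  "X1 z = (vt z + tau z / 2 * v0 z) * (3 * P z * (M1 z * v1 z + M z * v2 z))"
definition X2 :: "real \<times> real \<Rightarrow> real" where
  "X2 z = (P z * (M z)^3 * v0 z) * (vt z + 3 / 2 * tau z * v0 z)"
definition X3 :: "real \<times> real \<Rightarrow> real" where
  "X3 z = (P z)^2 * (product_form (M z) (M1 z) (v0 z) (v1 z) (v2 z) (v3 z) - bulk (M z) (M1 z) (M2 z) (v0 z) (v1 z) (v2 z))"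

lemma poly_growth_weights:
  "poly_growth T (\<lambda>z. G (snd z))" "poly_growth T c1" "poly_growth T c2" "poly_growth T c3" "poly_growth T h"
  "poly_growth T tau" "poly_growth T P" "poly_growth T M" "poly_growth T M1" "poly_growth T M2" "poly_growth T e"
  "poly_growth T B" "poly_growth T D" "poly_growth T (\<lambda>z. h z powr (1 / 2))"
proof -
  show G: "poly_growth T (\<lambda>z. G (snd z))"
  proof (rule poly_growth_space)
    show "G \<in> borel_measurable borel" by (rule borel_measurable_continuous_onI[OF G_continuous])
    show "\<bar>G x\<bar> \<le> E" for x using G_bounds(1)[of x] G_bounds(2)[of x] by simp
  qed
  show c1: "poly_growth T c1" unfolding c1_def[abs_def]
    by (rule poly_growth_space[OF glue_measurable glue_bounded[OF part, where K = K]]) (use b_continuous K in auto)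
  show c2: "poly_growth T c2" unfolding c2_def[abs_def]
    by (rule poly_growth_space[OF glue_measurable glue_bounded[OF part, where K = K]]) (use b_continuous K in auto)
  show c3: "poly_growth T c3" unfolding c3_def[abs_def]
    by (rule poly_growth_space[OF glue_measurable glue_bounded[OF part, where K = K]]) (use d(4) K in auto)
  show h: "poly_growth T h" unfolding h_def[abs_def] by (rule poly_growth_\<theta>)
  show tau: "poly_growth T tau" unfolding tau_def[abs_def] by (rule poly_growth_\<tau>)
  show "poly_growth T P" by (rule poly_growth_space[OF pcoef_borel pcoef_bounded])
  show "poly_growth T M" unfolding M_def[abs_def] mu_def sg_def by (intro poly_growth_intros G c1 h)
  show "poly_growth T M1" unfolding M1_def[abs_def] mu1_def sg_def by (intro poly_growth_intros G c1 c2 h)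
  show "poly_growth T M2" unfolding M2_def[abs_def] mu2_def sg_def by (intro poly_growth_intros G c1 c2 c3 h)
  show "poly_growth T e" unfolding e_def[abs_def] by (intro poly_growth_intros G h tau)
  show "poly_growth T B" by (rule poly_growth_bounded[OF BD(1,3)])
  show "poly_growth T D" by (rule poly_growth_bounded[OF BD(2,4)])
  show "poly_growth T (\<lambda>z. h z powr (1 / 2))" unfolding h_def by (rule poly_growth_sqrt)
qed

lemmas pg = poly_growth_intros poly_growth_divide poly_growth_weights

lemma m_measurable: "m \<in> borel_measurable borel"
proof -
  have [measurable]: "(\<lambda>z :: real \<times> real. G (snd z)) \<in> borel_measurable borel" "h \<in> borel_measurable borel"
    using poly_growth_weights(1,5) by (auto simp: poly_growth_def)
  show ?thesis unfolding m_def[abs_def] mm_def by measurable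
qed

text \<open>\<open>E - G\<close> is at least \<open>c0 > 0\<close>, so \<open>m\<close> is at most
  \<open>exp (- s c0 \<theta>)\<close>.\<close>

lemma rapid_m:
  assumes "sq_int (\<lambda>z. I z * f z)"
  shows "rapid T L (\<lambda>z. I z * (m z * f z))"
proof (rule rapid_exp[OF assms m_measurable, of "s * c0"])
  show "s * c0 > 0" using s E(1) by simp
  fix t x assume t: "t \<in> {0<..<T}"
  have "s * c0 * \<theta> T t \<le> s * (E - G x) * \<theta> T t"
    using G_bounds(3)[of x] s \<theta>_pos[OF t] by (intro mult_right_mono mult_left_mono) auto
  then show "\<bar>m (t, x)\<bar> \<le> exp (- (s * c0) * \<theta> T t)" by (simp add: m_def mm_def h_def)
qed

lemma sq_int_cylinder: "sq_int f \<Longrightarrow> sq_int (\<lambda>z. I z * f z)"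
  unfolding sq_int_def using cylinder_borel[of T L]
  by (auto intro!: sq_integrable_cmult_bounded[where K = 1] simp: indicator_def)

lemma rapid_v:
  "rapid T L v0" "rapid T L v1" "rapid T L v2" "rapid T L v3" "rapid T L vt"
  "rapid T L (\<lambda>z. I z * (m z * u1 z))" "rapid T L (\<lambda>z. I z * (m z * u2 z))" "rapid T L (\<lambda>z. I z * (m z * u3 z))"
  "rapid T L (\<lambda>z. I z * (m z * Z z))"
proof -
  show 0: "rapid T L v0" unfolding v0_def[abs_def] by (rule rapid_m[OF U])
  show 1: "rapid T L (\<lambda>z. I z * (m z * u1 z))" and 2: "rapid T L (\<lambda>z. I z * (m z * u2 z))"
    and 3: "rapid T L (\<lambda>z. I z * (m z * u3 z))" and z: "rapid T L (\<lambda>z. I z * (m z * Z z))"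
    by (rule rapid_m, rule sq_int_cylinder, rule u Z)+
  have "v1 = (\<lambda>z. I z * (m z * u1 z) - M z * v0 z)"
    by (simp add: fun_eq_iff v1_def v0_def conj1_def algebra_simps)
  then show "rapid T L v1" by (simp only:) (intro rapid_diff rapid_mult 0 1 pg)
  have "v2 = (\<lambda>z. I z * (m z * u2 z) - (2 * M z) * (I z * (m z * u1 z)) + ((M z)^2 - M1 z) * v0 z)"
    by (simp add: fun_eq_iff v2_def v0_def conj2_def algebra_simps)
  then show "rapid T L v2" by (simp only:) (intro rapid_add rapid_diff rapid_mult 0 1 2 pg)
  have "v3 = (\<lambda>z. I z * (m z * u3 z) - (3 * M z) * (I z * (m z * u2 z)) + (3 * ((M z)^2 - M1 z)) * (I z * (m z * u1 z))
      + (- ((M z)^3) + 3 * M z * M1 z - M2 z) * v0 z)"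
    by (simp add: fun_eq_iff v3_def v0_def conj3_def algebra_simps)
  then show "rapid T L v3" by (simp only:) (intro rapid_add rapid_diff rapid_mult 0 1 2 3 pg)
  have "vt = (\<lambda>z. I z * (m z * Z z) - e z * v0 z)"
    by (simp add: fun_eq_iff vt_def v0_def algebra_simps)
  then show "rapid T L vt" by (simp only:) (intro rapid_diff rapid_mult 0 z pg)
qed

lemma X_integrable: "integrable lborel X1" "integrable lborel X2" "integrable lborel X3"
proof -
  note r = rapid_integrable rapid_add rapid_diff rapid_mult pg rapid_v
  show "integrable lborel X1" unfolding X1_def[abs_def]
  proof (rule rapid_integrable[of T L])
    show "rapid T L (\<lambda>z. vt z + tau z / 2 * v0 z)"
      by (intro rapid_add rapid_mult rapid_v pg)
    show "rapid T L (\<lambda>z. 3 * P z * (M1 z * v1 z + M z * v2 z))" by (intro rapid_add rapid_mult rapid_v pg)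
  qed
  show "integrable lborel X2" unfolding X2_def[abs_def]
    by (rule rapid_integrable[of T L]) (intro rapid_add rapid_mult rapid_v pg)+
  \<comment> \<open>Every term is a product of two derivatives of the conjugated function with a
    coefficient of polynomial growth; grouped in this way each factor is
    \<open>rapid\<close>.\<close>
  have "X3 = (\<lambda>z. ((P z)^2 * (v3 z + 3 * (M z)^2 * v1 z + 3 * M z * M1 z * v0 z)) * (3 * M z * v2 z + 3 * M1 z * v1 z + (M z)^3 * v0 z)
     + (((P z)^2 * (9 / 2 * M1 z)) * v2 z + ((P z)^2 * (3 * M2 z)) * v1 z) * v2 z
     + (((P z)^2 * (9 * (M z)^2 * M1 z)) * v1 z + ((P z)^2 * (6 * (2 * M z * (M1 z)^2 + (M z)^2 * M2 z) - 9 * M z * (M1 z)^2)) * v0 z) * v1 z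
     + (((P z)^2 * (9 / 2 * (M z)^4 * M1 z)) * v0 z) * v0 z)"
    by (simp add: fun_eq_iff X3_def product_form_def bulk_def power2_eq_square algebra_simps)
  then show "integrable lborel X3"
    by (simp only:) (intro Bochner_Integration.integrable_add rapid_integrable[of T L]; intro rapid_add rapid_mult rapid_v pg)
qed

lemma slice_values:
  assumes t: "t \<in> {0<..<T}"
    and c: "chain N a p L (\<lambda>x. U (t, x)) (\<lambda>x. u1 (t, x)) (\<lambda>x. u2 (t, x)) (\<lambda>x. u3 (t, x))"
  obtains y0 y1 y2 y3 where "slice y0 y1 y2 y3"
    "\<And>k. k < N \<Longrightarrow> AE x in lborel. x \<in> subint a k \<longrightarrow>
       v0 (t, x) = y0 k x \<and> v1 (t, x) = y1 k x \<and> v2 (t, x) = y2 k x \<and> v3 (t, x) = y3 k x"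
proof (rule slice_conj[OF c, of "\<theta> T t"])
  fix y0 y1 y2 y3
  assume S: "slice y0 y1 y2 y3" and ae: "\<And>k. k < N \<Longrightarrow> AE x in lborel. x \<in> subint a k \<longrightarrow>
       mm (\<theta> T t) x * U (t, x) = y0 k x \<and>
       conj1 (mm (\<theta> T t) x) (mu (\<theta> T t) x (b1 k x)) (U (t, x)) (u1 (t, x)) = y1 k x \<and>
       conj2 (mm (\<theta> T t) x) (mu (\<theta> T t) x (b1 k x)) (mu1 (\<theta> T t) x (b1 k x) (b2 k x)) (U (t, x)) (u1 (t, x)) (u2 (t, x)) = y2 k x \<and>
       conj3 (mm (\<theta> T t) x) (mu (\<theta> T t) x (b1 k x)) (mu1 (\<theta> T t) x (b1 k x) (b2 k x)) (mu2 (\<theta> T t) x (b1 k x) (b2 k x) (b3 k x))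
         (U (t, x)) (u1 (t, x)) (u2 (t, x)) (u3 (t, x)) = y3 k x"
  show thesis
  proof (rule that[OF S])
    fix k assume k: "k < N"
    show "AE x in lborel. x \<in> subint a k \<longrightarrow>
       v0 (t, x) = y0 k x \<and> v1 (t, x) = y1 k x \<and> v2 (t, x) = y2 k x \<and> v3 (t, x) = y3 k x"
      using ae[OF k]
    proof eventually_elim
      case (elim x)
      show ?case
      proof
        assume x: "x \<in> subint a k"
        then have "I (t, x) = 1" using t partition_subint(4)[OF part k] by (auto simp: cylinder_def)
        then show "v0 (t, x) = y0 k x \<and> v1 (t, x) = y1 k x \<and> v2 (t, x) = y2 k x \<and> v3 (t, x) = y3 k x"
          using elim x by (simp add: v0_def v1_def v2_def v3_def m_def M_def M1_def M2_def h_def c1_def c2_def c3_def glue_eq[OF part k x])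
      qed
    qed
  qed
qed

lemma integral_space: "(\<And>x. x \<notin> {0<..<L} \<Longrightarrow> f x = 0) \<Longrightarrow> (LBINT x. f x) = (LBINT x:{0<..<L}. (f x :: real))"
  unfolding set_lebesgue_integral_def by (rule Bochner_Integration.integral_cong) (auto simp: indicator_def)

lemma integral_X3: "0 \<le> (LINT z|lborel. X3 z)"
proof -
  have "AE t in lborel. 0 \<le> (LBINT x. X3 (t, x))"
    using space
  proof eventually_elim
    case (elim t)
    have off: "X3 (t, x) = 0" if "(t, x) \<notin> cylinder T L" for x
      using that by (simp add: X3_def v0_def v1_def v2_def v3_def product_form_def bulk_def)
    show ?case
    proof (cases "t \<in> {0<..<T}")
      case False
      then have "X3 (t, x) = 0" for x by (intro off) (auto simp: cylinder_def)
      then show ?thesis by simp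
    next
      case t: True
      obtain y0 y1 y2 y3 where S: "slice y0 y1 y2 y3" and y: "\<And>k. k < N \<Longrightarrow> AE x in lborel. x \<in> subint a k \<longrightarrow>
         v0 (t, x) = y0 k x \<and> v1 (t, x) = y1 k x \<and> v2 (t, x) = y2 k x \<and> v3 (t, x) = y3 k x"
        using slice_values[OF t elim[rule_format, OF t]] by blast
      have "0 \<le> (LBINT x:{0<..<L}. X3 (t, x))"
      proof (rule slice_flux[OF t S])
        show "(\<lambda>x. X3 (t, x)) \<in> borel_measurable borel"
          by (rule borel_slice) (use borel_measurable_integrable[OF X_integrable(3)] in simp)
        fix k assume k: "k < N"
        show "AE x in lborel. x \<in> subint a k \<longrightarrow> X3 (t, x) = (p k)^2 *
           (product_form (mu (\<theta> T t) x (b1 k x)) (mu1 (\<theta> T t) x (b1 k x) (b2 k x)) (y0 k x) (y1 k x) (y2 k x) (y3 k x)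
            - bulk (mu (\<theta> T t) x (b1 k x)) (mu1 (\<theta> T t) x (b1 k x) (b2 k x)) (mu2 (\<theta> T t) x (b1 k x) (b2 k x) (b3 k x)) (y0 k x) (y1 k x) (y2 k x))"
          using y[OF k]
        proof (rule eventually_mono, intro impI)
          fix x assume x: "x \<in> subint a k" and v: "x \<in> subint a k \<longrightarrow>
            v0 (t, x) = y0 k x \<and> v1 (t, x) = y1 k x \<and> v2 (t, x) = y2 k x \<and> v3 (t, x) = y3 k x"
          show "X3 (t, x) = (p k)^2 *
           (product_form (mu (\<theta> T t) x (b1 k x)) (mu1 (\<theta> T t) x (b1 k x) (b2 k x)) (y0 k x) (y1 k x) (y2 k x) (y3 k x)
            - bulk (mu (\<theta> T t) x (b1 k x)) (mu1 (\<theta> T t) x (b1 k x) (b2 k x)) (mu2 (\<theta> T t) x (b1 k x) (b2 k x) (b3 k x)) (y0 k x) (y1 k x) (y2 k x))"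
            using v x by (simp add: X3_def M_def M1_def M2_def h_def c1_def c2_def c3_def glue_eq[OF part k x] pcoef_eq[OF part k x])
        qed
      qed simp
      also have "(LBINT x:{0<..<L}. X3 (t, x)) = (LBINT x. X3 (t, x))"
        by (rule integral_space[symmetric], rule off) (simp add: cylinder_def)
      finally show ?thesis .
    qed
  qed
  then show ?thesis unfolding integral_pair_iterated[OF X_integrable(3)] by (rule integral_nonneg_AE)
qed

lemma integral_X2: "(LINT z|lborel. X2 z) = 0"
proof -
  have "AE x in lborel. (LBINT t. X2 (t, x)) = 0"
    using time
  proof eventually_elim
    case (elim x)
    have off: "X2 (t, x) = 0" if "(t, x) \<notin> cylinder T L" for t
      using that by (simp add: X2_def v0_def)
    show ?case
    proof (cases "x \<in> {0<..<L}")
      case False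
      then have "X2 (t, x) = 0" for t by (intro off) (auto simp: cylinder_def)
      then show ?thesis by simp
    next
      case x: True
      \<comment> \<open>\<open>P M^3 v0^2 / 2\<close> equals
        \<open>A \<theta>^3 exp (- c \<theta>) U^2\<close>, and \<open>X2\<close> is its time
        derivative: the factor \<open>\<theta>^3\<close> contributes \<open>3 \<tau>\<close>, hence
        the \<open>3 / 2\<close> in \<open>X2\<close>. The function vanishes at 0 and
        \<open>T\<close>.\<close>
      define c where "c = 2 * (s * (E - G x))"
      define A where "A = pcoef N a p x * (mu 1 x (glue N a b1 x))^3 / 2"
      have c: "c > 0" using s G_bounds(3)[of x] E(1) by (simp add: c_def)
      note ac = AC_mult[OF AC_time_weight[OF T c, of 3] AC_mult[OF elim elim], simplified]
      have "X2 (t, x) = A * (indicator {0..T} t * (\<theta> T t powr 3 * exp (- (c * \<theta> T t)) * ((3 - c * \<theta> T t) * \<tau> T t) * (U (t, x) * U (t, x)) +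
          \<theta> T t powr 3 * exp (- (c * \<theta> T t)) * (Z (t, x) * U (t, x) + U (t, x) * Z (t, x))))" (is "_ = A * (_ * ?f t)") for t
      proof (cases "t \<in> {0<..<T}")
        case False
        then have "X2 (t, x) = 0" by (intro off) (auto simp: cylinder_def)
        moreover have "indicator {0..T} t * ?f t = 0" using False by (cases "t = 0 \<or> t = T") (auto simp: \<theta>_def)
        ultimately show ?thesis by simp
      next
        case t: True
        have i: "I (t, x) = 1" using t x by (simp add: cylinder_def)
        have th: "\<theta> T t powr 3 = (\<theta> T t)^3" using \<theta>_pos[OF t] by (simp add: powr_numeral)
        have ex: "exp (- (c * \<theta> T t)) = (mm (\<theta> T t) x)^2"
          by (simp add: mm_def c_def power2_eq_square flip: exp_add)
        have mu: "mu (\<theta> T t) x (glue N a b1 x) = \<theta> T t * mu 1 x (glue N a b1 x)" by (simp add: mu_def sg_def)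
        show ?thesis unfolding th ex using t i
          by (simp add: X2_def A_def v0_def vt_def m_def M_def h_def c1_def tau_def e_def mu c_def power2_eq_square power3_eq_cube algebra_simps)
      qed
      then have "(LBINT t. X2 (t, x)) = A * (LBINT t:{0..T}. ?f t)"
        by (simp add: set_lebesgue_integral_def)
      also have "(LBINT t:{0..T}. ?f t) = 0" using AC_integral[OF ac] T by (simp add: \<theta>_def)
      finally show ?thesis by simp
    qed
  qed
  then have "(LBINT x. LBINT t. X2 (t, x)) = (LBINT x :: real. 0 :: real)"
  proof (rule integral_cong_AE[rotated 2])
    have "(\<lambda>z. X2 z) \<in> borel_measurable (borel \<Otimes>\<^sub>M borel)"
      using borel_measurable_integrable[OF X_integrable(2)] by (simp add: borel_prod)
    then have [measurable]: "(\<lambda>(x, t). X2 (t, x)) \<in> borel_measurable (borel \<Otimes>\<^sub>M borel)" by measurable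
    show "(\<lambda>x. LBINT t. X2 (t, x)) \<in> borel_measurable lborel" by measurable
  qed simp
  then show ?thesis unfolding integral_pair_iterated_swap[OF X_integrable(2)] by simp
qed

lemma integral_X1: "(LINT z|lborel. X1 z) = 0"
proof -
  \<comment> \<open>\<open>M\<close> and \<open>M1\<close> each contain one factor \<open>h\<close>.
    One half of it goes to \<open>w\<close> and the other to \<open>W\<close>, so that
    \<open>W\<close> is the image of \<open>w\<close> under an operator with coefficients
    \<open>mu 1\<close>. Differentiating the square root of \<open>h\<close> accounts for
    \<open>tau / 2\<close> in \<open>wt\<close>.\<close>
  define w where "w z = h z powr (1 / 2) * v0 z" for z
  define wt where "wt z = h z powr (1 / 2) * (vt z + tau z / 2 * v0 z)" for z
  define W where "W z = h z powr (1 / 2) * (3 * P z * (mu1 1 (snd z) (c1 z) (c2 z) * v1 z + mu 1 (snd z) (c1 z) * v2 z))" for z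
  have pm: "poly_growth T (\<lambda>z. mu 1 (snd z) (c1 z))" "poly_growth T (\<lambda>z. mu1 1 (snd z) (c1 z) (c2 z))"
    unfolding mu_def mu1_def sg_def by (intro pg)+
  have w: "sq_int w" unfolding w_def[abs_def] by (rule rapid_sq_int[of T L], intro rapid_mult rapid_v pg)
  have wt: "sq_int wt" unfolding wt_def[abs_def] by (rule rapid_sq_int[of T L], intro rapid_mult rapid_add rapid_v pg)
  have W: "sq_int W" unfolding W_def[abs_def] by (rule rapid_sq_int[of T L], intro rapid_mult rapid_add rapid_v pg pm)
  have off: "w z = 0" "wt z = 0" "W z = 0" if "z \<notin> cylinder T L" for z
    using that by (simp_all add: w_def wt_def W_def v0_def v1_def v2_def vt_def)
  have "(LINT z|lborel. wt z * W z) = 0"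
  proof (rule symmetric_evolution[OF w wt W _ space])
    show "AE x in lborel. \<forall>t h. h > 0 \<longrightarrow> w (t + h, x) - w (t - h, x) = (LBINT s:{t - h..t + h}. wt (s, x))"
      using time
    proof eventually_elim
      case (elim x)
      show ?case
      proof (cases "x \<in> {0<..<L}")
        case False
        then have "w (t, x) = 0" "wt (t, x) = 0" for t by (auto intro!: off simp: cylinder_def)
        then show ?thesis by simp
      next
        case x: True
        define c where "c = s * (E - G x)"
        have c: "c > 0" using s G_bounds(3)[of x] E(1) by (simp add: c_def)
        have ac: "AC 0 T (\<lambda>t. \<theta> T t powr (1 / 2) * exp (- c * \<theta> T t) * U (t, x))
          (\<lambda>t. \<theta> T t powr (1 / 2) * exp (- c * \<theta> T t) * ((1 / 2 - c * \<theta> T t) * \<tau> T t) * U (t, x)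
             + \<theta> T t powr (1 / 2) * exp (- c * \<theta> T t) * Z (t, x))" (is "AC 0 T ?f ?f'")
          by (rule AC_mult[OF AC_time_weight[OF T c] elim]) simp
        have "w (t, x) = indicator {0<..<T} t * ?f t" "wt (t, x) = indicator {0<..<T} t * ?f' t" for t
          using x by (simp_all add: w_def wt_def v0_def vt_def m_def mm_def h_def tau_def e_def c_def cylinder_def indicator_def algebra_simps)
        \<comment> \<open>The end point values are zero by \<open>1 / 0 = 0\<close> and
          \<open>0 powr (1 / 2) = 0\<close>.\<close>
        then show ?thesis using AC_zero_extension[OF ac T] by (simp add: \<theta>_def)
      qed
    qed
  next
    fix t t'
    assume ch: "t \<in> {0<..<T} \<longrightarrow> chain N a p L (\<lambda>x. U (t, x)) (\<lambda>x. u1 (t, x)) (\<lambda>x. u2 (t, x)) (\<lambda>x. u3 (t, x))"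
      "t' \<in> {0<..<T} \<longrightarrow> chain N a p L (\<lambda>x. U (t', x)) (\<lambda>x. u1 (t', x)) (\<lambda>x. u2 (t', x)) (\<lambda>x. u3 (t', x))"
    show "(LBINT x. w (t, x) * W (t', x)) = (LBINT x. w (t', x) * W (t, x))"
    proof (cases "t \<in> {0<..<T} \<and> t' \<in> {0<..<T}")
      case False
      then have "w (t, x) * W (t', x) = 0" "w (t', x) * W (t, x) = 0" for x
        using off[of "(t, x)"] off[of "(t', x)"] by (auto simp: cylinder_def)
      then show ?thesis by (simp only:)
    next
      case True
      then have t: "t \<in> {0<..<T}" and t': "t' \<in> {0<..<T}" by auto
      obtain y0 y1 y2 y3 where S: "slice y0 y1 y2 y3" and y: "\<And>k. k < N \<Longrightarrow> AE x in lborel. x \<in> subint a k \<longrightarrow>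
         v0 (t, x) = y0 k x \<and> v1 (t, x) = y1 k x \<and> v2 (t, x) = y2 k x \<and> v3 (t, x) = y3 k x"
        using slice_values[OF t ch(1)[rule_format, OF t]] by blast
      obtain z0 z1 z2 z3 where S': "slice z0 z1 z2 z3" and z: "\<And>k. k < N \<Longrightarrow> AE x in lborel. x \<in> subint a k \<longrightarrow>
         v0 (t', x) = z0 k x \<and> v1 (t', x) = z1 k x \<and> v2 (t', x) = z2 k x \<and> v3 (t', x) = z3 k x"
        using slice_values[OF t' ch(2)[rule_format, OF t']] by blast
      have bm: "w \<in> borel_measurable borel" "W \<in> borel_measurable borel" using w W by (auto simp: sq_int_def)
      let ?c = "3 * (\<theta> T t powr (1 / 2) * \<theta> T t' powr (1 / 2))"
      have "(LBINT x:{0<..<L}. w (t, x) * W (t', x)) = (LBINT x:{0<..<L}. w (t', x) * W (t, x))"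
      proof (rule slice_symmetric[OF S S', where c = ?c])
        show "(\<lambda>x. w (t, x) * W (t', x)) \<in> borel_measurable borel" "(\<lambda>x. w (t', x) * W (t, x)) \<in> borel_measurable borel"
          using borel_slice(1)[OF bm(1)] borel_slice(1)[OF bm(2)] by (auto intro: borel_measurable_times)
        fix k assume k: "k < N"
        show "AE x in lborel. x \<in> subint a k \<longrightarrow> w (t, x) * W (t', x) =
          ?c * (p k * (y0 k x * (mu1 1 x (b1 k x) (b2 k x) * z1 k x + mu 1 x (b1 k x) * z2 k x)))"
          using y[OF k] z[OF k]
        proof eventually_elim
          case (elim x)
          then show ?case
            by (auto simp: w_def W_def h_def c1_def c2_def glue_eq[OF part k] pcoef_eq[OF part k])
        qed
        show "AE x in lborel. x \<in> subint a k \<longrightarrow> w (t', x) * W (t, x) =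
          ?c * (p k * (z0 k x * (mu1 1 x (b1 k x) (b2 k x) * y1 k x + mu 1 x (b1 k x) * y2 k x)))"
          using y[OF k] z[OF k]
        proof eventually_elim
          case (elim x)
          then show ?case
            by (auto simp: w_def W_def h_def c1_def c2_def glue_eq[OF part k] pcoef_eq[OF part k])
        qed
      qed
      moreover have "w (\<tau>, x) = 0" if "x \<notin> {0<..<L}" for \<tau> x using off(1)[of "(\<tau>, x)"] that by (simp add: cylinder_def)
      ultimately show ?thesis by (subst (1 2) integral_space) auto
    qed
  qed
  also have "(\<lambda>z. wt z * W z) = X1"
  proof
    fix z
    show "wt z * W z = X1 z"
    proof (cases "z \<in> cylinder T L")
      case False
      then show ?thesis using off[of z] by (simp add: X1_def vt_def v0_def)
    next
      case True
      then have h: "h z > 0" by (auto simp: h_def cylinder_def intro!: \<theta>_pos)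
      have r: "h z powr (1 / 2) * h z powr (1 / 2) = h z" using h by (simp flip: powr_add)
      have mu: "M z = h z * mu 1 (snd z) (c1 z)" "M1 z = h z * mu1 1 (snd z) (c1 z) (c2 z)"
        by (simp_all add: M_def M1_def mu_def mu1_def sg_def)
      have "wt z * W z = (h z powr (1 / 2) * h z powr (1 / 2)) * ((vt z + tau z / 2 * v0 z) *
         (3 * P z * (mu1 1 (snd z) (c1 z) (c2 z) * v1 z + mu 1 (snd z) (c1 z) * v2 z)))"
        by (simp only: wt_def W_def mult_ac)
      also have "\<dots> = X1 z" unfolding r X1_def mu by (simp add: algebra_simps)
      finally show ?thesis .
    qed
  qed
  finally show ?thesis .
qed

text \<open>This is \<open>l \<sigma> m\<^sup>2 (\<sigma>\<^sup>4 u\<^sup>2 + \<sigma>\<^sup>2 u\<^sub>x\<^sup>2 + u\<^sub>x\<^sub>x\<^sup>2)\<close> with \<open>\<sigma> = s l \<xi>\<close> and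
  \<open>m = exp (- s \<eta>)\<close>, the integrand of both energies in the Carleman inequality.\<close>

definition \<Phi> :: "real \<times> real \<Rightarrow> real" where
  "\<Phi> z = I z * (l * sg (h z) (snd z) * ((m z)^2 * ((sg (h z) (snd z))^4 * (U z)^2 + (sg (h z) (snd z))^2 * (u1 z)^2 + (u2 z)^2)))"

text \<open>The weighted right-hand side \<open>exp (- s \<eta>) L u\<close>, with
  \<open>L u\<close> expressed through the representatives of \<open>u_t\<close> and of the space
  derivatives.\<close>

definition F :: "real \<times> real \<Rightarrow> real" where
  "F z = I z * (m z * (Z z + P z * u3 z + B z * u1 z + D z * U z))"

lemma F_integrable: "integrable lborel (\<lambda>z. (F z)^2)"
proof -
  have "F = (\<lambda>z. I z * (m z * Z z) + P z * (I z * (m z * u3 z)) + B z * (I z * (m z * u1 z)) + D z * v0 z)"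
    by (simp add: fun_eq_iff F_def v0_def algebra_simps)
  then have "rapid T L F" by (simp only:) (intro rapid_add rapid_mult rapid_v pg)
  then show ?thesis using rapid_sq_int by (auto simp: sq_int_def)
qed

lemma \<Phi>_integrable: "integrable lborel \<Phi>"
proof -
  have sg: "poly_growth T (\<lambda>z. sg (h z) (snd z))" unfolding sg_def by (intro pg)
  have "\<Phi> = (\<lambda>z. ((l * (sg (h z) (snd z))^5) * v0 z) * v0 z
     + ((l * (sg (h z) (snd z))^3) * (I z * (m z * u1 z))) * (I z * (m z * u1 z))
     + ((l * sg (h z) (snd z)) * (I z * (m z * u2 z))) * (I z * (m z * u2 z)))"
    by (simp add: fun_eq_iff \<Phi>_def v0_def indicator_def algebra_simps eval_nat_numeral)
  then show ?thesis
    by (simp only:) (intro Bochner_Integration.integrable_add rapid_integrable[of T L]; intro rapid_mult rapid_v pg sg)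
qed

lemma \<Phi>_nonneg: "0 \<le> \<Phi> z"
proof (cases "z \<in> cylinder T L")
  case True
  then have "sg (h z) (snd z) > 0" by (intro sg_pos) (auto simp: h_def cylinder_def intro!: \<theta>_pos)
  then show ?thesis using l by (simp add: \<Phi>_def)
qed (simp add: \<Phi>_def)

text \<open>Integrate \<open>carleman_pointwise\<close>: the integrals of \<open>X1\<close> and
  \<open>X2\<close> are zero and that of \<open>X3\<close> is nonnegative, so all three may be
  dropped on the left. The set \<omega> enters only as the place where \<open>b1\<close> may be
  smaller than \<rho>.\<close>

lemma carleman_integrated:
  fixes pm pM :: real
  defines "CR \<equiv> 24 * pM * T * K^3 + 4 * (2 * Mb * K + T + 5 * pM * K^3)^2"
  assumes \<kappa>': "\<kappa> \<ge> 1" "57 * K^5 \<le> \<rho>^6 * \<kappa>" "CR \<le> pm^2 * \<rho>^6 * \<kappa>" and l2: "2 * K \<le> l * \<rho>^2"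
    and pp: "0 < pm" "\<And>k. k < N \<Longrightarrow> pm \<le> p k" "\<And>k. k < N \<Longrightarrow> p k \<le> pM"
  shows "pm^2 * \<rho>^6 / (10 * K^4) * (LINT z|lborel. \<Phi> z) \<le> 2 * (LINT z|lborel. (F z)^2) +
     (pm^2 * \<rho>^6 / (10 * K^4) + 30 * K^4 * (pm^2 * \<rho>^6 + 300 * pM^2 * K^6)) * (LINT z|lborel. indicator (UNIV \<times> \<omega>) z * \<Phi> z)"
proof -
  define cc where "cc = pm^2 * \<rho>^6 / (10 * K^4)"
  define CC where "CC = pm^2 * \<rho>^6 / (10 * K^4) + 30 * K^4 * (pm^2 * \<rho>^6 + 300 * pM^2 * K^6)"
  have CC0: "CC \<ge> 0" unfolding CC_def using \<rho> K(1) by simp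
  have nn: "AE z in (lborel :: (real \<times> real) measure). snd z \<notin> a ` {..N}" by (rule AE_snd[OF AE_not_node])
  have ae: "AE z in lborel. cc * \<Phi> z + 4 * (X1 z + X2 z + X3 z) \<le> 2 * (F z)^2 + CC * (indicator (UNIV \<times> \<omega>) z * \<Phi> z)"
    using nn
  proof eventually_elim
    case (elim z)
    show ?case
    proof (cases "z \<in> cylinder T L")
      case False
      then have "\<Phi> z = 0" "X1 z = 0" "X2 z = 0" "X3 z = 0"
        by (simp_all add: \<Phi>_def X1_def X2_def X3_def v0_def v1_def v2_def v3_def vt_def product_form_def bulk_def)
      then show ?thesis by simp
    next
      case True
      then have t: "fst z \<in> {0<..<T}" and x: "snd z \<in> {0<..<L}" by (auto simp: cylinder_def)
      obtain k where k: "k < N" and xk: "snd z \<in> subint a k" using partition_cover[OF part x elim] by blast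
      have xJ: "snd z \<in> {a k..a (Suc k)}" using xk by (auto simp: subint_def)
      have i: "I z = 1" using True by simp
      let ?\<sigma> = "sg (h z) (snd z)"
      have c: "c1 z = b1 k (snd z)" "c2 z = b2 k (snd z)" "c3 z = b3 k (snd z)" and pz: "P z = p k"
        by (simp_all add: c1_def c2_def c3_def glue_eq[OF part k xk] pcoef_eq[OF part k xk])
      have th: "h z > 0" unfolding h_def by (rule \<theta>_pos[OF t])
      have th\<sigma>: "h z \<le> ?\<sigma>"
      proof -
        have "1 \<le> s * l * G (snd z)" using s l G_bounds(1)[of "snd z"] by (metis mult_ge1_I)
        from mult_right_mono[OF this, of "h z"] th show ?thesis by (simp add: sg_def mult_ac)
      qed
      have \<tau>: "\<bar>tau z\<bar> \<le> T * ?\<sigma>"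
        using \<tau>_bound[OF t] mult_left_mono[OF th\<sigma>, of T] T unfolding tau_def h_def by linarith
      \<comment> \<open>Here \<open>E \<le> G^2\<close> is used: it gives
        \<open>|e| \<le> T s (G h)^2\<close>, and \<open>s \<le> (s l)^2\<close> turns this into the
        square of \<open>sg\<close>.\<close>
      have e: "\<bar>e z\<bar> \<le> T * ?\<sigma>^2"
      proof -
        have "\<bar>e z\<bar> = s * (E - G (snd z)) * (\<bar>tau z\<bar> * h z)"
          using s G_bounds(3)[of "snd z"] E(1) th by (simp add: e_def abs_mult)
        also have "\<dots> \<le> s * (G (snd z))^2 * ((T * h z) * h z)"
          using s G_bounds(1)[of "snd z"] G_bounds(3)[of "snd z"] G_bounds(4)[of "snd z"] E(1) th \<tau>_bound[OF t] T
          by (intro mult_mono mult_nonneg_nonneg) (auto simp: tau_def h_def)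
        also have "\<dots> = T * (s * (G (snd z) * h z)^2)" by (simp add: power2_eq_square mult_ac)
        also have "\<dots> \<le> T * ((s * l)^2 * (G (snd z) * h z)^2)"
        proof -
          have "s * 1 \<le> (s * l) * (s * l)" using s l by (intro mult_mono) (auto simp: mult_ge1_I)
          then have "s \<le> (s * l)^2" by (simp add: power2_eq_square)
          then show ?thesis using T by (intro mult_left_mono mult_right_mono) auto
        qed
        also have "\<dots> = T * ?\<sigma>^2" by (simp add: sg_def power2_eq_square mult_ac)
        finally show ?thesis .
      qed
      define LA where "LA = vt z + p k * (v3 z + 3 * (M z)^2 * v1 z + 3 * M z * M1 z * v0 z)"
      define LB where "LB = p k * (3 * M z * v2 z + 3 * M1 z * v1 z + (M z)^3 * v0 z)"
      have Me: "M z = - ?\<sigma> * b1 k (snd z)" "M1 z = - ?\<sigma> * (l * (b1 k (snd z))^2 + b2 k (snd z))"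
        "M2 z = - ?\<sigma> * (l^2 * (b1 k (snd z))^3 + 3 * l * b1 k (snd z) * b2 k (snd z) + b3 k (snd z))"
        by (simp_all add: M_def M1_def M2_def mu_def mu1_def mu2_def c)
      have v: "v0 z = m z * U z" "v1 z = m z * (u1 z - M z * U z)"
        "v2 z = m z * (u2 z - 2 * M z * u1 z + ((M z)^2 - M1 z) * U z)"
        by (simp_all add: v0_def v1_def v2_def i conj1_def conj2_def)
      have sum: "LA + LB = F z - B z * (v1 z + M z * v0 z) - D z * v0 z - e z * v0 z - p k * M2 z * v0 z"
        unfolding LA_def LB_def v
        by (simp add: F_def vt_def v3_def conj3_def i pz power2_eq_square power3_eq_cube algebra_simps)
      \<comment> \<open>The time derivative in \<open>LA\<close> meets the second order group and
        the \<open>M^3\<close> term of \<open>LB\<close>. Completing these products to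
        \<open>X1\<close> and \<open>X2\<close> costs \<open>tau / 2 * 3\<close> and
        \<open>3 / 2 * tau\<close> respectively, hence the common factor of the error.\<close>
      have prod: "LA * LB = (X1 z + X2 z + X3 z) + (p k)^2 * bulk (M z) (M1 z) (M2 z) (v0 z) (v1 z) (v2 z)
         - 3 / 2 * p k * tau z * (v0 z * M1 z * v1 z + v0 z * M z * v2 z + (M z)^3 * (v0 z)^2)"
        unfolding LA_def LB_def X1_def X2_def X3_def product_form_def pz
        by (simp add: power2_eq_square power3_eq_cube algebra_simps)
      have st: "\<kappa> * l \<le> ?\<sigma>" unfolding h_def by (rule sg_ge[OF t])
      have "cc * (l * ?\<sigma> * ((m z)^2 * (?\<sigma>^4 * (U z)^2 + ?\<sigma>^2 * (u1 z)^2 + (u2 z)^2))) + 4 * (X1 z + X2 z + X3 z)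
        \<le> 2 * (F z)^2 + (if \<rho> \<le> \<bar>b1 k (snd z)\<bar> then 0 else CC * (l * ?\<sigma> * ((m z)^2 * (?\<sigma>^4 * (U z)^2 + ?\<sigma>^2 * (u1 z)^2 + (u2 z)^2))))"
        unfolding cc_def CC_def
        by (rule carleman_pointwise[OF K(1) \<rho>(1,2) _ \<kappa>'[unfolded CR_def] l l2 st pp(1) pp(2)[OF k] pp(3)[OF k]
              BD(3) BD(4) K(2)[OF k xJ] K(3)[OF k xJ] K(4)[OF k xJ] \<tau> e Me v sum prod]) (use T in simp)
      then have main: "cc * \<Phi> z + 4 * (X1 z + X2 z + X3 z)
        \<le> 2 * (F z)^2 + (if \<rho> \<le> \<bar>b1 k (snd z)\<bar> then 0 else CC * \<Phi> z)"
        by (simp only: \<Phi>_def i mult_1)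
      show ?thesis
      proof (cases "snd z \<in> \<omega>")
        case True
        then have "indicator (UNIV \<times> \<omega>) z = (1 :: real)" by (cases z) simp
        moreover have "0 \<le> CC * \<Phi> z" using CC0 \<Phi>_nonneg by simp
        ultimately show ?thesis using main by (simp split: if_splits)
      next
        case False
        then show ?thesis using main \<rho>(3)[OF k xJ False] by (cases z) simp
      qed
    qed
  qed
  have mI: "integrable lborel (\<lambda>z. indicator (UNIV \<times> \<omega>) z * \<Phi> z)"
  proof (rule Bochner_Integration.integrable_bound[OF \<Phi>_integrable])
    have [measurable]: "\<Phi> \<in> borel_measurable borel" "(UNIV :: real set) \<times> \<omega> \<in> sets borel"
      using borel_measurable_integrable[OF \<Phi>_integrable] \<omega>(1) by (auto simp flip: borel_prod)
    show "(\<lambda>z. indicator (UNIV \<times> \<omega>) z * \<Phi> z) \<in> borel_measurable lborel" by measurable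
  qed (auto simp: indicator_def)
  have "(LINT z|lborel. cc * \<Phi> z + 4 * (X1 z + X2 z + X3 z)) \<le> (LINT z|lborel. 2 * (F z)^2 + CC * (indicator (UNIV \<times> \<omega>) z * \<Phi> z))"
    by (rule integral_mono_AE[OF _ _ ae])
       (intro Bochner_Integration.integrable_add integrable_mult_right X_integrable \<Phi>_integrable F_integrable mI)+
  also have "(LINT z|lborel. cc * \<Phi> z + 4 * (X1 z + X2 z + X3 z)) =
     cc * (LINT z|lborel. \<Phi> z) + 4 * ((LINT z|lborel. X1 z) + (LINT z|lborel. X2 z) + (LINT z|lborel. X3 z))"
    using X_integrable \<Phi>_integrable by simp
  also have "(LINT z|lborel. 2 * (F z)^2 + CC * (indicator (UNIV \<times> \<omega>) z * \<Phi> z)) =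
     2 * (LINT z|lborel. (F z)^2) + CC * (LINT z|lborel. indicator (UNIV \<times> \<omega>) z * \<Phi> z)"
    using F_integrable mI by simp
  finally have "cc * (LINT z|lborel. \<Phi> z) + 4 * ((LINT z|lborel. X1 z) + (LINT z|lborel. X2 z) + (LINT z|lborel. X3 z))
    \<le> 2 * (LINT z|lborel. (F z)^2) + CC * (LINT z|lborel. indicator (UNIV \<times> \<omega>) z * \<Phi> z)" .
  then show ?thesis using integral_X3 unfolding integral_X1 integral_X2 cc_def CC_def by simp
qed

end

text \<open>Returns from Borel representatives to integrals over \<open>lebesgue_on\<close>. The
  inner set is enlarged to \<open>\<omega>'\<close> on the right, which is allowed because the
  density is nonnegative.\<close>

lemma (in carleman_solution) carleman_energies:
  fixes f0 f1 f2 g \<eta> \<xi> :: "real \<Rightarrow> real \<Rightarrow> real" and pm pM :: real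
  defines "CR \<equiv> 24 * pM * T * K^3 + 4 * (2 * Mb * K + T + 5 * pM * K^3)^2"
    and "dens \<equiv> \<lambda>t x. exp (- 2 * s * \<eta> t x) *
        (s^5 * l^6 * (\<xi> t x)^5 * \<bar>f0 t x\<bar>\<^sup>2 + s^3 * l^4 * (\<xi> t x)^3 * \<bar>f1 t x\<bar>\<^sup>2 + s * l^2 * \<xi> t x * \<bar>f2 t x\<bar>\<^sup>2)"
  defines "En \<equiv> \<lambda>S. LINT (t, x)|lebesgue_on S. dens t x"
  assumes \<kappa>': "\<kappa> \<ge> 1" "57 * K^5 \<le> \<rho>^6 * \<kappa>" "CR \<le> pm^2 * \<rho>^6 * \<kappa>" and l2: "2 * K \<le> l * \<rho>^2"
    and pp: "0 < pm" "\<And>k. k < N \<Longrightarrow> pm \<le> p k" "\<And>k. k < N \<Longrightarrow> p k \<le> pM"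
    and \<eta>: "\<And>t x. (t, x) \<in> cylinder T L \<Longrightarrow> \<eta> t x = (E - exp (l * \<beta> x)) / (t * (T - t))"
    and \<xi>: "\<And>t x. (t, x) \<in> cylinder T L \<Longrightarrow> \<xi> t x = exp (l * \<beta> x) / (t * (T - t))"
    and f: "AE z in lborel. z \<in> cylinder T L \<longrightarrow> f0 (fst z) (snd z) = U z"
      "AE z in lborel. z \<in> cylinder T L \<longrightarrow> f1 (fst z) (snd z) = u1 z"
      "AE z in lborel. z \<in> cylinder T L \<longrightarrow> f2 (fst z) (snd z) = u2 z"
    and g: "AE z in lborel. z \<in> cylinder T L \<longrightarrow> g (fst z) (snd z) = Z z + P z * u3 z + B z * u1 z + D z * U z"
    and \<omega>': "\<omega> \<subseteq> \<omega>'" "open \<omega>'" "\<omega>' \<subseteq> {0<..<L}"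
  shows "pm^2 * \<rho>^6 / (10 * K^4) * En (cylinder T L) \<le> 2 * (L2_norm (cylinder T L) (\<lambda>(t, x). exp (- s * \<eta> t x) * g t x))\<^sup>2 +
     (pm^2 * \<rho>^6 / (10 * K^4) + 30 * K^4 * (pm^2 * \<rho>^6 + 300 * pM^2 * K^6)) * En ({0<..<T} \<times> \<omega>')"
proof -
  note [measurable] = cylinder_borel[of T L]
  define S where "S = {0<..<T} \<times> \<omega>'"
  have S [measurable]: "S \<in> sets borel" unfolding S_def by (rule borel_open) (intro open_Times \<omega>' open_greaterThanLessThan)
  have SC: "S \<subseteq> cylinder T L" using \<omega>'(3) by (auto simp: S_def cylinder_def)
  have \<Phi>m [measurable]: "\<Phi> \<in> borel_measurable borel" using borel_measurable_integrable[OF \<Phi>_integrable] by simp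
  have mh: "m (t, x) = exp (- s * \<eta> t x)" "sg (h (t, x)) x = s * l * \<xi> t x" if "(t, x) \<in> cylinder T L" for t x
    using \<eta>[OF that] \<xi>[OF that] by (simp_all add: m_def mm_def h_def \<theta>_def sg_def G_def)
  have eq: "AE z in lborel. z \<in> cylinder T L \<longrightarrow> (case z of (t, x) \<Rightarrow> dens t x) = \<Phi> z"
    using f
  proof eventually_elim
    case (elim z)
    show ?case
    proof
      assume z: "z \<in> cylinder T L"
      obtain t x where tx: "z = (t, x)" by (cases z)
      have e: "exp (- 2 * s * \<eta> t x) = (exp (- s * \<eta> t x))^2" by (simp add: power2_eq_square flip: exp_add)
      have ff: "f0 t x = U z" "f1 t x = u1 z" "f2 t x = u2 z" using elim z unfolding tx by auto
      have "\<Phi> z = l * (s * l * \<xi> t x) * ((exp (- s * \<eta> t x))^2 * ((s * l * \<xi> t x)^4 * (U z)^2 + (s * l * \<xi> t x)^2 * (u1 z)^2 + (u2 z)^2))"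
        using z mh[of t x] unfolding tx by (simp add: \<Phi>_def)
      also have "\<dots> = (exp (- s * \<eta> t x))^2 *
        (s^5 * l^6 * (\<xi> t x)^5 * \<bar>U z\<bar>\<^sup>2 + s^3 * l^4 * (\<xi> t x)^3 * \<bar>u1 z\<bar>\<^sup>2 + s * l^2 * \<xi> t x * \<bar>u2 z\<bar>\<^sup>2)"
        by (simp add: power_mult_distrib algebra_simps eval_nat_numeral)
      finally show "(case z of (t, x) \<Rightarrow> dens t x) = \<Phi> z"
        unfolding tx prod.case dens_def e ff[unfolded tx] by simp
    qed
  qed
  have EC: "En (cylinder T L) = (LINT z|lborel. \<Phi> z)"
  proof -
    have "En (cylinder T L) = (LBINT z:cylinder T L. \<Phi> z)"
      unfolding En_def by (rule lebesgue_on_transfer(1)[OF \<Phi>m cylinder_borel eq])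
    also have "\<dots> = (LINT z|lborel. \<Phi> z)"
      unfolding set_lebesgue_integral_def
      by (rule Bochner_Integration.integral_cong) (auto simp: \<Phi>_def indicator_def)
    finally show ?thesis .
  qed
  have ES: "(LINT z|lborel. indicator (UNIV \<times> \<omega>) z * \<Phi> z) \<le> En S"
  proof -
    have "AE z in lborel. z \<in> S \<longrightarrow> (case z of (t, x) \<Rightarrow> dens t x) = \<Phi> z"
      using eq by (rule eventually_mono) (use SC in blast)
    then have "En S = (LBINT z:S. \<Phi> z)" unfolding En_def by (rule lebesgue_on_transfer(1)[OF \<Phi>m S])
    moreover have "(LINT z|lborel. indicator (UNIV \<times> \<omega>) z * \<Phi> z) \<le> (LINT z|lborel. indicator S z * \<Phi> z)"
    proof (rule integral_mono)
      have [measurable]: "(UNIV :: real set) \<times> \<omega> \<in> sets borel" using \<omega>(1) by (auto simp flip: borel_prod)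
      show "integrable lborel (\<lambda>z. indicator (UNIV \<times> \<omega>) z * \<Phi> z)"
        by (rule Bochner_Integration.integrable_bound[OF \<Phi>_integrable]) (auto simp: indicator_def)
      show "integrable lborel (\<lambda>z. indicator S z * \<Phi> z)"
        by (rule Bochner_Integration.integrable_bound[OF \<Phi>_integrable]) (auto simp: indicator_def)
      fix z
      show "indicator (UNIV \<times> \<omega>) z * \<Phi> z \<le> indicator S z * \<Phi> z"
      proof (cases "z \<in> cylinder T L")
        case True
        then have "z \<in> UNIV \<times> \<omega> \<Longrightarrow> z \<in> S" using \<omega>'(1) by (auto simp: S_def cylinder_def)
        then show ?thesis using \<Phi>_nonneg[of z] by (auto simp: indicator_def)
      qed (simp add: \<Phi>_def)
    qed
    ultimately show ?thesis by (simp add: set_lebesgue_integral_def)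
  qed
  have FL: "(L2_norm (cylinder T L) (\<lambda>(t, x). exp (- s * \<eta> t x) * g t x))\<^sup>2 = (LINT z|lborel. (F z)^2)"
  proof -
    have Fm: "F \<in> borel_measurable borel"
    proof -
      have [measurable]: "m \<in> borel_measurable borel" "Z \<in> borel_measurable borel" "u1 \<in> borel_measurable borel"
        "u3 \<in> borel_measurable borel" "B \<in> borel_measurable borel" "D \<in> borel_measurable borel" "P \<in> borel_measurable borel"
        "(\<lambda>z. I z * U z) \<in> borel_measurable borel"
        using m_measurable Z u U BD poly_growth_weights(7) by (auto simp: sq_int_def poly_growth_def)
      have "F = (\<lambda>z. I z * (m z * (Z z + P z * u3 z + B z * u1 z + D z * (I z * U z))))"
        by (auto simp: fun_eq_iff F_def indicator_def)
      then show ?thesis by simp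
    qed
    have "AE z in lborel. z \<in> cylinder T L \<longrightarrow> (case z of (t, x) \<Rightarrow> exp (- s * \<eta> t x) * g t x) = F z"
      using g
    proof eventually_elim
      case (elim z)
      then show ?case using mh by (cases z) (simp add: F_def)
    qed
    moreover have c: "(\<lambda>z. indicator (cylinder T L) z *\<^sub>R (F z)^2) = (\<lambda>z. (F z)^2)"
      by (auto simp: fun_eq_iff F_def indicator_def)
    ultimately have "L2_norm (cylinder T L) (\<lambda>(t, x). exp (- s * \<eta> t x) * g t x) = sqrt (LBINT z:cylinder T L. (F z)^2)"
      using F_integrable by (intro L2_I(2)[OF Fm cylinder_borel]) (simp_all add: set_integrable_def)
    also have "(LBINT z:cylinder T L. (F z)^2) = (LINT z|lborel. (F z)^2)"
      unfolding set_lebesgue_integral_def c ..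
    finally show ?thesis by simp
  qed
  have C0: "0 \<le> pm^2 * \<rho>^6 / (10 * K^4) + 30 * K^4 * (pm^2 * \<rho>^6 + 300 * pM^2 * K^6)" using \<rho> K(1) by simp
  show "pm^2 * \<rho>^6 / (10 * K^4) * En (cylinder T L) \<le> 2 * (L2_norm (cylinder T L) (\<lambda>(t, x). exp (- s * \<eta> t x) * g t x))\<^sup>2 +
     (pm^2 * \<rho>^6 / (10 * K^4) + 30 * K^4 * (pm^2 * \<rho>^6 + 300 * pM^2 * K^6)) * En ({0<..<T} \<times> \<omega>')"
    unfolding EC FL S_def[symmetric]
    using carleman_integrated[OF \<kappa>'[unfolded CR_def] l2 pp] mult_left_mono[OF ES C0] by linarith
qed

section \<open>From a weight function to the constants of the estimate\<close>

lemma Dw_Suc: "Dw S (Suc i) f x = vector_derivative (Dw S i f) (at x within S)"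
  by (simp add: Dw_def)

lemma Cm_on_deriv:
  assumes "Cm_on n S f" "i < n" "x \<in> S"
  shows "(Dw S i f has_real_derivative Dw S (Suc i) f x) (at x within S)"
proof -
  have "Dw S i f differentiable at x within S" using assms by (auto simp: Cm_on_def differentiable_on_def)
  then show ?thesis unfolding Dw_Suc has_real_derivative_iff_has_vector_derivative by (simp only: vector_derivative_works)
qed

lemma uniform_lower_bound:
  fixes f :: "nat \<Rightarrow> real \<Rightarrow> real"
  assumes "\<And>k. k < N \<Longrightarrow> compact (S k)" "\<And>k. k < N \<Longrightarrow> continuous_on (S k) (f k)" "\<And>k x. k < N \<Longrightarrow> x \<in> S k \<Longrightarrow> f k x \<noteq> 0"
  obtains \<rho> where "0 < \<rho>" "\<rho> \<le> 1" "\<And>k x. k < N \<Longrightarrow> x \<in> S k \<Longrightarrow> \<rho> \<le> \<bar>f k x\<bar>"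
proof -
  have "\<exists>\<rho>>0. \<forall>x\<in>S k. \<rho> \<le> \<bar>f k x\<bar>" if k: "k < N" for k
  proof (cases "S k = {}")
    case False
    obtain x where "x \<in> S k" "\<forall>y\<in>S k. \<bar>f k x\<bar> \<le> \<bar>f k y\<bar>"
      using continuous_attains_inf[OF assms(1)[OF k] False continuous_on_rabs[OF assms(2)[OF k]]] by blast
    then show ?thesis using assms(3)[OF k] by (intro exI[of _ "\<bar>f k x\<bar>"]) auto
  qed (auto intro: exI[of _ 1])
  then obtain r where r: "\<And>k. k < N \<Longrightarrow> r k > 0" "\<And>k x. k < N \<Longrightarrow> x \<in> S k \<Longrightarrow> r k \<le> \<bar>f k x\<bar>" by metis
  let ?\<rho> = "Min (insert 1 (r ` {..<N}))"
  show thesis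
  proof (rule that[of ?\<rho>])
    fix k x assume k: "k < N" "x \<in> S k"
    have "?\<rho> \<le> r k" using k by (intro Min_le) auto
    then show "?\<rho> \<le> \<bar>f k x\<bar>" using r(2)[OF k] by linarith
  qed (use r(1) in auto)
qed

lemma uniform_upper_bound:
  fixes f :: "nat \<Rightarrow> real \<Rightarrow> real"
  assumes "\<And>k. k < N \<Longrightarrow> compact (S k)" "\<And>k. k < N \<Longrightarrow> continuous_on (S k) (f k)"
  obtains K where "1 \<le> K" "\<And>k x. k < N \<Longrightarrow> x \<in> S k \<Longrightarrow> \<bar>f k x\<bar> \<le> K"
proof -
  have "\<exists>K. \<forall>x\<in>S k. \<bar>f k x\<bar> \<le> K" if k: "k < N" for k
    using compact_imp_bounded[OF compact_continuous_image[OF assms(2)[OF k] assms(1)[OF k]]] by (auto simp: bounded_iff)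
  then obtain r where r: "\<And>k x. k < N \<Longrightarrow> x \<in> S k \<Longrightarrow> \<bar>f k x\<bar> \<le> r k" by metis
  let ?K = "Max (insert 1 (r ` {..<N}))"
  show thesis
  proof (rule that[of ?K])
    fix k x assume k: "k < N" "x \<in> S k"
    have "r k \<le> ?K" using k by (intro Max_ge) auto
    then show "\<bar>f k x\<bar> \<le> ?K" using r[OF k] by linarith
  qed auto
qed

text \<open>To the left of the subinterval \<open>j\<close> both \<beta> increases and
  \<open>p\<close> decreases from piece to piece, to the right the reverse; the three cases of
  hypothesis M collapse to this one pattern, in which an end piece is either the subinterval
  \<open>j\<close> itself or lies on a side of known sign.\<close>

lemma weight_signs:
  assumes part: "is_partition L N a" and p: "\<And>k. k < N \<Longrightarrow> p k > 0"
    and hyp: "hypothesis_M L N a p \<omega> j" and w: "weight_function L N a p \<omega>\<^sub>0 j \<kappa> \<beta>"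
  defines "b \<equiv> \<lambda>k. Dw {a k..a (Suc k)} 1 \<beta>"
  shows "\<And>k x. k < N \<Longrightarrow> x \<in> {a k..a (Suc k)} \<Longrightarrow> x \<notin> \<omega>\<^sub>0 \<Longrightarrow> b k x \<noteq> 0"
    "\<And>k. k \<in> {1..<N} \<Longrightarrow> p (k - 1) > p k \<and> b k (a k) > 0 \<or> p (k - 1) < p k \<and> b k (a k) < 0"
    "b 0 0 > 0" "b (N - 1) L < 0"
proof -
  note w = w[unfolded weight_function_def Let_def]
  obtain r where r: "r > 0" and nz': "\<forall>x\<in>{a j..a (Suc j)} - \<omega>\<^sub>0. b j x \<noteq> 0"
    and mid': "j \<notin> {0, N - 1} \<longrightarrow> (\<forall>k<j. \<forall>x\<in>{a k..a (Suc k)}. b k x \<ge> r) \<and> (\<forall>k\<in>{j+1..N-1}. \<forall>x\<in>{a k..a (Suc k)}. b k x \<le> - r)"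
    and first': "j = 0 \<longrightarrow> (\<forall>k\<in>{1..N-1}. \<forall>x\<in>{a k..a (Suc k)}. b k x \<le> - r) \<and> b 0 0 > 0"
    and last': "j = N - 1 \<longrightarrow> (\<forall>k<N-1. \<forall>x\<in>{a k..a (Suc k)}. b k x \<ge> r) \<and> b (N - 1) L < 0"
    using w[THEN conjunct2, THEN conjunct2, THEN conjunct1] unfolding b_def by (elim exE conjE) (assumption | rule that)+
  note nz = nz'[rule_format]
  have node: "sqrt (p (k - 1)) * b (k - 1) (a k) = sqrt (p k) * b k (a k)" if "k \<in> {1..<N}" for k
  proof -
    from that have "Suc (k - 1) = k" by simp
    then show ?thesis
      using w[THEN conjunct2, THEN conjunct2, THEN conjunct2, THEN conjunct2, rule_format, OF that, THEN conjunct2, THEN conjunct1]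
      unfolding b_def by simp
  qed
  have j: "j \<le> N - 1" using hyp by (simp add: hypothesis_M_def)
  have N: "N \<ge> 1" "a 0 = 0" "a N = L" "Suc (N - 1) = N" using part by (auto simp: is_partition_def)
  have A: "r \<le> b k x" if "k < j" "x \<in> {a k..a (Suc k)}" for k x
    using that mid' last' j by (cases "j = N - 1") auto
  have B: "b k x \<le> - r" if "j < k" "k < N" "x \<in> {a k..a (Suc k)}" for k x
    using that mid' first' j by (cases "j = 0") auto
  have pA: "p (k - 1) > p k" if "1 \<le> k" "k \<le> j" for k
    using hyp that unfolding hypothesis_M_def by (cases "j = N - 1") auto
  have pB: "p (k - 1) < p k" if "j < k" "k < N" for k
    using hyp that unfolding hypothesis_M_def by (cases "j = 0") auto
  show "b k x \<noteq> 0" if "k < N" "x \<in> {a k..a (Suc k)}" "x \<notin> \<omega>\<^sub>0" for k x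
  proof -
    consider "k < j" | "k = j" | "j < k" by linarith
    then show ?thesis using A[of k x] B[of k x] nz[of x] that r by cases auto
  qed
  show "p (k - 1) > p k \<and> b k (a k) > 0 \<or> p (k - 1) < p k \<and> b k (a k) < 0" if k: "k \<in> {1..<N}" for k
  \<comment> \<open>For \<open>k = j\<close> the sign on the right of the node is not prescribed,
    since \<beta> may turn inside that subinterval. It is carried across the node from the
    subinterval \<open>k - 1\<close> by the condition on the first derivatives.\<close>
  proof (cases "k \<le> j")
    case True
    have "a (k - 1) \<le> a k" using partition_mono[OF part, of "k - 1" k] k by simp
    then have "r \<le> b (k - 1) (a k)" using k True by (intro A) auto
    then have "0 < sqrt (p k) * b k (a k)" unfolding node[OF k, symmetric] using r p[of "k - 1"] k by (intro mult_pos_pos) auto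
    then have "b k (a k) > 0" using p[of k] k by (simp add: zero_less_mult_iff)
    then show ?thesis using pA[OF _ True] k by auto
  next
    case False
    have "a k \<le> a (Suc k)" using partition_mono[OF part, of k "Suc k"] k by simp
    then have "b k (a k) \<le> - r" using k False by (intro B) auto
    then show ?thesis using pB[of k] False k r by auto
  qed
  have le: "a 0 \<le> a (Suc 0)" "a (N - 1) \<le> a (Suc (N - 1))"
    using partition_mono[OF part, of 0 "Suc 0"] partition_mono[OF part, of "N - 1" N] N by auto
  show "b 0 0 > 0"
  proof (cases "j = 0")
    case False
    then have "r \<le> b 0 0" using N le by (intro A) auto
    then show ?thesis using r by simp
  qed (use first' in auto)
  show "b (N - 1) L < 0"
  proof (cases "j = N - 1")
    case False
    then have "b (N - 1) L \<le> - r" using N le j by (intro B) auto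
    then show ?thesis using r by simp
  qed (use last' in auto)
qed

lemma sup_inf_bounds:
  assumes c: "continuous_on {0..L} \<beta>" and L: "L \<ge> 0" and pos: "(INF x\<in>{0..L}. \<beta> x) \<ge> r" "r > 0" and x: "x \<in> {0..L}"
  shows "(INF x\<in>{0..L}. \<beta> x) \<le> \<beta> x" "\<beta> x \<le> sup_norm L \<beta>" "sup_norm L \<beta> = (SUP x\<in>{0..L}. \<beta> x)"
proof -
  have "compact (\<beta> ` {0..L})" by (rule compact_continuous_image[OF c]) simp
  then have bd: "bounded (\<beta> ` {0..L})" by (rule compact_imp_bounded)
  note b = bounded_imp_bdd_below[OF bd] bounded_imp_bdd_above[OF bd]
  have inf: "(INF x\<in>{0..L}. \<beta> x) \<le> \<beta> x" if "x \<in> {0..L}" for x by (rule cINF_lower[OF b(1) that])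
  show "(INF x\<in>{0..L}. \<beta> x) \<le> \<beta> x" by (rule inf[OF x])
  have "\<bar>\<beta> x\<bar> = \<beta> x" if "x \<in> {0..L}" for x using inf[OF that] pos by simp
  then show e: "sup_norm L \<beta> = (SUP x\<in>{0..L}. \<beta> x)" unfolding sup_norm_def by (intro SUP_cong) auto
  show "\<beta> x \<le> sup_norm L \<beta>" unfolding e by (rule cSUP_upper[OF x b(2)])
qed

text \<open>\<open>\<kappa> > 1\<close> makes the gap between \<open>E\<close> and the maximum of
  \<open>exp (l \<beta>)\<close> positive, and \<open>\<kappa> max \<beta> < 2 min \<beta>\<close>
  makes \<open>E\<close> at most the square of \<open>exp (l \<beta>)\<close>. \<open>K\<close> and
  \<rho> come from compactness and are fixed before \<open>T\<close>, \<open>s\<close> and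
  \<open>l\<close>, so that thresholds can be built from them.\<close>

lemma weight_carleman:
  assumes part: "is_partition L N a" and p: "\<And>k. k < N \<Longrightarrow> p k > 0"
    and hyp: "hypothesis_M L N a p \<omega> j" and \<omega>\<^sub>0: "open \<omega>\<^sub>0" "closure \<omega>\<^sub>0 \<subseteq> \<omega>"
    and \<kappa>: "1 < \<kappa>" and w: "weight_function L N a p \<omega>\<^sub>0 j \<kappa> \<beta>"
  obtains K \<rho> where "1 \<le> K" "0 < \<rho>" "\<rho> \<le> 1"
    "\<And>T kap s l. T > 0 \<Longrightarrow> 1 \<le> s \<Longrightarrow> 1 \<le> l \<Longrightarrow> 12 * K^2 \<le> kap * \<rho>^2 \<Longrightarrow> kap * T^2 \<le> 4 * s \<Longrightarrow>
       carleman_weight T L N a p (\<lambda>x. \<beta> (max 0 (min L x))) (\<lambda>k. Dw {a k..a (Suc k)} 1 \<beta>) (\<lambda>k. Dw {a k..a (Suc k)} 2 \<beta>)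
         (\<lambda>k. Dw {a k..a (Suc k)} 3 \<beta>) K \<rho> kap s l (exp (\<kappa> * l * sup_norm L \<beta>))
         (exp (\<kappa> * l * sup_norm L \<beta>) - exp (l * sup_norm L \<beta>)) \<omega>\<^sub>0"
proof -
  let ?J = "\<lambda>k. {a k..a (Suc k)}"
  note w' = w[unfolded weight_function_def Let_def]
  have cont: "continuous_on {0..L} \<beta>" using w' by (rule conjunct1)
  have Cm: "Cm_on 3 (?J k) \<beta>" if "k < N" for k using w'[THEN conjunct2, THEN conjunct1] that by blast
  obtain r where r: "r > 0" "(INF x\<in>{0..L}. \<beta> x) \<ge> r"
    using w'[THEN conjunct2, THEN conjunct2, THEN conjunct1] by (elim exE conjE) (rule that)
  have sup: "\<kappa> * (SUP x\<in>{0..L}. \<beta> x) < 2 * (INF x\<in>{0..L}. \<beta> x)"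
    using w'[THEN conjunct2, THEN conjunct2, THEN conjunct2, THEN conjunct1] .
  have node: "sqrt (p (k - 1)) * Dw (?J (k - 1)) 1 \<beta> (a k) = sqrt (p k) * Dw (?J k) 1 \<beta> (a k)"
    "p (k - 1) * Dw (?J (k - 1)) 2 \<beta> (a k) = p k * Dw (?J k) 2 \<beta> (a k)" if "k \<in> {1..<N}" for k
    using w'[THEN conjunct2, THEN conjunct2, THEN conjunct2, THEN conjunct2, rule_format, OF that, THEN conjunct2]
    by (rule conjunct1, rule conjunct2)
  have L: "L > 0" using part partition_subint(1)[OF part, of 0] partition_mono[OF part, of 1 N] by (auto simp: is_partition_def)
  define S where "S = sup_norm L \<beta>"
  note sb = sup_inf_bounds[OF cont less_imp_le[OF L] r(2,1), folded S_def]
  have b: "(INF x\<in>{0..L}. \<beta> x) \<le> \<beta> (max 0 (min L x))" "\<beta> (max 0 (min L x)) \<le> S" for x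
    by (rule sb; use L in \<open>simp add: max_def min_def\<close>)+
  have S: "S > 0" "\<kappa> * S < 2 * (INF x\<in>{0..L}. \<beta> x)" using b[of 0] r sup sb(3)[of 0] L by auto
  have cD: "continuous_on (?J k) (Dw (?J k) i \<beta>)" if "k < N" "i \<le> 3" for k i using Cm[OF that(1)] that(2) by (simp add: Cm_on_def)
  obtain K1 where K1: "1 \<le> K1" "\<And>k x. k < N \<Longrightarrow> x \<in> ?J k \<Longrightarrow> \<bar>Dw (?J k) 1 \<beta> x\<bar> \<le> K1"
    by (rule uniform_upper_bound[of N ?J "\<lambda>k. Dw (?J k) 1 \<beta>"]) (use cD in auto)
  obtain K2 where K2: "1 \<le> K2" "\<And>k x. k < N \<Longrightarrow> x \<in> ?J k \<Longrightarrow> \<bar>Dw (?J k) 2 \<beta> x\<bar> \<le> K2"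
    by (rule uniform_upper_bound[of N ?J "\<lambda>k. Dw (?J k) 2 \<beta>"]) (use cD in auto)
  obtain K3 where K3: "1 \<le> K3" "\<And>k x. k < N \<Longrightarrow> x \<in> ?J k \<Longrightarrow> \<bar>Dw (?J k) 3 \<beta> x\<bar> \<le> K3"
    by (rule uniform_upper_bound[of N ?J "\<lambda>k. Dw (?J k) 3 \<beta>"]) (use cD in auto)
  define K where "K = max K1 (max K2 K3)"
  note ws = weight_signs[OF part p hyp w]
  have "compact (?J k - \<omega>\<^sub>0)" for k by (rule compact_diff[OF _ \<omega>\<^sub>0(1)]) simp
  moreover have "continuous_on (?J k - \<omega>\<^sub>0) (Dw (?J k) 1 \<beta>)" if "k < N" for k
    by (rule continuous_on_subset[OF cD[OF that]]) auto
  moreover have "Dw (?J k) 1 \<beta> x \<noteq> 0" if "k < N" "x \<in> ?J k - \<omega>\<^sub>0" for k x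
    using ws(1)[of k x] that by blast
  ultimately obtain \<rho> where \<rho>: "0 < \<rho>" "\<rho> \<le> 1" "\<And>k x. k < N \<Longrightarrow> x \<in> ?J k - \<omega>\<^sub>0 \<Longrightarrow> \<rho> \<le> \<bar>Dw (?J k) 1 \<beta> x\<bar>"
    using uniform_lower_bound[of N "\<lambda>k. ?J k - \<omega>\<^sub>0" "\<lambda>k. Dw (?J k) 1 \<beta>"] by metis
  have nodes_out: "a k \<notin> \<omega>\<^sub>0" if "k \<le> N" for k
  proof
    assume "a k \<in> \<omega>\<^sub>0"
    then have "a k \<in> subint a j" using \<omega>\<^sub>0(2) hyp closure_subset[of \<omega>\<^sub>0] closure_subset[of \<omega>] unfolding hypothesis_M_def by blast
    then have k: "a j < a k" "a k < a (Suc j)" by (auto simp: subint_def)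
    have "j < N" using hyp part by (auto simp: hypothesis_M_def is_partition_def)
    then show False using k partition_mono[OF part, of k j] partition_mono[OF part, of "Suc j" k] that
      by (cases "k \<le> j") auto
  qed
  show thesis
  proof (rule that[of K \<rho>])
    show "1 \<le> K" using K1(1) by (simp add: K_def)
    fix T kap s l :: real
    assume T: "T > 0" and s: "1 \<le> s" and l: "1 \<le> l" and kap: "12 * K^2 \<le> kap * \<rho>^2" "kap * T^2 \<le> 4 * s"
    show "carleman_weight T L N a p (\<lambda>x. \<beta> (max 0 (min L x))) (\<lambda>k. Dw (?J k) 1 \<beta>) (\<lambda>k. Dw (?J k) 2 \<beta>)
         (\<lambda>k. Dw (?J k) 3 \<beta>) K \<rho> kap s l (exp (\<kappa> * l * sup_norm L \<beta>)) (exp (\<kappa> * l * sup_norm L \<beta>) - exp (l * sup_norm L \<beta>)) \<omega>\<^sub>0"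
      unfolding S_def[symmetric]
    proof (rule carleman_weight.intro)
      show "continuous_on UNIV (\<lambda>x. \<beta> (max 0 (min L x)))"
        by (rule continuous_on_compose2[OF cont]) (use L in \<open>auto intro!: continuous_intros\<close>)
      show "0 \<le> \<beta> (max 0 (min L x))" for x using b(1)[of x] r by linarith
      have "l * S < \<kappa> * l * S" using \<kappa> l S by simp
      then show "0 < exp (\<kappa> * l * S) - exp (l * S)" by simp
      show "exp (l * \<beta> (max 0 (min L x))) + (exp (\<kappa> * l * S) - exp (l * S)) \<le> exp (\<kappa> * l * S)" for x
        using b(2)[of x] l by simp
      show "exp (\<kappa> * l * S) \<le> (exp (l * \<beta> (max 0 (min L x))))^2" for x
      proof -
        have "l * (\<kappa> * S) \<le> l * (2 * \<beta> (max 0 (min L x)))" using b(1)[of x] S l by (intro mult_left_mono) auto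
        then show ?thesis by (simp add: mult_ac flip: exp_double)
      qed
      fix k x assume k: "k < N" "x \<in> ?J k"
      \<comment> \<open>The clamped function agrees with \<beta> on the subinterval, and the
        derivative is taken within the subinterval, so the extension does not change it.\<close>
      have "((\<lambda>x. Dw (?J k) 0 \<beta> (max 0 (min L x))) has_real_derivative Dw (?J k) (Suc 0) \<beta> x) (at x within ?J k)"
      proof (rule has_field_derivative_transform_within[OF Cm_on_deriv[OF Cm[OF k(1)] _ k(2)] zero_less_one k(2)])
        fix y assume "y \<in> ?J k"
        then have "max 0 (min L y) = y" using partition_subint(2,3)[OF part k(1)] by auto
        then show "Dw (?J k) 0 \<beta> y = Dw (?J k) 0 \<beta> (max 0 (min L y))" by simp
      qed simp
      then show "((\<lambda>x. \<beta> (max 0 (min L x))) has_real_derivative Dw (?J k) 1 \<beta> x) (at x within ?J k)" by (simp add: Dw_def)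
      show "(Dw (?J k) 1 \<beta> has_real_derivative Dw (?J k) 2 \<beta> x) (at x within ?J k)"
        using Cm_on_deriv[OF Cm[OF k(1)] _ k(2), of 1] by (simp add: eval_nat_numeral)
      show "(Dw (?J k) 2 \<beta> has_real_derivative Dw (?J k) 3 \<beta> x) (at x within ?J k)"
        using Cm_on_deriv[OF Cm[OF k(1)] _ k(2), of 2] by (simp add: eval_nat_numeral)
      show "\<bar>Dw (?J k) 1 \<beta> x\<bar> \<le> K" "\<bar>Dw (?J k) 2 \<beta> x\<bar> \<le> K" "\<bar>Dw (?J k) 3 \<beta> x\<bar> \<le> K"
        using K1(2)[OF k] K2(2)[OF k] K3(2)[OF k] by (simp_all add: K_def)
      show "\<rho> \<le> \<bar>Dw (?J k) 1 \<beta> x\<bar>" if "x \<notin> \<omega>\<^sub>0" using \<rho>(3)[OF k(1)] k(2) that by blast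
    next
      fix k assume "k < N"
      then show "continuous_on (?J k) (Dw (?J k) 3 \<beta>)" by (rule cD) simp
    next
      show "1 \<le> K" using K1(1) by (simp add: K_def)
      show "\<omega>\<^sub>0 \<in> sets borel" using \<omega>\<^sub>0(1) by (rule borel_open)
    qed (assumption | rule T part p s l kap \<rho>(1,2) node nodes_out ws(2-4))+
  qed (rule \<rho>(1,2))+
qed

lemma sq_int_curried:
  "(\<lambda>(t, x). f t x) \<in> borel_measurable (borel \<Otimes>\<^sub>M borel) \<Longrightarrow> integrable lborel (\<lambda>z. (f (fst z) (snd z))\<^sup>2) \<Longrightarrow>
     sq_int (\<lambda>z :: real \<times> real. f (fst z) (snd z))"
  by (simp add: sq_int_def borel_prod case_prod_beta')

text \<open>All constants are fixed before \<open>u\<close>, \<open>s\<close> and \<open>l\<close>.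
  The bounds of \<open>b\<close> and \<open>d\<close> enter only \<open>s0\<close>, through the size
  of \<open>kap\<close>; \<open>c\<close> and \<open>C\<close> are built from \<open>p\<close>,
  \<open>K\<close> and \<rho>.\<close>

lemma carleman_estimate:
  assumes T: "T > 0" and L: "L > 0" and part: "is_partition L N a" and p: "\<And>k. k < N \<Longrightarrow> p k > 0"
    and hyp: "hypothesis_M L N a p \<omega> j" and \<omega>\<^sub>0: "open \<omega>\<^sub>0" "closure \<omega>\<^sub>0 \<subseteq> \<omega>"
    and \<kappa>: "1 < \<kappa>" and w: "weight_function L N a p \<omega>\<^sub>0 j \<kappa> \<beta>"
    and b: "(\<lambda>(t, x). b t x) \<in> Linf (cylinder T L)" and d: "(\<lambda>(t, x). d t x) \<in> Linf (cylinder T L)"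
  defines "En \<equiv> \<lambda>u s l S. LINT (t, x)|lebesgue_on S. exp (- 2 * s * carleman_eta T L \<kappa> \<beta> l t x) *
        (s^5 * l^6 * (carleman_xi T \<beta> l t x)^5 * \<bar>u t x\<bar>\<^sup>2 + s^3 * l^4 * (carleman_xi T \<beta> l t x)^3 * \<bar>pw_dx 1 T L N a u t x\<bar>\<^sup>2
         + s * l^2 * carleman_xi T \<beta> l t x * \<bar>pw_dx 2 T L N a u t x\<bar>\<^sup>2)"
  obtains c C s0 l0 where "c > 0" "C \<ge> 0" "s0 \<ge> 1" "l0 \<ge> 1"
    "\<And>u s l. u \<in> Vspace T L N a p b d \<Longrightarrow> s \<ge> s0 \<Longrightarrow> l \<ge> l0 \<Longrightarrow> c * En u s l (cylinder T L)
       \<le> 2 * (L2_norm (cylinder T L) (\<lambda>(t, x). exp (- s * carleman_eta T L \<kappa> \<beta> l t x) * Lop T L N a p b d u t x))\<^sup>2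
         + C * En u s l ({0<..<T} \<times> \<omega>)"
proof -
  obtain K \<rho> where K: "1 \<le> K" and \<rho>: "0 < \<rho>" "\<rho> \<le> 1" and cw:
    "\<And>T kap s l. T > 0 \<Longrightarrow> 1 \<le> s \<Longrightarrow> 1 \<le> l \<Longrightarrow> 12 * K^2 \<le> kap * \<rho>^2 \<Longrightarrow> kap * T^2 \<le> 4 * s \<Longrightarrow>
       carleman_weight T L N a p (\<lambda>x. \<beta> (max 0 (min L x))) (\<lambda>k. Dw {a k..a (Suc k)} 1 \<beta>) (\<lambda>k. Dw {a k..a (Suc k)} 2 \<beta>)
         (\<lambda>k. Dw {a k..a (Suc k)} 3 \<beta>) K \<rho> kap s l (exp (\<kappa> * l * sup_norm L \<beta>))
         (exp (\<kappa> * l * sup_norm L \<beta>) - exp (l * sup_norm L \<beta>)) \<omega>\<^sub>0"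
    by (rule weight_carleman[OF part p hyp \<omega>\<^sub>0 \<kappa> w]) (assumption | rule that)+
  obtain B M where B: "(\<lambda>(t, x). B t x) \<in> borel_measurable (borel \<Otimes>\<^sub>M borel)"
    "AE z in lborel. z \<in> cylinder T L \<longrightarrow> b (fst z) (snd z) = B (fst z) (snd z)" "M \<ge> 0" "\<And>t x. \<bar>B t x\<bar> \<le> M"
    by (rule Linf_representative[OF b]) (assumption | rule that)+
  obtain D M' where D: "(\<lambda>(t, x). D t x) \<in> borel_measurable (borel \<Otimes>\<^sub>M borel)"
    "AE z in lborel. z \<in> cylinder T L \<longrightarrow> d (fst z) (snd z) = D (fst z) (snd z)" "M' \<ge> 0" "\<And>t x. \<bar>D t x\<bar> \<le> M'"
    by (rule Linf_representative[OF d]) (assumption | rule that)+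
  define Mb where "Mb = max M M'"
  have Mb: "\<And>t x. \<bar>B t x\<bar> \<le> Mb" "\<And>t x. \<bar>D t x\<bar> \<le> Mb"
    using B(4) D(4) by (auto simp: Mb_def le_max_iff_disj)
  have N: "0 < N" using part by (simp add: is_partition_def)
  define pm where "pm = Min (p ` {..<N})"
  define pM where "pM = Max (p ` {..<N})"
  have pm: "0 < pm" "\<And>k. k < N \<Longrightarrow> pm \<le> p k" "\<And>k. k < N \<Longrightarrow> p k \<le> pM"
  proof -
    have ne: "p ` {..<N} \<noteq> {}" using N by auto
    show "0 < pm" unfolding pm_def by (subst Min_gr_iff) (use ne p in auto)
  qed (auto simp: pm_def pM_def)
  define CR where "CR = 24 * pM * T * K^3 + 4 * (2 * Mb * K + T + 5 * pM * K^3)^2"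
  \<comment> \<open>The required ratio of \<sigma> to \<open>l\<close>: large enough for the flux
    sign (\<open>12 * K^2\<close>), for the lower order part of the bulk form
    (\<open>57 * K^5\<close>) and for the absorption of the residual terms
    (\<open>CR\<close>).\<close>
  define kap where "kap = max 1 (max (12 * K^2 / \<rho>^2) (max (57 * K^5 / \<rho>^6) (CR / (pm^2 * \<rho>^6))))"
  have kap: "kap \<ge> 1" "12 * K^2 \<le> kap * \<rho>^2" "57 * K^5 \<le> \<rho>^6 * kap" "CR \<le> pm^2 * \<rho>^6 * kap"
  proof -
    have "12 * K^2 / \<rho>^2 \<le> kap" "57 * K^5 / \<rho>^6 \<le> kap" "CR / (pm^2 * \<rho>^6) \<le> kap" by (simp_all add: kap_def)
    then show "12 * K^2 \<le> kap * \<rho>^2" "57 * K^5 \<le> \<rho>^6 * kap" "CR \<le> pm^2 * \<rho>^6 * kap"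
      using \<rho> pm(1) by (simp_all add: pos_divide_le_eq mult_ac)
  qed (simp add: kap_def)
  \<comment> \<open>Since \<theta> is at least \<open>4 / T^2\<close>, this threshold gives
    \<open>s \<theta> \<ge> kap\<close>; the threshold \<open>l0\<close> lets \<open>l b1^2\<close>
    dominate \<open>b2\<close> wherever \<open>|b1| \<ge> \<rho>\<close>.\<close>
  define s0 where "s0 = max 1 (kap * T^2 / 4)"
  define l0 where "l0 = max 1 (2 * K / \<rho>^2)"
  define c where "c = pm^2 * \<rho>^6 / (10 * K^4)"
  define C where "C = pm^2 * \<rho>^6 / (10 * K^4) + 30 * K^4 * (pm^2 * \<rho>^6 + 300 * pM^2 * K^6)"
  have om: "open \<omega>" "\<omega> \<subseteq> {0<..<L}" "\<omega>\<^sub>0 \<subseteq> \<omega>"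
    using hyp \<omega>\<^sub>0(2) closure_subset[of \<omega>\<^sub>0] unfolding hypothesis_M_def by blast+
  have main: "c * En u s l (cylinder T L)
       \<le> 2 * (L2_norm (cylinder T L) (\<lambda>(t, x). exp (- s * carleman_eta T L \<kappa> \<beta> l t x) * Lop T L N a p b d u t x))\<^sup>2
         + C * En u s l ({0<..<T} \<times> \<omega>)"
    if u: "u \<in> Vspace T L N a p b d" and s: "s \<ge> s0" and l: "l \<ge> l0" for u s l
  proof -
    have sl: "1 \<le> s" "1 \<le> l" "kap * T^2 \<le> 4 * s" using s l by (simp_all add: s0_def l0_def)
    have "2 * K / \<rho>^2 \<le> l" using l by (simp add: l0_def)
    then have l2: "2 * K \<le> l * \<rho>^2" using \<rho>(1) by (simp add: pos_divide_le_eq)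
    obtain U Z u1 u2 u3 where m:
      "(\<lambda>(t, x). U t x) \<in> borel_measurable (borel \<Otimes>\<^sub>M borel)" "(\<lambda>(t, x). Z t x) \<in> borel_measurable (borel \<Otimes>\<^sub>M borel)"
      "(\<lambda>(t, x). u1 t x) \<in> borel_measurable (borel \<Otimes>\<^sub>M borel)" "(\<lambda>(t, x). u2 t x) \<in> borel_measurable (borel \<Otimes>\<^sub>M borel)"
      "(\<lambda>(t, x). u3 t x) \<in> borel_measurable (borel \<Otimes>\<^sub>M borel)"
      and sq: "integrable lborel (\<lambda>z. (indicator (cylinder T L) z * U (fst z) (snd z))\<^sup>2)"
      "integrable lborel (\<lambda>z. (Z (fst z) (snd z))\<^sup>2)" "integrable lborel (\<lambda>z. (u1 (fst z) (snd z))\<^sup>2)"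
      "integrable lborel (\<lambda>z. (u2 (fst z) (snd z))\<^sup>2)" "integrable lborel (\<lambda>z. (u3 (fst z) (snd z))\<^sup>2)"
      and time: "AE x in lborel. AC 0 T (\<lambda>t. U t x) (\<lambda>t. Z t x)"
      and space: "AE t in lborel. t \<in> {0<..<T} \<longrightarrow> chain N a p L (U t) (u1 t) (u2 t) (u3 t)"
      and eq: "AE z in lborel. z \<in> cylinder T L \<longrightarrow> u (fst z) (snd z) = U (fst z) (snd z)"
      "AE z in lborel. z \<in> cylinder T L \<longrightarrow> pw_dx 1 T L N a u (fst z) (snd z) = u1 (fst z) (snd z)"
      "AE z in lborel. z \<in> cylinder T L \<longrightarrow> pw_dx 2 T L N a u (fst z) (snd z) = u2 (fst z) (snd z)"
      "AE z in lborel. z \<in> cylinder T L \<longrightarrow> Lop T L N a p b d u (fst z) (snd z) = Z (fst z) (snd z) +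
         pcoef N a p (snd z) * u3 (fst z) (snd z) + B (fst z) (snd z) * u1 (fst z) (snd z) + D (fst z) (snd z) * U (fst z) (snd z)"
      by (rule Vspace_data[OF T L part B(1,2) Mb(1) D(1,2) Mb(2) u]) (assumption | rule that)+
    interpret carleman_solution T L N a p "\<lambda>x. \<beta> (max 0 (min L x))" "\<lambda>k. Dw {a k..a (Suc k)} 1 \<beta>" "\<lambda>k. Dw {a k..a (Suc k)} 2 \<beta>"
      "\<lambda>k. Dw {a k..a (Suc k)} 3 \<beta>" K \<rho> kap s l "exp (\<kappa> * l * sup_norm L \<beta>)"
      "exp (\<kappa> * l * sup_norm L \<beta>) - exp (l * sup_norm L \<beta>)" \<omega>\<^sub>0
      "\<lambda>z. U (fst z) (snd z)" "\<lambda>z. Z (fst z) (snd z)" "\<lambda>z. u1 (fst z) (snd z)" "\<lambda>z. u2 (fst z) (snd z)"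
      "\<lambda>z. u3 (fst z) (snd z)" "\<lambda>z. B (fst z) (snd z)" "\<lambda>z. D (fst z) (snd z)" Mb
    proof (rule carleman_solution.intro[OF cw[OF T sl(1,2) kap(2) sl(3)]], rule carleman_solution_axioms.intro)
      have "(\<lambda>z. U (fst z) (snd z)) \<in> borel_measurable borel" using m(1) by (simp add: borel_prod case_prod_beta')
      then show "sq_int (\<lambda>z. indicator (cylinder T L) z * U (fst z) (snd z))"
        using sq(1) cylinder_borel[of T L] by (simp add: sq_int_def)
      show "(\<lambda>z. B (fst z) (snd z)) \<in> borel_measurable borel" "(\<lambda>z. D (fst z) (snd z)) \<in> borel_measurable borel"
        using B(1) D(1) by (simp_all add: borel_prod case_prod_beta')
    qed (use Mb time space in \<open>simp_all add: sq_int_curried[OF m(2) sq(2)] sq_int_curried[OF m(3) sq(3)]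
         sq_int_curried[OF m(4) sq(4)] sq_int_curried[OF m(5) sq(5)]\<close>)
    have x: "max 0 (min L x) = x" if "(t, x) \<in> cylinder T L" for t x using that by (auto simp: cylinder_def)
    note ce = carleman_energies[OF kap(1) kap(3) kap(4)[unfolded CR_def] l2 pm _ _ eq om(3,1,2),
      where \<eta> = "carleman_eta T L \<kappa> \<beta> l" and \<xi> = "carleman_xi T \<beta> l"]
    show ?thesis unfolding En_def c_def C_def
      by (rule ce) (simp_all add: carleman_eta_def carleman_xi_def x)
  qed
  show thesis
  proof (rule that[of c C s0 l0])
    show "c > 0" using pm(1) \<rho>(1) K by (simp add: c_def)
    show "C \<ge> 0" using \<rho>(1) K by (simp add: C_def)
  qed (use main in \<open>simp_all add: s0_def l0_def\<close>)
qed

theorem theorem1p1: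
  fixes T L :: real and N j :: nat and a p :: "nat \<Rightarrow> real" and \<omega> :: "real set"
  assumes "T > 0" and "L > 0"
    and "is_partition L N a"
    and "\<forall>k<N. p k > 0"
    and "hypothesis_M L N a p \<omega> j"
  shows "\<exists>C :: real \<Rightarrow> real \<Rightarrow> real \<Rightarrow> real. (\<forall>n s\<^sub>0 lam\<^sub>0. C n s\<^sub>0 lam\<^sub>0 > 0) \<and>
    (\<forall>\<omega>\<^sub>0 \<kappa> \<beta> b d.
       \<omega>\<^sub>0 \<noteq> {} \<and> open \<omega>\<^sub>0 \<and> closure \<omega>\<^sub>0 \<subseteq> \<omega> \<and> 1 < \<kappa> \<and> \<kappa> < 2 \<and>
       weight_function L N a p \<omega>\<^sub>0 j \<kappa> \<beta> \<and>
       (\<lambda>(t, x). b t x) \<in> Linf (cylinder T L) \<and> (\<lambda>(t, x). d t x) \<in> Linf (cylinder T L) \<longrightarrow>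
       (\<exists>s\<^sub>0>0. \<exists>lam\<^sub>0>0. \<forall>u\<in>Vspace T L N a p b d. \<forall>s\<ge>s\<^sub>0. \<forall>lam\<ge>lam\<^sub>0.
          (let \<eta> = carleman_eta T L \<kappa> \<beta> lam; \<xi> = carleman_xi T \<beta> lam;
               ux = pw_dx 1 T L N a u; uxx = pw_dx 2 T L N a u;
               E = (\<lambda>S. LINT (t, x)|lebesgue_on S. exp (- 2 * s * \<eta> t x) *
                     (s^5 * lam^6 * (\<xi> t x)^5 * \<bar>u t x\<bar>\<^sup>2 +
                      s^3 * lam^4 * (\<xi> t x)^3 * \<bar>ux t x\<bar>\<^sup>2 +
                      s * lam^2 * \<xi> t x * \<bar>uxx t x\<bar>\<^sup>2))
           in C (C3_norm L N a \<beta>) s\<^sub>0 lam\<^sub>0 * E (cylinder T L)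
                \<le> (L2_norm (cylinder T L)
                     (\<lambda>(t, x). exp (- s * \<eta> t x) * Lop T L N a p b d u t x))\<^sup>2
                   + E ({0<..<T} \<times> \<omega>))))"
  \<comment> \<open>\<open>s\<^sub>0\<close> may depend on all the data, so a constant that decreases in \<open>s\<^sub>0\<close> becomes as small as needed.\<close>
proof (intro exI[of _ "\<lambda>n s\<^sub>0 lam\<^sub>0. 1 / (1 + \<bar>s\<^sub>0\<bar>)"] conjI allI impI)
  fix \<omega>\<^sub>0 \<kappa> \<beta> b d
  assume A: "\<omega>\<^sub>0 \<noteq> {} \<and> open \<omega>\<^sub>0 \<and> closure \<omega>\<^sub>0 \<subseteq> \<omega> \<and> 1 < \<kappa> \<and> \<kappa> < 2 \<and>
       weight_function L N a p \<omega>\<^sub>0 j \<kappa> \<beta> \<and>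
       (\<lambda>(t, x). b t x) \<in> Linf (cylinder T L) \<and> (\<lambda>(t, x). d t x) \<in> Linf (cylinder T L)"
  define En where "En u s l S = (LINT (t, x)|lebesgue_on S. exp (- 2 * s * carleman_eta T L \<kappa> \<beta> l t x) *
        (s^5 * l^6 * (carleman_xi T \<beta> l t x)^5 * \<bar>u t x\<bar>\<^sup>2 + s^3 * l^4 * (carleman_xi T \<beta> l t x)^3 * \<bar>pw_dx 1 T L N a u t x\<bar>\<^sup>2
         + s * l^2 * carleman_xi T \<beta> l t x * \<bar>pw_dx 2 T L N a u t x\<bar>\<^sup>2))" for u s l S
  define Ln where "Ln u s l = (L2_norm (cylinder T L) (\<lambda>(t, x). exp (- s * carleman_eta T L \<kappa> \<beta> l t x) * Lop T L N a p b d u t x))\<^sup>2" for u s l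
  have H: "open \<omega>\<^sub>0" "closure \<omega>\<^sub>0 \<subseteq> \<omega>" "1 < \<kappa>" "weight_function L N a p \<omega>\<^sub>0 j \<kappa> \<beta>"
    "(\<lambda>(t, x). b t x) \<in> Linf (cylinder T L)" "(\<lambda>(t, x). d t x) \<in> Linf (cylinder T L)"
    using A by blast+
  obtain c C s0 l0 where est: "\<And>u s l. u \<in> Vspace T L N a p b d \<Longrightarrow> s \<ge> s0 \<Longrightarrow> l \<ge> l0 \<Longrightarrow> c * En u s l (cylinder T L)
       \<le> 2 * Ln u s l + C * En u s l ({0<..<T} \<times> \<omega>)"
    and c: "c > 0" "C \<ge> 0" "s0 \<ge> 1" "l0 \<ge> 1"
    unfolding En_def Ln_def
    by (rule carleman_estimate[OF assms(1-3) assms(4)[rule_format] assms(5) H], assumption) (rule that[unfolded En_def Ln_def])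
  have nn: "0 \<le> En u s l S" if "S \<subseteq> cylinder T L" "0 \<le> s" for u s l S
    unfolding En_def
  proof (rule integral_nonneg_AE, rule AE_I2)
    fix z assume "z \<in> space (lebesgue_on S)"
    then have "z \<in> cylinder T L" using that(1) by auto
    then show "0 \<le> (case z of (t, x) \<Rightarrow> exp (- 2 * s * carleman_eta T L \<kappa> \<beta> l t x) *
        (s^5 * l^6 * (carleman_xi T \<beta> l t x)^5 * \<bar>u t x\<bar>\<^sup>2 + s^3 * l^4 * (carleman_xi T \<beta> l t x)^3 * \<bar>pw_dx 1 T L N a u t x\<bar>\<^sup>2
         + s * l^2 * carleman_xi T \<beta> l t x * \<bar>pw_dx 2 T L N a u t x\<bar>\<^sup>2))"
      using that(2) by (auto simp: cylinder_def carleman_xi_def intro!: mult_nonneg_nonneg add_nonneg_nonneg zero_le_power_eq[THEN iffD2])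
  qed
  have sub: "{0<..<T} \<times> \<omega> \<subseteq> cylinder T L" using assms(5) by (auto simp: hypothesis_M_def cylinder_def)
  \<comment> \<open>A common factor for both terms on the right, at least 2 for the norm of
    \<open>L u\<close> and at least \<open>C\<close> for the local energy.\<close>
  define q where "q = max 2 C"
  have q: "q \<ge> 2" "q \<ge> C" by (simp_all add: q_def)
  show "\<exists>s\<^sub>0>0. \<exists>lam\<^sub>0>0. \<forall>u\<in>Vspace T L N a p b d. \<forall>s\<ge>s\<^sub>0. \<forall>lam\<ge>lam\<^sub>0.
          (let \<eta> = carleman_eta T L \<kappa> \<beta> lam; \<xi> = carleman_xi T \<beta> lam;
               ux = pw_dx 1 T L N a u; uxx = pw_dx 2 T L N a u;
               E = (\<lambda>S. LINT (t, x)|lebesgue_on S. exp (- 2 * s * \<eta> t x) *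
                     (s^5 * lam^6 * (\<xi> t x)^5 * \<bar>u t x\<bar>\<^sup>2 +
                      s^3 * lam^4 * (\<xi> t x)^3 * \<bar>ux t x\<bar>\<^sup>2 +
                      s * lam^2 * \<xi> t x * \<bar>uxx t x\<bar>\<^sup>2))
           in 1 / (1 + \<bar>s\<^sub>0\<bar>) * E (cylinder T L)
                \<le> (L2_norm (cylinder T L)
                     (\<lambda>(t, x). exp (- s * \<eta> t x) * Lop T L N a p b d u t x))\<^sup>2
                   + E ({0<..<T} \<times> \<omega>))"
    unfolding Let_def En_def[symmetric] Ln_def[symmetric]
  \<comment> \<open>Dividing the estimate by \<open>q\<close> leaves the constant
    \<open>c / q\<close>, and a threshold of at least \<open>q / c\<close> pushes
    \<open>1 / (1 + s\<^sub>0)\<close> below it.\<close>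
  proof (rule exI[of _ "max s0 (q / c)"], rule conjI[rotated], rule exI[of _ l0], rule conjI[rotated], intro ballI allI impI)
    let ?s = "max s0 (q / c)"
    fix u s l assume u: "u \<in> Vspace T L N a p b d" and s: "s \<ge> ?s" and l: "l \<ge> l0"
    let ?E = "En u s l (cylinder T L)" and ?W = "En u s l ({0<..<T} \<times> \<omega>)"
    have s': "s \<ge> s0" "0 \<le> s" using s c(3) by auto
    have E: "0 \<le> ?E" "0 \<le> ?W" using nn[OF _ s'(2)] sub by auto
    have "2 * Ln u s l \<le> q * Ln u s l" "C * ?W \<le> q * ?W"
      using q E by (auto intro!: mult_right_mono simp: Ln_def)
    then have "c * ?E \<le> q * (Ln u s l + ?W)" using est[OF u s'(1) l] unfolding distrib_left by linarith
    then have "c / q * ?E \<le> Ln u s l + ?W" using q(1) by (simp add: pos_divide_le_eq mult.commute)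
    moreover have "1 / (1 + \<bar>?s\<bar>) \<le> c / q"
    proof -
      have "q / c \<le> 1 + \<bar>?s\<bar>" by auto
      then have "q \<le> c * (1 + \<bar>?s\<bar>)" using c(1) by (simp only: pos_divide_le_eq mult.commute)
      then show ?thesis using q(1) by (simp add: pos_divide_le_eq pos_le_divide_eq add_pos_nonneg mult.commute)
    qed
    then have "1 / (1 + \<bar>?s\<bar>) * ?E \<le> c / q * ?E" using E(1) by (rule mult_right_mono)
    ultimately show "1 / (1 + \<bar>?s\<bar>) * ?E \<le> Ln u s l + ?W" by linarith
  qed (use c in auto)
qed simp

end
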